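(* Let $\Delta t^{n+1}>0$ and let the data $\bm f^{n+1}\in L^2(\Omega^+\cup\Omega^-)^3$, $g_3^{n+1}\in L^2(\Sigma)$, $\bm v^n\in L^2(\Omega^+\cup\Omega^-)^3$, $u_3^n\in L^2(\Sigma)$, $w_3^n\in L^2(\Sigma)$ be given. Then there exists a unique $\bm y^{n+1}=(\bm v^{n+1},p^{n+1},\bar{\bm u}^{n+1},u_3^{n+1},w_3^{n+1})\in\mathcal Y$ such that for all $(\bm V,P,\bar{\bm U},U_3,W_3)\in\mathcal Y$: \begin{align*} &\tfrac{\rho_f}{\Delta t^{n+1}}(\bm v^{n+1},\bm V)_{\Omega^\pm}+2\mu(D(\bm v^{n+1}),D(\bm V))_{\Omega^\pm}-(p^{n+1},\nabla\cdot\bm V)_{\Omega^\pm}+(\hat{\bm K}^{-1}\bm v^{n+1},\bm V)_\Sigma-\tfrac{1}{\Delta t^{n+1}}(\hat{\bm K}^{-1}u_3^{n+1}\bm e_3,\bm V)_\Sigma\\ &\qquad=(\bm f^{n+1},\bm V)_{\Omega^\pm}+\tfrac{\rho_f}{\Delta t^{n+1}}(\bm v^n,\bm V)_{\Omega^\pm}-\tfrac{1}{\Delta t^{n+1}}(\hat{\bm K}^{-1}u_3^n\bm e_3,\bm V)_\Sigma,\\ &-(\nabla\cdot\bm v^{n+1},P)_{\Omega^\pm}=0,\\ &\tfrac{\hat\rho_s}{\Delta t^{n+1}}(w_3^{n+1},U_3)_\Sigma+a^{\mathrm{hom}}((\bar{\bm u}^{n+1},u_3^{n+1}),(\bar{\bm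 U},U_3))-(\hat{\bm K}^{-1}\bm v^{n+1},U_3\bm e_3)_\Sigma+\tfrac{1}{\Delta t^{n+1}}(\hat{\bm K}^{-1}u_3^{n+1}\bm e_3,U_3\bm e_3)_\Sigma\\ &\qquad=(g_3^{n+1},U_3)_\Sigma+\tfrac{\hat\rho_s}{\Delta t^{n+1}}(w_3^n,U_3)_\Sigma+\tfrac{1}{\Delta t^{n+1}}(\hat{\bm K}^{-1}u_3^n\bm e_3,U_3\bm e_3)_\Sigma,\\ &\hat\rho_s(w_3^{n+1},W_3)_\Sigma-\tfrac{\hat\rho_s}{\Delta t^{n+1}}(u_3^{n+1},W_3)_\Sigma=-\tfrac{\hat\rho_s}{\Delta t^{n+1}}(u_3^n,W_3)_\Sigma. \end{align*} Consequently, starting from initial data, the semi-discrete scheme has a unique solution $\bm y^{n+1}$ for every $n=0,\dots,N-1$.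
   Context: Let $L_1,L_2,L_3>0$, $\Omega^-=(0,L_1)\times(0,L_2)\times(-L_3,0)$, $\Omega^+=(0,L_1)\times(0,L_2)\times(0,L_3)$, $\Omega=(0,L_1)\times(0,L_2)\times(-L_3,L_3)$, $\Sigma=(0,L_1)\times(0,L_2)\times\{0\}$ (identified with a 2D rectangle with in-plane variable $\bar x=(x_1,x_2)$), $\partial^{\mathrm{in}}\Omega=(0,L_1)\times(0,L_2)\times\{-L_3\}$, $\partial^{\mathrm{out}}\Omega=(0,L_1)\times(0,L_2)\times\{L_3\}$, $\partial^{\mathrm{no\text{-}slip}}\Omega=\partial\Omega\setminus(\partial^{\mathrm{in}}\Omega\cup\partial^{\mathrm{out}}\Omega)$. Write $\Omega^\pm=\Omega^+\cup\Omega^-$ and $(\cdot,\cdot)_{\Omega^\pm}$, $(\cdot,\cdot)_\Sigma$ for the $L^2$ inner products. $D(\bm v)=\frac12(\nabla\bm v+\nabla\bm v^T)$, $D_{\bar x}$, $\nabla^2_{\bar x}$ denote the in-plane symmetric gradient and Hessian, $\bm e_3$ the third unit vector. Spaces: $\mathcal V=\{\bm v\in H^1(\Omega^\pm)^3:\bm v=\bm 0$ on $\partial^{\mathrm{in}}\Omega\cup\partial^{\mathrm{no\text{-}slip}}\Omega\}$, where functions of $\mathcal V$ are understood to have equal traces from $\Omega^+$ and $\Omega^-$ on $\Sigma$ (continuity of velocity across $\Sigma$); $\mathcal Y=\mathcal V\times L^2(\Omega^\pm)\times H^1_0(\Sigma)^2\times H^2_0(\Sigma)\times L^2(\Sigma)$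 (the pressure may jump across $\Sigma$). Constants $\rho_f,\mu,\hat\rho_s>0$. $\hat{\bm K}\in\mathbb R^{3\times3}$ is symmetric positive definite (scaled permeability), so $\hat{\bm K}^{-1}$ is symmetric positive definite. Homogenized stiffness tensors $\underline{\bm A}^{\mathrm{hom}},\underline{\bm B}^{\mathrm{hom}},\underline{\bm C}^{\mathrm{hom}}\in\mathbb R^{2\times2\times2\times2}$ (fourth-order tensors acting on $2\times2$ matrices by $(\underline{\bm A}\bm B)_{ij}=\sum_{kl}a_{ijkl}b_{kl}$) define $a^{\mathrm{hom}}((\bar{\bm u},u_3),(\bar{\bm U},U_3))=(\underline{\bm A}^{\mathrm{hom}}D_{\bar x}\bar{\bm u},D_{\bar x}\bar{\bm U})_\Sigma+(\underline{\bm B}^{\mathrm{hom}}D_{\bar x}\bar{\bm u},\nabla^2_{\bar x}U_3)_\Sigma+(\underline{\bm B}^{\mathrm{hom}}\nabla^2_{\bar x}u_3,D_{\bar x}\bar{\bm U})_\Sigma+(\underline{\bm C}^{\mathrm{hom}}\nabla^2_{\bar x}u_3,\nabla^2_{\bar x}U_3)_\Sigma$; it is assumed that $a^{\mathrm{hom}}$ is a bounded bilinear form on $H^1_0(\Sigma)^2\times H^2_0(\Sigma)$ whose induced quadratic form $\|(\bar{\bm u},u_3)\|_{\mathrm{hom}}^2=a^{\mathrm{hom}}((\bar{\bm u},u_3),(\bar{\bm u},u_3))$ is equivalent to the squared standard norm of $H^1_0(\Sigma)^2\times H^2_0(\Sigma)$. *)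

theory Defs
  imports "HOL-Analysis.Analysis"
begin

definition partial_dir :: "'a::euclidean_space \<Rightarrow> ('a \<Rightarrow> real) \<Rightarrow> 'a \<Rightarrow> real" where
  "partial_dir b f x = (THE d. ((\<lambda>t. f (x + t *\<^sub>R b)) has_real_derivative d) (at 0))"

fun Ck :: "nat \<Rightarrow> ('a::euclidean_space \<Rightarrow> real) \<Rightarrow> bool" where
  "Ck 0 f = continuous_on UNIV f"
| "Ck (Suc k) f = (continuous_on UNIV f \<and>
     (\<forall>b\<in>Basis. (\<forall>x. \<exists>d. ((\<lambda>t. f (x + t *\<^sub>R b)) has_real_derivative d) (at 0))
                 \<and> Ck k (partial_dir b f)))"

definition smooth_fun :: "('a::euclidean_space \<Rightarrow> real) \<Rightarrow> bool" where
  "smooth_fun f \<longleftrightarrow> (\<forall>k. Ck k f)"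

definition tsupp :: "('a::euclidean_space \<Rightarrow> real) \<Rightarrow> 'a set" where
  "tsupp f = closure {x. f x \<noteq> 0}"

definition test_fun :: "'a::euclidean_space set \<Rightarrow> ('a \<Rightarrow> real) \<Rightarrow> bool" where
  "test_fun U \<phi> \<longleftrightarrow> smooth_fun \<phi> \<and> compact (tsupp \<phi>) \<and> tsupp \<phi> \<subseteq> U"

definition Lsq :: "'a::euclidean_space set \<Rightarrow> ('a \<Rightarrow> real) \<Rightarrow> bool" where
  "Lsq S f \<longleftrightarrow> f \<in> borel_measurable (lebesgue_on S) \<and> integrable (lebesgue_on S) (\<lambda>x. (f x)\<^sup>2)"

definition ip :: "'a::euclidean_space set \<Rightarrow> ('a \<Rightarrow> real) \<Rightarrow> ('a \<Rightarrow> real) \<Rightarrow> real" where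
  "ip S f g = integral\<^sup>L (lebesgue_on S) (\<lambda>x. f x * g x)"

definition weak_pd :: "'a::euclidean_space set \<Rightarrow> 'a \<Rightarrow> ('a \<Rightarrow> real) \<Rightarrow> ('a \<Rightarrow> real) \<Rightarrow> bool" where
  "weak_pd U b f g \<longleftrightarrow> (\<forall>\<phi>. test_fun U \<phi> \<longrightarrow>
      integral\<^sup>L (lebesgue_on U) (\<lambda>x. f x * partial_dir b \<phi> x)
        = - integral\<^sup>L (lebesgue_on U) (\<lambda>x. g x * \<phi> x))"

text \<open>The (a.e. unique) L2 weak derivative.\<close>
definition wd :: "'a::euclidean_space set \<Rightarrow> 'a \<Rightarrow> ('a \<Rightarrow> real) \<Rightarrow> 'a \<Rightarrow> real" where
  "wd U b f = (SOME g. Lsq U g \<and> weak_pd U b f g)"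

definition H1 :: "'a::euclidean_space set \<Rightarrow> ('a \<Rightarrow> real) \<Rightarrow> bool" where
  "H1 U f \<longleftrightarrow> Lsq U f \<and> (\<forall>b\<in>Basis. \<exists>g. Lsq U g \<and> weak_pd U b f g)"

definition H2 :: "'a::euclidean_space set \<Rightarrow> ('a \<Rightarrow> real) \<Rightarrow> bool" where
  "H2 U f \<longleftrightarrow> Lsq U f \<and> (\<forall>b\<in>Basis. \<exists>g. H1 U g \<and> weak_pd U b f g)"

definition H1norm :: "'a::euclidean_space set \<Rightarrow> ('a \<Rightarrow> real) \<Rightarrow> real" where
  "H1norm U f = sqrt (ip U f f + (\<Sum>b\<in>Basis. ip U (wd U b f) (wd U b f)))"

definition H2norm :: "'a::euclidean_space set \<Rightarrow> ('a \<Rightarrow> real) \<Rightarrow> real" where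
  "H2norm U f = sqrt (ip U f f + (\<Sum>b\<in>Basis. ip U (wd U b f) (wd U b f))
      + (\<Sum>b\<in>Basis. \<Sum>c\<in>Basis. ip U (wd U c (wd U b f)) (wd U c (wd U b f))))"

definition H10 :: "'a::euclidean_space set \<Rightarrow> ('a \<Rightarrow> real) \<Rightarrow> bool" where
  "H10 U f \<longleftrightarrow> H1 U f \<and> (\<forall>e>0. \<exists>\<phi>. test_fun U \<phi> \<and> H1norm U (\<lambda>x. f x - \<phi> x) < e)"

definition H20 :: "'a::euclidean_space set \<Rightarrow> ('a \<Rightarrow> real) \<Rightarrow> bool" where
  "H20 U f \<longleftrightarrow> H2 U f \<and> (\<forall>e>0. \<exists>\<phi>. test_fun U \<phi> \<and> H2norm U (\<lambda>x. f x - \<phi> x) < e)"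

text \<open>Trace: t is the trace of f in H^1(U) on the flat face P ` R (P an isometric affine
  parametrisation of the face by the planar parameter set R), defined by extension by
  continuity from functions smooth up to the boundary.\<close>
definition is_trace :: "(real^3) set \<Rightarrow> (real^2 \<Rightarrow> real^3) \<Rightarrow> (real^2) set
     \<Rightarrow> (real^3 \<Rightarrow> real) \<Rightarrow> (real^2 \<Rightarrow> real) \<Rightarrow> bool" where
  "is_trace U P R f t \<longleftrightarrow> Lsq R t \<and> (\<exists>\<phi>::nat \<Rightarrow> real^3 \<Rightarrow> real. (\<forall>k. smooth_fun (\<phi> k)) \<and>
      (\<lambda>k. H1norm U (\<lambda>x. f x - \<phi> k x)) \<longlonglongrightarrow> 0 \<and>
      (\<lambda>k. integral\<^sup>L (lebesgue_on R) (\<lambda>y. (\<phi> k (P y) - t y)\<^sup>2)) \<longlonglongrightarrow> 0)"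

definition OmM :: "real \<Rightarrow> real \<Rightarrow> real \<Rightarrow> (real^3) set" where
  "OmM L1 L2 L3 = box (vector [0, 0, - L3]) (vector [L1, L2, 0])"

definition OmP :: "real \<Rightarrow> real \<Rightarrow> real \<Rightarrow> (real^3) set" where
  "OmP L1 L2 L3 = box (vector [0, 0, 0]) (vector [L1, L2, L3])"

definition OmPM :: "real \<Rightarrow> real \<Rightarrow> real \<Rightarrow> (real^3) set" where
  "OmPM L1 L2 L3 = OmP L1 L2 L3 \<union> OmM L1 L2 L3"

text \<open>Sigma, identified with the rectangle (0,L1) x (0,L2) in the variable xbar\<close>
definition Sig :: "real \<Rightarrow> real \<Rightarrow> (real^2) set" where
  "Sig L1 L2 = box (vector [0, 0]) (vector [L1, L2])"

definition fz :: "real \<Rightarrow> real^2 \<Rightarrow> real^3" where "fz c y = vector [y$1, y$2, c]"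
definition fx :: "real \<Rightarrow> real^2 \<Rightarrow> real^3" where "fx c y = vector [c, y$1, y$2]"
definition fy :: "real \<Rightarrow> real^2 \<Rightarrow> real^3" where "fy c y = vector [y$1, c, y$2]"

definition e3 :: "real^3" where "e3 = axis 3 1"

text \<open>Zero trace on the inflow boundary and on the lateral (no-slip) boundary, for the
  parts of the boundary belonging to Omega^- resp. Omega^+.\<close>
definition zero_bc :: "real \<Rightarrow> real \<Rightarrow> real \<Rightarrow> (real^3 \<Rightarrow> real) \<Rightarrow> bool" where
  "zero_bc L1 L2 L3 f \<longleftrightarrow>
     is_trace (OmM L1 L2 L3) (fz (- L3)) (Sig L1 L2) f (\<lambda>_. 0) \<and>
     is_trace (OmM L1 L2 L3) (fx 0)  (box (vector [0, - L3]) (vector [L2, 0])) f (\<lambda>_. 0) \<and>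
     is_trace (OmM L1 L2 L3) (fx L1) (box (vector [0, - L3]) (vector [L2, 0])) f (\<lambda>_. 0) \<and>
     is_trace (OmM L1 L2 L3) (fy 0)  (box (vector [0, - L3]) (vector [L1, 0])) f (\<lambda>_. 0) \<and>
     is_trace (OmM L1 L2 L3) (fy L2) (box (vector [0, - L3]) (vector [L1, 0])) f (\<lambda>_. 0) \<and>
     is_trace (OmP L1 L2 L3) (fx 0)  (box (vector [0, 0]) (vector [L2, L3])) f (\<lambda>_. 0) \<and>
     is_trace (OmP L1 L2 L3) (fx L1) (box (vector [0, 0]) (vector [L2, L3])) f (\<lambda>_. 0) \<and>
     is_trace (OmP L1 L2 L3) (fy 0)  (box (vector [0, 0]) (vector [L1, L3])) f (\<lambda>_. 0) \<and>
     is_trace (OmP L1 L2 L3) (fy L2) (box (vector [0, 0]) (vector [L1, L3])) f (\<lambda>_. 0)"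

definition Vspace :: "real \<Rightarrow> real \<Rightarrow> real \<Rightarrow> (real^3 \<Rightarrow> real^3) \<Rightarrow> bool" where
  "Vspace L1 L2 L3 v \<longleftrightarrow> (\<forall>i. H1 (OmPM L1 L2 L3) (\<lambda>x. v x $ i)
     \<and> (\<exists>t. is_trace (OmP L1 L2 L3) (fz 0) (Sig L1 L2) (\<lambda>x. v x $ i) t
           \<and> is_trace (OmM L1 L2 L3) (fz 0) (Sig L1 L2) (\<lambda>x. v x $ i) t)
     \<and> zero_bc L1 L2 L3 (\<lambda>x. v x $ i))"

definition Yspace :: "real \<Rightarrow> real \<Rightarrow> real \<Rightarrow> (real^3 \<Rightarrow> real^3) \<Rightarrow> (real^3 \<Rightarrow> real)
     \<Rightarrow> (real^2 \<Rightarrow> real^2) \<Rightarrow> (real^2 \<Rightarrow> real) \<Rightarrow> (real^2 \<Rightarrow> real) \<Rightarrow> bool" where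
  "Yspace L1 L2 L3 v p ub u3 w3 \<longleftrightarrow> Vspace L1 L2 L3 v \<and> Lsq (OmPM L1 L2 L3) p
     \<and> (\<forall>i. H10 (Sig L1 L2) (\<lambda>y. ub y $ i)) \<and> H20 (Sig L1 L2) u3 \<and> Lsq (Sig L1 L2) w3"

text \<open>Trace of v on Sigma (taken from Omega^+; for v in V it coincides with the one from Omega^-).\<close>
definition trSig :: "real \<Rightarrow> real \<Rightarrow> real \<Rightarrow> (real^3 \<Rightarrow> real^3) \<Rightarrow> real^2 \<Rightarrow> real^3" where
  "trSig L1 L2 L3 v = (\<lambda>y. \<chi> i. (SOME t. is_trace (OmP L1 L2 L3) (fz 0) (Sig L1 L2) (\<lambda>x. v x $ i) t) y)"

definition symgrad3 :: "(real^3) set \<Rightarrow> (real^3 \<Rightarrow> real^3) \<Rightarrow> 3 \<Rightarrow> 3 \<Rightarrow> real^3 \<Rightarrow> real" where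
  "symgrad3 U v i j x = (wd U (axis j 1) (\<lambda>y. v y $ i) x + wd U (axis i 1) (\<lambda>y. v y $ j) x) / 2"

definition div3 :: "(real^3) set \<Rightarrow> (real^3 \<Rightarrow> real^3) \<Rightarrow> real^3 \<Rightarrow> real" where
  "div3 U v x = (\<Sum>i\<in>UNIV. wd U (axis i 1) (\<lambda>y. v y $ i) x)"

definition symgrad2 :: "(real^2) set \<Rightarrow> (real^2 \<Rightarrow> real^2) \<Rightarrow> 2 \<Rightarrow> 2 \<Rightarrow> real^2 \<Rightarrow> real" where
  "symgrad2 U u i j x = (wd U (axis j 1) (\<lambda>y. u y $ i) x + wd U (axis i 1) (\<lambda>y. u y $ j) x) / 2"

definition hess2 :: "(real^2) set \<Rightarrow> (real^2 \<Rightarrow> real) \<Rightarrow> 2 \<Rightarrow> 2 \<Rightarrow> real^2 \<Rightarrow> real" where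
  "hess2 U w i j x = wd U (axis j 1) (wd U (axis i 1) w) x"

definition tpair :: "(real^2) set \<Rightarrow> (2 \<Rightarrow> 2 \<Rightarrow> 2 \<Rightarrow> 2 \<Rightarrow> real)
     \<Rightarrow> (2 \<Rightarrow> 2 \<Rightarrow> real^2 \<Rightarrow> real) \<Rightarrow> (2 \<Rightarrow> 2 \<Rightarrow> real^2 \<Rightarrow> real) \<Rightarrow> real" where
  "tpair S A M N = integral\<^sup>L (lebesgue_on S)
     (\<lambda>x. \<Sum>i\<in>UNIV. \<Sum>j\<in>UNIV. (\<Sum>k\<in>UNIV. \<Sum>l\<in>UNIV. A i j k l * M k l x) * N i j x)"

definition ahom :: "(real^2) set \<Rightarrow> (2 \<Rightarrow> 2 \<Rightarrow> 2 \<Rightarrow> 2 \<Rightarrow> real) \<Rightarrow> (2 \<Rightarrow> 2 \<Rightarrow> 2 \<Rightarrow> 2 \<Rightarrow> real)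
     \<Rightarrow> (2 \<Rightarrow> 2 \<Rightarrow> 2 \<Rightarrow> 2 \<Rightarrow> real) \<Rightarrow> (real^2 \<Rightarrow> real^2) \<Rightarrow> (real^2 \<Rightarrow> real)
     \<Rightarrow> (real^2 \<Rightarrow> real^2) \<Rightarrow> (real^2 \<Rightarrow> real) \<Rightarrow> real" where
  "ahom S A B C ub u3 Ub U3 =
       tpair S A (symgrad2 S ub) (symgrad2 S Ub) + tpair S B (symgrad2 S ub) (hess2 S U3)
     + tpair S B (hess2 S u3) (symgrad2 S Ub) + tpair S C (hess2 S u3) (hess2 S U3)"

definition stdnorm2 :: "(real^2) set \<Rightarrow> (real^2 \<Rightarrow> real^2) \<Rightarrow> (real^2 \<Rightarrow> real) \<Rightarrow> real" where
  "stdnorm2 S ub u3 = (\<Sum>i\<in>UNIV. (H1norm S (\<lambda>y. ub y $ i))\<^sup>2) + (H2norm S u3)\<^sup>2"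

definition scheme_eqs :: "real \<Rightarrow> real \<Rightarrow> real \<Rightarrow> real \<Rightarrow> real \<Rightarrow> real \<Rightarrow> real^3^3
     \<Rightarrow> (2 \<Rightarrow> 2 \<Rightarrow> 2 \<Rightarrow> 2 \<Rightarrow> real) \<Rightarrow> (2 \<Rightarrow> 2 \<Rightarrow> 2 \<Rightarrow> 2 \<Rightarrow> real) \<Rightarrow> (2 \<Rightarrow> 2 \<Rightarrow> 2 \<Rightarrow> 2 \<Rightarrow> real)
     \<Rightarrow> real \<Rightarrow> (real^3 \<Rightarrow> real^3) \<Rightarrow> (real^2 \<Rightarrow> real) \<Rightarrow> (real^3 \<Rightarrow> real^3)
     \<Rightarrow> (real^2 \<Rightarrow> real) \<Rightarrow> (real^2 \<Rightarrow> real)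
     \<Rightarrow> (real^3 \<Rightarrow> real^3) \<Rightarrow> (real^3 \<Rightarrow> real) \<Rightarrow> (real^2 \<Rightarrow> real^2) \<Rightarrow> (real^2 \<Rightarrow> real)
     \<Rightarrow> (real^2 \<Rightarrow> real) \<Rightarrow> bool" where
  "scheme_eqs L1 L2 L3 \<rho>f \<mu> \<rho>s K A B C dt f g3 vn u3n w3n v p ub u3 w3 \<longleftrightarrow>
   (let Om = OmPM L1 L2 L3; S = Sig L1 L2; Ki = matrix_inv K; trv = trSig L1 L2 L3 v in
   (\<forall>V P Ub U3 W3. Yspace L1 L2 L3 V P Ub U3 W3 \<longrightarrow>
      (let trV = trSig L1 L2 L3 V in
       \<rho>f / dt * integral\<^sup>L (lebesgue_on Om) (\<lambda>x. v x \<bullet> V x)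
       + 2 * \<mu> * integral\<^sup>L (lebesgue_on Om)
            (\<lambda>x. \<Sum>i\<in>UNIV. \<Sum>j\<in>UNIV. symgrad3 Om v i j x * symgrad3 Om V i j x)
       - ip Om p (div3 Om V)
       + integral\<^sup>L (lebesgue_on S) (\<lambda>y. (Ki *v trv y) \<bullet> trV y)
       - 1 / dt * integral\<^sup>L (lebesgue_on S) (\<lambda>y. (Ki *v (u3 y *\<^sub>R e3)) \<bullet> trV y)
     = integral\<^sup>L (lebesgue_on Om) (\<lambda>x. f x \<bullet> V x)
       + \<rho>f / dt * integral\<^sup>L (lebesgue_on Om) (\<lambda>x. vn x \<bullet> V x)
       - 1 / dt * integral\<^sup>L (lebesgue_on S) (\<lambda>y. (Ki *v (u3n y *\<^sub>R e3)) \<bullet> trV y))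
    \<and> - ip Om (div3 Om v) P = 0
    \<and> \<rho>s / dt * ip S w3 U3 + ahom S A B C ub u3 Ub U3
       - integral\<^sup>L (lebesgue_on S) (\<lambda>y. (Ki *v trv y) \<bullet> (U3 y *\<^sub>R e3))
       + 1 / dt * integral\<^sup>L (lebesgue_on S) (\<lambda>y. (Ki *v (u3 y *\<^sub>R e3)) \<bullet> (U3 y *\<^sub>R e3))
     = ip S g3 U3 + \<rho>s / dt * ip S w3n U3
       + 1 / dt * integral\<^sup>L (lebesgue_on S) (\<lambda>y. (Ki *v (u3n y *\<^sub>R e3)) \<bullet> (U3 y *\<^sub>R e3))
    \<and> \<rho>s * ip S w3 W3 - \<rho>s / dt * ip S u3 W3 = - (\<rho>s / dt * ip S u3n W3)))"

definition Y_eq :: "real \<Rightarrow> real \<Rightarrow> real \<Rightarrow>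
     (real^3 \<Rightarrow> real^3) \<times> (real^3 \<Rightarrow> real) \<times> (real^2 \<Rightarrow> real^2) \<times> (real^2 \<Rightarrow> real) \<times> (real^2 \<Rightarrow> real)
  \<Rightarrow> (real^3 \<Rightarrow> real^3) \<times> (real^3 \<Rightarrow> real) \<times> (real^2 \<Rightarrow> real^2) \<times> (real^2 \<Rightarrow> real) \<times> (real^2 \<Rightarrow> real)
  \<Rightarrow> bool" where
  "Y_eq L1 L2 L3 y y' \<longleftrightarrow> (case y of (v, p, ub, u3, w3) \<Rightarrow> case y' of (v', p', ub', u3', w3') \<Rightarrow>
     (AE x in lebesgue_on (OmPM L1 L2 L3). v x = v' x \<and> p x = p' x) \<and>
     (AE y in lebesgue_on (Sig L1 L2). ub y = ub' y \<and> u3 y = u3' y \<and> w3 y = w3' y))"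

end

theory Submission
  imports Defs
begin

text \<open>Square-integrable functions modulo equality almost everywhere form a Hilbert space, and all function
  spaces of the scheme become closed subspaces of products of it.  Eliminating the plate velocity leaves a
  saddle point problem whose bilinear form is not symmetric but coercive: the permeability terms are a square,
  the plate form is coercive by assumption, and the viscous term controls the velocity by Korn's inequality.
  The pressure exists and is unique because the divergence is onto, which follows from an approximate right
  inverse: sine sums are dense, on them the Poisson equation is solved explicitly, and the wrong boundary values
  of the gradient are removed one coordinate at a time by reflections.  The remainder is of first order in the
  field and is absorbed by its antiderivative normal to the outflow face, where no boundary value is
  prescribed.  Korn's inequality is obtained by duality from the same right inverse.\<close>

section \<open>The Hilbert space of square-integrable functions\<close>

text \<open>The trace bound and Korn's inequality are proved for smooth functions and pass to
  limits. They reach every velocity because a trace is by definition a limit of functions smooth up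
  to the boundary: a trace on the interface already makes a velocity component, on either half of
  the channel, a limit of smooth functions. The approximations on the two halves are unrelated, so
  Korn is applied to each half; the divergence is solved on the whole box, where a smooth field has
  equal traces on the interface.

  The obstacle on a box is to correct both faces of a coordinate without spoiling the divergence. A
  suitable combination of dilated reflections across one face commutes with the divergence, but two
  faces require a partition by cut-offs, whose derivatives leave the remainder. It vanishes on the
  boundary together with the field and has a first-order bound. This serves twice: the remainder can
  be integrated along the free direction, and in Korn's inequality a derivative can be shifted from
  the velocity onto it, at the price of the L2 norm of the velocity.\<close>

definition sqint :: "('a::euclidean_space \<Rightarrow> real) \<Rightarrow> bool" where
  "sqint f \<longleftrightarrow> f \<in> borel_measurable lebesgue \<and> integrable lebesgue (\<lambda>x. (f x)\<^sup>2)"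

lemma sqint_mult_integrable:
  assumes "sqint f" "sqint g"
  shows "integrable lebesgue (\<lambda>x. f x * g x)"
proof (rule Bochner_Integration.integrable_bound)
  show "integrable lebesgue (\<lambda>x. (f x)\<^sup>2 + (g x)\<^sup>2)"
    using assms by (auto simp: sqint_def)
  show "(\<lambda>x. f x * g x) \<in> borel_measurable lebesgue"
    using assms by (auto simp: sqint_def)
  have "\<bar>f x * g x\<bar> \<le> (f x)\<^sup>2 + (g x)\<^sup>2" for x
  proof -
    have "0 \<le> (\<bar>f x\<bar> - \<bar>g x\<bar>)\<^sup>2" by simp
    then have "2 * (\<bar>f x\<bar> * \<bar>g x\<bar>) \<le> (f x)\<^sup>2 + (g x)\<^sup>2"
      by (simp add: power2_eq_square algebra_simps)
    then show ?thesis
      using mult_nonneg_nonneg[of "\<bar>f x\<bar>" "\<bar>g x\<bar>"] by (simp only: abs_mult) linarith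
  qed
  then show "AE x in lebesgue. norm (f x * g x) \<le> norm ((f x)\<^sup>2 + (g x)\<^sup>2)"
    by simp
qed

lemma sqint_add:
  assumes "sqint f" "sqint g"
  shows "sqint (\<lambda>x. f x + g x)"
proof -
  have "integrable lebesgue (\<lambda>x. (f x)\<^sup>2 + 2 * (f x * g x) + (g x)\<^sup>2)"
    using assms sqint_mult_integrable[OF assms] by (auto simp: sqint_def)
  then have "integrable lebesgue (\<lambda>x. (f x + g x)\<^sup>2)"
    by (simp add: power2_sum algebra_simps)
  then show ?thesis using assms by (auto simp: sqint_def)
qed

lemma sqint_scale: "sqint f \<Longrightarrow> sqint (\<lambda>x. c * f x)"
  by (auto simp: sqint_def power_mult_distrib)

lemma sqint_diff: "sqint f \<Longrightarrow> sqint g \<Longrightarrow> sqint (\<lambda>x. f x - g x)"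
  using sqint_add[OF _ sqint_scale[of g "-1"], of f] by simp

lemma sqint_zero: "sqint (\<lambda>x. 0)"
  by (auto simp: sqint_def)

\<comment> \<open>The relation is partial, with the square-integrable functions as its domain, and
  there is one type for all domains: functions on a set enter by extension with zero, so that
  classes on different sets can be added and compared.\<close>
quotient_type (overloaded) 'a l2 = "'a::euclidean_space \<Rightarrow> real" / partial:
  "\<lambda>f g. sqint f \<and> sqint g \<and> (AE x in lebesgue. f x = g x)"
  morphisms rep_l2 abs_l2
proof (rule part_equivpI)
  show "\<exists>f::'a \<Rightarrow> real. sqint f \<and> sqint f \<and> (AE x in lebesgue. f x = f x)"
    using sqint_zero by auto
  show "symp (\<lambda>f g::'a \<Rightarrow> real. sqint f \<and> sqint g \<and> (AE x in lebesgue. f x = g x))"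
    by (auto simp: symp_def eq_commute)
  show "transp (\<lambda>f g::'a \<Rightarrow> real. sqint f \<and> sqint g \<and> (AE x in lebesgue. f x = g x))"
    unfolding transp_def by (auto elim: AE_mp)
qed

instantiation l2 :: (euclidean_space) real_vector
begin

lift_definition zero_l2 :: "'a l2" is "\<lambda>x. 0"
  by (simp add: sqint_zero)
lift_definition plus_l2 :: "'a l2 \<Rightarrow> 'a l2 \<Rightarrow> 'a l2" is "\<lambda>f g x. f x + g x"
  by (auto intro!: sqint_add elim: AE_mp)
lift_definition minus_l2 :: "'a l2 \<Rightarrow> 'a l2 \<Rightarrow> 'a l2" is "\<lambda>f g x. f x - g x"
  by (auto intro!: sqint_diff elim: AE_mp)
lift_definition uminus_l2 :: "'a l2 \<Rightarrow> 'a l2" is "\<lambda>f x. - f x"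
  using sqint_scale[where c="-1"] by (fastforce elim: AE_mp)
lift_definition scaleR_l2 :: "real \<Rightarrow> 'a l2 \<Rightarrow> 'a l2" is "\<lambda>c f x. c * f x"
  by (auto intro!: sqint_scale elim: AE_mp)
instance
proof
  fix a b c :: "'a l2" and r s :: real
  show "a + b + c = a + (b + c)" by transfer (auto intro!: sqint_add simp: algebra_simps)
  show "a + b = b + a" by transfer (auto intro!: sqint_add simp: algebra_simps)
  show "0 + a = a" by transfer auto
  show "- a + a = 0"
    by transfer (use sqint_scale[where c="-1"] in \<open>auto simp: sqint_zero\<close>)
  show "a - b = a + - b"
    by transfer (use sqint_scale[where c="-1"] in \<open>auto intro!: sqint_diff\<close>)
  show "r *\<^sub>R (a + b) = r *\<^sub>R a + r *\<^sub>R b"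
    by transfer (auto intro!: sqint_add sqint_scale simp: algebra_simps)
  show "(r + s) *\<^sub>R a = r *\<^sub>R a + s *\<^sub>R a"
    by transfer (auto intro!: sqint_add sqint_scale simp: algebra_simps)
  show "r *\<^sub>R s *\<^sub>R a = (r * s) *\<^sub>R a"
    by transfer (auto intro!: sqint_add sqint_scale simp: algebra_simps)
  show "1 *\<^sub>R a = a" by transfer auto
qed

end

instantiation l2 :: (euclidean_space) real_inner
begin

lift_definition inner_l2 :: "'a l2 \<Rightarrow> 'a l2 \<Rightarrow> real" is
  "\<lambda>f g. integral\<^sup>L lebesgue (\<lambda>x. f x * g x)"
  by (intro integral_cong_AE) (auto simp: sqint_def elim: AE_mp)

definition norm_l2 :: "'a l2 \<Rightarrow> real" where "norm_l2 x = sqrt (inner x x)"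
definition dist_l2 :: "'a l2 \<Rightarrow> 'a l2 \<Rightarrow> real" where "dist_l2 x y = norm (x - y)"
definition sgn_l2 :: "'a l2 \<Rightarrow> 'a l2" where "sgn_l2 x = x /\<^sub>R norm x"
definition uniformity_l2 :: "('a l2 \<times> 'a l2) filter" where
  "uniformity_l2 = (INF e\<in>{0 <..}. principal {(x, y). dist x y < e})"
definition open_l2 :: "'a l2 set \<Rightarrow> bool" where
  "open_l2 U \<longleftrightarrow> (\<forall>x\<in>U. \<forall>\<^sub>F (x', y) in uniformity. x' = x \<longrightarrow> y \<in> U)"

instance
proof
  fix a b c :: "'a l2" and r s :: real
  show "dist a b = norm (a - b)" by (rule dist_l2_def)
  show "sgn a = a /\<^sub>R norm a" by (rule sgn_l2_def)
  show "inner a b = inner b a" by transfer (auto simp: mult.commute)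
  show "inner (a + b) c = inner a c + inner b c"
    by transfer (auto simp: distrib_right sqint_mult_integrable)
  show "inner (r *\<^sub>R a) b = r * inner a b"
    by transfer (auto simp: mult.assoc)
  show "0 \<le> inner a a" by transfer auto
  show "(inner a a = 0) = (a = 0)"
  proof transfer
    fix f :: "'a \<Rightarrow> real"
    assume f: "sqint f \<and> sqint f \<and> (AE x in lebesgue. f x = f x)"
    have "(integral\<^sup>L lebesgue (\<lambda>x. f x * f x) = 0) = (AE x in lebesgue. f x * f x = 0)"
      by (rule integral_nonneg_eq_0_iff_AE) (use f sqint_mult_integrable in auto)
    then show "(integral\<^sup>L lebesgue (\<lambda>x. f x * f x) = 0)
        = (sqint f \<and> sqint (\<lambda>x. 0::real) \<and> (AE x in lebesgue. f x = 0))"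
      using f by (simp add: sqint_zero)
  qed
  show "norm a = sqrt (inner a a)" by (rule norm_l2_def)
  show "(uniformity :: ('a l2 \<times> 'a l2) filter) = (INF e\<in>{0 <..}. principal {(x, y). dist x y < e})"
    by (rule uniformity_l2_def)
  show "open U = (\<forall>x\<in>U. \<forall>\<^sub>F (x', y) in uniformity. x' = x \<longrightarrow> y \<in> U)" for U :: "'a l2 set"
    by (rule open_l2_def)
qed

end

section \<open>Representatives of classes and the Riesz-Fischer theorem\<close>

lemma inner_abs_l2:
  "sqint f \<Longrightarrow> sqint g \<Longrightarrow> inner (abs_l2 f) (abs_l2 g) = integral\<^sup>L lebesgue (\<lambda>x. f x * g x)"
  by (rule inner_l2.abs_eq) auto

lemma diff_abs_l2: "sqint f \<Longrightarrow> sqint g \<Longrightarrow> abs_l2 f - abs_l2 g = abs_l2 (\<lambda>x. f x - g x)"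
  by (rule minus_l2.abs_eq) auto

lemma add_abs_l2: "sqint f \<Longrightarrow> sqint g \<Longrightarrow> abs_l2 f + abs_l2 g = abs_l2 (\<lambda>x. f x + g x)"
  by (rule plus_l2.abs_eq) auto

lemma scaleR_abs_l2: "sqint f \<Longrightarrow> c *\<^sub>R abs_l2 f = abs_l2 (\<lambda>x. c * f x)"
  by (rule scaleR_l2.abs_eq) auto

lemma abs_l2_eq_iff:
  "sqint f \<Longrightarrow> sqint g \<Longrightarrow> abs_l2 f = abs_l2 g \<longleftrightarrow> (AE x in lebesgue. f x = g x)"
  using Quotient_rel[OF Quotient_l2, of f g] by auto

lemma abs_l2_cases: obtains f where "sqint f" "F = abs_l2 f"
  using Quotient_rep_reflp[OF Quotient_l2, of F] Quotient_abs_rep[OF Quotient_l2, of F] by metis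

text \<open>The nonnegative integral on the right is what Fatou's lemma and monotone convergence
  speak about, before the integrability of a limit is known.\<close>

lemma norm_abs_l2_ennreal:
  assumes "sqint f"
  shows "ennreal ((norm (abs_l2 f))\<^sup>2) = (\<integral>\<^sup>+x. ennreal ((f x)\<^sup>2) \<partial>lebesgue)"
  using assms inner_abs_l2[OF assms assms] by (subst nn_integral_eq_integral)
    (auto simp: power2_norm_eq_inner sqint_def simp flip: power2_eq_square)

text \<open>Riesz-Fischer: rapid convergence makes the representatives converge almost everywhere,
  and Fatou's lemma shows that the pointwise limit is the limit in norm.\<close>

lemma l2_rapid_convergent:
  fixes X :: "nat \<Rightarrow> 'a::euclidean_space l2"
  assumes rapid: "\<And>n. norm (X (Suc n) - X n) \<le> (1/2) ^ n" and Cau: "Cauchy X"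
  shows "convergent X"
proof -
  have "\<forall>n. \<exists>f. sqint f \<and> X n = abs_l2 f" by (metis abs_l2_cases)
  then obtain f where sq: "\<And>n. sqint (f n)" and X: "\<And>n. X n = abs_l2 (f n)" by metis
  note [measurable] = sq[unfolded sqint_def, THEN conjunct1]
  define d where "d n x = f (Suc n) x - f n x" for n x
  have dsq: "sqint (d n)" for n
    unfolding d_def by (intro sqint_diff sq)
  note [measurable] = dsq[unfolded sqint_def, THEN conjunct1]
  have nd: "(\<integral>\<^sup>+x. ennreal ((d n x)\<^sup>2) \<partial>lebesgue) \<le> ennreal ((1/4)^n)" for n
  proof -
    have "norm (abs_l2 (d n)) \<le> (1/2)^n"
      using rapid[of n] unfolding X d_def by (simp add: diff_abs_l2 sq)
    then have "(norm (abs_l2 (d n)))\<^sup>2 \<le> ((1/2)^n)\<^sup>2" by (intro power_mono) auto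
    also have "... = (1/4)^n" by (simp add: power2_eq_square flip: power_mult_distrib)
    finally show ?thesis unfolding norm_abs_l2_ennreal[OF dsq, of n, symmetric] by (rule ennreal_leI)
  qed
  \<comment> \<open>The weight \<open>2^n\<close> is small enough for the decay
    \<open>(1/4)^n\<close> of the squared norms, so the weighted sum has a finite integral, and
    large enough for that sum to control the unsquared differences.\<close>
  have "(\<integral>\<^sup>+x. (\<Sum>n. ennreal (2^n * (d n x)\<^sup>2)) \<partial>lebesgue)
      = (\<Sum>n. \<integral>\<^sup>+x. ennreal (2^n * (d n x)\<^sup>2) \<partial>lebesgue)"
    by (rule nn_integral_suminf) simp
  also have "... \<le> (\<Sum>n. ennreal ((1/2)^n))"
  proof (rule suminf_le)
    fix n
    have "(\<integral>\<^sup>+x. ennreal (2^n * (d n x)\<^sup>2) \<partial>lebesgue) = ennreal (2^n) * (\<integral>\<^sup>+x. ennreal ((d n x)\<^sup>2) \<partial>lebesgue)"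
      using dsq[of n] by (subst nn_integral_cmult[symmetric]) (auto simp: ennreal_mult sqint_def)
    also have "... \<le> ennreal (2^n) * ennreal ((1/4)^n)" by (intro mult_left_mono nd) auto
    also have "... = ennreal ((1/2)^n)" by (simp flip: ennreal_mult power_mult_distrib)
    finally show "(\<integral>\<^sup>+x. ennreal (2^n * (d n x)\<^sup>2) \<partial>lebesgue) \<le> ennreal ((1/2)^n)" .
  qed auto
  also have "... < \<infinity>"
    by (subst suminf_ennreal2) (auto intro!: summable_geometric)
  finally have "AE x in lebesgue. (\<Sum>n. ennreal (2^n * (d n x)\<^sup>2)) \<noteq> \<infinity>"
    using dsq by (intro nn_integral_PInf_AE) (auto simp: sqint_def)
  then have ae: "AE x in lebesgue. convergent (\<lambda>n. f n x)"
  proof eventually_elim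
    fix x assume "(\<Sum>n. ennreal (2^n * (d n x)\<^sup>2)) \<noteq> \<infinity>"
    then have s: "summable (\<lambda>n. 2^n * (d n x)\<^sup>2)" by (intro summable_suminf_not_top) auto
    have "summable (\<lambda>n. (1/2)^n + 2^n * (d n x)\<^sup>2)" by (intro summable_add s summable_geometric) auto
    then have "summable (\<lambda>n. d n x)"
    proof (rule summable_comparison_test', simp)
      fix n
      \<comment> \<open>Young's inequality with weight \<open>2^n\<close>: expanding the square
        bounds twice the modulus of \<open>d n x\<close> by its weighted square plus
        \<open>(1/2)^n\<close>, so the increments are summable.\<close>
      have "0 \<le> 2^n * (\<bar>d n x\<bar> - (1/2)^n)\<^sup>2" by simp
      also have "... = 2^n * (d n x)\<^sup>2 + (1/2)^n * ((1/2)^n * 2^n) - 2 * \<bar>d n x\<bar> * ((1/2)^n * 2^n)"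
        by (simp add: power2_eq_square algebra_simps)
      also have "(1/2::real)^n * 2^n = 1" by (simp flip: power_mult_distrib)
      finally show "\<bar>d n x\<bar> \<le> (1/2)^n + 2^n * (d n x)\<^sup>2" by simp
    qed
    then have "convergent (\<lambda>n. \<Sum>i<n. d i x)" by (simp add: summable_iff_convergent)
    moreover have "(\<Sum>i<n. d i x) = f n x - f 0 x" for n
      unfolding d_def by (rule sum_lessThan_telescope)
    ultimately have "convergent (\<lambda>n. f n x - f 0 x)" by simp
    from convergent_add[OF this convergent_const[of "f 0 x"]] show "convergent (\<lambda>n. f n x)" by simp
  qed
  define F where "F x = lim (\<lambda>n. f n x)" for x
  have Fm[measurable]: "F \<in> borel_measurable lebesgue" unfolding F_def by measurable
  have lim: "AE x in lebesgue. (\<lambda>n. f n x) \<longlonglongrightarrow> F x"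
    using ae by eventually_elim (simp add: F_def convergent_LIMSEQ_iff)
  have key: "(\<integral>\<^sup>+x. ennreal ((F x - f m x)\<^sup>2) \<partial>lebesgue) \<le> ennreal (e\<^sup>2)"
    if m: "\<And>n. n \<ge> m \<Longrightarrow> norm (X n - X m) \<le> e" and "e > 0" for m e
  proof -
    have "(\<integral>\<^sup>+x. ennreal ((F x - f m x)\<^sup>2) \<partial>lebesgue)
        = (\<integral>\<^sup>+x. liminf (\<lambda>n. ennreal ((f n x - f m x)\<^sup>2)) \<partial>lebesgue)"
    proof (rule nn_integral_cong_AE, use lim in eventually_elim)
      fix x assume "(\<lambda>n. f n x) \<longlonglongrightarrow> F x"
      then have "(\<lambda>n. ennreal ((f n x - f m x)\<^sup>2)) \<longlonglongrightarrow> ennreal ((F x - f m x)\<^sup>2)"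
        by (intro tendsto_ennrealI tendsto_intros)
      then show "ennreal ((F x - f m x)\<^sup>2) = liminf (\<lambda>n. ennreal ((f n x - f m x)\<^sup>2))"
        using lim_imp_Liminf trivial_limit_sequentially by metis
    qed
    also have "... \<le> liminf (\<lambda>n. \<integral>\<^sup>+x. ennreal ((f n x - f m x)\<^sup>2) \<partial>lebesgue)"
      by (intro nn_integral_liminf) auto
    also have "... \<le> liminf (\<lambda>n. ennreal (e\<^sup>2))"
    proof (rule Liminf_mono, rule eventually_sequentiallyI[of m])
      fix n assume "m \<le> n"
      have "norm (abs_l2 (\<lambda>x. f n x - f m x)) \<le> e"
        using m[OF \<open>m \<le> n\<close>] by (simp add: X diff_abs_l2 sq)
      then have "(norm (abs_l2 (\<lambda>x. f n x - f m x)))\<^sup>2 \<le> e\<^sup>2" by (intro power_mono) auto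
      then show "(\<integral>\<^sup>+x. ennreal ((f n x - f m x)\<^sup>2) \<partial>lebesgue) \<le> ennreal (e\<^sup>2)"
        by (subst norm_abs_l2_ennreal[symmetric]) (auto intro!: sqint_diff sq ennreal_leI)
    qed
    also have "... = ennreal (e\<^sup>2)" by (simp add: Liminf_const)
    finally show ?thesis .
  qed
  have ex: "\<exists>m. \<forall>n\<ge>m. \<forall>k\<ge>m. norm (X n - X k) \<le> e" if "e > 0" for e
    using CauchyD[OF Cau that] by (metis less_imp_le)
  have fin: "sqint (\<lambda>x. F x - f m x)" if "\<And>n. n \<ge> m \<Longrightarrow> norm (X n - X m) \<le> e" "e > 0" for m e
    unfolding sqint_def integrable_iff_bounded
    using le_less_trans[OF key[OF that], of \<infinity>] by simp
  \<comment> \<open>The Cauchy property controls only the difference of F to a late member; adding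
    that member back gives F.\<close>
  have Fsq: "sqint F"
  proof -
    obtain m where "\<forall>n\<ge>m. \<forall>k\<ge>m. norm (X n - X k) \<le> 1" using ex[of 1] by auto
    then have "sqint (\<lambda>x. F x - f m x)" using fin[of m 1] by simp
    from sqint_add[OF this sq[of m]] show ?thesis by simp
  qed
  have "X \<longlonglongrightarrow> abs_l2 F"
  proof (rule LIMSEQ_I)
    fix e :: real assume "e > 0"
    obtain m where m: "\<forall>n\<ge>m. \<forall>k\<ge>m. norm (X n - X k) \<le> e/2" using ex[of "e/2"] \<open>e > 0\<close> by auto
    show "\<exists>no. \<forall>n\<ge>no. norm (X n - abs_l2 F) < e"
    proof (intro exI allI impI)
      fix n assume "m \<le> n"
      have "(\<integral>\<^sup>+x. ennreal ((F x - f n x)\<^sup>2) \<partial>lebesgue) \<le> ennreal ((e/2)\<^sup>2)"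
        using key[of n "e/2"] m \<open>m \<le> n\<close> \<open>e > 0\<close> by (meson half_gt_zero le_trans)
      then have "ennreal ((norm (abs_l2 (\<lambda>x. F x - f n x)))\<^sup>2) \<le> ennreal ((e/2)\<^sup>2)"
        by (subst norm_abs_l2_ennreal) (auto intro!: sqint_diff sq Fsq)
      then have "(norm (abs_l2 (\<lambda>x. F x - f n x)))\<^sup>2 \<le> (e/2)\<^sup>2" by (simp add: ennreal_le_iff)
      then have "norm (abs_l2 (\<lambda>x. F x - f n x)) \<le> e/2"
        by (rule power2_le_imp_le) (use \<open>e > 0\<close> in simp)
      then have "norm (abs_l2 F - X n) \<le> e/2" by (simp add: X diff_abs_l2 sq Fsq)
      then show "norm (X n - abs_l2 F) < e" using \<open>e > 0\<close> by (simp add: norm_minus_commute)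
    qed
  qed
  then show ?thesis by (auto simp: convergent_def)
qed

instance l2 :: (euclidean_space) banach
proof
  fix X :: "nat \<Rightarrow> 'a l2"
  assume C: "Cauchy X"
  have "\<exists>M. \<forall>m\<ge>M. \<forall>n\<ge>M. norm (X m - X n) < (1/2)^k" for k :: nat
    by (rule CauchyD[OF C]) simp
  then obtain M where M: "\<And>k m n. m \<ge> M k \<Longrightarrow> n \<ge> M k \<Longrightarrow> norm (X m - X n) < (1/2)^k" by metis
  \<comment> \<open>The summand \<open>k\<close> makes \<open>r\<close> strictly increasing, and the
    partial sums of \<open>M\<close> keep it above \<open>M k\<close>.\<close>
  define r where "r k = k + (\<Sum>i\<le>k. M i)" for k
  have rM: "r k \<ge> M k" for k
    using member_le_sum[of k "{..k}" M] by (auto simp: r_def)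
  have sm: "strict_mono r" by (rule strict_monoI_Suc) (auto simp: r_def)
  have "convergent (X \<circ> r)"
  proof (rule l2_rapid_convergent)
    fix n
    have "r (Suc n) \<ge> M n" using rM[of n] strict_monoD[OF sm, of n "Suc n"] by simp
    then show "norm ((X \<circ> r) (Suc n) - (X \<circ> r) n) \<le> (1/2)^n"
      using M[of n "r (Suc n)" "r n"] rM[of n] by (simp add: less_imp_le)
  next
    show "Cauchy (X \<circ> r)" using C sm by (rule Cauchy_subseq_Cauchy)
  qed
  then show "convergent X"
    using Cauchy_converges_subseq[OF C sm] by (auto simp: convergent_def)
qed

section \<open>Classes of functions on a measurable set\<close>

text \<open>Extension by zero embeds the functions on every set S in one Hilbert space; the image is
  the range of the projection \<open>restr S\<close> below.\<close>

definition cls :: "'a::euclidean_space set \<Rightarrow> ('a \<Rightarrow> real) \<Rightarrow> 'a l2" where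
  "cls S f = abs_l2 (\<lambda>x. if x \<in> S then f x else 0)"

lemma indicator_scaleR_if: "(\<lambda>x. indicator S x *\<^sub>R f x) = (\<lambda>x. if x \<in> S then f x else (0::real))"
  by (auto simp: indicator_def)

lemma Lsq_iff_sqint:
  assumes "S \<in> sets lebesgue"
  shows "Lsq S f \<longleftrightarrow> sqint (\<lambda>x. if x \<in> S then f x else 0)"
proof -
  have "f \<in> borel_measurable (lebesgue_on S) \<longleftrightarrow> (\<lambda>x. if x \<in> S then f x else 0) \<in> borel_measurable lebesgue"
    using assms by (subst borel_measurable_restrict_space_iff) (simp_all only: indicator_scaleR_if sets.Int_space_eq2)
  moreover have "integrable (lebesgue_on S) (\<lambda>x. (f x)\<^sup>2) \<longleftrightarrow> integrable lebesgue (\<lambda>x. (if x \<in> S then f x else 0)\<^sup>2)"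
    using assms by (subst integrable_restrict_space)
      (simp_all only: indicator_scaleR_if sets.Int_space_eq2 if_distrib[of "\<lambda>x. x\<^sup>2"] zero_power2)
  ultimately show ?thesis by (simp add: Lsq_def sqint_def)
qed

lemma Lsq_add: "S \<in> sets lebesgue \<Longrightarrow> Lsq S f \<Longrightarrow> Lsq S g \<Longrightarrow> Lsq S (\<lambda>x. f x + g x)"
  unfolding Lsq_iff_sqint 
    using sqint_add[of "\<lambda>x. if x \<in> S then f x else 0" "\<lambda>x. if x \<in> S then g x else 0"]
    by (auto simp: if_distrib cong: if_cong elim!: back_subst[of sqint])

lemma Lsq_scale: "S \<in> sets lebesgue \<Longrightarrow> Lsq S f \<Longrightarrow> Lsq S (\<lambda>x. c * f x)"
  unfolding Lsq_iff_sqint 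
    using sqint_scale[of "\<lambda>x. if x \<in> S then f x else 0" c]
    by (simp only: if_distrib[of "\<lambda>t. c * t"] mult_zero_right simp_thms)

lemma Lsq_diff: "S \<in> sets lebesgue \<Longrightarrow> Lsq S f \<Longrightarrow> Lsq S g \<Longrightarrow> Lsq S (\<lambda>x. f x - g x)"
  unfolding Lsq_iff_sqint 
    using sqint_diff[of "\<lambda>x. if x \<in> S then f x else 0" "\<lambda>x. if x \<in> S then g x else 0"]
    by (auto simp: if_distrib cong: if_cong elim!: back_subst[of sqint])

lemma Lsq_zero: "S \<in> sets lebesgue \<Longrightarrow> Lsq S (\<lambda>x. 0)"
  unfolding Lsq_iff_sqint by (simp add: sqint_zero)

lemma cls_add: "S \<in> sets lebesgue \<Longrightarrow> Lsq S f \<Longrightarrow> Lsq S g \<Longrightarrow> cls S (\<lambda>x. f x + g x) = cls S f + cls S g"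
  unfolding cls_def Lsq_iff_sqint by (subst add_abs_l2) (auto intro!: arg_cong[where f=abs_l2])

lemma cls_diff: "S \<in> sets lebesgue \<Longrightarrow> Lsq S f \<Longrightarrow> Lsq S g \<Longrightarrow> cls S (\<lambda>x. f x - g x) = cls S f - cls S g"
  unfolding cls_def Lsq_iff_sqint by (subst diff_abs_l2) (auto intro!: arg_cong[where f=abs_l2])

lemma cls_scale: "S \<in> sets lebesgue \<Longrightarrow> Lsq S f \<Longrightarrow> cls S (\<lambda>x. c * f x) = c *\<^sub>R cls S f"
  unfolding cls_def Lsq_iff_sqint by (subst scaleR_abs_l2) (auto intro!: arg_cong[where f=abs_l2])

lemma cls_zero: "cls S (\<lambda>x. 0) = 0"
  unfolding cls_def zero_l2_def by (auto intro!: arg_cong[where f=abs_l2])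

lemma cls_cong: "(\<And>x. x \<in> S \<Longrightarrow> f x = g x) \<Longrightarrow> cls S f = cls S g"
  unfolding cls_def by (auto intro!: arg_cong[where f=abs_l2])

lemma inner_cls:
  assumes "S \<in> sets lebesgue" "Lsq S f" "Lsq S g"
  shows "inner (cls S f) (cls S g) = ip S f g"
proof -
  have "inner (cls S f) (cls S g)
      = integral\<^sup>L lebesgue (\<lambda>x. (if x \<in> S then f x else 0) * (if x \<in> S then g x else 0))"
    using assms unfolding cls_def by (subst inner_abs_l2) (auto simp: Lsq_iff_sqint)
  also have "... = integral\<^sup>L lebesgue (\<lambda>x. indicator S x *\<^sub>R (f x * g x))"
    by (rule arg_cong[where f="integral\<^sup>L lebesgue"]) (auto simp: indicator_def)
  also have "... = ip S f g"
    using assms unfolding ip_def by (subst integral_restrict_space) auto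
  finally show ?thesis .
qed

lemma Lsq_mult_integrable:
  assumes "S \<in> sets lebesgue" "Lsq S f" "Lsq S g"
  shows "integrable (lebesgue_on S) (\<lambda>x. f x * g x)"
proof -
  have "integrable lebesgue (\<lambda>x. (if x \<in> S then f x else 0) * (if x \<in> S then g x else 0))"
    using assms by (intro sqint_mult_integrable) (auto simp: Lsq_iff_sqint)
  then show ?thesis
    using assms by (subst integrable_restrict_space) (auto simp: indicator_def elim!: back_subst[of "integrable lebesgue"])
qed

lemma cls_eq_iff:
  assumes "S \<in> sets lebesgue" "Lsq S f" "Lsq S g"
  shows "cls S f = cls S g \<longleftrightarrow> (AE x in lebesgue_on S. f x = g x)"
proof -
  have "cls S f = cls S g \<longleftrightarrow> (AE x in lebesgue. (if x \<in> S then f x else 0) = (if x \<in> S then g x else 0))"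
    using assms unfolding cls_def by (subst abs_l2_eq_iff) (auto simp: Lsq_iff_sqint)
  also have "... \<longleftrightarrow> (AE x in lebesgue. x \<in> S \<longrightarrow> f x = g x)"
    by (rule AE_cong) auto
  also have "... \<longleftrightarrow> (AE x in lebesgue_on S. f x = g x)"
    using assms by (subst AE_restrict_space_iff) auto
  finally show ?thesis .
qed

section \<open>Representatives and restriction to a set\<close>

definition rp :: "'a::euclidean_space l2 \<Rightarrow> 'a \<Rightarrow> real" where
  "rp F = (SOME f. sqint f \<and> F = abs_l2 f)"

lemma sqint_rp: "sqint (rp F)" and abs_l2_rp: "abs_l2 (rp F) = F"
proof -
  have "\<exists>f. sqint f \<and> F = abs_l2 f" by (metis abs_l2_cases)
  then have "sqint (rp F) \<and> F = abs_l2 (rp F)" unfolding rp_def by (rule someI_ex)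
  then show "sqint (rp F)" "abs_l2 (rp F) = F" by auto
qed

lemma sqint_indicator:
  assumes "S \<in> sets lebesgue" "sqint f"
  shows "sqint (\<lambda>x. if x \<in> S then f x else 0)"
proof -
  have "(\<lambda>x. if x \<in> S then f x else 0) = (\<lambda>x. indicator S x * f x)"
    by (auto simp: indicator_def)
  moreover have "integrable lebesgue (\<lambda>x. indicator S x * (f x)\<^sup>2)"
    using assms integrable_mult_indicator[of S lebesgue "\<lambda>x. (f x)\<^sup>2"] by (auto simp: sqint_def)
  moreover have "(\<lambda>x. indicator S x * (f x)\<^sup>2) = (\<lambda>x. (indicator S x * f x)\<^sup>2)"
    by (auto simp: indicator_def)
  ultimately show ?thesis using assms by (auto simp: sqint_def)
qed

lemma Lsq_rp: "S \<in> sets lebesgue \<Longrightarrow> Lsq S (rp F)"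
  by (simp add: Lsq_iff_sqint sqint_indicator sqint_rp)

text \<open>This is the orthogonal projection onto the classes that vanish outside S; the equation
  \<open>restr S F = F\<close> serves throughout as the membership condition for L2(S).\<close>

definition restr :: "'a::euclidean_space set \<Rightarrow> 'a l2 \<Rightarrow> 'a l2" where
  "restr S F = cls S (rp F)"

lemma restr_abs_l2:
  assumes "S \<in> sets lebesgue" "sqint f"
  shows "restr S (abs_l2 f) = cls S f"
proof -
  have "AE x in lebesgue. rp (abs_l2 f) x = f x"
    using abs_l2_eq_iff[OF sqint_rp[of "abs_l2 f"] assms(2)] by (simp add: abs_l2_rp)
  then have "AE x in lebesgue. (if x \<in> S then rp (abs_l2 f) x else 0) = (if x \<in> S then f x else 0)"
    by eventually_elim auto
  then show ?thesis unfolding restr_def cls_def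
    by (subst abs_l2_eq_iff) (auto intro!: sqint_indicator sqint_rp assms)
qed

lemma restr_cls:
  assumes "S \<in> sets lebesgue" "T \<in> sets lebesgue" "Lsq S f"
  shows "restr T (cls S f) = cls (S \<inter> T) f"
proof -
  have "restr T (cls S f) = cls T (\<lambda>x. if x \<in> S then f x else 0)"
    using assms unfolding cls_def[of S] by (intro restr_abs_l2) (auto simp: Lsq_iff_sqint)
  then show ?thesis unfolding cls_def by (auto intro!: arg_cong[of _ _ abs_l2])
qed

lemma restr_subset:
  "S \<in> sets lebesgue \<Longrightarrow> T \<in> sets lebesgue \<Longrightarrow> T \<subseteq> S \<Longrightarrow> Lsq S f \<Longrightarrow> restr T (cls S f) = cls T f"
  by (simp add: restr_cls Int_absorb1)

lemma restr_idem: "S \<in> sets lebesgue \<Longrightarrow> Lsq S f \<Longrightarrow> restr S (cls S f) = cls S f"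
  by (simp add: restr_cls)

lemma Lsq_subset:
  assumes "S \<in> sets lebesgue" "T \<in> sets lebesgue" "T \<subseteq> S" "Lsq S f"
  shows "Lsq T f"
proof -
  have "sqint (\<lambda>x. if x \<in> T then (if x \<in> S then f x else 0) else 0)"
    using assms(4) unfolding Lsq_iff_sqint[OF assms(1)] by (rule sqint_indicator[OF assms(2)])
  also have "(\<lambda>x. if x \<in> T then (if x \<in> S then f x else 0) else 0) = (\<lambda>x. if x \<in> T then f x else 0)"
    using assms by (intro ext) auto
  finally show ?thesis using assms(2) by (simp add: Lsq_iff_sqint)
qed

lemma inner_restr:
  assumes "S \<in> sets lebesgue"
  shows "inner (restr S F) G = inner (restr S F) (restr S G)"
    and "inner (restr S F) G = inner F (restr S G)"
proof -
  have F: "F = abs_l2 (rp F)" and G: "G = abs_l2 (rp G)" by (simp_all add: abs_l2_rp)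
  have 1: "inner (restr S F) G = integral\<^sup>L lebesgue (\<lambda>x. (if x \<in> S then rp F x else 0) * rp G x)"
    unfolding restr_def cls_def by (subst G, subst inner_abs_l2) (auto intro!: sqint_rp sqint_indicator assms)
  have 2: "inner (restr S F) (restr S G) = integral\<^sup>L lebesgue (\<lambda>x. (if x \<in> S then rp F x else 0) * (if x \<in> S then rp G x else 0))"
    unfolding restr_def cls_def by (subst inner_abs_l2) (auto intro!: sqint_rp sqint_indicator assms)
  have 3: "inner F (restr S G) = integral\<^sup>L lebesgue (\<lambda>x. rp F x * (if x \<in> S then rp G x else 0))"
    unfolding restr_def cls_def by (subst F, subst inner_abs_l2) (auto intro!: sqint_rp sqint_indicator assms)
  show "inner (restr S F) G = inner (restr S F) (restr S G)" unfolding 1 2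
    by (rule arg_cong[where f="integral\<^sup>L lebesgue"]) auto
  show "inner (restr S F) G = inner F (restr S G)" unfolding 1 3
    by (rule arg_cong[where f="integral\<^sup>L lebesgue"]) auto
qed

lemma bounded_linear_restr:
  assumes S: "S \<in> sets lebesgue"
  shows "bounded_linear (restr S)"
proof (rule bounded_linear_intro[where K=1])
  fix F G :: "'a l2" and c :: real
  have *: "F + G = abs_l2 (\<lambda>x. rp F x + rp G x)" "c *\<^sub>R F = abs_l2 (\<lambda>x. c * rp F x)"
    by (simp_all add: abs_l2_rp sqint_rp flip: add_abs_l2 scaleR_abs_l2)
  show "restr S (F + G) = restr S F + restr S G"
    unfolding * by (subst restr_abs_l2) (auto simp: S sqint_add sqint_rp cls_add Lsq_rp restr_def)
  show "restr S (c *\<^sub>R F) = c *\<^sub>R restr S F"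
    unfolding * by (subst restr_abs_l2) (auto simp: S sqint_scale sqint_rp cls_scale Lsq_rp restr_def)
  have "(norm (restr S F))\<^sup>2 \<le> norm (restr S F) * norm F"
    unfolding power2_norm_eq_inner inner_restr(1)[OF S, symmetric] by (rule norm_cauchy_schwarz)
  then show "norm (restr S F) \<le> norm F * 1"
    by (cases "norm (restr S F) = 0") (auto simp: power2_eq_square)
qed

lemma norm_restr_le: "S \<in> sets lebesgue \<Longrightarrow> norm (restr S F) \<le> norm F"
proof -
  assume S: "S \<in> sets lebesgue"
  have "(norm (restr S F))\<^sup>2 \<le> norm (restr S F) * norm F"
    unfolding power2_norm_eq_inner inner_restr(1)[OF S, symmetric] by (rule norm_cauchy_schwarz)
  then show ?thesis
    by (cases "norm (restr S F) = 0") (auto simp: power2_eq_square)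
qed

lemma norm_cls_subset:
  "S \<in> sets lebesgue \<Longrightarrow> T \<in> sets lebesgue \<Longrightarrow> T \<subseteq> S \<Longrightarrow> Lsq S f \<Longrightarrow> norm (cls T f) \<le> norm (cls S f)"
  using norm_restr_le[of T "cls S f"] by (simp add: restr_subset)

section \<open>Saddle point problems in Hilbert spaces\<close>

text \<open>The minimiser of the squared norm minus \<open>2 * l x\<close> represents l; by the
  parallelogram law every minimising sequence is Cauchy. Linearity and the bound are asked for on S
  only, because some functionals to be represented are built from a mere choice of preimages and are
  linear only there.\<close>

lemma riesz_subspace:
  fixes S :: "'x::{real_inner,banach} set" and l :: "'x \<Rightarrow> real"
  assumes S: "subspace S" "closed S"
    and add: "\<And>x y. x \<in> S \<Longrightarrow> y \<in> S \<Longrightarrow> l (x + y) = l x + l y"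
    and scale: "\<And>c x. x \<in> S \<Longrightarrow> l (c *\<^sub>R x) = c * l x"
    and bd: "\<And>x. x \<in> S \<Longrightarrow> \<bar>l x\<bar> \<le> K * norm x"
  shows "\<exists>z\<in>S. \<forall>y\<in>S. l y = inner z y"
proof -
  define J where "J x = (norm x)\<^sup>2 - 2 * l x" for x
  have J_lower: "- K\<^sup>2 \<le> J x" if "x \<in> S" for x
  proof -
    have "0 \<le> (norm x - K)\<^sup>2" by simp
    then show ?thesis using bd[OF that] unfolding J_def by (simp add: power2_eq_square algebra_simps)
  qed
  have S0: "0 \<in> S" using S by (simp add: subspace_0)
  define m where "m = Inf (J ` S)"
  have bb: "bdd_below (J ` S)" using J_lower by (intro bdd_belowI2) auto
  have mle: "m \<le> J x" if "x \<in> S" for x unfolding m_def using that bb by (intro cInf_lower) auto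
  have "\<exists>x\<in>S. J x < m + e" if "e > 0" for e
    using cInf_lessD[of "J ` S" "m + e"] S0 that unfolding m_def by auto
  then have "\<forall>n. \<exists>x\<in>S. J x < m + 1 / real (Suc n)" by simp
  then obtain X where XS: "\<And>n. X n \<in> S" and XJ: "\<And>n. J (X n) < m + 1 / real (Suc n)" by metis
  have par: "(norm (x - y))\<^sup>2 \<le> 2 * (J x + J y - 2 * m)" if "x \<in> S" "y \<in> S" for x y
  proof -
    have "(1/2) *\<^sub>R (x + y) \<in> S" using S that by (simp add: subspace_add subspace_scale)
    then have "m \<le> J ((1/2) *\<^sub>R (x + y))" by (rule mle)
    also have "l ((1/2) *\<^sub>R (x + y)) = (l x + l y) / 2"
      using scale[of "x + y" "1/2"] add that S by (simp add: subspace_add)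
    then have "J ((1/2) *\<^sub>R (x + y)) = (norm (x + y))\<^sup>2 / 4 - (l x + l y)"
      unfolding J_def by (simp add: power_divide)
    finally have "m \<le> (norm (x + y))\<^sup>2 / 4 - (l x + l y)" .
    moreover have "(norm (x + y))\<^sup>2 + (norm (x - y))\<^sup>2 = 2 * (norm x)\<^sup>2 + 2 * (norm y)\<^sup>2"
      by (simp add: power2_norm_eq_inner inner_simps)
    ultimately show ?thesis unfolding J_def by (simp add: algebra_simps)
  qed
  have "Cauchy X"
  proof (rule CauchyI)
    fix e :: real assume "e > 0"
    then obtain N where N: "inverse (real (Suc N)) < e\<^sup>2 / 4" using reals_Archimedean[of "e\<^sup>2/4"] by auto
    show "\<exists>M. \<forall>i\<ge>M. \<forall>k\<ge>M. norm (X i - X k) < e"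
    proof (intro exI allI impI)
      fix i k assume ik: "N \<le> i" "N \<le> k"
      have J_small: "J (X i) < m + e\<^sup>2 / 4" if "N \<le> i" for i
      proof -
        have "1 / real (Suc i) \<le> inverse (real (Suc N))" using that by (auto simp: field_simps)
        then show ?thesis using XJ[of i] N by argo
      qed
      have "(norm (X i - X k))\<^sup>2 < e\<^sup>2"
        using par[OF XS[of i] XS[of k]] J_small[OF ik(1)] J_small[OF ik(2)] by argo
      then show "norm (X i - X k) < e" using \<open>e > 0\<close> by (rule power2_less_imp_less[OF _ less_imp_le])
    qed
  qed
  then obtain z where z: "X \<longlonglongrightarrow> z" using Cauchy_convergent convergent_def by blast
  have zS: "z \<in> S" using closed_sequentially[OF S(2) _ z] XS by blast
  have lz: "(\<lambda>n. l (X n)) \<longlonglongrightarrow> l z"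
  proof (rule LIM_zero_cancel, rule Lim_null_comparison)
    show "(\<lambda>n. \<bar>K\<bar> * norm (X n - z)) \<longlonglongrightarrow> 0"
      using z by (intro tendsto_mult_right_zero tendsto_norm_zero) (simp add: LIM_zero)
    have "norm (l (X n) - l z) \<le> \<bar>K\<bar> * norm (X n - z)" for n
    proof -
      have "l (X n - z) = l (X n) - l z"
        using add[of "X n" "(-1) *\<^sub>R z"] scale[of z "-1"] XS zS S by (simp add: subspace_scale subspace_neg)
      moreover have "\<bar>l (X n - z)\<bar> \<le> K * norm (X n - z)" using bd XS zS S by (simp add: subspace_diff)
      moreover have "K * norm (X n - z) \<le> \<bar>K\<bar> * norm (X n - z)" by (intro mult_right_mono) auto
      ultimately show ?thesis by simp
    qed
    then show "\<forall>\<^sub>F n in sequentially. norm (l (X n) - l z) \<le> \<bar>K\<bar> * norm (X n - z)" by simp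
  qed
  have "(\<lambda>n. J (X n)) \<longlonglongrightarrow> J z" unfolding J_def by (intro tendsto_intros z lz)
  moreover have "(\<lambda>n. m + 1 / real (Suc n)) \<longlonglongrightarrow> m + 0"
    using LIMSEQ_inverse_real_of_nat by (intro tendsto_intros) (simp add: inverse_eq_divide)
  ultimately have Jz: "J z \<le> m"
    using LIMSEQ_le[of "\<lambda>n. J (X n)" "J z" "\<lambda>n. m + 1 / real (Suc n)" m] XJ by (auto intro: less_imp_le)
  have "l y = inner z y" if y: "y \<in> S" for y
  proof -
    define d where "d = inner z y - l y"
    have *: "0 \<le> 2 * t * d + t\<^sup>2 * (norm y)\<^sup>2" for t
    proof -
      have "z + t *\<^sub>R y \<in> S" using zS y S by (simp add: subspace_add subspace_scale)
      then have "J z \<le> J (z + t *\<^sub>R y)" using Jz mle order_trans by blast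
      moreover have "l (z + t *\<^sub>R y) = l z + t * l y"
        using add zS y S scale by (simp add: subspace_scale)
      moreover have "(norm (z + t *\<^sub>R y))\<^sup>2 = (norm z)\<^sup>2 + 2 * t * inner z y + t\<^sup>2 * (norm y)\<^sup>2"
        unfolding power2_norm_eq_inner
        by (simp add: inner_add_left inner_add_right inner_commute[of y z] power2_eq_square algebra_simps)
      ultimately show ?thesis unfolding J_def d_def by (simp add: algebra_simps)
    qed
    \<comment> \<open>The best step would be \<open>- d\<close> over the squared norm of y. Adding 1
      avoids a case distinction for y = 0 and still makes the quadratic negative unless d =
      0.\<close>
    define q where "q = (norm y)\<^sup>2 + 1"
    have q: "q > 0" by (simp add: q_def add_nonneg_pos)
    have "0 \<le> 2 * (- d / q) * d + (- d / q)\<^sup>2 * (norm y)\<^sup>2" by (rule *)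
    also have "... \<le> 2 * (- d / q) * d + (- d / q)\<^sup>2 * q"
      unfolding q_def by (intro add_left_mono mult_left_mono) auto
    also have "... = - (d\<^sup>2 / q)" using q by (simp add: field_simps power2_eq_square)
    finally have "d\<^sup>2 / q \<le> 0" by simp
    then have "d\<^sup>2 \<le> 0" using q by (simp add: divide_le_0_iff)
    then show ?thesis by (simp add: d_def)
  qed
  then show ?thesis using zS by blast
qed

text \<open>The Riesz representative of \<open>inner x\<close> on S is the orthogonal projection of
  x, and x minus its projection is the vector sought.\<close>

lemma orthogonal_vector_exists:
  fixes S :: "'x::{real_inner,banach} set"
  assumes S: "subspace S" "closed S" and T: "subspace T" "S \<subseteq> T" and x: "x \<in> T" "x \<notin> S"
  shows "\<exists>w\<in>T. w \<noteq> 0 \<and> (\<forall>y\<in>S. inner w y = 0)"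
proof -
  have "\<exists>z\<in>S. \<forall>y\<in>S. inner x y = inner z y"
    by (rule riesz_subspace[OF S, where K="norm x"]) (auto simp: inner_add_right Cauchy_Schwarz_ineq2)
  then obtain z where "z \<in> S" "\<forall>y\<in>S. inner x y = inner z y" by blast
  then show ?thesis
    using x T by (intro bexI[of _ "x - z"]) (auto simp: inner_diff_left subspace_diff)
qed

text \<open>As a is not symmetric, there is no energy to minimise. The solution is the fixed point
  of \<open>x - t *\<^sub>R (T x - z)\<close>, where T and z are the Riesz representatives of the
  form and of the functional.\<close>

lemma lax_milgram:
  fixes S :: "'x::{real_inner,banach} set"
  assumes S: "subspace S" "closed S" and a: "bounded_bilinear a" and l: "bounded_linear l"
    and c: "c > 0" and coer: "\<And>x. x \<in> S \<Longrightarrow> c * (norm x)\<^sup>2 \<le> a x x"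
  shows "\<exists>x\<in>S. \<forall>y\<in>S. a x y = (l y :: real)"
proof -
  interpret a: bounded_bilinear a by fact
  interpret l: bounded_linear l by fact
  obtain M0 where M0: "\<And>x y. norm (a x y) \<le> norm x * norm y * M0" using a.nonneg_bounded by blast
  \<comment> \<open>Adding c makes M positive and at least c, so that the contraction factor
    \<open>k\<close> below is the root of a number in [0, 1).\<close>
  define M where "M = \<bar>M0\<bar> + c"
  have M: "\<bar>a x y\<bar> \<le> M * norm x * norm y" for x y
  proof -
    have "\<bar>a x y\<bar> \<le> norm x * norm y * M0" using M0[of x y] by simp
    also have "... \<le> norm x * norm y * M" using c by (intro mult_left_mono) (auto simp: M_def)
    finally show ?thesis by (simp add: mult_ac)
  qed
  have Mc: "M > 0" "c \<le> M" using c by (auto simp: M_def)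
  have "\<forall>x. \<exists>z\<in>S. \<forall>y\<in>S. a x y = inner z y"
    using M by (intro allI riesz_subspace[OF S, where K="M * norm _"])
      (auto simp: a.add_right a.scaleR_right)
  then obtain T where TS: "\<And>x. T x \<in> S" and T: "\<And>x y. y \<in> S \<Longrightarrow> a x y = inner (T x) y" by metis
  obtain L where L: "\<And>x. norm (l x) \<le> norm x * L" using l.bounded by blast
  have "\<exists>z\<in>S. \<forall>y\<in>S. l y = inner z y"
    using L by (intro riesz_subspace[OF S, where K=L]) (auto simp: l.add l.scaleR mult.commute)
  then obtain z where zS: "z \<in> S" and z: "\<And>y. y \<in> S \<Longrightarrow> l y = inner z y" by blast
  \<comment> \<open>This t minimises \<open>1 - 2 * t * c + t\<^sup>2 * M\<^sup>2\<close>, the bound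
    for the squared contraction factor.\<close>
  define t where "t = c / M\<^sup>2"
  define f where "f x = x - t *\<^sub>R (T x - z)" for x
  define k where "k = sqrt (1 - (c / M)\<^sup>2)"
  have cM: "0 < (c / M)\<^sup>2" "(c / M)\<^sup>2 \<le> 1" using Mc c by (auto simp: power_le_one)
  have contr: "norm (f x - f y) \<le> k * norm (x - y)" if "x \<in> S" "y \<in> S" for x y
  proof -
    define w where "w = x - y"
    define u where "u = T x - T y"
    have uS: "u \<in> S" and wS: "w \<in> S" using that TS S by (auto simp: u_def w_def subspace_diff)
    have au: "a w v = inner u v" if "v \<in> S" for v
      by (simp only: w_def u_def a.diff_left inner_diff_left T[OF that, symmetric])
    have nu: "norm u \<le> M * norm w"
    proof -
      have "norm u * norm u \<le> (M * norm w) * norm u"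
        using au[OF uS] M[of w u] by (simp add: power2_norm_eq_inner flip: power2_eq_square)
      then show ?thesis using Mc by (cases "norm u = 0") auto
    qed
    have "f x - f y = w - t *\<^sub>R u" by (simp add: f_def w_def u_def algebra_simps)
    have "(norm (f x - f y))\<^sup>2 = (norm w)\<^sup>2 - 2 * t * inner u w + t\<^sup>2 * (norm u)\<^sup>2"
      unfolding \<open>f x - f y = w - t *\<^sub>R u\<close> power2_norm_eq_inner
      by (simp add: inner_diff_left inner_diff_right inner_commute[of w u] power2_eq_square algebra_simps)
    also have "... \<le> (norm w)\<^sup>2 - 2 * t * (c * (norm w)\<^sup>2) + t\<^sup>2 * (M * norm w)\<^sup>2"
    proof -
      have "2 * t * (c * (norm w)\<^sup>2) \<le> 2 * t * inner u w"
        using coer[OF wS] au[OF wS] c by (intro mult_left_mono) (auto simp: t_def)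
      moreover have "t\<^sup>2 * (norm u)\<^sup>2 \<le> t\<^sup>2 * (M * norm w)\<^sup>2"
        using nu by (intro mult_left_mono power_mono) auto
      ultimately show ?thesis by linarith
    qed
    also have "... = (1 - (c / M)\<^sup>2) * (norm w)\<^sup>2"
      unfolding t_def using Mc by (simp add: field_simps power2_eq_square)
    also have "... = (k * norm w)\<^sup>2" using cM by (simp add: k_def power_mult_distrib)
    finally show ?thesis unfolding w_def
      by (rule power2_le_imp_le) (use cM in \<open>simp add: k_def\<close>)
  qed
  have "\<exists>!x\<in>S. f x = x"
  proof (rule Banach_fix)
    show "complete S" using S(2) by (simp add: complete_eq_closed)
    show "S \<noteq> {}" using zS by auto
    show "0 \<le> k" "k < 1" using cM by (auto simp: k_def)
    show "f ` S \<subseteq> S" unfolding f_def using TS zS S by (auto intro!: subspace_diff subspace_scale)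
    show "dist (f x) (f y) \<le> k * dist x y" if "x \<in> S" "y \<in> S" for x y
      using contr that by (simp add: dist_norm)
  qed
  then obtain x where xS: "x \<in> S" and fx: "f x = x" by blast
  have "t \<noteq> 0" using c Mc by (simp add: t_def)
  then have "T x = z" using fx by (simp add: f_def)
  then have "\<forall>y\<in>S. a x y = l y" using T z by simp
  then show ?thesis using xS by blast
qed

text \<open>Each application of the approximate inverse halves the residual, so the corrections form
  a geometric series. The approximate inverse is a choice without linearity.\<close>

lemma right_inverse_from_approximate:
  fixes B :: "'x::{real_inner,banach} \<Rightarrow> 'q::{real_inner,banach}"
  assumes S: "subspace S" "closed S" and B: "bounded_linear B" and Q: "subspace Q" "B ` S \<subseteq> Q"
    and approx: "\<And>q. q \<in> Q \<Longrightarrow> \<exists>x\<in>S. norm x \<le> C * norm q \<and> norm (B x - q) \<le> norm q / 2"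
    and q: "q \<in> Q"
  shows "\<exists>x\<in>S. B x = q \<and> norm x \<le> 2 * C * norm q"
proof -
  interpret B: bounded_linear B by fact
  obtain R where RS: "\<And>q. q \<in> Q \<Longrightarrow> R q \<in> S" and RC: "\<And>q. q \<in> Q \<Longrightarrow> norm (R q) \<le> C * norm q"
    and RB: "\<And>q. q \<in> Q \<Longrightarrow> norm (B (R q) - q) \<le> norm q / 2"
    using approx by metis
  define r where "r = rec_nat q (\<lambda>n s. s - B (R s))"
  have r0: "r 0 = q" and rS: "r (Suc n) = r n - B (R (r n))" for n by (simp_all add: r_def)
  have rQ: "r n \<in> Q" for n
  proof (induction n)
    case (Suc n)
    then show ?case using RS[OF Suc] Q by (auto simp: rS intro!: subspace_diff)
  qed (simp add: r0 q)
  have rn: "norm (r n) \<le> (1/2)^n * norm q" for n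
  proof (induction n)
    case (Suc n)
    have "norm (r (Suc n)) \<le> norm (r n) / 2"
      using RB[OF rQ[of n]] by (simp add: rS norm_minus_commute)
    also have "... \<le> (1/2)^Suc n * norm q" using Suc by simp
    finally show ?case .
  qed (simp add: r0)
  have C0: "0 \<le> C * norm q" using order_trans[OF norm_ge_zero RC[OF q]] .
  \<comment> \<open>No sign of C is assumed; it follows only when q is nonzero, hence the
    split.\<close>
  have xn: "norm (R (r n)) \<le> (1/2)^n * (C * norm q)" for n
  proof (cases "norm q = 0")
    case True
    then have "norm (r n) = 0" using rn[of n] by simp
    then show ?thesis using RC[OF rQ[of n]] True by simp
  next
    case False
    then have "C \<ge> 0" using C0 by (simp add: zero_le_mult_iff)
    have "norm (R (r n)) \<le> C * norm (r n)" by (rule RC[OF rQ])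
    also have "... \<le> C * ((1/2)^n * norm q)" using rn \<open>C \<ge> 0\<close> by (intro mult_left_mono)
    finally show ?thesis by (simp add: mult_ac)
  qed
  have sg: "summable (\<lambda>n. (1/2::real)^n * (C * norm q))" by (intro summable_mult2 summable_geometric) simp
  have sn: "summable (\<lambda>n. norm (R (r n)))" by (rule summable_comparison_test'[OF sg, of 0]) (simp add: xn)
  then have sR: "summable (\<lambda>n. R (r n))" by (rule summable_norm_cancel)
  define x where "x = (\<Sum>n. R (r n))"
  have "(\<lambda>n. \<Sum>i<n. R (r i)) \<longlonglongrightarrow> x" unfolding x_def using sR by (rule summable_LIMSEQ)
  moreover have "(\<Sum>i<n. R (r i)) \<in> S" for n using S RS rQ by (intro subspace_sum) auto
  ultimately have xS: "x \<in> S" by (intro closed_sequentially[OF S(2), of "\<lambda>n. \<Sum>i<n. R (r i)" x])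
  have "norm x \<le> (\<Sum>n. norm (R (r n)))" unfolding x_def by (rule summable_norm[OF sn])
  also have "... \<le> (\<Sum>n. (1/2)^n * (C * norm q))" by (rule suminf_le[OF xn sn sg])
  also have "... = 2 * C * norm q"
    using suminf_mult2[OF summable_geometric[of "1/2::real"], of "C * norm q"] suminf_geometric[of "1/2::real"]
    by simp
  finally have nx: "norm x \<le> 2 * C * norm q" .
  have "(\<lambda>n. B (R (r n))) sums B x" unfolding x_def using sR by (intro B.sums summable_sums)
  moreover have "(\<lambda>n. B (R (r n))) sums q"
  proof -
    have "(\<Sum>i<n. B (R (r i))) = q - r n" for n by (induction n) (simp_all add: r0 rS)
    moreover have "r \<longlonglongrightarrow> 0"
    proof (rule Lim_null_comparison)
      show "\<forall>\<^sub>F n in sequentially. norm (r n) \<le> (1/2)^n * norm q" using rn by simp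
      show "(\<lambda>n. (1/2)^n * norm q) \<longlonglongrightarrow> 0" by (intro tendsto_mult_left_zero LIMSEQ_power_zero) simp
    qed
    then have "(\<lambda>n. q - r n) \<longlonglongrightarrow> q" using tendsto_diff[OF tendsto_const] by force
    ultimately show ?thesis by (simp add: sums_def)
  qed
  ultimately have "B x = q" by (rule sums_unique2)
  then show ?thesis using xS nx by blast
qed

text \<open>Lax-Milgram on the kernel of B gives x. The residual \<open>F y = a x y - l y\<close>
  vanishes on that kernel, so it depends on \<open>B y\<close> alone, and its Riesz representative
  on Q is the multiplier p.\<close>

lemma saddle_point_exists:
  fixes B :: "'x::{real_inner,banach} \<Rightarrow> 'q::{real_inner,banach}" and a :: "'x \<Rightarrow> 'x \<Rightarrow> real"
  assumes S: "subspace S" "closed S" and a: "bounded_bilinear a" and l: "bounded_linear l"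
    and c: "c > 0" and coer: "\<And>x. x \<in> S \<Longrightarrow> c * (norm x)\<^sup>2 \<le> a x x"
    and B: "bounded_linear B" and Q: "subspace Q" "closed Q" "B ` S \<subseteq> Q"
    and approx: "\<And>q. q \<in> Q \<Longrightarrow> \<exists>x\<in>S. norm x \<le> C * norm q \<and> norm (B x - q) \<le> norm q / 2"
  shows "\<exists>x\<in>S. \<exists>p\<in>Q. B x = 0 \<and> (\<forall>y\<in>S. a x y - inner p (B y) = l y)"
proof -
  interpret a: bounded_bilinear a by fact
  interpret l: bounded_linear l by fact
  interpret B: bounded_linear B by fact
  define Z where "Z = S \<inter> {x. B x = 0}"
  have Z1: "subspace Z" unfolding Z_def
    using S(1) by (auto simp: subspace_def B.add B.scaleR B.zero)
  have "closed {x. B x = 0}"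
    using B.continuous_on[OF continuous_on_id] by (intro closed_Collect_eq continuous_on_const) auto
  then have Z2: "closed Z" unfolding Z_def using S by auto
  obtain x where x: "x \<in> Z" "\<And>y. y \<in> Z \<Longrightarrow> a x y = l y"
    using lax_milgram[OF Z1 Z2 a l c] coer unfolding Z_def by blast
  obtain R where RS: "\<And>q. q \<in> Q \<Longrightarrow> R q \<in> S" and RB: "\<And>q. q \<in> Q \<Longrightarrow> B (R q) = q"
    and RC: "\<And>q. q \<in> Q \<Longrightarrow> norm (R q) \<le> 2 * C * norm q"
    using right_inverse_from_approximate[OF S B Q(1,3) approx] by metis
  define F where "F y = a x y - l y" for y
  have Fadd: "F (y + z) = F y + F z" "F (y - z) = F y - F z" and Fsc: "F (k *\<^sub>R y) = k * F y" for y z k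
    by (simp_all add: F_def a.add_right l.add a.diff_right l.diff a.scaleR_right l.scaleR algebra_simps)
  have F0: "F y = 0" if "y \<in> S" "B y = 0" for y using x(2) that by (simp add: F_def Z_def)
  obtain La where La: "\<And>y. norm (a x y) \<le> norm y * La"
    using bounded_linear.bounded[OF a.bounded_linear_right] by blast
  obtain Ll where Ll: "\<And>y. norm (l y) \<le> norm y * Ll" using l.bounded by blast
  \<comment> \<open>The preimages \<open>R q\<close> are not linear in q, but their defect lies in
    the kernel of B, where F vanishes; this makes \<open>F (R q)\<close> linear.\<close>
  have "\<exists>p\<in>Q. \<forall>q\<in>Q. F (R q) = inner p q"
  proof (rule riesz_subspace[OF Q(1,2)])
    fix q q' assume qs: "q \<in> Q" "q' \<in> Q"
    have "F (R (q + q') - (R q + R q')) = 0"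
      using qs S Q RS by (intro F0) (auto simp: B.diff B.add RB subspace_add intro!: subspace_diff subspace_add)
    then show "F (R (q + q')) = F (R q) + F (R q')" by (simp add: Fadd)
  next
    fix k q assume q: "q \<in> Q"
    have "F (R (k *\<^sub>R q) - k *\<^sub>R R q) = 0"
      using q S Q RS by (intro F0) (auto simp: B.diff B.scaleR RB subspace_scale intro!: subspace_diff subspace_scale)
    then show "F (R (k *\<^sub>R q)) = k * F (R q)" by (simp add: Fadd Fsc)
  next
    fix q assume q: "q \<in> Q"
    have "\<bar>F (R q)\<bar> \<le> norm (R q) * (\<bar>La\<bar> + \<bar>Ll\<bar>)"
    proof -
      have "norm (R q) * La \<le> norm (R q) * \<bar>La\<bar>" "norm (R q) * Ll \<le> norm (R q) * \<bar>Ll\<bar>"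
        by (auto intro!: mult_left_mono)
      then show ?thesis using La[of "R q"] Ll[of "R q"] unfolding F_def by (simp add: distrib_left)
    qed
    also have "... \<le> (2 * C * norm q) * (\<bar>La\<bar> + \<bar>Ll\<bar>)" using RC[OF q] by (intro mult_right_mono) auto
    finally show "\<bar>F (R q)\<bar> \<le> (2 * C * (\<bar>La\<bar> + \<bar>Ll\<bar>)) * norm q" by (simp add: mult_ac)
  qed
  then obtain p where p: "p \<in> Q" "\<And>q. q \<in> Q \<Longrightarrow> F (R q) = inner p q" by blast
  have "a x y - inner p (B y) = l y" if y: "y \<in> S" for y
  proof -
    have By: "B y \<in> Q" using y Q by auto
    have "F (y - R (B y)) = 0" using y RS[OF By] S by (intro F0) (auto simp: B.diff RB[OF By] intro: subspace_diff)
    then have "F y = inner p (B y)" using p(2)[OF By] by (simp add: Fadd)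
    then show ?thesis by (simp add: F_def)
  qed
  then show ?thesis using x(1) p(1) unfolding Z_def by blast
qed

text \<open>Testing the difference with itself removes the multiplier and leaves coercivity; the
  difference of the multipliers is then tested with a preimage of itself under B.\<close>

lemma saddle_point_unique:
  fixes B :: "'x::{real_inner,banach} \<Rightarrow> 'q::{real_inner,banach}" and a :: "'x \<Rightarrow> 'x \<Rightarrow> real"
  assumes S: "subspace S" "closed S" and a: "bounded_bilinear a"
    and c: "c > 0" and coer: "\<And>x. x \<in> S \<Longrightarrow> c * (norm x)\<^sup>2 \<le> a x x"
    and B: "bounded_linear B" and Q: "subspace Q" "B ` S \<subseteq> Q"
    and approx: "\<And>q. q \<in> Q \<Longrightarrow> \<exists>x\<in>S. norm x \<le> C * norm q \<and> norm (B x - q) \<le> norm q / 2"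
    and 1: "x \<in> S" "p \<in> Q" "B x = 0" "\<And>y. y \<in> S \<Longrightarrow> a x y - inner p (B y) = l y"
    and 2: "x' \<in> S" "p' \<in> Q" "B x' = 0" "\<And>y. y \<in> S \<Longrightarrow> a x' y - inner p' (B y) = l y"
  shows "x = x' \<and> p = p'"
proof -
  interpret a: bounded_bilinear a by fact
  interpret B: bounded_linear B by fact
  have eq: "a (x - x') y = inner (p - p') (B y)" if "y \<in> S" for y
    using 1(4)[OF that] 2(4)[OF that] by (simp add: a.diff_left inner_diff_left)
  have d: "x - x' \<in> S" using 1 2 S by (simp add: subspace_diff)
  have "a (x - x') (x - x') = 0" using eq[OF d] 1 2 by (simp add: B.diff)
  then have "c * (norm (x - x'))\<^sup>2 \<le> 0" using coer[OF d] by simp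
  then have xx: "x = x'" using c by (simp add: mult_le_0_iff)
  have "p - p' \<in> Q" using 1 2 Q by (simp add: subspace_diff)
  then obtain y where y: "y \<in> S" "B y = p - p'"
    using right_inverse_from_approximate[OF S B Q approx] by metis
  then have "inner (p - p') (p - p') = 0" using eq[OF y(1)] xx by (simp add: a.zero_left)
  then show ?thesis using xx by simp
qed

section \<open>Smooth functions\<close>

lemma partial_dir_eqI:
  "((\<lambda>t. f (x + t *\<^sub>R b)) has_real_derivative d) (at 0) \<Longrightarrow> partial_dir b f x = d"
  unfolding partial_dir_def by (rule the_equality) (auto intro: DERIV_unique)

lemma Ck_SucI:
  assumes "continuous_on UNIV f"
    and "\<And>b x. b \<in> Basis \<Longrightarrow> ((\<lambda>t. f (x + t *\<^sub>R b)) has_real_derivative g b x) (at 0)"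
    and "\<And>b. b \<in> Basis \<Longrightarrow> Ck k (g b)"
  shows "Ck (Suc k) f"
proof -
  have "partial_dir b f = g b" if "b \<in> Basis" for b
    using assms(2)[OF that] by (auto intro!: partial_dir_eqI)
  then show ?thesis using assms by auto
qed

lemma Ck_SucD:
  assumes "Ck (Suc k) f" "b \<in> Basis"
  shows "((\<lambda>t. f (x + t *\<^sub>R b)) has_real_derivative partial_dir b f x) (at 0)"
    and "Ck k (partial_dir b f)"
proof -
  obtain d where d: "((\<lambda>t. f (x + t *\<^sub>R b)) has_real_derivative d) (at 0)"
    using assms by auto
  then show "((\<lambda>t. f (x + t *\<^sub>R b)) has_real_derivative partial_dir b f x) (at 0)"
    using partial_dir_eqI[OF d] by simp
  show "Ck k (partial_dir b f)" using assms by auto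
qed

lemma Ck_continuous: "Ck k f \<Longrightarrow> continuous_on UNIV f"
  by (cases k) auto

lemma Ck_lower: "Ck (Suc k) f \<Longrightarrow> Ck k f"
proof (induction k arbitrary: f)
  case (Suc k)
  show ?case
    by (rule Ck_SucI[where g="\<lambda>b. partial_dir b f", OF Ck_continuous[OF Suc.prems]
        Ck_SucD(1)[OF Suc.prems] Suc.IH[OF Ck_SucD(2)[OF Suc.prems]]])
qed (auto dest: Ck_continuous)

lemma Ck_const: "Ck k (\<lambda>x. c)"
proof (induction k arbitrary: c)
  case (Suc k)
  show ?case by (rule Ck_SucI[where g="\<lambda>b x. 0"]) (simp_all add: Suc del: Ck.simps)
qed auto

lemma Ck_add: "Ck k f \<Longrightarrow> Ck k g \<Longrightarrow> Ck k (\<lambda>x. f x + g x)"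
proof (induction k arbitrary: f g)
  case (Suc k)
  show ?case
    by (rule Ck_SucI[where g="\<lambda>b x. partial_dir b f x + partial_dir b g x"])
      (intro continuous_on_add DERIV_add Suc.IH Ck_continuous[OF Suc.prems(1)] Ck_continuous[OF Suc.prems(2)]
        Ck_SucD[OF Suc.prems(1)] Ck_SucD[OF Suc.prems(2)]; assumption)+
qed (auto intro: continuous_on_add)

lemma Ck_mult: "Ck k f \<Longrightarrow> Ck k g \<Longrightarrow> Ck k (\<lambda>x. f x * g x)"
proof (induction k arbitrary: f g)
  case (Suc k)
  show ?case
  proof (rule Ck_SucI[where g="\<lambda>b x. partial_dir b f x * g x + partial_dir b g x * f x"])
    show "continuous_on UNIV (\<lambda>x. f x * g x)"
      by (intro continuous_on_mult Ck_continuous[OF Suc.prems(1)] Ck_continuous[OF Suc.prems(2)])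
  next
    fix b x :: 'a assume b: "b \<in> Basis"
    show "((\<lambda>t. f (x + t *\<^sub>R b) * g (x + t *\<^sub>R b)) has_real_derivative
        partial_dir b f x * g x + partial_dir b g x * f x) (at 0)"
      using DERIV_mult[OF Ck_SucD(1)[OF Suc.prems(1) b, of x] Ck_SucD(1)[OF Suc.prems(2) b, of x]] by simp
  next
    fix b :: 'a assume b: "b \<in> Basis"
    show "Ck k (\<lambda>x. partial_dir b f x * g x + partial_dir b g x * f x)"
      by (intro Ck_add Suc.IH Ck_SucD(2)[OF Suc.prems(1) b] Ck_SucD(2)[OF Suc.prems(2) b]
          Ck_lower[OF Suc.prems(1)] Ck_lower[OF Suc.prems(2)])
  qed
qed (auto intro: continuous_on_mult)

lemma smooth_CkD: "smooth_fun f \<Longrightarrow> Ck k f"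
  by (simp add: smooth_fun_def)

lemma smooth_partial_deriv:
  assumes "smooth_fun f" "b \<in> Basis"
  shows "((\<lambda>t. f (x + t *\<^sub>R b)) has_real_derivative partial_dir b f x) (at 0)"
  by (rule Ck_SucD(1)[OF smooth_CkD[OF assms(1), of "Suc 0"] assms(2)])

lemma smooth_partial: "smooth_fun f \<Longrightarrow> b \<in> Basis \<Longrightarrow> smooth_fun (partial_dir b f)"
  using Ck_SucD(2) by (auto simp add: smooth_fun_def simp del: Ck.simps)

lemma smooth_continuous: "smooth_fun f \<Longrightarrow> continuous_on A f"
  using Ck_continuous continuous_on_subset by (metis smooth_CkD subset_UNIV)

lemma smoothI:
  assumes "\<And>b x. b \<in> Basis \<Longrightarrow> ((\<lambda>t. f (x + t *\<^sub>R b)) has_real_derivative g b x) (at 0)"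
    and "continuous_on UNIV f" "\<And>b. b \<in> Basis \<Longrightarrow> smooth_fun (g b)"
  shows "smooth_fun f"
  unfolding smooth_fun_def
proof
  fix k
  have "Ck (Suc k) f" by (rule Ck_SucI[OF assms(2,1) smooth_CkD[OF assms(3)]])
  then show "Ck k f" by (rule Ck_lower)
qed

lemma smooth_line_deriv:
  assumes "smooth_fun f" "b \<in> Basis"
  shows "((\<lambda>t. f (x + t *\<^sub>R b)) has_real_derivative partial_dir b f (x + s *\<^sub>R b)) (at s)"
proof -
  have "((\<lambda>t. f (x + (t + s) *\<^sub>R b)) has_real_derivative partial_dir b f (x + s *\<^sub>R b)) (at 0)"
    using smooth_partial_deriv[OF assms, of "x + s *\<^sub>R b"] by (simp add: algebra_simps)
  then show ?thesis using DERIV_shift[of "\<lambda>t. f (x + t *\<^sub>R b)" _ 0 s] by simp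
qed

lemma smooth_const: "smooth_fun (\<lambda>x. c)"
  by (simp add: smooth_fun_def Ck_const)

lemma smooth_add: "smooth_fun f \<Longrightarrow> smooth_fun g \<Longrightarrow> smooth_fun (\<lambda>x. f x + g x)"
  by (simp add: smooth_fun_def Ck_add)

lemma smooth_mult: "smooth_fun f \<Longrightarrow> smooth_fun g \<Longrightarrow> smooth_fun (\<lambda>x. f x * g x)"
  by (simp add: smooth_fun_def Ck_mult)

lemma smooth_cmult: "smooth_fun f \<Longrightarrow> smooth_fun (\<lambda>x. c * f x)"
  by (rule smooth_mult[OF smooth_const])

lemma smooth_diff: "smooth_fun f \<Longrightarrow> smooth_fun g \<Longrightarrow> smooth_fun (\<lambda>x. f x - g x)"
  using smooth_add[OF _ smooth_cmult[of g "-1"], of f] by simp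

lemma smooth_sum: "(\<And>i. i \<in> I \<Longrightarrow> smooth_fun (f i)) \<Longrightarrow> smooth_fun (\<lambda>x. \<Sum>i\<in>I. f i x)"
  by (induction I rule: infinite_finite_induct) (auto intro: smooth_const smooth_add)

lemma smooth_prod: "(\<And>i. i \<in> I \<Longrightarrow> smooth_fun (f i)) \<Longrightarrow> smooth_fun (\<lambda>x. \<Prod>i\<in>I. f i x)"
  by (induction I rule: infinite_finite_induct) (auto intro: smooth_const smooth_mult)

lemma smooth_inner: "smooth_fun (\<lambda>x. x \<bullet> c)"
  by (rule smoothI[where g="\<lambda>b x. b \<bullet> c"])
    (auto intro!: derivative_eq_intros continuous_intros smooth_const simp: inner_add_left)

lemma partial_const: "partial_dir b (\<lambda>x. c) x = 0"
  by (rule partial_dir_eqI) auto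

lemma partial_add:
  "smooth_fun f \<Longrightarrow> smooth_fun g \<Longrightarrow> b \<in> Basis \<Longrightarrow>
    partial_dir b (\<lambda>x. f x + g x) = (\<lambda>x. partial_dir b f x + partial_dir b g x)"
  by (intro ext partial_dir_eqI DERIV_add smooth_partial_deriv)

lemma partial_cmult:
  "smooth_fun f \<Longrightarrow> b \<in> Basis \<Longrightarrow> partial_dir b (\<lambda>x. c * f x) = (\<lambda>x. c * partial_dir b f x)"
  by (intro ext partial_dir_eqI DERIV_cmult smooth_partial_deriv)

lemma partial_mult:
  assumes "smooth_fun f" "smooth_fun g" "b \<in> Basis"
  shows "partial_dir b (\<lambda>x. f x * g x) = (\<lambda>x. partial_dir b f x * g x + f x * partial_dir b g x)"
proof (intro ext partial_dir_eqI)
  fix x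
  show "((\<lambda>t. f (x + t *\<^sub>R b) * g (x + t *\<^sub>R b)) has_real_derivative
      partial_dir b f x * g x + f x * partial_dir b g x) (at 0)"
    using DERIV_mult[OF smooth_partial_deriv[OF assms(1,3), of x] smooth_partial_deriv[OF assms(2,3), of x]]
    by (simp add: mult.commute)
qed

lemma partial_sum:
  "(\<And>i. i \<in> I \<Longrightarrow> smooth_fun (f i)) \<Longrightarrow> b \<in> Basis \<Longrightarrow>
    partial_dir b (\<lambda>x. \<Sum>i\<in>I. f i x) = (\<lambda>x. \<Sum>i\<in>I. partial_dir b (f i) x)"
  by (intro ext partial_dir_eqI DERIV_sum smooth_partial_deriv)

text \<open>One induction gives smoothness for a family that is closed under differentiation up to
  linear combinations. Polynomials, sines with shifted phase and the functions \<open>flat k\<close>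
  are its instances.\<close>

lemma smooth_family_inner:
  fixes g :: "'i \<Rightarrow> real \<Rightarrow> real" and b :: "'a::euclidean_space"
  assumes g: "\<And>i x. (g i has_real_derivative \<alpha> i * g (\<sigma> i) x + \<beta> i * g (\<tau> i) x) (at x)"
  shows "smooth_fun (\<lambda>x. g i (x \<bullet> b))"
proof -
  have cont: "continuous_on UNIV (\<lambda>x. g i (x \<bullet> b))" for i
  proof -
    have "continuous_on UNIV (g i)"
      using g by (meson DERIV_isCont continuous_at_imp_continuous_on)
    then show ?thesis by (rule continuous_on_compose2) (auto intro!: continuous_intros)
  qed
  have "Ck k (\<lambda>x. g i (x \<bullet> b))" for k i
  proof (induction k arbitrary: i)
    case (Suc k)
    show ?case
    proof (rule Ck_SucI[OF cont])
      fix c x :: 'a assume "c \<in> Basis"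
      have "((\<lambda>t. g i ((x + t *\<^sub>R c) \<bullet> b)) has_real_derivative
          (\<alpha> i * g (\<sigma> i) (x \<bullet> b) + \<beta> i * g (\<tau> i) (x \<bullet> b)) * (c \<bullet> b)) (at 0)"
      proof (rule DERIV_chain2[where f="g i"])
        show "(g i has_real_derivative \<alpha> i * g (\<sigma> i) (x \<bullet> b) + \<beta> i * g (\<tau> i) (x \<bullet> b)) (at ((x + 0 *\<^sub>R c) \<bullet> b))"
          using g[of i "x \<bullet> b"] by simp
        show "((\<lambda>t. (x + t *\<^sub>R c) \<bullet> b) has_real_derivative c \<bullet> b) (at 0)"
          by (auto intro!: derivative_eq_intros simp: inner_add_left)
      qed
      then show "((\<lambda>t. g i ((x + t *\<^sub>R c) \<bullet> b)) has_real_derivative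
          (c \<bullet> b) * (\<alpha> i * g (\<sigma> i) (x \<bullet> b) + \<beta> i * g (\<tau> i) (x \<bullet> b))) (at 0)"
        by (simp add: mult.commute)
    next
      fix c :: 'a
      show "Ck k (\<lambda>x. (c \<bullet> b) * (\<alpha> i * g (\<sigma> i) (x \<bullet> b) + \<beta> i * g (\<tau> i) (x \<bullet> b)))"
        by (intro Ck_mult Ck_add Ck_const Suc.IH)
    qed
  qed (simp add: cont)
  then show ?thesis by (simp add: smooth_fun_def)
qed

subsection \<open>A smooth bump\<close>

text \<open>\<open>flat 0\<close> is the classical function with all derivatives zero at the origin;
  the powers k are included because differentiation produces them.\<close>

definition flat :: "nat \<Rightarrow> real \<Rightarrow> real" where
  "flat k x = (if x > 0 then inverse x ^ k * exp (- inverse x) else 0)"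

lemma flat_tendsto_0: "(flat k \<longlongrightarrow> 0) (at_right 0)"
proof -
  have "((\<lambda>x. inverse x ^ k / exp (inverse x)) \<longlongrightarrow> (0::real)) (at_right 0)"
    using filterlim_compose[OF tendsto_power_div_exp_0 filterlim_inverse_at_top_right] .
  then show ?thesis
    by (rule Lim_transform_eventually)
      (auto simp: eventually_at_filter flat_def exp_minus divide_inverse)
qed

lemma flat_deriv: "(flat k has_real_derivative - real k * flat (Suc k) x + 1 * flat (k + 2) x) (at x)"
proof (cases x "0::real" rule: linorder_cases)
  case greater
  have "((\<lambda>x. inverse x ^ k * exp (- inverse x)) has_real_derivative
      - real k * flat (Suc k) x + 1 * flat (k + 2) x) (at x)"
  proof -
    have i: "(inverse has_real_derivative - (inverse x ^ Suc (Suc 0))) (at x)"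
      using DERIV_inverse[of x UNIV] greater by simp
    have e: "((\<lambda>x. exp (- inverse x)) has_real_derivative exp (- inverse x) * - (- (inverse x ^ Suc (Suc 0)))) (at x)"
      by (rule DERIV_chain2[OF DERIV_exp DERIV_minus[OF i]])
    show ?thesis
      by (rule DERIV_cong[OF DERIV_mult[OF DERIV_power[OF i, of k] e]])
        (use greater in \<open>cases k; simp add: flat_def algebra_simps\<close>)
  qed
  then show ?thesis
    by (rule has_field_derivative_transform_within_open[where S="{0<..}"])
      (use greater in \<open>auto simp: flat_def\<close>)
next
  case less
  have "((\<lambda>x. 0) has_real_derivative 0) (at x)" by simp
  then have "(flat k has_real_derivative 0) (at x)"
    by (rule has_field_derivative_transform_within_open[where S="{..<0}"])
      (use less in \<open>auto simp: flat_def\<close>)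
  then show ?thesis using less by (simp add: flat_def)
next
  case equal
  \<comment> \<open>Division by y raises the power of \<open>inverse y\<close> by one, so the
    difference quotient from the right is \<open>flat (Suc k)\<close>.\<close>
  have "((\<lambda>y. flat k y / y) \<longlongrightarrow> 0) (at_right 0)"
    using flat_tendsto_0[of "Suc k"]
    by (rule Lim_transform_eventually) (auto simp: eventually_at_filter flat_def divide_inverse)
  moreover have "((\<lambda>y. flat k y / y) \<longlongrightarrow> 0) (at_left 0)"
    using tendsto_const[of "0::real" "at_left 0"]
    by (rule Lim_transform_eventually) (auto simp: eventually_at_filter flat_def)
  ultimately have "((\<lambda>y. flat k y / y) \<longlongrightarrow> 0) (at 0)"
    using filterlim_split_at by blast
  then have "(flat k has_real_derivative 0) (at 0)"
    by (simp add: has_field_derivative_iff flat_def)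
  then show ?thesis using equal by (simp add: flat_def)
qed

subsection \<open>Affine changes of one coordinate\<close>

text \<open>An affine change of coordinate b alone, with two uses: for m = -1 and m = -2 these are
  reflections with dilation across a face, and for m = s, d = a - s * a they contract towards the
  plane where coordinate b equals a.\<close>

definition rc :: "'a::euclidean_space \<Rightarrow> real \<Rightarrow> real \<Rightarrow> 'a \<Rightarrow> 'a" where
  "rc b m d x = x + (m * (x \<bullet> b) + d - x \<bullet> b) *\<^sub>R b"

lemma rc_inner:
  assumes "b \<in> Basis" "c \<in> Basis"
  shows "rc b m d x \<bullet> c = (if c = b then m * (x \<bullet> b) + d else x \<bullet> c)"
  using assms by (auto simp: rc_def inner_add_left inner_Basis)

lemma rc_line:
  assumes "b \<in> Basis" "c \<in> Basis"
  shows "rc b m d (x + t *\<^sub>R c) = rc b m d x + ((if c = b then m else 1) * t) *\<^sub>R c"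
  using assms by (auto simp: rc_def inner_add_left inner_Basis algebra_simps)

lemma rc_line_deriv:
  assumes b: "b \<in> Basis" and c: "c \<in> Basis"
    and f: "((\<lambda>t. f (rc b m d x + t *\<^sub>R c)) has_real_derivative D) (at 0)"
  shows "((\<lambda>t. f (rc b m d (x + t *\<^sub>R c))) has_real_derivative (if c = b then m else 1) * D) (at 0)"
proof -
  define k where "k = (if c = b then m else 1)"
  have "((\<lambda>t. f (rc b m d x + (k * t) *\<^sub>R c)) has_real_derivative D * k) (at 0)"
    by (rule DERIV_chain2[where f="\<lambda>t. f (rc b m d x + t *\<^sub>R c)"])
      (use f in \<open>auto intro!: derivative_eq_intros\<close>)
  then show ?thesis unfolding rc_line[OF b c] k_def by (simp add: mult.commute)
qed

lemma continuous_on_rc: "continuous_on A (rc b m d)"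
  unfolding rc_def by (intro continuous_intros)

lemma smooth_rc:
  assumes "smooth_fun f" "b \<in> Basis"
  shows "smooth_fun (\<lambda>x. f (rc b m d x))"
proof -
  have "Ck k (\<lambda>x. f (rc b m d x))" if "Ck k f" for k f
    using that
  proof (induction k arbitrary: f)
    case 0
    then show ?case by (auto intro: continuous_on_compose2[OF _ continuous_on_rc])
  next
    case (Suc k)
    show ?case
    proof (rule Ck_SucI)
      show "continuous_on UNIV (\<lambda>x. f (rc b m d x))"
        using Ck_continuous[OF Suc.prems] by (auto intro: continuous_on_compose2[OF _ continuous_on_rc])
      fix c :: 'a assume c: "c \<in> Basis"
      show "((\<lambda>t. f (rc b m d (x + t *\<^sub>R c))) has_real_derivative
          (if c = b then m else 1) * partial_dir c f (rc b m d x)) (at 0)" for x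
        by (rule rc_line_deriv[OF assms(2) c Ck_SucD(1)[OF Suc.prems c]])
      show "Ck k (\<lambda>x. (if c = b then m else 1) * partial_dir c f (rc b m d x))"
        by (intro Ck_mult Ck_const Suc.IH Ck_SucD(2)[OF Suc.prems c])
    qed
  qed
  then show ?thesis using assms by (simp add: smooth_fun_def)
qed

lemma partial_rc:
  assumes "smooth_fun f" "b \<in> Basis" "c \<in> Basis"
  shows "partial_dir c (\<lambda>x. f (rc b m d x)) = (\<lambda>x. (if c = b then m else 1) * partial_dir c f (rc b m d x))"
  by (intro ext partial_dir_eqI rc_line_deriv smooth_partial_deriv assms)

subsection \<open>Symmetry of second derivatives\<close>

lemma second_difference:
  assumes f: "smooth_fun f" and b: "b \<in> Basis" and c: "c \<in> Basis" and h: "h > 0"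
  shows "\<exists>y. dist y x \<le> 2 * h \<and> f (x + h *\<^sub>R b + h *\<^sub>R c) - f (x + h *\<^sub>R b) - f (x + h *\<^sub>R c) + f x
      = h\<^sup>2 * partial_dir c (partial_dir b f) y"
proof -
  define \<phi> where "\<phi> t = f ((x + h *\<^sub>R c) + t *\<^sub>R b) - f (x + t *\<^sub>R b)" for t
  have "(\<phi> has_real_derivative partial_dir b f ((x + h *\<^sub>R c) + t *\<^sub>R b) - partial_dir b f (x + t *\<^sub>R b)) (at t)" for t
    unfolding \<phi>_def by (intro DERIV_diff smooth_line_deriv f b)
  then obtain s where s: "0 < s" "s < h"
    "\<phi> h - \<phi> 0 = (h - 0) * (partial_dir b f ((x + h *\<^sub>R c) + s *\<^sub>R b) - partial_dir b f (x + s *\<^sub>R b))"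
    using MVT2[OF h, of \<phi> "\<lambda>t. partial_dir b f ((x + h *\<^sub>R c) + t *\<^sub>R b) - partial_dir b f (x + t *\<^sub>R b)"] by blast
  define \<psi> where "\<psi> t = partial_dir b f ((x + s *\<^sub>R b) + t *\<^sub>R c)" for t
  have "(\<psi> has_real_derivative partial_dir c (partial_dir b f) ((x + s *\<^sub>R b) + t *\<^sub>R c)) (at t)" for t
    unfolding \<psi>_def by (intro smooth_line_deriv smooth_partial f b c)
  then obtain r where r: "0 < r" "r < h"
    "\<psi> h - \<psi> 0 = (h - 0) * partial_dir c (partial_dir b f) ((x + s *\<^sub>R b) + r *\<^sub>R c)"
    using MVT2[OF h, of \<psi> "\<lambda>t. partial_dir c (partial_dir b f) ((x + s *\<^sub>R b) + t *\<^sub>R c)"] by blast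
  have "dist ((x + s *\<^sub>R b) + r *\<^sub>R c) x \<le> norm (s *\<^sub>R b) + norm (r *\<^sub>R c)"
    using norm_triangle_ineq[of "s *\<^sub>R b" "r *\<^sub>R c"] by (simp add: dist_norm)
  also have "... \<le> 2 * h" using r s b c by simp
  finally have "dist ((x + s *\<^sub>R b) + r *\<^sub>R c) x \<le> 2 * h" .
  moreover have "\<phi> h - \<phi> 0 = h * (h * partial_dir c (partial_dir b f) ((x + s *\<^sub>R b) + r *\<^sub>R c))"
    using s(3) r(3) unfolding \<psi>_def by (simp add: algebra_simps)
  ultimately show ?thesis unfolding \<phi>_def
    by (intro exI[of _ "(x + s *\<^sub>R b) + r *\<^sub>R c"]) (simp add: algebra_simps power2_eq_square)
qed

text \<open>Both mixed derivatives are limits of the same symmetric second difference quotient, each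
  attained at intermediate points that tend to x.\<close>

lemma partial_commute:
  assumes f: "smooth_fun f" and b: "b \<in> Basis" and c: "c \<in> Basis"
  shows "partial_dir b (partial_dir c f) = partial_dir c (partial_dir b f)"
proof
  fix x
  define h where "h n = 1 / real (Suc n)" for n
  have h: "h n > 0" for n by (simp add: h_def)
  have h0: "h \<longlonglongrightarrow> 0" unfolding h_def using LIMSEQ_inverse_real_of_nat by (simp add: inverse_eq_divide)
  obtain y where y: "\<And>n. dist (y n) x \<le> 2 * h n"
    "\<And>n. f (x + h n *\<^sub>R b + h n *\<^sub>R c) - f (x + h n *\<^sub>R b) - f (x + h n *\<^sub>R c) + f x
      = (h n)\<^sup>2 * partial_dir c (partial_dir b f) (y n)"
    using second_difference[OF f b c h, of x] by metis
  obtain z where z: "\<And>n. dist (z n) x \<le> 2 * h n"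
    "\<And>n. f (x + h n *\<^sub>R c + h n *\<^sub>R b) - f (x + h n *\<^sub>R c) - f (x + h n *\<^sub>R b) + f x
      = (h n)\<^sup>2 * partial_dir b (partial_dir c f) (z n)"
    using second_difference[OF f c b h, of x] by metis
  have lim: "w \<longlonglongrightarrow> x" if "\<And>n. dist (w n) x \<le> 2 * h n" for w
    by (rule metric_tendsto_imp_tendsto[where f="\<lambda>n. 2 * h n" and a=0])
      (use that h h0 tendsto_mult_right_zero[of h sequentially 2] in \<open>auto simp: less_imp_le\<close>)
  have "partial_dir c (partial_dir b f) (y n) = partial_dir b (partial_dir c f) (z n)" for n
  proof -
    have "(h n)\<^sup>2 * partial_dir c (partial_dir b f) (y n) = (h n)\<^sup>2 * partial_dir b (partial_dir c f) (z n)"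
      unfolding y(2)[of n, symmetric] z(2)[of n, symmetric] by (simp add: algebra_simps)
    then show ?thesis using h[of n] by simp
  qed
  moreover have "(\<lambda>n. partial_dir c (partial_dir b f) (y n)) \<longlonglongrightarrow> partial_dir c (partial_dir b f) x"
    by (rule continuous_on_tendsto_compose[OF smooth_continuous[of _ UNIV] lim[OF y(1)]])
      (auto intro!: smooth_partial f b c)
  moreover have "(\<lambda>n. partial_dir b (partial_dir c f) (z n)) \<longlonglongrightarrow> partial_dir b (partial_dir c f) x"
    by (rule continuous_on_tendsto_compose[OF smooth_continuous[of _ UNIV] lim[OF z(1)]])
      (auto intro!: smooth_partial f b c)
  ultimately show "partial_dir b (partial_dir c f) x = partial_dir c (partial_dir b f) x"
    using LIMSEQ_unique by fastforce
qed

subsection \<open>Antiderivatives in one coordinate\<close>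

text \<open>The integral of f along direction b from the plane \<open>x \<bullet> b = a\<close>,
  rescaled to the fixed interval [0, 1], so that differentiation always takes place under an
  integral with constant limits.\<close>

definition antider :: "'a::euclidean_space \<Rightarrow> real \<Rightarrow> ('a \<Rightarrow> real) \<Rightarrow> 'a \<Rightarrow> real" where
  "antider b a f x = (x \<bullet> b - a) * integral {0..1} (\<lambda>s. f (rc b s (a - s * a) x))"

lemma continuous_on_rc_param:
  assumes "continuous_on UNIV f"
  shows "continuous_on (A \<times> B) (\<lambda>(x, s). f (rc b s (a - s * a) x))"
  unfolding rc_def split_beta
  by (rule continuous_on_compose2[OF assms]) (auto intro!: continuous_intros)

lemma continuous_antider:
  assumes "smooth_fun f"
  shows "continuous_on UNIV (antider b a f)"
proof -
  have "continuous_on UNIV (\<lambda>x. integral (cbox 0 1) (\<lambda>s. f (rc b s (a - s * a) x)))"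
    by (rule integral_continuous_on_param)
      (rule continuous_on_rc_param, rule smooth_continuous[OF assms])
  then show ?thesis unfolding antider_def by (intro continuous_intros) simp
qed

lemma integral_rc_param_deriv:
  assumes f: "smooth_fun f" and b: "b \<in> Basis" and c: "c \<in> Basis"
  shows "((\<lambda>t. integral {0..1} (\<lambda>s. f (rc b s (a - s * a) (x + t *\<^sub>R c)))) has_real_derivative
      integral {0..1} (\<lambda>s. (if c = b then s else 1) * partial_dir c f (rc b s (a - s * a) x))) (at 0)"
proof -
  let ?g = "\<lambda>t s. (if c = b then s else 1) * partial_dir c f (rc b s (a - s * a) (x + t *\<^sub>R c))"
  have "((\<lambda>t. integral (cbox 0 1) (\<lambda>s. f (rc b s (a - s * a) (x + t *\<^sub>R c)))) has_real_derivative
      integral (cbox 0 1) (?g 0)) (at 0 within UNIV)"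
  proof (rule leibniz_rule_field_derivative)
    fix t s :: real
    have "((\<lambda>u. f (rc b s (a - s * a) (x + (u + t) *\<^sub>R c))) has_real_derivative ?g t s) (at 0)"
      using rc_line_deriv[OF b c smooth_partial_deriv[OF f c], of s "a - s * a" "x + t *\<^sub>R c"]
      by (simp add: algebra_simps)
    then show "((\<lambda>t. f (rc b s (a - s * a) (x + t *\<^sub>R c))) has_real_derivative ?g t s) (at t within UNIV)"
      using DERIV_shift[of "\<lambda>t. f (rc b s (a - s * a) (x + t *\<^sub>R c))" _ 0 t] by simp
  next
    fix t :: real
    have "continuous_on (cbox 0 1) (\<lambda>s. f (rc b s (a - s * a) (x + t *\<^sub>R c)))"
      unfolding rc_def
      by (rule continuous_on_compose2[OF smooth_continuous[OF f, of UNIV]]) (auto intro!: continuous_intros)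
    then show "(\<lambda>s. f (rc b s (a - s * a) (x + t *\<^sub>R c))) integrable_on cbox 0 1"
      by (rule integrable_continuous)
  next
    have "continuous_on (UNIV \<times> cbox 0 1) (\<lambda>(t, s). partial_dir c f (rc b s (a - s * a) (x + t *\<^sub>R c)))"
      unfolding rc_def split_beta
      by (rule continuous_on_compose2[OF smooth_continuous[OF smooth_partial[OF f c], of UNIV]])
        (auto intro!: continuous_intros)
    then show "continuous_on (UNIV \<times> cbox 0 1) (\<lambda>(t, s). ?g t s)"
      unfolding split_beta by (cases "c = b") (auto intro!: continuous_intros)
  qed auto
  then show ?thesis by simp
qed

lemma antider_deriv_other:
  assumes f: "smooth_fun f" and b: "b \<in> Basis" and c: "c \<in> Basis" "c \<noteq> b"
  shows "((\<lambda>t. antider b a f (x + t *\<^sub>R c)) has_real_derivative antider b a (partial_dir c f) x) (at 0)"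
proof -
  have "((\<lambda>t. (x \<bullet> b - a) * integral {0..1} (\<lambda>s. f (rc b s (a - s * a) (x + t *\<^sub>R c)))) has_real_derivative
    (x \<bullet> b - a) * integral {0..1} (\<lambda>s. (if c = b then s else 1) * partial_dir c f (rc b s (a - s * a) x))) (at 0)"
    by (intro DERIV_cmult integral_rc_param_deriv assms)
  moreover have "(x + t *\<^sub>R c) \<bullet> b = x \<bullet> b" for t using b c by (auto simp: inner_add_left inner_Basis)
  ultimately show ?thesis using c unfolding antider_def by simp
qed

lemma antider_deriv_same:
  assumes f: "smooth_fun f" and b: "b \<in> Basis"
  shows "((\<lambda>t. antider b a f (x + t *\<^sub>R b)) has_real_derivative f x) (at 0)"
proof -
  let ?I = "\<lambda>t. integral {0..1} (\<lambda>s. f (rc b s (a - s * a) (x + t *\<^sub>R b)))"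
  let ?J = "integral {0..1} (\<lambda>s. s * partial_dir b f (rc b s (a - s * a) x))"
  have 1: "(?I has_real_derivative ?J) (at 0)"
    using integral_rc_param_deriv[OF f b b] by simp
  have 2: "((\<lambda>t. x \<bullet> b + t - a) has_real_derivative 1) (at 0)"
    by (auto intro!: derivative_eq_intros)
  have "((\<lambda>t. (x \<bullet> b + t - a) * ?I t) has_real_derivative (x \<bullet> b - a) * ?J + ?I 0) (at 0)"
    using DERIV_mult[OF 2 1] by (simp add: mult.commute add.commute)
  moreover have "(x + t *\<^sub>R b) \<bullet> b = x \<bullet> b + t" for t using b by (simp add: inner_add_left)
  \<comment> \<open>The sum is the integral over [0, 1] of the derivative of
    \<open>s * f (rc b s (a - s * a) x)\<close>, whose value at s = 1 is \<open>f x\<close>.\<close>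
  moreover have "(x \<bullet> b - a) * ?J + ?I 0 = f x"
  proof -
    let ?u = "\<lambda>s. s * f (rc b s (a - s * a) x)"
    let ?u' = "\<lambda>s. (x \<bullet> b - a) * (s * partial_dir b f (rc b s (a - s * a) x)) + f (rc b s (a - s * a) x)"
    define z where "z = x + (a - x \<bullet> b) *\<^sub>R b"
    have rz: "rc b s (a - s * a) x = z + (s * (x \<bullet> b - a)) *\<^sub>R b" for s
      by (simp add: rc_def z_def algebra_simps)
    have "(?u has_vector_derivative ?u' s) (at s within {0..1})" for s
    proof -
      have "((\<lambda>s. f (z + (s * (x \<bullet> b - a)) *\<^sub>R b)) has_real_derivative
          partial_dir b f (z + (s * (x \<bullet> b - a)) *\<^sub>R b) * (x \<bullet> b - a)) (at s)"
        by (rule DERIV_chain2[where f="\<lambda>t. f (z + t *\<^sub>R b)", OF smooth_line_deriv[OF f b]])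
          (auto intro!: derivative_eq_intros)
      from DERIV_mult[OF DERIV_ident this]
      have "(?u has_real_derivative ?u' s) (at s)" unfolding rz by (simp add: mult_ac add.commute)
      then show ?thesis
        by (simp add: has_real_derivative_iff_has_vector_derivative has_vector_derivative_at_within)
    qed
    then have "(?u' has_integral ?u 1 - ?u 0) {0..1}"
      by (intro fundamental_theorem_of_calculus) auto
    then have "integral {0..1} ?u' = f x" by (auto simp: rc_def dest: integral_unique)
    moreover have "continuous_on {0..1} (\<lambda>s. partial_dir b f (rc b s (a - s * a) x))"
      unfolding rc_def by (rule continuous_on_compose2[OF smooth_continuous[OF smooth_partial[OF f b], of UNIV]])
        (auto intro!: continuous_intros)
    then have "(\<lambda>s. (x \<bullet> b - a) * (s * partial_dir b f (rc b s (a - s * a) x))) integrable_on {0..1}"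
      by (intro integrable_continuous_real continuous_intros)
    moreover have "continuous_on {0..1} (\<lambda>s. f (rc b s (a - s * a) x))"
      unfolding rc_def by (rule continuous_on_compose2[OF smooth_continuous[OF f, of UNIV]])
        (auto intro!: continuous_intros)
    then have "(\<lambda>s. f (rc b s (a - s * a) x)) integrable_on {0..1}" by (rule integrable_continuous_real)
    ultimately show ?thesis by (simp add: Henstock_Kurzweil_Integration.integral_add)
  qed
  ultimately show ?thesis unfolding antider_def by simp
qed

lemma smooth_antider:
  assumes f: "smooth_fun f" and b: "b \<in> Basis"
  shows "smooth_fun (antider b a f)"
proof -
  have "Ck k (antider b a f)" if "smooth_fun f" for k f
    using that
  proof (induction k arbitrary: f)
    case 0
    then show ?case by (simp add: continuous_antider)
  next
    case (Suc k)
    show ?case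
    proof (rule Ck_SucI[where g="\<lambda>c. if c = b then f else antider b a (partial_dir c f)"])
      show "continuous_on UNIV (antider b a f)" by (rule continuous_antider[OF Suc.prems])
      fix c :: 'a assume c: "c \<in> Basis"
      show "((\<lambda>t. antider b a f (x + t *\<^sub>R c)) has_real_derivative
          (if c = b then f else antider b a (partial_dir c f)) x) (at 0)" for x
        using antider_deriv_same[OF Suc.prems b] antider_deriv_other[OF Suc.prems b c] by auto
      show "Ck k (if c = b then f else antider b a (partial_dir c f))"
        using Suc.IH[OF smooth_partial[OF Suc.prems c]] smooth_CkD[OF Suc.prems] by auto
    qed
  qed
  then show ?thesis using f by (simp add: smooth_fun_def)
qed

lemma partial_antider:
  assumes "smooth_fun f" "b \<in> Basis" "c \<in> Basis"
  shows "partial_dir c (antider b a f) = (if c = b then f else antider b a (partial_dir c f))"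
  using antider_deriv_same[OF assms(1,2)] antider_deriv_other[OF assms]
  by (auto intro!: ext partial_dir_eqI)

section \<open>Functions orthogonal to rich classes of functions\<close>

lemma Lsq_continuous:
  fixes f :: "'a::euclidean_space \<Rightarrow> real"
  assumes "continuous_on UNIV f" "bounded S" "S \<in> sets lebesgue"
  shows "Lsq S f"
proof -
  obtain c where c: "S \<subseteq> cbox (-c) c" using bounded_subset_cbox_symmetric assms by metis
  have f: "continuous_on (cbox (-c) c) f" using assms continuous_on_subset by blast
  then have "Lsq (cbox (-c) c) f" unfolding Lsq_def
    by (auto intro!: continuous_imp_measurable_on_sets_lebesgue continuous_imp_integrable continuous_intros)
  then show ?thesis by (rule Lsq_subset[rotated 3]) (use assms c in auto)
qed

text \<open>The indicator of a closed subset of the set where w is positive is a pointwise limit of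
  continuous cut-offs of the distance, so w integrates to 0 over the subset, which is therefore
  null. Inner regularity by closed sets does the rest.\<close>

lemma null_set_if_orthogonal_continuous:
  fixes w :: "'a::euclidean_space \<Rightarrow> real"
  assumes T: "closed T" and w: "integrable (lebesgue_on T) w"
    and orth: "\<And>f. continuous_on UNIV f \<Longrightarrow> (\<And>x. 0 \<le> f x \<and> f x \<le> 1) \<Longrightarrow>
      integral\<^sup>L (lebesgue_on T) (\<lambda>x. w x * f x) = 0"
  shows "{x \<in> T. w x > 0} \<in> null_sets lebesgue"
proof -
  have Tm: "T \<in> sets lebesgue" using T by auto
  define A where "A = {x \<in> T. w x > 0}"
  have Am: "A \<in> sets lebesgue"
  proof -
    have "w \<in> borel_measurable (lebesgue_on T)" using w by auto
    then have "{x \<in> space (lebesgue_on T). 0 < w x} \<in> sets (lebesgue_on T)" by measurable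
    then have "A \<in> sets (lebesgue_on T)" by (simp add: A_def)
    then show ?thesis using Tm by (metis sets_restrict_space_iff space_lebesgue_on inf_top.right_neutral UNIV_I space_completion space_lborel sets.Int_space_eq2)
  qed
  have closed_null: "C \<in> null_sets lebesgue" if C: "closed C" "C \<subseteq> A" for C
  proof (cases "C = {}")
    case False
    have Cm: "C \<in> sets lebesgue" using C by auto
    define f where "f n x = max 0 (1 - real n * infdist x C)" for n x
    have "(\<lambda>n. integral\<^sup>L (lebesgue_on T) (\<lambda>x. w x * f n x)) \<longlonglongrightarrow>
        integral\<^sup>L (lebesgue_on T) (\<lambda>x. w x * indicator C x)"
    proof (rule integral_dominated_convergence[where w="\<lambda>x. \<bar>w x\<bar>"])
      show "integrable (lebesgue_on T) (\<lambda>x. \<bar>w x\<bar>)" using w by auto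
      show "(\<lambda>x. w x * indicator C x) \<in> borel_measurable (lebesgue_on T)"
      proof (rule borel_measurable_times)
        have "C \<inter> space (lebesgue_on T) = C" using C(2) by (auto simp: A_def)
        then show "indicat_real C \<in> borel_measurable (lebesgue_on T)"
          using Cm Tm by (subst borel_measurable_indicator_iff) (auto simp: sets_restrict_space_iff A_def)
      qed (use w in auto)
      have "continuous_on T (f n)" for n unfolding f_def by (intro continuous_intros)
      then show "(\<lambda>x. w x * f n x) \<in> borel_measurable (lebesgue_on T)" for n
        using w by (intro borel_measurable_times borel_measurable_integrable
            continuous_imp_measurable_on_sets_lebesgue Tm)
      show "AE x in lebesgue_on T. (\<lambda>n. w x * f n x) \<longlonglongrightarrow> w x * indicator C x"
      proof (rule AE_I2, rule tendsto_mult_left)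
        fix x
        show "(\<lambda>n. f n x) \<longlonglongrightarrow> indicator C x"
        proof (cases "x \<in> C")
          case True
          then show ?thesis by (simp add: f_def)
        next
          case False
          then have p: "infdist x C > 0"
            using C \<open>C \<noteq> {}\<close> in_closed_iff_infdist_zero infdist_nonneg less_eq_real_def by metis
          obtain N where N: "1 < real N * infdist x C" using reals_Archimedean3[OF p] by blast
          have "\<forall>\<^sub>F n in sequentially. f n x = 0"
          proof (rule eventually_sequentiallyI[of N])
            fix n assume "N \<le> n"
            then have "real N * infdist x C \<le> real n * infdist x C" using p by (intro mult_right_mono) auto
            then show "f n x = 0" using N by (simp add: f_def)
          qed
          then show ?thesis using False by (simp add: tendsto_eventually)
        qed
      qed
      have "\<bar>f n x\<bar> \<le> 1" for n x by (simp add: f_def infdist_nonneg)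
      then show "AE x in lebesgue_on T. norm (w x * f n x) \<le> \<bar>w x\<bar>" for n
        by (intro AE_I2) (simp add: abs_mult mult_left_le)
    qed
    moreover have "integral\<^sup>L (lebesgue_on T) (\<lambda>x. w x * f n x) = 0" for n
    proof (rule orth)
      show "continuous_on UNIV (f n)" unfolding f_def by (intro continuous_intros)
    qed (auto simp: f_def infdist_nonneg)
    ultimately have z: "integral\<^sup>L (lebesgue_on T) (\<lambda>x. w x * indicator C x) = 0"
      using LIMSEQ_unique[OF _ tendsto_const] by auto
    have i: "integrable (lebesgue_on T) (\<lambda>x. w x * indicator C x)"
      using integrable_real_mult_indicator[OF _ w, of C] C T A_def
      by (auto simp: sets_restrict_space_iff Cm Tm)
    have "AE x in lebesgue_on T. 0 \<le> w x * indicator C x"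
      using C(2) by (intro AE_I2) (auto simp: A_def indicator_def)
    then have "AE x in lebesgue_on T. w x * indicator C x = 0"
      using integral_nonneg_eq_0_iff_AE[OF i] z by blast
    then have "AE x in lebesgue. x \<in> T \<longrightarrow> w x * indicator C x = 0"
      using Tm by (subst (asm) AE_restrict_space_iff) auto
    then have "AE x in lebesgue. x \<notin> C"
    proof (rule eventually_mono)
      fix x assume "x \<in> T \<longrightarrow> w x * indicator C x = 0"
      moreover have "x \<in> T" "w x \<noteq> 0" if "x \<in> C" using that C(2) unfolding A_def by auto
      ultimately show "x \<notin> C" by (metis indicator_simps(1) mult.right_neutral)
    qed
    then show ?thesis using Cm by (simp add: AE_iff_null_sets)
  qed simp
  have small: "emeasure lebesgue A \<le> ennreal e" if e: "e > 0" for e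
  proof -
    obtain C where C: "closed C" "C \<subseteq> A" "emeasure lebesgue (A - C) < ennreal e"
      by (rule sets_lebesgue_inner_closed[OF Am e]) (rule that)
    have "emeasure lebesgue A \<le> emeasure lebesgue C + emeasure lebesgue (A - C)"
    proof -
      have "C \<union> (A - C) = A" using C(2) by blast
      moreover have "C \<in> sets lebesgue" using C(1) by auto
      ultimately show ?thesis using emeasure_subadditive[of C lebesgue "A - C"] Am by auto
    qed
    also have "emeasure lebesgue C = 0" using closed_null[OF C(1,2)] by auto
    finally show ?thesis using C(3) by simp
  qed
  have "emeasure lebesgue A \<le> 0"
    by (rule ennreal_le_epsilon) (use small in simp)
  then have "emeasure lebesgue A = 0" by simp
  then show ?thesis using Am by (simp add: A_def null_setsI)
qed

lemma AE_zero_if_orthogonal_continuous: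
  fixes w :: "'a::euclidean_space \<Rightarrow> real"
  assumes T: "closed T" and w: "integrable (lebesgue_on T) w"
    and orth: "\<And>f. continuous_on UNIV f \<Longrightarrow> (\<And>x. 0 \<le> f x \<and> f x \<le> 1) \<Longrightarrow>
      integral\<^sup>L (lebesgue_on T) (\<lambda>x. w x * f x) = 0"
  shows "AE x in lebesgue_on T. w x = 0"
proof -
  have 1: "{x \<in> T. w x > 0} \<in> null_sets lebesgue"
    by (rule null_set_if_orthogonal_continuous[OF T w orth])
  have 2: "{x \<in> T. - w x > 0} \<in> null_sets lebesgue"
  proof (rule null_set_if_orthogonal_continuous[OF T])
    show "integrable (lebesgue_on T) (\<lambda>x. - w x)" using w by simp
    fix f :: "'a \<Rightarrow> real"
    assume "continuous_on UNIV f" "\<And>x. 0 \<le> f x \<and> f x \<le> 1"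
    from orth[OF this] show "integral\<^sup>L (lebesgue_on T) (\<lambda>x. - w x * f x) = 0" by simp
  qed
  have "AE x in lebesgue. x \<notin> {x \<in> T. w x > 0}" "AE x in lebesgue. x \<notin> {x \<in> T. - w x > 0}"
    using 1 2 by (auto simp only: intro: AE_not_in)
  then have "AE x in lebesgue. x \<in> T \<longrightarrow> w x = 0"
    by eventually_elim auto
  then show ?thesis using T by (subst AE_restrict_space_iff) auto
qed

lemma integrable_mult_continuous:
  fixes w :: "'a::euclidean_space \<Rightarrow> real"
  assumes T: "compact T" and w: "integrable (lebesgue_on T) w" and g: "continuous_on T g"
  shows "integrable (lebesgue_on T) (\<lambda>x. w x * g x)"
proof -
  have Tm: "T \<in> sets lebesgue" using compact_imp_closed[OF T] by auto
  have "bounded (g ` T)" using T g compact_continuous_image compact_imp_bounded by blast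
  then obtain B where B: "\<And>x. x \<in> T \<Longrightarrow> norm (g x) \<le> B" unfolding bounded_iff by auto
  show ?thesis
  proof (rule Bochner_Integration.integrable_bound)
    show "integrable (lebesgue_on T) (\<lambda>x. B * w x)" using w by simp
    show "(\<lambda>x. w x * g x) \<in> borel_measurable (lebesgue_on T)"
      using w g by (intro borel_measurable_times borel_measurable_integrable
          continuous_imp_measurable_on_sets_lebesgue Tm)
    have "norm (w x * g x) \<le> norm (B * w x)" if "x \<in> T" for x
      using mult_right_mono[OF order_trans[OF B[OF that] abs_ge_self[of B]], of "\<bar>w x\<bar>"]
      by (simp add: abs_mult mult.commute)
    then show "AE x in lebesgue_on T. norm (w x * g x) \<le> norm (B * w x)"
      using Tm by (intro AE_I2) auto
  qed
qed

text \<open>Uniform approximation by Stone-Weierstrass costs at most the uniform error times the L1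
  norm of w. The ring is kept abstract for two uses: all smooth functions, and the multipliers of
  the sine sums.\<close>

lemma AE_zero_if_orthogonal_ring:
  fixes w :: "'a::euclidean_space \<Rightarrow> real"
  assumes R: "function_ring_on R T" and w: "integrable (lebesgue_on T) w"
    and orth: "\<And>f. f \<in> R \<Longrightarrow> integral\<^sup>L (lebesgue_on T) (\<lambda>x. w x * f x) = 0"
  shows "AE x in lebesgue_on T. w x = 0"
proof (rule AE_zero_if_orthogonal_continuous[OF _ w])
  have T: "compact T" using R by (simp add: function_ring_on_def)
  then show "closed T" by (rule compact_imp_closed)
  then have Tm: "T \<in> sets lebesgue" by auto
  fix f :: "'a \<Rightarrow> real" assume "continuous_on UNIV f"
  then have f: "continuous_on T f" using continuous_on_subset by blast
  define I where "I = integral\<^sup>L (lebesgue_on T) (\<lambda>x. \<bar>w x\<bar>)"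
  have "\<bar>integral\<^sup>L (lebesgue_on T) (\<lambda>x. w x * f x)\<bar> \<le> e * I" if e: "e > 0" for e
  proof -
    obtain g where g: "g \<in> R" "\<forall>x\<in>T. \<bar>f x - g x\<bar> < e"
      using function_ring_on.Stone_Weierstrass_basic[OF R f e] by blast
    have gc: "continuous_on T g" using function_ring_on.continuous[OF R] g by blast
    note if' = integrable_mult_continuous[OF T w f] and ig = integrable_mult_continuous[OF T w gc]
    have "integral\<^sup>L (lebesgue_on T) (\<lambda>x. w x * f x)
        = integral\<^sup>L (lebesgue_on T) (\<lambda>x. w x * f x - w x * g x)"
      using orth[OF g(1)] if' ig by simp
    also have "\<bar>...\<bar> \<le> integral\<^sup>L (lebesgue_on T) (\<lambda>x. \<bar>w x * f x - w x * g x\<bar>)"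
      using integral_norm_bound[of "lebesgue_on T" "\<lambda>x. w x * f x - w x * g x"] by simp
    also have "... \<le> integral\<^sup>L (lebesgue_on T) (\<lambda>x. e * \<bar>w x\<bar>)"
    proof (rule integral_mono)
      show "integrable (lebesgue_on T) (\<lambda>x. \<bar>w x * f x - w x * g x\<bar>)" using if' ig by auto
      show "integrable (lebesgue_on T) (\<lambda>x. e * \<bar>w x\<bar>)" using w by auto
      fix x assume "x \<in> space (lebesgue_on T)"
      then have "\<bar>f x - g x\<bar> \<le> e" using g(2) by (auto intro: less_imp_le)
      then have "\<bar>f x - g x\<bar> * \<bar>w x\<bar> \<le> e * \<bar>w x\<bar>" by (rule mult_right_mono) simp
      then show "\<bar>w x * f x - w x * g x\<bar> \<le> e * \<bar>w x\<bar>"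
        by (simp add: mult.commute flip: abs_mult left_diff_distrib)
    qed
    finally show ?thesis by (simp add: I_def)
  qed
  note bound = this
  have I0: "I \<ge> 0" by (simp add: I_def)
  show "integral\<^sup>L (lebesgue_on T) (\<lambda>x. w x * f x) = 0"
  proof (rule ccontr)
    assume ne: "integral\<^sup>L (lebesgue_on T) (\<lambda>x. w x * f x) \<noteq> 0" (is "?J \<noteq> 0")
    have "\<bar>?J\<bar> \<le> (\<bar>?J\<bar> / (2 * (I + 1))) * I" using ne I0 by (intro bound) auto
    also have "... \<le> \<bar>?J\<bar> / 2" using I0 by (simp add: field_simps)
    finally show False using ne by simp
  qed
qed

subsection \<open>Test functions determine square-integrable functions\<close>

lemma smooth_flat: "smooth_fun (\<lambda>x. flat k (x \<bullet> v + e))"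
proof (rule smooth_family_inner[where g="\<lambda>k y. flat k (y + e)" and \<alpha>="\<lambda>k. - real k" and \<sigma>=Suc
      and \<beta>="\<lambda>k. 1" and \<tau>="\<lambda>k. k + 2"])
  show "((\<lambda>y. flat k (y + e)) has_real_derivative - real k * flat (Suc k) (x + e) + 1 * flat (k + 2) (x + e)) (at x)"
    for k x using flat_deriv[of k "x + e"] by (simp add: DERIV_shift)
qed

text \<open>Being positive on the whole open box and zero outside, it turns smooth functions into
  functions supported in the closed box without losing information inside.\<close>

definition bump :: "'a::euclidean_space \<Rightarrow> 'a \<Rightarrow> 'a \<Rightarrow> real" where
  "bump a c x = (\<Prod>b\<in>Basis. flat 0 (x \<bullet> b + - (a \<bullet> b)) * flat 0 (x \<bullet> (- b) + c \<bullet> b))"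

lemma smooth_bump: "smooth_fun (bump a c)"
  unfolding bump_def[abs_def] by (intro smooth_prod smooth_mult smooth_flat)

lemma bump_pos: "x \<in> box a c \<Longrightarrow> bump a c x > 0"
  unfolding bump_def by (intro prod_pos) (auto simp: flat_def mem_box)

lemma bump_zero: "x \<notin> box a c \<Longrightarrow> bump a c x = 0"
proof -
  assume "x \<notin> box a c"
  then obtain i where i: "i \<in> Basis" "\<not> (a \<bullet> i < x \<bullet> i \<and> x \<bullet> i < c \<bullet> i)" unfolding mem_box by blast
  then have "flat 0 (x \<bullet> i + - (a \<bullet> i)) * flat 0 (x \<bullet> (- i) + c \<bullet> i) = 0"
    by (auto simp: flat_def not_less)
  then show ?thesis unfolding bump_def using i(1) by (intro prod_zero) auto
qed

lemma test_fun_bump: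
  assumes "cbox a c \<subseteq> U" "smooth_fun f"
  shows "test_fun U (\<lambda>x. bump a c x * f x)"
proof -
  have "{x. bump a c x * f x \<noteq> 0} \<subseteq> cbox a c"
    using bump_zero box_subset_cbox by (metis (mono_tags, lifting) mem_Collect_eq mult_zero_left subset_iff)
  then have "tsupp (\<lambda>x. bump a c x * f x) \<subseteq> cbox a c"
    unfolding tsupp_def by (rule closure_minimal) (rule closed_cbox)
  moreover from this have "compact (tsupp (\<lambda>x. bump a c x * f x))"
    by (metis bounded_cbox bounded_subset closed_closure compact_eq_bounded_closed tsupp_def)
  ultimately show ?thesis using assms unfolding test_fun_def
    by (auto intro!: smooth_mult smooth_bump)
qed

lemma function_ring_smooth:
  assumes "compact T"
  shows "function_ring_on {f::'a::euclidean_space \<Rightarrow> real. smooth_fun f} T"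
proof
  fix x y :: 'a assume "x \<noteq> y"
  then obtain b where "b \<in> Basis" "x \<bullet> b \<noteq> y \<bullet> b" using euclidean_eqI by blast
  then show "\<exists>f\<in>{f. smooth_fun f}. f x \<noteq> f y" by (auto intro!: exI[of _ "\<lambda>x. x \<bullet> b"] smooth_inner)
qed (auto intro: assms smooth_continuous smooth_add smooth_mult smooth_const)

text \<open>On a closed box inside U the bump turns every smooth function into a test function of U.
  So g times the bump is orthogonal to a ring that separates points, hence zero, and countably many
  boxes exhaust U.\<close>

lemma fundamental_lemma:
  fixes G :: "'a::euclidean_space l2"
  assumes U: "open U" and G: "restr U G = G"
    and orth: "\<And>\<phi>. test_fun U \<phi> \<Longrightarrow> inner G (cls U \<phi>) = 0"
  shows "G = 0"
proof -
  have Um: "U \<in> sets lebesgue" using U by auto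
  define g where "g = rp G"
  have gsq: "Lsq S g" if "S \<in> sets lebesgue" for S using Lsq_rp[OF that] by (simp add: g_def)
  have Gg: "G = cls U g" using G by (simp add: restr_def g_def)
  have zero: "AE x in lebesgue. x \<in> cbox a c \<longrightarrow> g x = 0" if sub: "cbox a c \<subseteq> U" for a c
  proof -
    have Cm: "cbox a c \<in> sets lebesgue" by auto
    have "AE x in lebesgue_on (cbox a c). g x * bump a c x = 0"
    proof (rule AE_zero_if_orthogonal_ring[OF function_ring_smooth[OF compact_cbox]])
      show "integrable (lebesgue_on (cbox a c)) (\<lambda>x. g x * bump a c x)"
        by (intro Lsq_mult_integrable Cm gsq Lsq_continuous bounded_cbox smooth_continuous smooth_bump)
      fix f :: "'a \<Rightarrow> real" assume "f \<in> {f. smooth_fun f}"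
      then have f: "smooth_fun f" by simp
      define \<phi> where "\<phi> x = bump a c x * f x" for x
      have \<phi>: "test_fun U \<phi>" unfolding \<phi>_def by (rule test_fun_bump[OF sub f])
      have \<phi>0: "\<phi> x = 0" if "x \<notin> cbox a c" for x
        using that bump_zero box_subset_cbox by (force simp: \<phi>_def)
      have \<phi>L: "Lsq (cbox a c) \<phi>" using \<phi>
        by (intro Lsq_continuous smooth_continuous bounded_cbox Cm) (simp add: test_fun_def)
      have "integral\<^sup>L (lebesgue_on (cbox a c)) (\<lambda>x. g x * \<phi> x) = inner (cls (cbox a c) g) (cls (cbox a c) \<phi>)"
        by (simp add: inner_cls Cm gsq \<phi>L ip_def)
      also have "cls (cbox a c) g = restr (cbox a c) G"
        unfolding Gg using sub by (simp add: restr_subset Um Cm gsq)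
      also have "inner (restr (cbox a c) G) (cls (cbox a c) \<phi>) = inner G (cls (cbox a c) \<phi>)"
        by (simp add: inner_restr(2) Cm restr_idem \<phi>L)
      also have "cls (cbox a c) \<phi> = cls U \<phi>"
        unfolding cls_def by (intro arg_cong[where f=abs_l2] ext) (use sub \<phi>0 in auto)
      also have "inner G (cls U \<phi>) = 0" by (rule orth[OF \<phi>])
      finally show "integral\<^sup>L (lebesgue_on (cbox a c)) (\<lambda>x. g x * bump a c x * f x) = 0"
        by (simp add: \<phi>_def mult.assoc)
    qed
    then have 1: "AE x in lebesgue. x \<in> cbox a c \<longrightarrow> g x * bump a c x = 0"
      by (subst (asm) AE_restrict_space_iff) auto
    \<comment> \<open>The bump vanishes on the faces of the box, so nothing is learnt about g there;
      they form a null set.\<close>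
    have "cbox a c - box a c \<in> null_sets lebesgue"
      using negligible_frontier_interval negligible_iff_null_sets by blast
    then have "AE x in lebesgue. x \<notin> cbox a c - box a c" by (rule AE_not_in)
    with 1 show ?thesis
      by eventually_elim (use bump_pos in force)
  qed
  obtain D where D: "countable D" "D \<subseteq> Pow U" "\<And>X. X \<in> D \<Longrightarrow> \<exists>a b. X = cbox a b" "\<Union>D = U"
    using open_countable_Union_open_cbox[OF U] by metis
  have "AE x in lebesgue. \<forall>X\<in>D. x \<in> X \<longrightarrow> g x = 0"
  proof (subst AE_ball_countable[OF D(1)], rule ballI)
    fix X assume X: "X \<in> D"
    then obtain a b where "X = cbox a b" using D(3) by blast
    then show "AE x in lebesgue. x \<in> X \<longrightarrow> g x = 0" using zero[of a b] X D(2) by blast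
  qed
  then have "AE x in lebesgue. x \<in> U \<longrightarrow> g x = 0"
    by (rule AE_mp) (use D(4) in auto)
  then have "AE x in lebesgue_on U. g x = 0" using Um by (subst AE_restrict_space_iff) auto
  then have "cls U g = cls U (\<lambda>x. 0)" using Um by (subst cls_eq_iff) (auto intro: gsq Lsq_zero)
  then show ?thesis using Gg by (simp add: cls_zero)
qed

section \<open>Integration of partial derivatives over a box\<close>

lemma smooth_increment_bound:
  assumes h: "smooth_fun h" and b: "b \<in> Basis" and s: "s \<ge> 0"
    and x: "x \<in> cbox a c" "x + s *\<^sub>R b \<in> cbox a c"
    and M: "\<And>y. y \<in> cbox a c \<Longrightarrow> \<bar>partial_dir b h y\<bar> \<le> M"
  shows "\<bar>h (x + s *\<^sub>R b) - h x\<bar> \<le> M * s"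
proof (cases "s = 0")
  case False
  then have "0 < s" using s by simp
  then obtain z where z: "0 < z" "z < s" "h (x + s *\<^sub>R b) - h (x + 0 *\<^sub>R b) = (s - 0) * partial_dir b h (x + z *\<^sub>R b)"
    using MVT2[of 0 s "\<lambda>t. h (x + t *\<^sub>R b)" "\<lambda>t. partial_dir b h (x + t *\<^sub>R b)",
        OF _ smooth_line_deriv[OF h b]] by blast
  have "x + z *\<^sub>R b \<in> cbox a c"
    unfolding mem_box
  proof (rule ballI)
    fix i :: 'a assume i: "i \<in> Basis"
    have "0 \<le> b \<bullet> i" using b i by (simp add: inner_Basis)
    then have "x \<bullet> i \<le> x \<bullet> i + z * (b \<bullet> i)" "x \<bullet> i + z * (b \<bullet> i) \<le> x \<bullet> i + s * (b \<bullet> i)"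
      using z by (auto intro: mult_right_mono)
    moreover have "a \<bullet> i \<le> x \<bullet> i" "x \<bullet> i + s * (b \<bullet> i) \<le> c \<bullet> i"
      using x i by (auto simp: mem_box inner_add_left)
    ultimately show "a \<bullet> i \<le> (x + z *\<^sub>R b) \<bullet> i \<and> (x + z *\<^sub>R b) \<bullet> i \<le> c \<bullet> i"
      by (simp add: inner_add_left)
  qed
  from M[OF this] have "\<bar>s * partial_dir b h (x + z *\<^sub>R b)\<bar> \<le> s * M"
    using s by (simp add: abs_mult mult_left_mono)
  then show ?thesis using z(3) by (simp add: mult.commute)
qed simp

lemma mem_box_line:
  fixes x :: "'a::euclidean_space"
  assumes "b \<in> Basis"
  shows "x + s *\<^sub>R b \<in> box a c \<longleftrightarrow> a \<bullet> b < x \<bullet> b + s \<and> x \<bullet> b + s < c \<bullet> b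
      \<and> (\<forall>i\<in>Basis - {b}. a \<bullet> i < x \<bullet> i \<and> x \<bullet> i < c \<bullet> i)"
    and "x + s *\<^sub>R b \<in> cbox a c \<longleftrightarrow> a \<bullet> b \<le> x \<bullet> b + s \<and> x \<bullet> b + s \<le> c \<bullet> b
      \<and> (\<forall>i\<in>Basis - {b}. a \<bullet> i \<le> x \<bullet> i \<and> x \<bullet> i \<le> c \<bullet> i)"
proof -
  have i: "(x + s *\<^sub>R b) \<bullet> i = (if i = b then x \<bullet> b + s else x \<bullet> i)" if "i \<in> Basis" for i
    using that assms by (auto simp: inner_add_left inner_Basis)
  have B: "(\<forall>i\<in>Basis. P i) \<longleftrightarrow> P b \<and> (\<forall>i\<in>Basis - {b}. P i)" for P
    using assms by blast
  show "x + s *\<^sub>R b \<in> box a c \<longleftrightarrow> a \<bullet> b < x \<bullet> b + s \<and> x \<bullet> b + s < c \<bullet> b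
      \<and> (\<forall>i\<in>Basis - {b}. a \<bullet> i < x \<bullet> i \<and> x \<bullet> i < c \<bullet> i)"
    unfolding mem_box B by (auto simp: i assms)
  show "x + s *\<^sub>R b \<in> cbox a c \<longleftrightarrow> a \<bullet> b \<le> x \<bullet> b + s \<and> x \<bullet> b + s \<le> c \<bullet> b
      \<and> (\<forall>i\<in>Basis - {b}. a \<bullet> i \<le> x \<bullet> i \<and> x \<bullet> i \<le> c \<bullet> i)"
    unfolding mem_box B by (auto simp: i assms)
qed

text \<open>By translation invariance the difference quotients of the extension H by zero have
  integral 0. The boundary values of h keep them bounded, and dominated convergence passes to the
  derivative.\<close>

lemma integral_partial_zero:
  fixes h :: "'a::euclidean_space \<Rightarrow> real"
  assumes h: "smooth_fun h" and b: "b \<in> Basis"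
    and ha: "\<And>x. x \<in> cbox a c \<Longrightarrow> x \<bullet> b = a \<bullet> b \<Longrightarrow> h x = 0"
    and hc: "\<And>x. x \<in> cbox a c \<Longrightarrow> x \<bullet> b = c \<bullet> b \<Longrightarrow> h x = 0"
  shows "integral\<^sup>L (lebesgue_on (box a c)) (partial_dir b h) = 0"
proof -
  define H where "H x = indicator (box a c) x * h x" for x
  define e where "e n = 1 / real (Suc n)" for n
  have e: "0 < e n" "e n \<le> 1" for n by (auto simp: e_def)
  have e0: "e \<longlonglongrightarrow> 0" unfolding e_def using LIMSEQ_inverse_real_of_nat by (simp add: inverse_eq_divide)
  define Q where "Q n x = (H (x + e n *\<^sub>R b) - H x) / e n" for n x
  have hm[measurable]: "h \<in> borel_measurable borel"
    by (intro borel_measurable_continuous_onI smooth_continuous h)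
  have Hm[measurable]: "H \<in> borel_measurable borel" unfolding H_def by measurable
  have dm[measurable]: "partial_dir b h \<in> borel_measurable borel"
    by (intro borel_measurable_continuous_onI smooth_continuous smooth_partial h b)
  have "compact (partial_dir b h ` cbox a c)"
    by (intro compact_continuous_image compact_cbox smooth_continuous smooth_partial h b)
  then obtain M where M: "\<And>y. y \<in> cbox a c \<Longrightarrow> \<bar>partial_dir b h y\<bar> \<le> M"
    using compact_imp_bounded bounded_iff by (metis imageI real_norm_def)
  have "compact (h ` cbox a c)"
    by (intro compact_continuous_image compact_cbox smooth_continuous h)
  then obtain K where K: "\<And>y. y \<in> cbox a c \<Longrightarrow> \<bar>h y\<bar> \<le> K"
    using compact_imp_bounded bounded_iff by (metis imageI real_norm_def)
  have Hint: "integrable lborel H"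
  proof (rule Bochner_Integration.integrable_bound)
    show "integrable lborel (\<lambda>x. K * indicator (cbox a c) x)"
      by (intro integrable_mult_right integrable_real_indicator) (simp_all only: sets_lborel borel_closed closed_cbox emeasure_lborel_cbox_finite)
    have "norm (H x) \<le> norm (K * indicator (cbox a c) x)" for x
      using K[of x] box_subset_cbox[of a c] by (auto simp: H_def indicator_def)
    then show "AE x in lborel. norm (H x) \<le> norm (K * indicator (cbox a c) x)" by simp
  qed simp
  have Qint: "integral\<^sup>L lborel (Q n) = 0" for n
  proof -
    have "integral\<^sup>L lborel (\<lambda>x. H (e n *\<^sub>R b + x)) = integral\<^sup>L (distr lborel borel ((+) (e n *\<^sub>R b))) H"
      by (subst integral_distr) auto
    also have "... = integral\<^sup>L lborel H" by (simp add: lborel_distr_plus)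
    finally have 1: "integral\<^sup>L lborel (\<lambda>x. H (x + e n *\<^sub>R b)) = integral\<^sup>L lborel H" by (simp add: add.commute)
    have "integrable (distr lborel borel ((+) (e n *\<^sub>R b))) H" using Hint by (simp add: lborel_distr_plus)
    then have "integrable lborel (\<lambda>x. H (x + e n *\<^sub>R b))"
      by (subst (asm) integrable_distr_eq) (auto simp: add.commute)
    then show ?thesis unfolding Q_def using 1 Hint by simp
  qed
  \<comment> \<open>H is Lipschitz along b: a step that enters or leaves the box is cut at the face,
    where h vanishes, and only the piece inside counts.\<close>
  have H0: "\<bar>H (x + e n *\<^sub>R b) - H x\<bar> \<le> \<bar>M\<bar> * e n" for n x
  proof -
    have Mx: "\<And>y. y \<in> cbox a c \<Longrightarrow> \<bar>partial_dir b h y\<bar> \<le> \<bar>M\<bar>" using M by fastforce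
    note inc = smooth_increment_bound[OF h b _ _ _ Mx]
    consider (both) "x \<in> box a c" "x + e n *\<^sub>R b \<in> box a c"
      | (leave) "x \<in> box a c" "x + e n *\<^sub>R b \<notin> box a c"
      | (enter) "x \<notin> box a c" "x + e n *\<^sub>R b \<in> box a c"
      | (out) "x \<notin> box a c" "x + e n *\<^sub>R b \<notin> box a c" by blast
    then show ?thesis
    proof cases
      case both
      then show ?thesis using inc[of "e n" x] e[of n] box_subset_cbox[of a c] by (auto simp: H_def less_imp_le)
    next
      case leave
      have xc: "x \<in> cbox a c" using leave(1) box_subset_cbox by blast
      define s where "s = c \<bullet> b - x \<bullet> b"
      have s: "0 \<le> s" "s \<le> e n"
        using mem_box_line[OF b, of x 0 a c] leave e(1)[of n]
        by (auto simp: s_def mem_box_line(1)[OF b])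
      have "x + s *\<^sub>R b \<in> cbox a c"
        using mem_box_line[OF b, of x 0 a c] xc by (auto simp: s_def mem_box_line(2)[OF b])
      moreover have "h (x + s *\<^sub>R b) = 0"
        by (rule hc[OF calculation]) (use b in \<open>simp add: s_def inner_add_left\<close>)
      ultimately have "\<bar>h x\<bar> \<le> \<bar>M\<bar> * s" using inc[OF s(1) xc] by simp
      also have "... \<le> \<bar>M\<bar> * e n" using s by (intro mult_left_mono) auto
      finally show ?thesis using leave by (simp add: H_def)
    next
      case enter
      define y where "y = x + e n *\<^sub>R b"
      have yc: "y \<in> cbox a c" using enter(2) box_subset_cbox y_def by blast
      define s where "s = y \<bullet> b - a \<bullet> b"
      have s: "0 \<le> s" "s \<le> e n"
        using mem_box_line[OF b, of x 0 a c] enter e(1)[of n] b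
        by (auto simp: s_def y_def inner_add_left mem_box_line(1)[OF b])
      have zc: "y + (- s) *\<^sub>R b \<in> cbox a c"
        unfolding mem_box_line(2)[OF b] using mem_box_line[OF b, of y 0 a c] yc by (auto simp: s_def)
      moreover have "h (y + (- s) *\<^sub>R b) = 0"
        by (rule ha[OF calculation]) (use b in \<open>simp add: s_def inner_add_left\<close>)
      ultimately have "\<bar>h y\<bar> \<le> \<bar>M\<bar> * s" using inc[OF s(1) zc] yc by simp
      also have "... \<le> \<bar>M\<bar> * e n" using s by (intro mult_left_mono) auto
      finally show ?thesis using enter by (simp add: H_def y_def)
    next
      case out
      then show ?thesis using e(1)[of n] by (simp add: H_def)
    qed
  qed
  \<comment> \<open>Steps have length at most 1, so all quotients are supported in the box enlarged
    by one unit below in direction b; this yields an integrable bound.\<close>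
  have Qout: "Q n x = 0" if "x \<notin> cbox (a - b) c" for n x
  proof -
    have ab: "(a - b) \<bullet> b = a \<bullet> b - 1" and ai: "\<And>i. i \<in> Basis - {b} \<Longrightarrow> (a - b) \<bullet> i = a \<bullet> i"
      using b by (auto simp: inner_diff_left inner_Basis)
    have "x \<in> cbox (a - b) c" if "s = 0 \<or> s = e n" "x + s *\<^sub>R b \<in> box a c" for s
    proof -
      have "x + 0 *\<^sub>R b \<in> cbox (a - b) c"
        using that e[of n] unfolding mem_box_line[OF b] by (auto simp: ab ai less_imp_le)
      then show ?thesis by simp
    qed
    from this[of 0] this[of "e n"] that have "x \<notin> box a c" "x + e n *\<^sub>R b \<notin> box a c" by auto
    then show ?thesis by (simp add: Q_def H_def)
  qed
  have "(\<lambda>n. integral\<^sup>L lborel (Q n)) \<longlonglongrightarrow> integral\<^sup>L lborel (\<lambda>x. indicator (box a c) x * partial_dir b h x)"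
  proof (rule integral_dominated_convergence[where w="\<lambda>x. \<bar>M\<bar> * indicator (cbox (a - b) c) x"])
    show "integrable lborel (\<lambda>x. \<bar>M\<bar> * indicator (cbox (a - b) c) x)"
      by (intro integrable_mult_right integrable_real_indicator) (simp_all only: sets_lborel borel_closed closed_cbox emeasure_lborel_cbox_finite)
    show "(\<lambda>x. indicator (box a c) x * partial_dir b h x) \<in> borel_measurable lborel" by measurable
    show "Q n \<in> borel_measurable lborel" for n unfolding Q_def by measurable
    show "AE x in lborel. norm (Q n x) \<le> \<bar>M\<bar> * indicator (cbox (a - b) c) x" for n
    proof (rule AE_I2)
      fix x
      show "norm (Q n x) \<le> \<bar>M\<bar> * indicator (cbox (a - b) c) x"
        using H0[of x n] Qout[of x n] e(1)[of n] by (cases "x \<in> cbox (a - b) c") (auto simp: Q_def field_simps)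
    qed
    have "cbox a c - box a c \<in> null_sets lebesgue"
      using negligible_frontier_interval negligible_iff_null_sets by blast
    then have "AE x in lebesgue. x \<notin> cbox a c - box a c" by (rule AE_not_in)
    then have "AE x in lborel. x \<notin> cbox a c - box a c" by (simp add: AE_completion_iff)
    then show "AE x in lborel. (\<lambda>n. Q n x) \<longlonglongrightarrow> indicator (box a c) x * partial_dir b h x"
    proof eventually_elim
      case (elim x)
      have shift: "(\<lambda>n. x + e n *\<^sub>R b) \<longlonglongrightarrow> x"
        using tendsto_add[OF tendsto_const tendsto_scaleR[OF e0 tendsto_const], of x b] by simp
      show ?case
      proof (cases "x \<in> box a c")
        case True
        have "\<forall>\<^sub>F n in sequentially. x + e n *\<^sub>R b \<in> box a c"
          using shift True by (rule topological_tendstoD[OF _ open_box])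
        then have ev: "\<forall>\<^sub>F n in sequentially. (h (x + e n *\<^sub>R b) - h (x + 0 *\<^sub>R b)) / (e n) = Q n x"
          by eventually_elim (simp add: Q_def H_def True)
        have "((\<lambda>t. (h (x + t *\<^sub>R b) - h (x + 0 *\<^sub>R b)) / t) \<longlongrightarrow> partial_dir b h x) (at 0)"
          using smooth_partial_deriv[OF h b, of x] by (simp add: has_field_derivative_iff)
        moreover have "filterlim e (at 0) sequentially"
          unfolding filterlim_at using e0 e(1) by (auto intro!: always_eventually simp: less_imp_neq[symmetric])
        ultimately have "(\<lambda>n. (h (x + e n *\<^sub>R b) - h (x + 0 *\<^sub>R b)) / (e n)) \<longlonglongrightarrow> partial_dir b h x"
          by (rule filterlim_compose)
        then have "(\<lambda>n. Q n x) \<longlonglongrightarrow> partial_dir b h x" using ev by (rule Lim_transform_eventually)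
        then show ?thesis using True by simp
      next
        case False
        then have xc: "x \<in> - cbox a c" using elim by auto
        have "\<forall>\<^sub>F n in sequentially. x + e n *\<^sub>R b \<in> - cbox a c"
          using shift xc by (rule topological_tendstoD[OF _ open_Compl[OF closed_cbox]])
        then have "\<forall>\<^sub>F n in sequentially. Q n x = 0"
          by eventually_elim (use False box_subset_cbox in \<open>auto simp: Q_def H_def indicator_def\<close>)
        then show ?thesis using False by (simp add: tendsto_eventually)
      qed
    qed
  qed
  then have "integral\<^sup>L lborel (\<lambda>x. indicator (box a c) x * partial_dir b h x) = 0"
    using LIMSEQ_unique[OF _ tendsto_const] by (simp add: Qint)
  moreover have "integral\<^sup>L (lebesgue_on (box a c)) (partial_dir b h)
      = integral\<^sup>L lebesgue (\<lambda>x. indicator (box a c) x * partial_dir b h x)"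
    by (subst integral_restrict_space) auto
  ultimately show ?thesis by (simp add: integral_completion)
qed

section \<open>The divergence on finite sine sums\<close>

lemma integral_lborel_prod:
  fixes h :: "'a::euclidean_space \<Rightarrow> real \<Rightarrow> real"
  assumes h: "\<And>b. b \<in> Basis \<Longrightarrow> integrable lborel (h b)"
  shows "integral\<^sup>L lborel (\<lambda>x. \<Prod>b\<in>Basis. h b (x \<bullet> b)) = (\<Prod>b\<in>Basis. integral\<^sup>L lborel (h b))"
proof -
  interpret product_sigma_finite "\<lambda>_. interval_measure (\<lambda>x. x)"
    unfolding product_sigma_finite_def lborel_eq_real[symmetric]
    using lborel.sigma_finite_measure_axioms by blast
  have m: "(\<lambda>f. \<Sum>b\<in>Basis. f b *\<^sub>R b) \<in> measurable (\<Pi>\<^sub>M b\<in>Basis. interval_measure (\<lambda>x. x)) (borel :: 'a measure)"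
    by measurable
  have hb: "h b \<in> borel_measurable borel" if "b \<in> Basis" for b using h[OF that] by auto
  have "integral\<^sup>L lborel (\<lambda>x. \<Prod>b\<in>Basis. h b (x \<bullet> b))
      = integral\<^sup>L (\<Pi>\<^sub>M b\<in>Basis. interval_measure (\<lambda>x. x)) (\<lambda>f. \<Prod>b\<in>Basis. h b ((\<Sum>i\<in>Basis. f i *\<^sub>R i) \<bullet> b))"
    unfolding lborel_def
    by (subst integral_distr[OF m]) (auto intro!: borel_measurable_prod measurable_compose[OF _ hb])
  also have "... = integral\<^sup>L (\<Pi>\<^sub>M b\<in>Basis. interval_measure (\<lambda>x. x)) (\<lambda>f. \<Prod>b\<in>Basis. h b (f b))"
    by (intro Bochner_Integration.integral_cong refl prod.cong) (auto simp: inner_sum_left inner_Basis if_distrib cong: if_cong)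
  also have "... = (\<Prod>b\<in>Basis. integral\<^sup>L (interval_measure (\<lambda>x. x)) (h b))"
    by (rule product_integral_prod) (auto simp: lborel_eq_real[symmetric] h)
  finally show ?thesis by (simp add: lborel_eq_real[symmetric])
qed

lemma subspace_closure:
  fixes S :: "'x::real_normed_vector set"
  assumes S: "subspace S"
  shows "subspace (closure S)"
  unfolding subspace_def
proof (intro conjI ballI allI)
  show "0 \<in> closure S" using subspace_0[OF S] closure_subset by blast
next
  fix x y assume "x \<in> closure S" "y \<in> closure S"
  then obtain X Y where "\<And>n. X n \<in> S" "X \<longlonglongrightarrow> x" "\<And>n. Y n \<in> S" "Y \<longlonglongrightarrow> y"
    unfolding closure_sequential by blast
  then show "x + y \<in> closure S"
    unfolding closure_sequential
    by (intro exI[of _ "\<lambda>n. X n + Y n"]) (auto intro: subspace_add[OF S] tendsto_add)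
next
  fix r :: real and x assume "x \<in> closure S"
  then obtain X where "\<And>n. X n \<in> S" "X \<longlonglongrightarrow> x"
    unfolding closure_sequential by blast
  then show "r *\<^sub>R x \<in> closure S"
    unfolding closure_sequential
    by (intro exI[of _ "\<lambda>n. r *\<^sub>R X n"]) (auto intro: subspace_scale[OF S] tendsto_scaleR tendsto_const)
qed

text \<open>The index m counts quarter periods of phase: each derivative adds one and a factor
  \<kappa>, so sines and cosines need no separate treatment.\<close>

definition sinf :: "real \<Rightarrow> real \<Rightarrow> nat \<Rightarrow> real \<Rightarrow> real" where
  "sinf \<kappa> \<alpha> m y = sin (\<kappa> * (y - \<alpha>) + real m * (pi / 2))"

lemma sinf_deriv: "(sinf \<kappa> \<alpha> m has_real_derivative \<kappa> * sinf \<kappa> \<alpha> (Suc m) y) (at y)"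
proof -
  have "\<kappa> * (y - \<alpha>) + real (Suc m) * (pi / 2) = (\<kappa> * (y - \<alpha>) + real m * (pi / 2)) + pi / 2"
    by (simp add: field_simps)
  then have "sin (\<kappa> * (y - \<alpha>) + real (Suc m) * (pi / 2)) = cos (\<kappa> * (y - \<alpha>) + real m * (pi / 2))"
    by (simp only: sin_add[of _ "pi / 2"]) simp
  then show ?thesis unfolding sinf_def
    by (auto intro!: derivative_eq_intros simp: mult.commute)
qed

lemma sin_nat_pi_shift: "sin (real i * pi + real m * pi) = 0"
  using sin_npi[of "i + m"] by (simp add: distrib_right)

text \<open>Up to sign these are sines for even m and cosines for odd m; with nonzero frequencies
  both systems are orthogonal on the interval and have the same norm. A common m suffices, as a
  derivative shifts the phase of all modes alike.\<close>

lemma sinf_orthogonal: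
  fixes \<alpha> \<gamma> :: real
  assumes l: "\<alpha> < \<gamma>" and ij: "i \<ge> 1" "j \<ge> 1"
  defines "\<omega> \<equiv> pi / (\<gamma> - \<alpha>)"
  shows "integral\<^sup>L lborel (\<lambda>y. sinf (real i * \<omega>) \<alpha> m y * sinf (real j * \<omega>) \<alpha> m y * indicator {\<alpha>..\<gamma>} y)
      = (if i = j then (\<gamma> - \<alpha>) / 2 else 0)"
proof -
  let ?f = "\<lambda>y. sinf (real i * \<omega>) \<alpha> m y * sinf (real j * \<omega>) \<alpha> m y"
  have w: "\<omega> > 0" using l by (simp add: \<omega>_def)
  have wl: "\<omega> * (\<gamma> - \<alpha>) = pi" using l by (simp add: \<omega>_def)
  have prod: "?f y = (cos ((real i - real j) * (\<omega> * (y - \<alpha>))) - cos ((real i + real j) * (\<omega> * (y - \<alpha>)) + real m * pi)) / 2" for y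
    unfolding sinf_def sin_times_sin by (simp add: algebra_simps)
  define G where "G y = sin ((real i + real j) * (\<omega> * (y - \<alpha>)) + real m * pi) / ((real i + real j) * \<omega>)" for y
  have ijp: "(real i + real j) * \<omega> \<noteq> 0" using ij w by simp
  have G: "(G has_real_derivative cos ((real i + real j) * (\<omega> * (y - \<alpha>)) + real m * pi)) (at y)" for y
    unfolding G_def using ijp by (auto intro!: derivative_eq_intros simp: mult_ac)
  have "G \<alpha> = 0" by (simp add: G_def)
  moreover have "G \<gamma> = 0" unfolding G_def wl using sin_nat_pi_shift[of "i + j" m] by simp
  ultimately have G0: "G \<gamma> = G \<alpha>" by simp
  define F where "F y = (if i = j then y else sin ((real i - real j) * (\<omega> * (y - \<alpha>))) / ((real i - real j) * \<omega>))" for y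
  have F: "(F has_real_derivative cos ((real i - real j) * (\<omega> * (y - \<alpha>)))) (at y)" for y
  proof (cases "i = j")
    case True
    then have "F = (\<lambda>y. y)" by (auto simp: F_def)
    then show ?thesis using True by simp
  next
    case False
    then have "(real i - real j) * \<omega> \<noteq> 0" using w by simp
    then show ?thesis using False unfolding F_def by (auto intro!: derivative_eq_intros simp: mult_ac)
  qed
  have F0: "F \<gamma> - F \<alpha> = (if i = j then \<gamma> - \<alpha> else 0)"
  proof -
    have "sin ((real i - real j) * pi) = 0"
      by (simp add: left_diff_distrib sin_diff)
    then show ?thesis by (simp add: F_def wl)
  qed
  have "integral\<^sup>L lborel (\<lambda>y. ?f y * indicator {\<alpha>..\<gamma>} y) = (F \<gamma> - G \<gamma>) / 2 - (F \<alpha> - G \<alpha>) / 2"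
  proof (rule integral_FTC_Icc_real)
    show "\<alpha> \<le> \<gamma>" using l by simp
    show "((\<lambda>y. (F y - G y) / 2) has_real_derivative ?f y) (at y)" for y
      unfolding prod by (intro DERIV_cdivide DERIV_diff F G)
    show "isCont ?f y" for y unfolding sinf_def by (intro continuous_intros)
  qed
  then show ?thesis using F0 G0 by (simp add: field_simps split: if_splits)
qed

lemma Lsq_smooth_cbox: "smooth_fun f \<Longrightarrow> Lsq (cbox u v) f"
  by (intro Lsq_continuous smooth_continuous) auto

lemma cls_sum:
  "finite I \<Longrightarrow> S \<in> sets lebesgue \<Longrightarrow> (\<And>i. i \<in> I \<Longrightarrow> Lsq S (f i)) \<Longrightarrow>
    Lsq S (\<lambda>x. \<Sum>i\<in>I. f i x) \<and> cls S (\<lambda>x. \<Sum>i\<in>I. f i x) = (\<Sum>i\<in>I. cls S (f i))"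
proof (induction I rule: finite_induct)
  case (insert i I)
  then have "Lsq S (f i)" "Lsq S (\<lambda>x. \<Sum>i\<in>I. f i x)" "cls S (\<lambda>x. \<Sum>i\<in>I. f i x) = (\<Sum>i\<in>I. cls S (f i))" by auto
  then show ?case using insert.hyps insert.prems by (simp add: cls_add Lsq_add)
qed (simp add: cls_zero Lsq_zero)

lemma restr_fixed_subspace:
  assumes "S \<in> sets lebesgue"
  shows "subspace {F. restr S F = F}" "closed {F. restr S F = F}"
proof -
  interpret r: bounded_linear "restr S" by (rule bounded_linear_restr[OF assms])
  show "subspace {F. restr S F = F}" by (auto simp: subspace_def r.add r.scaleR r.zero)
  show "closed {F. restr S F = F}"
    by (intro closed_Collect_eq continuous_on_id r.continuous_on)
qed

context
  fixes a c :: "'a::euclidean_space"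
  assumes ac: "\<And>b. b \<in> Basis \<Longrightarrow> a \<bullet> b < c \<bullet> b"
begin

definition om :: "'a \<Rightarrow> real" where "om b = pi / (c \<bullet> b - a \<bullet> b)"

lemma om_pos: "b \<in> Basis \<Longrightarrow> om b > 0"
  using ac by (simp add: om_def)

text \<open>k lists the number of half-waves in each coordinate and m the orders of differentiation;
  \<open>m = (\<lambda>_. 0)\<close> gives the Dirichlet eigenfunctions of the Laplacian on the
  box.\<close>

definition snp :: "('a \<Rightarrow> nat) \<Rightarrow> ('a \<Rightarrow> nat) \<Rightarrow> 'a \<Rightarrow> real" where
  "snp m k x = (\<Prod>b\<in>Basis. sinf (real (k b) * om b) (a \<bullet> b) (m b) (x \<bullet> b))"

lemma smooth_snp: "smooth_fun (snp m k)"
  unfolding snp_def[abs_def]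
proof (rule smooth_prod)
  fix b :: 'a
  show "smooth_fun (\<lambda>x. sinf (real (k b) * om b) (a \<bullet> b) (m b) (x \<bullet> b))"
    by (rule smooth_family_inner[where g="sinf (real (k b) * om b) (a \<bullet> b)" and \<alpha>="\<lambda>_. real (k b) * om b" and \<sigma>=Suc
      and \<beta>="\<lambda>_. 0" and \<tau>=id]) (use sinf_deriv in simp)
qed

lemma snp_split:
  assumes "b \<in> Basis"
  shows "snp m k x = sinf (real (k b) * om b) (a \<bullet> b) (m b) (x \<bullet> b)
    * (\<Prod>i\<in>Basis - {b}. sinf (real (k i) * om i) (a \<bullet> i) (m i) (x \<bullet> i))"
  unfolding snp_def using assms by (subst prod.remove[of _ b]) auto

lemma partial_snp:
  assumes b: "b \<in> Basis"
  shows "partial_dir b (snp m k) = (\<lambda>x. (real (k b) * om b) * snp (m(b := Suc (m b))) k x)"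
proof (intro ext partial_dir_eqI)
  fix x
  let ?P = "\<Prod>i\<in>Basis - {b}. sinf (real (k i) * om i) (a \<bullet> i) (m i) (x \<bullet> i)"
  have P: "(\<Prod>i\<in>Basis - {b}. sinf (real (k i) * om i) (a \<bullet> i) (m i) ((x + t *\<^sub>R b) \<bullet> i)) = ?P" for t
    using b by (intro prod.cong) (auto simp: inner_add_left inner_Basis)
  have l: "snp m k (x + t *\<^sub>R b) = sinf (real (k b) * om b) (a \<bullet> b) (m b) (t + x \<bullet> b) * ?P" for t
    unfolding snp_split[OF b] P using b by (simp add: inner_add_left add.commute)
  have "snp (m(b := Suc (m b))) k x = sinf (real (k b) * om b) (a \<bullet> b) (Suc (m b)) (x \<bullet> b) * ?P"
    unfolding snp_split[OF b] by (auto intro!: arg_cong2[where f="(*)"] prod.cong)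
  moreover have "((\<lambda>t. sinf (real (k b) * om b) (a \<bullet> b) (m b) (t + x \<bullet> b) * ?P) has_real_derivative
      (real (k b) * om b * sinf (real (k b) * om b) (a \<bullet> b) (Suc (m b)) (x \<bullet> b)) * ?P) (at 0)"
    by (intro DERIV_cmult_right iffD1[OF DERIV_shift]) (simp add: sinf_deriv)
  ultimately show "((\<lambda>t. snp m k (x + t *\<^sub>R b)) has_real_derivative
      real (k b) * om b * snp (m(b := Suc (m b))) k x) (at 0)"
    unfolding l by (simp add: mult.assoc)
qed

lemma snp_half_turn:
  assumes b: "b \<in> Basis"
  shows "snp (m(b := Suc (Suc (m b)))) k x = - snp m k x"
proof -
  have "sinf \<kappa> \<alpha> (Suc (Suc n)) y = - sinf \<kappa> \<alpha> n y" for \<kappa> \<alpha> n y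
  proof -
    have "\<kappa> * (y - \<alpha>) + real (Suc (Suc n)) * (pi / 2) = (\<kappa> * (y - \<alpha>) + real n * (pi / 2)) + pi"
      by (simp add: field_simps)
    then show ?thesis unfolding sinf_def by (simp only: sin_periodic_pi)
  qed
  then show ?thesis unfolding snp_split[OF b] by (auto intro!: prod.cong)
qed

lemma inner_snp:
  assumes k: "\<And>b. b \<in> Basis \<Longrightarrow> k b \<ge> 1" and l: "\<And>b. b \<in> Basis \<Longrightarrow> l b \<ge> 1"
  shows "inner (cls (cbox a c) (snp m k)) (cls (cbox a c) (snp m l))
      = (if \<forall>b\<in>Basis. k b = l b then \<Prod>b\<in>Basis. (c \<bullet> b - a \<bullet> b) / 2 else 0)"
proof -
  define h where "h b y = sinf (real (k b) * om b) (a \<bullet> b) (m b) y * sinf (real (l b) * om b) (a \<bullet> b) (m b) y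
      * indicator {a \<bullet> b..c \<bullet> b} y" for b y
  have "inner (cls (cbox a c) (snp m k)) (cls (cbox a c) (snp m l))
      = integral\<^sup>L lebesgue (\<lambda>x. indicator (cbox a c) x *\<^sub>R (snp m k x * snp m l x))"
    by (subst inner_cls) (auto simp: Lsq_smooth_cbox smooth_snp ip_def integral_restrict_space)
  also have "(\<lambda>x. indicator (cbox a c) x *\<^sub>R (snp m k x * snp m l x)) = (\<lambda>x. \<Prod>b\<in>Basis. h b (x \<bullet> b))"
  proof
    fix x
    have "(indicator (cbox a c) x :: real) = (\<Prod>b\<in>Basis. indicator {a \<bullet> b..c \<bullet> b} (x \<bullet> b))"
      by (auto simp: mem_box indicator_def)
    then show "indicator (cbox a c) x *\<^sub>R (snp m k x * snp m l x) = (\<Prod>b\<in>Basis. h b (x \<bullet> b))"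
      unfolding snp_def h_def by (simp add: prod.distrib)
  qed
  also have "integral\<^sup>L lebesgue ... = integral\<^sup>L lborel (\<lambda>x. \<Prod>b\<in>Basis. h b (x \<bullet> b))"
  proof (rule integral_completion)
    have "h b \<in> borel_measurable borel" for b unfolding h_def sinf_def by measurable
    then show "(\<lambda>x. \<Prod>b\<in>Basis. h b (x \<bullet> b)) \<in> borel_measurable lborel" by measurable
  qed
  also have "... = (\<Prod>b\<in>Basis. integral\<^sup>L lborel (h b))"
  proof (rule integral_lborel_prod)
    fix b :: 'a
    show "integrable lborel (h b)" unfolding h_def sinf_def
      by (rule borel_integrable_atLeastAtMost) (intro continuous_intros)
  qed
  also have "... = (\<Prod>b\<in>Basis. if k b = l b then (c \<bullet> b - a \<bullet> b) / 2 else 0)"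
    unfolding h_def om_def by (intro prod.cong refl sinf_orthogonal ac k l)
  also have "... = (if \<forall>b\<in>Basis. k b = l b then \<Prod>b\<in>Basis. (c \<bullet> b - a \<bullet> b) / 2 else 0)"
    by auto
  finally show ?thesis .
qed

text \<open>Frequencies off \<open>Basis\<close> are normalised to 0, so that different modes differ
  on \<open>Basis\<close> and are therefore orthogonal.\<close>

definition modes :: "('a \<Rightarrow> nat) set" where
  "modes = {k. (\<forall>b\<in>Basis. k b \<ge> 1) \<and> (\<forall>b. b \<notin> Basis \<longrightarrow> k b = 0)}"

definition mass :: real where "mass = (\<Prod>b\<in>Basis. (c \<bullet> b - a \<bullet> b) / 2)"

lemma mass_pos: "mass > 0"
  unfolding mass_def using ac by (intro prod_pos) auto

text \<open>Parseval's identity for a fixed phase m. A field component and each of its derivatives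
  is a sum with a single phase pattern, so their norms can be compared coefficient by
  coefficient.\<close>

lemma norm_snp_sum:
  assumes F: "finite F" "F \<subseteq> modes"
  shows "(norm (cls (cbox a c) (\<lambda>x. \<Sum>k\<in>F. d k * snp m k x)))\<^sup>2 = mass * (\<Sum>k\<in>F. (d k)\<^sup>2)"
proof -
  have 1: "cls (cbox a c) (\<lambda>x. \<Sum>k\<in>F. d k * snp m k x) = (\<Sum>k\<in>F. d k *\<^sub>R cls (cbox a c) (snp m k))"
    using cls_sum[OF F(1), of "cbox a c" "\<lambda>k x. d k * snp m k x"]
    by (simp add: Lsq_scale Lsq_smooth_cbox smooth_snp cls_scale)
  have 2: "inner (cls (cbox a c) (snp m k)) (cls (cbox a c) (snp m l)) = (if k = l then mass else 0)"
    if "k \<in> F" "l \<in> F" for k l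
  proof -
    have "k \<in> modes" "l \<in> modes" using that F(2) by blast+
    then have "k b = l b" if "b \<notin> Basis" for b using that by (simp add: modes_def)
    then have "(\<forall>b\<in>Basis. k b = l b) \<longleftrightarrow> k = l" by (auto simp: fun_eq_iff)
    moreover have "\<And>b. b \<in> Basis \<Longrightarrow> k b \<ge> 1" "\<And>b. b \<in> Basis \<Longrightarrow> l b \<ge> 1"
      using that F(2) by (auto simp: modes_def)
    ultimately show ?thesis using inner_snp[of k l m] by (simp add: mass_def)
  qed
  have "(norm (\<Sum>k\<in>F. d k *\<^sub>R cls (cbox a c) (snp m k)))\<^sup>2
      = (\<Sum>k\<in>F. \<Sum>l\<in>F. d k * d l * inner (cls (cbox a c) (snp m k)) (cls (cbox a c) (snp m l)))"
    unfolding power2_norm_eq_inner inner_sum_left inner_sum_right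
    by (intro sum.cong refl) (simp add: mult_ac inner_commute)
  also have "... = (\<Sum>k\<in>F. \<Sum>l\<in>F. if k = l then d k * d k * mass else 0)"
    by (intro sum.cong refl) (auto simp: 2)
  also have "... = (\<Sum>k\<in>F. d k * d k * mass)" using F by simp
  finally show ?thesis unfolding 1 by (simp add: sum_distrib_left power2_eq_square mult_ac)
qed

section \<open>Sine sums, their multipliers and their density\<close>

inductive_set sines :: "('a \<Rightarrow> real) set" where
  snp: "snp (\<lambda>_. 0) k \<in> sines"
| add: "f \<in> sines \<Longrightarrow> g \<in> sines \<Longrightarrow> (\<lambda>x. f x + g x) \<in> sines"
| scale: "f \<in> sines \<Longrightarrow> (\<lambda>x. r * f x) \<in> sines"

lemma sines_mult_cos:
  assumes f: "f \<in> sines" and b: "b \<in> Basis"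
  shows "(\<lambda>x. f x * cos (om b * (x \<bullet> b - a \<bullet> b))) \<in> sines"
  using f
proof induction
  case (snp k)
  show ?case
  proof (cases "k b")
    case 0
    have "(\<lambda>x. snp (\<lambda>_. 0) k x * cos (om b * (x \<bullet> b - a \<bullet> b))) = snp (\<lambda>_. 0) k"
      by (rule ext) (simp add: snp_split[OF b] 0 sinf_def)
    then show ?thesis by (simp add: sines.snp)
  next
    case (Suc n)
    let ?k1 = "k(b := Suc (Suc n))" and ?k2 = "k(b := n)"
    have "snp (\<lambda>_. 0) k x * cos (om b * (x \<bullet> b - a \<bullet> b)) = (1/2) * (snp (\<lambda>_. 0) ?k1 x + snp (\<lambda>_. 0) ?k2 x)" for x
    proof -
      let ?t = "om b * (x \<bullet> b - a \<bullet> b)"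
      let ?P = "\<Prod>i\<in>Basis - {b}. sinf (real (k i) * om i) (a \<bullet> i) 0 (x \<bullet> i)"
      have P: "(\<Prod>i\<in>Basis - {b}. sinf (real ((k(b := j)) i) * om i) (a \<bullet> i) 0 (x \<bullet> i)) = ?P" for j
        by (intro prod.cong) auto
      have "sin (real (Suc n) * ?t) * cos ?t = (1/2) * (sin (real (Suc (Suc n)) * ?t) + sin (real n * ?t))"
        unfolding sin_times_cos by (simp add: algebra_simps)
      then have "sin (real (Suc n) * ?t) * cos ?t * ?P
          = (1/2) * (sin (real (Suc (Suc n)) * ?t) * ?P + sin (real n * ?t) * ?P)" by (simp add: algebra_simps)
      then show ?thesis unfolding snp_split[OF b] P unfolding sinf_def Suc by (simp add: mult_ac)
    qed
    then have eq: "(\<lambda>x. snp (\<lambda>_. 0) k x * cos (om b * (x \<bullet> b - a \<bullet> b)))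
        = (\<lambda>x. (1/2) * (snp (\<lambda>_. 0) ?k1 x + snp (\<lambda>_. 0) ?k2 x))" by (rule ext)
    show ?thesis unfolding eq by (rule sines.scale[OF sines.add[OF sines.snp sines.snp]])
  qed
next
  case (add f g)
  then show ?case using sines.add[OF add.IH] by (simp add: distrib_right)
next
  case (scale f r)
  then show ?case using sines.scale[OF scale.IH, of r] by (simp add: mult.assoc)
qed

lemma sines_smooth: "f \<in> sines \<Longrightarrow> smooth_fun f"
  by (induction rule: sines.induct) (simp_all only: smooth_snp smooth_add smooth_cmult)

text \<open>Stone--Weierstrass applies to the multipliers of the sine sums rather than to the sums themselves,
  which contain no constants; the functions \<open>cos (om b * (x \<bullet> b - a \<bullet> b))\<close> are multipliers and separate points.\<close>

definition multipliers :: "('a \<Rightarrow> real) set" where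
  "multipliers = {f. continuous_on UNIV f \<and> (\<forall>h\<in>sines. (\<lambda>x. h x * f x) \<in> sines)}"

lemma multipliersI:
  "continuous_on UNIV f \<Longrightarrow> (\<And>h. h \<in> sines \<Longrightarrow> (\<lambda>x. h x * f x) \<in> sines) \<Longrightarrow> f \<in> multipliers"
  unfolding multipliers_def by blast

lemma multipliersD:
  assumes "f \<in> multipliers"
  shows "continuous_on UNIV f" "h \<in> sines \<Longrightarrow> (\<lambda>x. h x * f x) \<in> sines"
  using assms unfolding multipliers_def by blast+

lemma function_ring_multipliers: "function_ring_on multipliers (cbox a c)"
proof
  show "compact (cbox a c)" by simp
  show "continuous_on (cbox a c) f" if "f \<in> multipliers" for f
    by (rule continuous_on_subset[OF multipliersD(1)[OF that] subset_UNIV])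
  show "(\<lambda>x. f x + g x) \<in> multipliers" if f: "f \<in> multipliers" and g: "g \<in> multipliers" for f g
  proof (rule multipliersI)
    show "continuous_on UNIV (\<lambda>x. f x + g x)"
      by (rule continuous_on_add[OF multipliersD(1)[OF f] multipliersD(1)[OF g]])
    fix h assume h: "h \<in> sines"
    have "(\<lambda>x. h x * f x) \<in> sines" "(\<lambda>x. h x * g x) \<in> sines"
      by (rule multipliersD(2)[OF f h], rule multipliersD(2)[OF g h])
    then have "(\<lambda>x. h x * f x + h x * g x) \<in> sines" by (rule sines.add)
    then show "(\<lambda>x. h x * (f x + g x)) \<in> sines" unfolding distrib_left .
  qed
  show "(\<lambda>x. f x * g x) \<in> multipliers" if f: "f \<in> multipliers" and g: "g \<in> multipliers" for f g
  proof (rule multipliersI)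
    show "continuous_on UNIV (\<lambda>x. f x * g x)"
      by (rule continuous_on_mult[OF multipliersD(1)[OF f] multipliersD(1)[OF g]])
    fix h assume h: "h \<in> sines"
    have "(\<lambda>x. h x * f x) \<in> sines" by (rule multipliersD(2)[OF f h])
    then have "(\<lambda>x. (h x * f x) * g x) \<in> sines" by (rule multipliersD(2)[OF g])
    then show "(\<lambda>x. h x * (f x * g x)) \<in> sines" unfolding mult.assoc .
  qed
  show "(\<lambda>_. r) \<in> multipliers" for r
  proof (rule multipliersI)
    fix h assume "h \<in> sines"
    then have "(\<lambda>x. r * h x) \<in> sines" by (rule sines.scale)
    moreover have "(\<lambda>x. h x * r) = (\<lambda>x. r * h x)" by (rule ext) (rule mult.commute)
    ultimately show "(\<lambda>x. h x * r) \<in> sines" by (simp only:)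
  qed (rule continuous_on_const)
  show "\<exists>f\<in>multipliers. f x \<noteq> f y" if x: "x \<in> cbox a c" and y: "y \<in> cbox a c" and "x \<noteq> y" for x y
  proof -
    obtain b where b: "b \<in> Basis" "x \<bullet> b \<noteq> y \<bullet> b" using \<open>x \<noteq> y\<close> euclidean_eqI by blast
    let ?f = "\<lambda>x. cos (om b * (x \<bullet> b - a \<bullet> b))"
    \<comment> \<open>On the box the argument stays in [0, pi], where the cosine is
      injective.\<close>
    have t: "0 \<le> om b * (z \<bullet> b - a \<bullet> b)" "om b * (z \<bullet> b - a \<bullet> b) \<le> pi" if "z \<in> cbox a c" for z
    proof -
      have z: "a \<bullet> b \<le> z \<bullet> b" "z \<bullet> b \<le> c \<bullet> b" using that b by (auto simp: mem_box)
      then show "0 \<le> om b * (z \<bullet> b - a \<bullet> b)" using om_pos[OF b(1)] by simp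
      have "om b * (z \<bullet> b - a \<bullet> b) \<le> om b * (c \<bullet> b - a \<bullet> b)" using om_pos[OF b(1)] z by simp
      also have "... = pi" using ac[OF b(1)] by (simp add: om_def)
      finally show "om b * (z \<bullet> b - a \<bullet> b) \<le> pi" .
    qed
    have ne: "?f x \<noteq> ?f y"
    proof
      assume "?f x = ?f y"
      then have "om b * (x \<bullet> b - a \<bullet> b) = om b * (y \<bullet> b - a \<bullet> b)"
        using cos_inj_pi[OF t[OF x] t[OF y]] by blast
      then show False using b om_pos[OF b(1)] by simp
    qed
    have "continuous_on UNIV ?f" by (intro continuous_intros)
    then have "?f \<in> multipliers" by (rule multipliersI) (rule sines_mult_cos[OF _ b(1)])
    then show ?thesis by (rule bexI[where x="?f", rotated]) (rule ne)
  qed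
qed

text \<open>With s the lowest mode, \<open>g x * s x\<close> is orthogonal to all multipliers,
  because s times a multiplier is again a sine sum. So it vanishes almost everywhere, and s is
  positive inside the box.\<close>

lemma sines_complete:
  assumes G: "restr (cbox a c) G = G"
    and orth: "\<And>k. k \<in> modes \<Longrightarrow> inner G (cls (cbox a c) (snp (\<lambda>_. 0) k)) = 0"
  shows "G = 0"
proof -
  let ?D = "cbox a c"
  have Dm: "?D \<in> sets lebesgue" by auto
  define g where "g = rp G"
  have Gg: "G = cls ?D g" using G by (simp add: restr_def g_def)
  have gL: "Lsq ?D g" using Lsq_rp[OF Dm] by (simp add: g_def)
  have o: "inner G (cls ?D h) = 0" if "h \<in> sines" for h
    using that
  proof induction
    case (snp k)
    show ?case
    proof (cases "\<forall>b\<in>Basis. k b \<ge> 1")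
      case True
      define k' where "k' b = (if b \<in> Basis then k b else 0)" for b
      have "snp (\<lambda>_. 0) k = snp (\<lambda>_. 0) k'" unfolding snp_def[abs_def] by (auto simp: k'_def)
      moreover have "k' \<in> modes" using True by (auto simp: modes_def k'_def)
      ultimately show ?thesis using orth by simp
    next
      case False
      then obtain b where b: "b \<in> Basis" "k b = 0" by (metis less_one not_le)
      have "snp (\<lambda>_. 0) k = (\<lambda>x. 0)" by (rule ext) (simp add: snp_split[OF b(1)] b(2) sinf_def)
      then show ?thesis by (simp add: cls_zero)
    qed
  next
    case (add f h)
    then show ?case by (simp add: cls_add Lsq_smooth_cbox sines_smooth inner_add_right)
  next
    case (scale f r)
    then show ?case by (simp add: cls_scale Lsq_smooth_cbox sines_smooth)
  qed
  define s where "s = snp (\<lambda>_. 0) (\<lambda>_. 1)"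
  have s: "s \<in> sines" "smooth_fun s" unfolding s_def by (auto intro: sines.snp smooth_snp)
  have "AE x in lebesgue_on ?D. g x * s x = 0"
  proof (rule AE_zero_if_orthogonal_ring[OF function_ring_multipliers])
    show "integrable (lebesgue_on ?D) (\<lambda>x. g x * s x)"
      by (intro Lsq_mult_integrable Dm gL Lsq_smooth_cbox s)
    fix f assume "f \<in> multipliers"
    then have f: "(\<lambda>x. s x * f x) \<in> sines" by (rule multipliersD(2)[OF _ s(1)])
    have "integral\<^sup>L (lebesgue_on ?D) (\<lambda>x. g x * (s x * f x)) = inner G (cls ?D (\<lambda>x. s x * f x))"
      unfolding Gg using inner_cls[OF Dm gL Lsq_smooth_cbox[OF sines_smooth[OF f]]] by (simp add: ip_def)
    then show "integral\<^sup>L (lebesgue_on ?D) (\<lambda>x. g x * s x * f x) = 0"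
      using o[OF f] by (simp add: mult.assoc)
  qed
  then have 1: "AE x in lebesgue. x \<in> ?D \<longrightarrow> g x * s x = 0"
    by (subst (asm) AE_restrict_space_iff) auto
  have "?D - box a c \<in> null_sets lebesgue"
    using negligible_frontier_interval negligible_iff_null_sets by blast
  then have 2: "AE x in lebesgue. x \<notin> ?D - box a c" by (rule AE_not_in)
  have pos: "s x > 0" if "x \<in> box a c" for x
    unfolding s_def snp_def sinf_def
  proof (rule prod_pos)
    fix b :: 'a assume b: "b \<in> Basis"
    then have x: "a \<bullet> b < x \<bullet> b" "x \<bullet> b < c \<bullet> b" using that by (auto simp: mem_box)
    have "om b * (x \<bullet> b - a \<bullet> b) < om b * (c \<bullet> b - a \<bullet> b)" using om_pos[OF b] x by simp
    also have "... = pi" using ac[OF b] by (simp add: om_def)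
    finally show "0 < sin (real 1 * om b * (x \<bullet> b - a \<bullet> b) + real 0 * (pi / 2))"
      using om_pos[OF b] x by (simp add: sin_gt_zero)
  qed
  from 1 2 have "AE x in lebesgue. x \<in> ?D \<longrightarrow> g x = 0"
    by eventually_elim (use pos in force)
  then have "AE x in lebesgue_on ?D. g x = 0" by (subst AE_restrict_space_iff) auto
  then have "cls ?D g = cls ?D (\<lambda>x. 0)" by (subst cls_eq_iff) (auto intro: gL Lsq_zero)
  then show ?thesis using Gg by (simp add: cls_zero)
qed

text \<open>By completeness the orthogonal complement of the closed span is zero. The span is
  unfolded to finitely many explicit coefficients because the Poisson equation is solved mode by
  mode.\<close>

lemma sines_dense:
  assumes Q: "restr (cbox a c) Q = Q" and e: "e > 0"
  shows "\<exists>F d. finite F \<and> F \<subseteq> modes \<and> norm (cls (cbox a c) (\<lambda>x. \<Sum>k\<in>F. d k * snp (\<lambda>_. 0) k x) - Q) < e"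
proof -
  let ?D = "cbox a c"
  let ?T = "\<lambda>k. cls ?D (snp (\<lambda>_. 0) k)"
  define S where "S = closure (span (?T ` modes))"
  have S: "subspace S" "closed S" unfolding S_def by (rule subspace_closure[OF subspace_span], rule closed_closure)
  have Dm: "?D \<in> sets lebesgue" by auto
  note W = restr_fixed_subspace[OF Dm]
  have "?T ` modes \<subseteq> {F. restr ?D F = F}" by (auto simp: restr_idem Lsq_smooth_cbox smooth_snp)
  then have SW: "S \<subseteq> {F. restr ?D F = F}" unfolding S_def
    by (rule closure_minimal[OF span_minimal[OF _ W(1)] W(2)])
  have "Q \<in> S"
  proof (rule ccontr)
    assume "Q \<notin> S"
    then obtain w where w: "restr ?D w = w" "w \<noteq> 0" "\<And>y. y \<in> S \<Longrightarrow> inner w y = 0"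
      using orthogonal_vector_exists[OF S W(1) SW, of Q] Q by blast
    have "?T k \<in> S" if "k \<in> modes" for k
      unfolding S_def by (rule subsetD[OF closure_subset span_base[OF imageI[OF that]]])
    then have "w = 0" using w(3) by (intro sines_complete[OF w(1)]) auto
    with w(2) show False by simp
  qed
  then have "\<exists>y\<in>span (?T ` modes). dist y Q < e"
    using e by (simp add: S_def closure_approachable)
  then obtain y where y: "y \<in> span (?T ` modes)" "dist y Q < e" ..
  from y(1) have "\<exists>t r. y = (\<Sum>v\<in>t. r v *\<^sub>R v) \<and> finite t \<and> t \<subseteq> ?T ` modes"
    by (simp add: span_explicit)
  then obtain t r where t: "finite t" "t \<subseteq> ?T ` modes" "y = (\<Sum>v\<in>t. r v *\<^sub>R v)" by (elim exE conjE)
  from t(2) have "\<exists>F\<subseteq>modes. inj_on ?T F \<and> t = ?T ` F" by (simp only: subset_image_inj)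
  then obtain F where F: "F \<subseteq> modes" "inj_on ?T F" "t = ?T ` F" by (elim exE conjE)
  then have fF: "finite F" using t(1) finite_imageD by blast
  have "cls ?D (\<lambda>x. \<Sum>k\<in>F. r (?T k) * snp (\<lambda>_. 0) k x) = (\<Sum>k\<in>F. r (?T k) *\<^sub>R ?T k)"
    using cls_sum[OF fF, of ?D "\<lambda>k x. r (?T k) * snp (\<lambda>_. 0) k x"]
    by (simp add: Lsq_scale Lsq_smooth_cbox smooth_snp cls_scale)
  also have "... = y" unfolding t(3) F(3) using F(2) by (simp add: sum.reindex)
  finally show ?thesis using y(2) fF F(1) by (intro exI[of _ F] exI[of _ "\<lambda>k. r (?T k)"]) (auto simp: dist_norm)
qed

text \<open>V is the gradient of the Poisson solution, whose coefficients are
  \<open>- d k / \<Lambda> k\<close> with the eigenvalue \<open>\<Lambda> k\<close>. The bounds come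
  from \<open>w k b * w k b' \<le> \<Lambda> k\<close> for the derivatives of V and from
  \<open>w k b / \<Lambda> k \<le> 1 / om b\<close> for V itself.\<close>

lemma sine_gradient_field:
  fixes d :: "('a \<Rightarrow> nat) \<Rightarrow> real"
  assumes F: "finite F" "F \<subseteq> modes"
  defines "q \<equiv> \<lambda>x. \<Sum>k\<in>F. d k * snp (\<lambda>_. 0) k x"
  shows "\<exists>V. (\<forall>b\<in>Basis. smooth_fun (V b)) \<and> (\<lambda>x. \<Sum>b\<in>Basis. partial_dir b (V b) x) = q
    \<and> (\<forall>b\<in>Basis. norm (cls (cbox a c) (V b)) \<le> norm (cls (cbox a c) q) / om b)
    \<and> (\<forall>b\<in>Basis. \<forall>b'\<in>Basis. norm (cls (cbox a c) (partial_dir b' (V b))) \<le> norm (cls (cbox a c) q))"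
proof -
  let ?D = "cbox a c"
  define w where "w k b = real (k b) * om b" for k :: "'a \<Rightarrow> nat" and b
  define \<Lambda> where "\<Lambda> k = (\<Sum>b\<in>Basis. (w k b)\<^sup>2)" for k
  have wpos: "om b \<le> w k b" if "k \<in> F" "b \<in> Basis" for k b
    using that F(2) om_pos[OF that(2)] by (auto simp: w_def modes_def)
  have w\<Lambda>: "(w k b)\<^sup>2 \<le> \<Lambda> k" if "b \<in> Basis" for k b
    unfolding \<Lambda>_def using that by (intro member_le_sum) auto
  have \<Lambda>pos: "\<Lambda> k > 0" if k: "k \<in> F" for k
  proof -
    obtain b :: 'a where b: "b \<in> Basis" using nonempty_Basis by blast
    have "0 < (w k b)\<^sup>2" using wpos[OF k b] om_pos[OF b] by simp
    then show ?thesis using w\<Lambda>[OF b, of k] by (rule less_le_trans)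
  qed
  \<comment> \<open>The phase pattern of a first derivative in direction b. A second derivative in
    the same direction completes a half turn, and its sign cancels the minus in the
    coefficients.\<close>
  define one where "one b = (\<lambda>_. 0::nat)(b := Suc 0)" for b :: 'a
  define V where "V b x = (\<Sum>k\<in>F. (- d k / \<Lambda> k * w k b) * snp (one b) k x)" for b x
  have sV: "smooth_fun (V b)" for b unfolding V_def[abs_def] by (intro smooth_sum smooth_cmult smooth_snp)
  have pV: "partial_dir b' (V b) = (\<lambda>x. \<Sum>k\<in>F. (- d k / \<Lambda> k * w k b * w k b') * snp ((one b)(b' := Suc (one b b'))) k x)"
    if "b' \<in> Basis" for b b'
  proof -
    have "partial_dir b' (V b) = (\<lambda>x. \<Sum>k\<in>F. partial_dir b' (\<lambda>x. (- d k / \<Lambda> k * w k b) * snp (one b) k x) x)"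
      unfolding V_def[abs_def] by (rule partial_sum[OF smooth_cmult[OF smooth_snp] that])
    also have "... = (\<lambda>x. \<Sum>k\<in>F. (- d k / \<Lambda> k * w k b) * (w k b' * snp ((one b)(b' := Suc (one b b'))) k x))"
      by (simp only: partial_cmult[OF smooth_snp that] partial_snp[OF that] w_def)
    finally show ?thesis by (simp only: mult.assoc)
  qed
  have nq: "(norm (cls ?D q))\<^sup>2 = mass * (\<Sum>k\<in>F. (d k)\<^sup>2)"
    unfolding q_def by (rule norm_snp_sum[OF F])
  have cmp: "norm (cls ?D (\<lambda>x. \<Sum>k\<in>F. f k * snp m k x)) \<le> norm (cls ?D q) * r"
    if f: "\<And>k. k \<in> F \<Longrightarrow> \<bar>f k\<bar> \<le> \<bar>d k\<bar> * r" and r: "r \<ge> 0" for f m r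
  proof (rule power2_le_imp_le)
    have "(norm (cls ?D (\<lambda>x. \<Sum>k\<in>F. f k * snp m k x)))\<^sup>2 = mass * (\<Sum>k\<in>F. (f k)\<^sup>2)"
      by (rule norm_snp_sum[OF F])
    also have "... \<le> mass * (\<Sum>k\<in>F. (d k)\<^sup>2 * r\<^sup>2)"
    proof (intro mult_left_mono sum_mono)
      fix k assume "k \<in> F"
      then have "\<bar>f k\<bar>\<^sup>2 \<le> (\<bar>d k\<bar> * r)\<^sup>2" using f by (intro power_mono) auto
      then show "(f k)\<^sup>2 \<le> (d k)\<^sup>2 * r\<^sup>2" by (simp add: power_mult_distrib)
    qed (use mass_pos in simp)
    also have "... = (norm (cls ?D q) * r)\<^sup>2"
      by (simp add: power_mult_distrib nq flip: sum_distrib_right)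
    finally show "(norm (cls ?D (\<lambda>x. \<Sum>k\<in>F. f k * snp m k x)))\<^sup>2 \<le> (norm (cls ?D q) * r)\<^sup>2" .
  qed (use r in simp)
  have div: "(\<Sum>b\<in>Basis. partial_dir b (V b) x) = q x" for x
  proof -
    have "partial_dir b (V b) x = (\<Sum>k\<in>F. (d k / \<Lambda> k * (w k b)\<^sup>2) * snp (\<lambda>_. 0) k x)" if b: "b \<in> Basis" for b
    proof -
      have "(one b)(b := Suc (one b b)) = (\<lambda>_. 0)(b := Suc (Suc ((\<lambda>_. 0) b)))" by (auto simp: one_def)
      then have "snp ((one b)(b := Suc (one b b))) k x = - snp (\<lambda>_. 0) k x" for k
        using snp_half_turn[OF b, of "\<lambda>_. 0" k x] by simp
      then show ?thesis unfolding pV[OF b] by (intro sum.cong refl) (simp add: power2_eq_square)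
    qed
    then have "(\<Sum>b\<in>Basis. partial_dir b (V b) x) = (\<Sum>b\<in>Basis. \<Sum>k\<in>F. (d k / \<Lambda> k * (w k b)\<^sup>2) * snp (\<lambda>_. 0) k x)"
      by (intro sum.cong) auto
    also have "... = (\<Sum>k\<in>F. \<Sum>b\<in>Basis. (d k / \<Lambda> k * (w k b)\<^sup>2) * snp (\<lambda>_. 0) k x)" by (rule sum.swap)
    also have "... = (\<Sum>k\<in>F. (d k / \<Lambda> k * \<Lambda> k) * snp (\<lambda>_. 0) k x)"
      unfolding \<Lambda>_def by (simp add: sum_distrib_left sum_distrib_right)
    also have "... = q x" unfolding q_def
    proof (rule sum.cong)
      fix k assume "k \<in> F"
      then show "d k / \<Lambda> k * \<Lambda> k * snp (\<lambda>_. 0) k x = d k * snp (\<lambda>_. 0) k x" using \<Lambda>pos[of k] by simp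
    qed simp
    finally show ?thesis .
  qed
  have "norm (cls ?D (V b)) \<le> norm (cls ?D q) * (1 / om b)" if b: "b \<in> Basis" for b
    unfolding V_def
  proof (rule cmp)
    fix k assume k: "k \<in> F"
    have wp: "w k b > 0" using wpos[OF k b] om_pos[OF b] by linarith
    have "w k b / \<Lambda> k \<le> w k b / (w k b)\<^sup>2" using w\<Lambda>[OF b, of k] wp mult_pos_pos[OF \<Lambda>pos[OF k], of "(w k b)\<^sup>2"]
      by (intro divide_left_mono) auto
    also have "... = 1 / w k b" using wp by (simp add: power2_eq_square)
    also have "... \<le> 1 / om b" using wpos[OF k b] om_pos[OF b] by (intro divide_left_mono) (auto intro: mult_pos_pos wp)
    finally have "\<bar>d k\<bar> * (w k b / \<Lambda> k) \<le> \<bar>d k\<bar> * (1 / om b)" by (intro mult_left_mono) auto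
    then show "\<bar>- d k / \<Lambda> k * w k b\<bar> \<le> \<bar>d k\<bar> * (1 / om b)"
      using \<Lambda>pos[OF k] wp by (simp add: abs_mult)
  qed (use om_pos[OF b] in simp)
  moreover have "norm (cls ?D (partial_dir b' (V b))) \<le> norm (cls ?D q) * 1" if b: "b \<in> Basis" "b' \<in> Basis" for b b'
    unfolding pV[OF b(2)]
  proof (rule cmp)
    fix k assume k: "k \<in> F"
    have wp: "w k b > 0" "w k b' > 0" using wpos[OF k] om_pos b by (meson less_le_trans)+
    have "0 \<le> (w k b - w k b')\<^sup>2" by simp
    then have "2 * (w k b * w k b') \<le> (w k b)\<^sup>2 + (w k b')\<^sup>2" by (simp add: power2_eq_square algebra_simps)
    also have "... \<le> 2 * \<Lambda> k" using w\<Lambda>[OF b(1), of k] w\<Lambda>[OF b(2), of k] by simp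
    finally have "w k b * w k b' / \<Lambda> k \<le> 1" using \<Lambda>pos[OF k] by simp
    then have "\<bar>d k\<bar> * (w k b * w k b' / \<Lambda> k) \<le> \<bar>d k\<bar> * 1" by (intro mult_left_mono) auto
    then show "\<bar>- d k / \<Lambda> k * w k b * w k b'\<bar> \<le> \<bar>d k\<bar> * 1"
      using \<Lambda>pos[OF k] wp by (simp add: abs_mult mult.assoc)
  qed simp
  ultimately show ?thesis using sV div by (intro exI[of _ V]) auto
qed

end

section \<open>An approximate right inverse of the divergence with zero boundary values\<close>

lemma abs_poly_bounded:
  fixes p :: "real poly"
  assumes "bounded (D :: 'a::euclidean_space set)"
  shows "\<exists>M\<ge>0. \<forall>x\<in>D. \<bar>poly p (x \<bullet> b)\<bar> \<le> M"
proof -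
  obtain c where c: "D \<subseteq> cbox (-c) c" using bounded_subset_cbox_symmetric assms by metis
  have "compact ((\<lambda>x. poly p (x \<bullet> b)) ` cbox (-c) c)"
    by (intro compact_continuous_image continuous_intros compact_cbox)
  then obtain M where M: "\<And>x. x \<in> cbox (-c) c \<Longrightarrow> \<bar>poly p (x \<bullet> b)\<bar> \<le> M"
    using compact_imp_bounded bounded_iff by (metis imageI real_norm_def)
  then have "\<forall>x\<in>D. \<bar>poly p (x \<bullet> b)\<bar> \<le> max 0 M" using c by fastforce
  then show ?thesis by (intro exI[of _ "max 0 M"]) simp
qed

lemma Lsq_mult_bounded:
  assumes D: "D \<in> sets lebesgue" and g: "Lsq D g" and k: "continuous_on UNIV k"
    and M: "\<And>x. x \<in> D \<Longrightarrow> \<bar>k x\<bar> \<le> M" "M \<ge> 0"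
  shows "Lsq D (\<lambda>x. k x * g x) \<and> norm (cls D (\<lambda>x. k x * g x)) \<le> M * norm (cls D g)"
proof -
  have km: "k \<in> borel_measurable (lebesgue_on D)"
    by (rule continuous_imp_measurable_on_sets_lebesgue[OF continuous_on_subset[OF k] D]) simp
  have le: "(k x * g x)\<^sup>2 \<le> M\<^sup>2 * (g x)\<^sup>2" if "x \<in> D" for x
    unfolding power_mult_distrib using M(1)[OF that] M(2)
    by (intro mult_right_mono) (auto simp: abs_le_square_iff[symmetric])
  have gi: "integrable (lebesgue_on D) (\<lambda>x. M\<^sup>2 * (g x)\<^sup>2)" using g by (simp add: Lsq_def)
  have L: "Lsq D (\<lambda>x. k x * g x)" unfolding Lsq_def
  proof
    show m: "(\<lambda>x. k x * g x) \<in> borel_measurable (lebesgue_on D)"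
      using borel_measurable_times[OF km, of g] g by (simp add: Lsq_def)
    show "integrable (lebesgue_on D) (\<lambda>x. (k x * g x)\<^sup>2)"
      by (rule Bochner_Integration.integrable_bound[OF gi])
        (use m le D in \<open>auto intro!: AE_I2\<close>)
  qed
  have "(norm (cls D (\<lambda>x. k x * g x)))\<^sup>2 = integral\<^sup>L (lebesgue_on D) (\<lambda>x. (k x * g x)\<^sup>2)"
    unfolding power2_norm_eq_inner by (simp add: inner_cls D L ip_def power2_eq_square)
  also have "... \<le> integral\<^sup>L (lebesgue_on D) (\<lambda>x. M\<^sup>2 * (g x)\<^sup>2)"
    by (rule integral_mono) (use L gi le D in \<open>auto simp: Lsq_def\<close>)
  also have "... = M\<^sup>2 * (norm (cls D g))\<^sup>2"
    unfolding power2_norm_eq_inner by (simp add: inner_cls D g ip_def power2_eq_square)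
  finally have "(norm (cls D (\<lambda>x. k x * g x)))\<^sup>2 \<le> (M * norm (cls D g))\<^sup>2" by (simp add: power_mult_distrib)
  then have "norm (cls D (\<lambda>x. k x * g x)) \<le> M * norm (cls D g)"
    by (rule power2_le_imp_le) (use M in simp)
  with L show ?thesis by simp
qed

lemma rc_affine:
  assumes "b \<in> Basis"
  shows "rc b m d = (\<lambda>x. d *\<^sub>R b + (\<Sum>j\<in>Basis. ((if j = b then m else 1) * (x \<bullet> j)) *\<^sub>R j))"
proof (rule ext, rule euclidean_eqI)
  fix x i :: 'a assume i: "i \<in> Basis"
  have "(d *\<^sub>R b + (\<Sum>j\<in>Basis. ((if j = b then m else 1) * (x \<bullet> j)) *\<^sub>R j)) \<bullet> i
      = d * (b \<bullet> i) + (if i = b then m else 1) * (x \<bullet> i)"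
    using i by (simp add: inner_add_left)
  then show "rc b m d x \<bullet> i = (d *\<^sub>R b + (\<Sum>j\<in>Basis. ((if j = b then m else 1) * (x \<bullet> j)) *\<^sub>R j)) \<bullet> i"
    using rc_inner[OF assms i, of m d x] i assms by (auto simp: inner_Basis)
qed

text \<open>The change of variables has Jacobian \<open>\<bar>m\<bar>\<close>, so a dilation with a
  factor of modulus at least 1 does not enlarge the L2 norm.\<close>

lemma Lsq_rc:
  assumes b: "b \<in> Basis" and m: "\<bar>m\<bar> \<ge> 1" and D: "D \<in> sets lebesgue" "D' \<in> sets lebesgue"
    and maps: "\<And>x. x \<in> D' \<Longrightarrow> rc b m d x \<in> D" and f: "Lsq D f"
  shows "Lsq D' (\<lambda>x. f (rc b m d x)) \<and> norm (cls D' (\<lambda>x. f (rc b m d x))) \<le> norm (cls D f)"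
proof -
  let ?T = "rc b m d"
  define F where "F x = (if x \<in> D then f x else 0)" for x
  define c where "c j = (if j = b then m else 1)" for j
  have cn: "\<And>j. j \<in> Basis \<Longrightarrow> c j \<noteq> 0" using m by (auto simp: c_def)
  have T: "?T = (\<lambda>x. d *\<^sub>R b + (\<Sum>j\<in>Basis. (c j * (x \<bullet> j)) *\<^sub>R j))" unfolding c_def by (rule rc_affine[OF b])
  have Tm: "?T \<in> lebesgue \<rightarrow>\<^sub>M lebesgue" unfolding T by (rule lebesgue_affine_measurable[OF cn])
  have "(\<Prod>j\<in>Basis. \<bar>c j\<bar>) = \<bar>m\<bar>" using b by (subst prod.remove[OF finite_Basis b]) (auto simp: c_def)
  then have leb: "(lebesgue :: 'a measure) = density (distr lebesgue lebesgue ?T) (\<lambda>_. ennreal \<bar>m\<bar>)"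
    using lebesgue_affine_euclidean[where c=c and t="d *\<^sub>R b"] cn unfolding T by simp
  have Fs: "sqint F" using f D unfolding F_def by (simp add: Lsq_iff_sqint)
  have Fm[measurable]: "F \<in> borel_measurable lebesgue" using Fs by (simp add: sqint_def)
  have FTm: "(\<lambda>x. F (?T x)) \<in> borel_measurable lebesgue" by (rule measurable_compose[OF Tm Fm])
  have eq: "(\<integral>\<^sup>+x. ennreal ((F x)\<^sup>2) \<partial>lebesgue) = ennreal \<bar>m\<bar> * (\<integral>\<^sup>+x. ennreal ((F (?T x))\<^sup>2) \<partial>lebesgue)"
  proof -
    have "(\<integral>\<^sup>+x. ennreal ((F x)\<^sup>2) \<partial>lebesgue)
        = (\<integral>\<^sup>+x. ennreal ((F x)\<^sup>2) \<partial>density (distr lebesgue lebesgue ?T) (\<lambda>_. ennreal \<bar>m\<bar>))"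
      using leb by simp
    also have "... = (\<integral>\<^sup>+x. ennreal \<bar>m\<bar> * ennreal ((F x)\<^sup>2) \<partial>distr lebesgue lebesgue ?T)"
      by (rule nn_integral_density) auto
    also have "... = (\<integral>\<^sup>+x. ennreal \<bar>m\<bar> * ennreal ((F (?T x))\<^sup>2) \<partial>lebesgue)"
      by (rule nn_integral_distr[OF Tm]) auto
    also have "... = ennreal \<bar>m\<bar> * (\<integral>\<^sup>+x. ennreal ((F (?T x))\<^sup>2) \<partial>lebesgue)"
      by (rule nn_integral_cmult) (use FTm in auto)
    finally show ?thesis .
  qed
  have "(\<integral>\<^sup>+x. ennreal ((F (?T x))\<^sup>2) \<partial>lebesgue) \<le> ennreal \<bar>m\<bar> * (\<integral>\<^sup>+x. ennreal ((F (?T x))\<^sup>2) \<partial>lebesgue)"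
    using mult_right_mono[of 1 "ennreal \<bar>m\<bar>" "\<integral>\<^sup>+x. ennreal ((F (?T x))\<^sup>2) \<partial>lebesgue"] m by simp
  also have "... = ennreal ((norm (abs_l2 F))\<^sup>2)" unfolding eq[symmetric] norm_abs_l2_ennreal[OF Fs] ..
  finally have le: "(\<integral>\<^sup>+x. ennreal ((F (?T x))\<^sup>2) \<partial>lebesgue) \<le> ennreal ((norm (abs_l2 F))\<^sup>2)" .
  then have FTs: "sqint (\<lambda>x. F (?T x))"
    unfolding sqint_def integrable_iff_bounded using FTm le_less_trans[OF le, of \<infinity>] by simp
  have eqD: "(\<lambda>x. if x \<in> D' then f (?T x) else 0) = (\<lambda>x. if x \<in> D' then F (?T x) else 0)"
    using maps by (auto simp: F_def)
  have L: "Lsq D' (\<lambda>x. f (?T x))" unfolding Lsq_iff_sqint[OF D(2)] eqD by (rule sqint_indicator[OF D(2) FTs])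
  have "cls D' (\<lambda>x. f (?T x)) = restr D' (abs_l2 (\<lambda>x. F (?T x)))"
    unfolding restr_abs_l2[OF D(2) FTs] unfolding cls_def eqD ..
  then have "norm (cls D' (\<lambda>x. f (?T x))) \<le> norm (abs_l2 (\<lambda>x. F (?T x)))"
    using norm_restr_le[OF D(2)] by simp
  also have "... \<le> norm (abs_l2 F)"
  proof (rule power2_le_imp_le)
    show "(norm (abs_l2 (\<lambda>x. F (?T x))))\<^sup>2 \<le> (norm (abs_l2 F))\<^sup>2"
      using le unfolding norm_abs_l2_ennreal[OF FTs, symmetric] by (simp add: ennreal_le_iff)
  qed simp
  also have "abs_l2 F = cls D f" by (simp add: cls_def F_def[abs_def])
  finally show ?thesis using L by simp
qed

subsection \<open>A first-order seminorm on smooth functions\<close>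

text \<open>A sum of norms in place of the root of a sum of squares: the Sobolev norm up to a factor
  depending on the dimension, see \<open>norm_jet_le_hn\<close> and \<open>hn_le_norm_jet\<close>,
  but easier to estimate term by term.\<close>

definition hn :: "'a::euclidean_space set \<Rightarrow> ('a \<Rightarrow> real) \<Rightarrow> real" where
  "hn D f = norm (cls D f) + (\<Sum>b\<in>Basis. norm (cls D (partial_dir b f)))"

lemma hn_nonneg: "0 \<le> hn D f"
  unfolding hn_def by (intro add_nonneg_nonneg sum_nonneg) auto

lemma norm_cls_le_hn: "norm (cls D f) \<le> hn D f"
  unfolding hn_def by (simp add: sum_nonneg)

lemma norm_cls_partial_le_hn: "b \<in> Basis \<Longrightarrow> norm (cls D (partial_dir b f)) \<le> hn D f"
  unfolding hn_def using member_le_sum[of b Basis "\<lambda>b. norm (cls D (partial_dir b f))"]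
  by (simp add: add_increasing)

lemma Lsq_smooth: "smooth_fun f \<Longrightarrow> bounded D \<Longrightarrow> D \<in> sets lebesgue \<Longrightarrow> Lsq D f"
  by (intro Lsq_continuous smooth_continuous)

lemma hn_add:
  assumes "smooth_fun f" "smooth_fun g" "bounded D" "D \<in> sets lebesgue"
  shows "hn D (\<lambda>x. f x + g x) \<le> hn D f + hn D g"
proof -
  have "norm (cls D (\<lambda>x. f x + g x)) \<le> norm (cls D f) + norm (cls D g)"
    by (simp add: cls_add Lsq_smooth assms norm_triangle_ineq)
  moreover have "norm (cls D (partial_dir b (\<lambda>x. f x + g x))) \<le> norm (cls D (partial_dir b f)) + norm (cls D (partial_dir b g))"
    if "b \<in> Basis" for b
    using that assms by (simp add: partial_add cls_add Lsq_smooth smooth_partial norm_triangle_ineq)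
  then have "(\<Sum>b\<in>Basis. norm (cls D (partial_dir b (\<lambda>x. f x + g x))))
      \<le> (\<Sum>b\<in>Basis. norm (cls D (partial_dir b f)) + norm (cls D (partial_dir b g)))"
    by (rule sum_mono)
  ultimately show ?thesis unfolding hn_def by (simp add: sum.distrib)
qed

lemma hn_zero: "hn D (\<lambda>x. 0) = 0"
proof -
  have "partial_dir b (\<lambda>x. 0) = (\<lambda>x. 0)" for b :: 'a by (rule ext) (rule partial_const)
  then show ?thesis by (simp add: hn_def cls_zero)
qed

subsection \<open>Superpositions of coordinate reflections\<close>

text \<open>A summand is kept as data, a coefficient polynomial with the slope and shift of the
  affine map, so that the product and chain rules become operations on lists and identities between
  weights can be computed.\<close>

definition bop :: "'a::euclidean_space \<Rightarrow> real poly \<times> real \<times> real \<Rightarrow> ('a \<Rightarrow> real) \<Rightarrow> 'a \<Rightarrow> real" where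
  "bop b s f x = (case s of (p, m, d) \<Rightarrow> poly p (x \<bullet> b) * f (rc b m d x))"

definition Op :: "'a::euclidean_space \<Rightarrow> (real poly \<times> real \<times> real) list \<Rightarrow> ('a \<Rightarrow> real) \<Rightarrow> 'a \<Rightarrow> real" where
  "Op b L f x = (\<Sum>s\<leftarrow>L. bop b s f x)"

lemma Op_Nil: "Op b [] f = (\<lambda>x. 0)" and Op_Cons: "Op b (s # L) f = (\<lambda>x. bop b s f x + Op b L f x)"
  by (auto simp: Op_def)

lemma Op_add: "Op b L (\<lambda>x. f x + g x) x = Op b L f x + Op b L g x"
  by (induction L) (auto simp: Op_def bop_def algebra_simps split: prod.splits)

lemma Op_diff: "Op b L (\<lambda>x. f x - g x) x = Op b L f x - Op b L g x"
  by (induction L) (auto simp: Op_def bop_def algebra_simps split: prod.splits)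

lemma Op_sum: "finite J \<Longrightarrow> Op b L (\<lambda>x. \<Sum>j\<in>J. f j x) x = (\<Sum>j\<in>J. Op b L (f j) x)"
proof (induction J rule: finite_induct)
  case empty
  show ?case by (induction L) (auto simp: Op_def bop_def split: prod.splits)
qed (simp add: Op_add)

lemma smooth_poly: "smooth_fun (\<lambda>x. poly p (x \<bullet> b))"
  by (rule smooth_family_inner[where g=poly and \<alpha>="\<lambda>_. 1" and \<sigma>=pderiv and \<beta>="\<lambda>_. 0" and \<tau>=id])
    (simp add: poly_DERIV)

lemma partial_poly:
  assumes "b \<in> Basis" "c \<in> Basis"
  shows "partial_dir c (\<lambda>x. poly p (x \<bullet> b)) = (\<lambda>x. if c = b then poly (pderiv p) (x \<bullet> b) else 0)"
proof (intro ext partial_dir_eqI)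
  fix x
  have "((\<lambda>t. poly p (x \<bullet> b + t * (c \<bullet> b))) has_real_derivative poly (pderiv p) (x \<bullet> b + 0 * (c \<bullet> b)) * (c \<bullet> b)) (at 0)"
    by (rule DERIV_chain2[OF poly_DERIV]) (auto intro!: derivative_eq_intros)
  moreover have "c \<bullet> b = (if c = b then 1 else 0)" using assms by (auto simp: inner_Basis)
  ultimately show "((\<lambda>t. poly p ((x + t *\<^sub>R c) \<bullet> b)) has_real_derivative
      (if c = b then poly (pderiv p) (x \<bullet> b) else 0)) (at 0)"
    by (simp add: inner_add_left split: if_splits)
qed

lemma smooth_bop: "b \<in> Basis \<Longrightarrow> smooth_fun f \<Longrightarrow> smooth_fun (bop b s f)"
  unfolding bop_def[abs_def] by (cases s) (simp add: smooth_mult smooth_poly smooth_rc)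

lemma smooth_Op: "b \<in> Basis \<Longrightarrow> smooth_fun f \<Longrightarrow> smooth_fun (Op b L f)"
  by (induction L) (simp_all add: Op_Nil Op_Cons smooth_const smooth_add smooth_bop)

text \<open>The two halves of the product rule along b: here the derivative falls on the
  coefficient, while in \<open>mpoly\<close> below the chain rule multiplies by the slope.\<close>

definition dpoly :: "(real poly \<times> real \<times> real) list \<Rightarrow> (real poly \<times> real \<times> real) list" where
  "dpoly = map (\<lambda>(p, m, d). (pderiv p, m, d))"

definition mpoly :: "(real poly \<times> real \<times> real) list \<Rightarrow> (real poly \<times> real \<times> real) list" where
  "mpoly = map (\<lambda>(p, m, d). (smult m p, m, d))"

lemma partial_bop:
  assumes f: "smooth_fun f" and b: "b \<in> Basis" and c: "c \<in> Basis"
  shows "partial_dir c (bop b (p, m, d) f) = (\<lambda>x. if c = b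
    then bop b (pderiv p, m, d) f x + bop b (smult m p, m, d) (partial_dir c f) x
    else bop b (p, m, d) (partial_dir c f) x)"
proof -
  have "partial_dir c (bop b (p, m, d) f) = (\<lambda>x. partial_dir c (\<lambda>x. poly p (x \<bullet> b)) x * f (rc b m d x)
      + poly p (x \<bullet> b) * partial_dir c (\<lambda>x. f (rc b m d x)) x)"
    unfolding bop_def[abs_def] prod.case by (rule partial_mult[OF smooth_poly smooth_rc[OF f b] c])
  then show ?thesis
    unfolding partial_poly[OF b c] partial_rc[OF f b c] by (auto simp: bop_def)
qed

lemma partial_Op_other:
  assumes f: "smooth_fun f" and b: "b \<in> Basis" and c: "c \<in> Basis" "c \<noteq> b"
  shows "partial_dir c (Op b L f) = Op b L (partial_dir c f)"
proof (induction L)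
  case Nil
  show ?case by (auto simp: Op_Nil partial_const)
next
  case (Cons s L)
  obtain p m d where s: "s = (p, m, d)" by (cases s)
  show ?case unfolding Op_Cons
    using partial_add[OF smooth_bop[OF b f] smooth_Op[OF b f] c(1), of s L] partial_bop[OF f b c(1), of p m d] Cons c(2)
    by (simp add: s)
qed

lemma partial_Op_same:
  assumes f: "smooth_fun f" and b: "b \<in> Basis"
  shows "partial_dir b (Op b L f) = (\<lambda>x. Op b (dpoly L) f x + Op b (mpoly L) (partial_dir b f) x)"
proof (induction L)
  case Nil
  show ?case by (auto simp: Op_Nil partial_const dpoly_def mpoly_def)
next
  case (Cons s L)
  obtain p m d where s: "s = (p, m, d)" by (cases s)
  show ?case
    unfolding Op_Cons dpoly_def mpoly_def list.map
    unfolding partial_add[OF smooth_bop[OF b f] smooth_Op[OF b f] b]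
    using partial_bop[OF f b b, of p m d] Cons by (simp add: s dpoly_def mpoly_def fun_eq_iff)
qed

text \<open>Exactly what \<open>Lsq_rc\<close> asks of each summand. Only slope and shift matter, so
  the condition survives differentiation of the coefficients.\<close>

definition good :: "'a::euclidean_space \<Rightarrow> 'a set \<Rightarrow> 'a set \<Rightarrow> (real poly \<times> real \<times> real) list \<Rightarrow> bool" where
  "good b D D' L \<longleftrightarrow> (\<forall>(p, m, d)\<in>set L. \<bar>m\<bar> \<ge> 1 \<and> (\<forall>x\<in>D'. rc b m d x \<in> D))"

lemma good_dpoly: "good b D D' L \<Longrightarrow> good b D D' (dpoly L)"
  and good_mpoly: "good b D D' L \<Longrightarrow> good b D D' (mpoly L)"
  unfolding good_def dpoly_def mpoly_def by auto

lemma Op_bounded_L2: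
  fixes b :: "'a::euclidean_space"
  assumes b: "b \<in> Basis" and D: "bounded D'" "D \<in> sets lebesgue" "D' \<in> sets lebesgue"
    and L: "good b D D' L"
  shows "\<exists>C\<ge>0. \<forall>f. Lsq D f \<longrightarrow> Lsq D' (Op b L f) \<and> norm (cls D' (Op b L f)) \<le> C * norm (cls D f)"
  using L
proof (induction L)
  case Nil
  show ?case using Lsq_zero[OF D(3)] by (intro exI[of _ 0]) (auto simp: Op_Nil cls_zero)
next
  case (Cons s L)
  obtain p m d where s: "s = (p, m, d)" by (cases s)
  have g: "good b D D' L" "\<bar>m\<bar> \<ge> 1" "\<And>x. x \<in> D' \<Longrightarrow> rc b m d x \<in> D"
    using Cons.prems by (auto simp: good_def s)
  obtain C where C: "C \<ge> 0" "\<And>f. Lsq D f \<Longrightarrow> Lsq D' (Op b L f)"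
    "\<And>f. Lsq D f \<Longrightarrow> norm (cls D' (Op b L f)) \<le> C * norm (cls D f)"
    using Cons.IH[OF g(1)] by blast
  obtain M where M: "M \<ge> 0" "\<And>x. x \<in> D' \<Longrightarrow> \<bar>poly p (x \<bullet> b)\<bar> \<le> M"
    using abs_poly_bounded[OF D(1), of p b] by blast
  have "Lsq D' (Op b (s # L) f) \<and> norm (cls D' (Op b (s # L) f)) \<le> (M + C) * norm (cls D f)" if f: "Lsq D f" for f
  proof -
    note r = Lsq_rc[OF b g(2) D(2,3) g(3) f]
    have k: "continuous_on UNIV (\<lambda>x. poly p (x \<bullet> b))" by (intro continuous_intros)
    note q = Lsq_mult_bounded[OF D(3) conjunct1[OF r] k M(2,1)]
    have "bop b s f = (\<lambda>x. poly p (x \<bullet> b) * f (rc b m d x))" by (auto simp: bop_def s)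
    then have 1: "Lsq D' (bop b s f)" "norm (cls D' (bop b s f)) \<le> M * norm (cls D f)"
      using q r M(1) order_trans[OF _ mult_left_mono[OF _ M(1)]] by auto
    have "norm (cls D' (Op b (s # L) f)) \<le> norm (cls D' (bop b s f)) + norm (cls D' (Op b L f))"
      unfolding Op_Cons by (subst cls_add) (auto simp: D 1 C(2)[OF f] norm_triangle_ineq)
    also have "... \<le> (M + C) * norm (cls D f)" using 1(2) C(3)[OF f] by (simp add: distrib_right)
    finally show ?thesis unfolding Op_Cons using Lsq_add[OF D(3) 1(1) C(2)[OF f]] by simp
  qed
  then show ?case using C(1) M(1) by (intro exI[of _ "M + C"]) auto
qed

text \<open>A derivative of the superposition is again one of the same kind, or along b a sum of
  two, to which the L2 bound applies.\<close>

lemma Op_bounded_hn: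
  fixes b :: "'a::euclidean_space"
  assumes b: "b \<in> Basis" and D: "bounded D" "bounded D'" "D \<in> sets lebesgue" "D' \<in> sets lebesgue"
    and L: "good b D D' L"
  shows "\<exists>C\<ge>0. \<forall>f. smooth_fun f \<longrightarrow> hn D' (Op b L f) \<le> C * hn D f"
proof -
  obtain C1 where C1: "C1 \<ge> 0" "\<And>f. Lsq D f \<Longrightarrow> norm (cls D' (Op b L f)) \<le> C1 * norm (cls D f)"
    using Op_bounded_L2[OF b D(2-4) L] by blast
  obtain C2 where C2: "C2 \<ge> 0" "\<And>f. Lsq D f \<Longrightarrow> norm (cls D' (Op b (dpoly L) f)) \<le> C2 * norm (cls D f)"
    using Op_bounded_L2[OF b D(2-4) good_dpoly[OF L]] by blast
  obtain C3 where C3: "C3 \<ge> 0" "\<And>f. Lsq D f \<Longrightarrow> norm (cls D' (Op b (mpoly L) f)) \<le> C3 * norm (cls D f)"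
    using Op_bounded_L2[OF b D(2-4) good_mpoly[OF L]] by blast
  define C where "C = C1 + (\<Sum>c\<in>(Basis :: 'a set). C1 + C2 + C3)"
  have "hn D' (Op b L f) \<le> C * hn D f" if f: "smooth_fun f" for f
  proof -
    have LD: "Lsq D f" "\<And>c. c \<in> Basis \<Longrightarrow> Lsq D (partial_dir c f)"
      using f D by (auto intro: Lsq_smooth smooth_partial)
    have "norm (cls D' (partial_dir c (Op b L f))) \<le> (C1 + C2 + C3) * hn D f" if c: "c \<in> Basis" for c
    proof (cases "c = b")
      case False
      have "norm (cls D' (partial_dir c (Op b L f))) \<le> C1 * norm (cls D (partial_dir c f))"
        unfolding partial_Op_other[OF f b c False] by (rule C1(2)[OF LD(2)[OF c]])
      also have "... \<le> (C1 + C2 + C3) * hn D f"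
        using C1 C2 C3 norm_cls_partial_le_hn[OF c] by (intro mult_mono) auto
      finally show ?thesis .
    next
      case True
      have "norm (cls D' (partial_dir c (Op b L f)))
          \<le> norm (cls D' (Op b (dpoly L) f)) + norm (cls D' (Op b (mpoly L) (partial_dir b f)))"
        unfolding True partial_Op_same[OF f b]
        by (subst cls_add) (auto simp: D norm_triangle_ineq intro!: Lsq_smooth smooth_Op b smooth_partial f)
      also have "... \<le> C2 * hn D f + C3 * hn D f"
        by (intro add_mono order_trans[OF C2(2)[OF LD(1)]] order_trans[OF C3(2)[OF LD(2)[OF b]]]
            mult_left_mono norm_cls_le_hn norm_cls_partial_le_hn b C2(1) C3(1))
      also have "... \<le> (C1 + C2 + C3) * hn D f" using C1(1) hn_nonneg[of D f] by (simp add: distrib_right)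
      finally show ?thesis .
    qed
    then have "(\<Sum>c\<in>Basis. norm (cls D' (partial_dir c (Op b L f)))) \<le> (\<Sum>c\<in>(Basis::'a set). (C1 + C2 + C3) * hn D f)"
      by (rule sum_mono)
    moreover have "norm (cls D' (Op b L f)) \<le> C1 * hn D f"
      by (intro order_trans[OF C1(2)[OF LD(1)]] mult_left_mono norm_cls_le_hn C1(1))
    ultimately have "hn D' (Op b L f) \<le> C1 * hn D f + (\<Sum>c\<in>(Basis::'a set). (C1 + C2 + C3) * hn D f)"
      unfolding hn_def[of D'] by (rule add_mono[rotated])
    also have "... = C * hn D f" by (simp add: C_def algebra_simps)
    finally show ?thesis .
  qed
  moreover have "C \<ge> 0" unfolding C_def using C1 C2 C3 by (intro add_nonneg_nonneg sum_nonneg) auto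
  ultimately show ?thesis by blast
qed

subsection \<open>Correcting the boundary values one coordinate at a time\<close>

text \<open>With the cubic Hermite cut-off \<open>\<eta>\<close> (equal to 1 at the lower face and 0 at the upper face, with
  vanishing slopes at both) the corrections \<open>\<eta> (\<gamma> f(R\<^sub>1 x) + \<delta> f(R\<^sub>2 x))\<close> reflect across the
  faces with dilation factors 1 and 2.  Boundary values cancel if \<open>\<gamma> + \<delta> = -1\<close>.  The weights
  (3, -4) for divergence and tangential components and (-3, 2) for the normal component are the unique
  ones for which the corrected field has the corrected divergence up to derivatives of \<open>\<eta>\<close>.\<close>

definition hermite :: "real \<Rightarrow> real \<Rightarrow> real poly" where
  "hermite u v = pcompose [:1, 0, -3, 2:] [:- u / (v - u), 1 / (v - u):]"

lemma hermite_values: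
  assumes "u < v"
  shows "poly (hermite u v) u = 1" "poly (hermite u v) v = 0"
    "poly (pderiv (hermite u v)) u = 0" "poly (pderiv (hermite u v)) v = 0"
proof -
  define q where "q = [:- u / (v - u), 1 / (v - u):]"
  have q: "poly q u = 0" "poly q v = 1"
    using assms diff_divide_distrib[of v u "v - u"] by (simp_all add: q_def)
  show "poly (hermite u v) u = 1" "poly (hermite u v) v = 0"
    "poly (pderiv (hermite u v)) u = 0" "poly (pderiv (hermite u v)) v = 0"
    unfolding hermite_def q_def[symmetric] pderiv_pcompose poly_mult poly_pcompose q
    by (auto simp: pderiv_pCons)
qed

definition refl :: "real \<Rightarrow> real \<Rightarrow> real \<Rightarrow> real \<Rightarrow> (real poly \<times> real \<times> real) list" where
  "refl u v \<gamma> \<delta> = [([:1:], 1, 0),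
    (smult \<gamma> (hermite u v), -1, 2 * u), (smult \<delta> (hermite u v), -2, 3 * u),
    (smult \<gamma> (1 - hermite u v), -1, 2 * v), (smult \<delta> (1 - hermite u v), -2, 3 * v)]"

text \<open>The slopes -1 and -2 turn the weights (-3, 2) into (3, -4), and the identity has slope
  1. So the normal derivative of the normal component is reflected exactly like the other terms of
  the divergence.\<close>

lemma mpoly_refl: "mpoly (refl u v (-3) 2) = refl u v 3 (-4)"
  by (simp add: mpoly_def refl_def)

lemma rc_fixed: "m * (x \<bullet> b) + d = x \<bullet> b \<Longrightarrow> rc b m d x = x"
  by (simp add: rc_def)

text \<open>On a face its two reflections fix the point and the cut-off of the opposite face is 0,
  which leaves the factor \<open>1 + \<gamma> + \<delta>\<close>.\<close>

lemma refl_vanishes: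
  assumes uv: "u < v" and x: "x \<bullet> b = u \<or> x \<bullet> b = v" and \<gamma>: "\<gamma> + \<delta> = -1"
  shows "Op b (refl u v \<gamma> \<delta>) f x = 0"
proof -
  have *: "f x + (\<gamma> * f x + \<delta> * f x) = 0"
    using \<gamma> by (metis add.commute add.right_inverse distrib_right mult_minus1)
  show ?thesis using x
  proof
    assume x: "x \<bullet> b = u"
    then show ?thesis using * hermite_values[OF uv]
      by (simp add: Op_def refl_def bop_def rc_fixed)
  next
    assume x: "x \<bullet> b = v"
    then show ?thesis using * hermite_values[OF uv]
      by (simp add: Op_def refl_def bop_def rc_fixed)
  qed
qed

text \<open>This is what the zero slopes of the Hermite cubic are for: the terms sent to the
  remainder vanish on the faces.\<close>

lemma dpoly_refl_vanishes:
  assumes uv: "u < v" and x: "x \<bullet> b = u \<or> x \<bullet> b = v"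
  shows "Op b (dpoly (refl u v \<gamma> \<delta>)) f x = 0"
  using x hermite_values[OF uv]
  by (auto simp: Op_def refl_def bop_def dpoly_def pderiv_smult pderiv_diff pderiv_pCons)

definition dv :: "('a::euclidean_space \<Rightarrow> 'a \<Rightarrow> real) \<Rightarrow> 'a \<Rightarrow> real" where
  "dv V x = (\<Sum>b\<in>Basis. partial_dir b (V b) x)"

lemma smooth_dv: "(\<And>b. b \<in> Basis \<Longrightarrow> smooth_fun (V b)) \<Longrightarrow> smooth_fun (dv V)"
  unfolding dv_def[abs_def] by (intro smooth_sum smooth_partial)

context
  fixes a c :: "'a::euclidean_space"
  assumes nonempty: "\<forall>b\<in>Basis. a \<bullet> b < c \<bullet> b"
begin

lemma ac: "b \<in> Basis \<Longrightarrow> a \<bullet> b < c \<bullet> b"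
  using nonempty by blast

text \<open>I collects the coordinates already corrected. In the others the box is longer by two
  edge lengths on either side, since the dilated reflection \<open>3 * a - 2 * x\<close> carries the
  interval from a to c onto the one from \<open>a - 2 * (c - a)\<close> to a.\<close>

definition lo :: "'a set \<Rightarrow> 'a" where
  "lo I = (\<Sum>b\<in>Basis. (if b \<in> I then a \<bullet> b else a \<bullet> b - 2 * (c \<bullet> b - a \<bullet> b)) *\<^sub>R b)"

definition hi :: "'a set \<Rightarrow> 'a" where
  "hi I = (\<Sum>b\<in>Basis. (if b \<in> I then c \<bullet> b else c \<bullet> b + 2 * (c \<bullet> b - a \<bullet> b)) *\<^sub>R b)"

definition Bx :: "'a set \<Rightarrow> 'a set" where "Bx I = cbox (lo I) (hi I)"

lemma lo_hi_inner:
  assumes "b \<in> Basis"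
  shows "lo I \<bullet> b = (if b \<in> I then a \<bullet> b else a \<bullet> b - 2 * (c \<bullet> b - a \<bullet> b))"
    and "hi I \<bullet> b = (if b \<in> I then c \<bullet> b else c \<bullet> b + 2 * (c \<bullet> b - a \<bullet> b))"
  using assms by (simp_all add: lo_def hi_def)

lemma Bx_iff: "x \<in> Bx I \<longleftrightarrow> (\<forall>b\<in>Basis. lo I \<bullet> b \<le> x \<bullet> b \<and> x \<bullet> b \<le> hi I \<bullet> b)"
  by (simp add: Bx_def mem_box)

lemma Bx_facts: "bounded (Bx I)" "Bx I \<in> sets lebesgue"
  by (auto simp: Bx_def)

lemma Bx_Basis: "Bx Basis = cbox a c"
proof -
  have "x \<in> Bx Basis \<longleftrightarrow> x \<in> cbox a c" for x by (simp add: Bx_iff mem_box lo_hi_inner)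
  then show ?thesis by blast
qed

lemma rc_Bx:
  assumes b: "b \<in> Basis" "b \<notin> I" and x: "x \<in> Bx (insert b I)"
    and m: "a \<bullet> b - 2 * (c \<bullet> b - a \<bullet> b) \<le> m * (x \<bullet> b) + d" "m * (x \<bullet> b) + d \<le> c \<bullet> b + 2 * (c \<bullet> b - a \<bullet> b)"
  shows "rc b m d x \<in> Bx I"
  unfolding Bx_iff
proof
  fix i :: 'a assume i: "i \<in> Basis"
  show "lo I \<bullet> i \<le> rc b m d x \<bullet> i \<and> rc b m d x \<bullet> i \<le> hi I \<bullet> i"
  proof (cases "i = b")
    case True
    then show ?thesis using m b by (simp add: rc_inner lo_hi_inner)
  next
    case False
    then show ?thesis using x i b unfolding Bx_iff
      by (auto simp: rc_inner lo_hi_inner dest!: bspec[of _ _ i])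
  qed
qed

lemma good_refl:
  assumes b: "b \<in> Basis" "b \<notin> I"
  shows "good b (Bx I) (Bx (insert b I)) (refl (a \<bullet> b) (c \<bullet> b) \<gamma> \<delta>)"
proof -
  have x: "a \<bullet> b \<le> x \<bullet> b" "x \<bullet> b \<le> c \<bullet> b" if "x \<in> Bx (insert b I)" for x
    using that b unfolding Bx_iff by (auto simp: lo_hi_inner dest!: bspec[of _ _ b])
  have "rc b m d y \<in> Bx I" if y: "y \<in> Bx (insert b I)"
    and md: "(m, d) \<in> {(1, 0), (-1, 2 * (a \<bullet> b)), (-2, 3 * (a \<bullet> b)), (-1, 2 * (c \<bullet> b)), (-2, 3 * (c \<bullet> b))}" for y m d
    using md x[OF y] ac[OF b(1)] by (intro rc_Bx[OF b y]) auto
  then show ?thesis unfolding good_def refl_def by auto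
qed

text \<open>Reflected points lie outside the open box and q vanishes there, so only the identity
  summand is seen.\<close>

lemma Op_refl_supported:
  assumes b: "b \<in> Basis" "b \<notin> I" and x: "x \<in> Bx (insert b I)" and q: "\<And>x. x \<notin> box a c \<Longrightarrow> q x = 0"
  shows "Op b (refl (a \<bullet> b) (c \<bullet> b) \<gamma> \<delta>) q x = q x"
proof -
  have x: "a \<bullet> b \<le> x \<bullet> b" "x \<bullet> b \<le> c \<bullet> b"
    using x b unfolding Bx_iff by (auto simp: lo_hi_inner dest!: bspec[of _ _ b])
  have out: "q (rc b m d x) = 0" if "m * (x \<bullet> b) + d \<le> a \<bullet> b \<or> c \<bullet> b \<le> m * (x \<bullet> b) + d" for m d
  proof (rule q)
    show "rc b m d x \<notin> box a c"
      using that b(1) rc_inner[OF b(1) b(1), of m d x] unfolding mem_box by force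
  qed
  show ?thesis using x out by (simp add: Op_def refl_def bop_def rc_fixed)
qed

definition vanish :: "'a set \<Rightarrow> ('a \<Rightarrow> real) \<Rightarrow> bool" where
  "vanish I f \<longleftrightarrow> (\<forall>x\<in>Bx I. \<forall>i\<in>I. x \<bullet> i = a \<bullet> i \<or> x \<bullet> i = c \<bullet> i \<longrightarrow> f x = 0)"

text \<open>Reflections in coordinate b leave the other coordinates alone, so boundary values
  corrected earlier are not destroyed.\<close>

lemma vanish_Op:
  assumes b: "b \<in> Basis" "b \<notin> I" and I: "I \<subseteq> Basis" and f: "vanish I f" and L: "good b (Bx I) (Bx (insert b I)) L"
    and face: "\<And>x. x \<bullet> b = a \<bullet> b \<or> x \<bullet> b = c \<bullet> b \<Longrightarrow> Op b L f x = 0"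
  shows "vanish (insert b I) (Op b L f)"
  unfolding vanish_def
proof (intro ballI impI)
  fix x i assume x: "x \<in> Bx (insert b I)" and i: "i \<in> insert b I" "x \<bullet> i = a \<bullet> i \<or> x \<bullet> i = c \<bullet> i"
  show "Op b L f x = 0"
  proof (cases "i = b")
    case True
    then show ?thesis using face i by simp
  next
    case False
    then have iI: "i \<in> I" "i \<in> Basis" using i I by auto
    have "bop b s f x = 0" if "s \<in> set L" for s
    proof -
      obtain p m d where s: "s = (p, m, d)" by (cases s)
      have "rc b m d x \<in> Bx I" using L that x by (auto simp: good_def s)
      moreover have "rc b m d x \<bullet> i = x \<bullet> i" using rc_inner[OF b(1) iI(2)] False by simp
      ultimately have "f (rc b m d x) = 0" using f iI i(2) unfolding vanish_def by metis
      then show ?thesis by (simp add: bop_def s)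
    qed
    then have "map (\<lambda>s. bop b s f x) L = map (\<lambda>s. 0) L" by (intro map_cong) auto
    then show ?thesis unfolding Op_def by (simp only: sum_list_0)
  qed
qed

definition step :: "'a \<Rightarrow> ('a \<Rightarrow> 'a \<Rightarrow> real) \<Rightarrow> 'a \<Rightarrow> 'a \<Rightarrow> real" where
  "step b W i = (if i = b then Op b (refl (a \<bullet> b) (c \<bullet> b) (-3) 2) (W i)
    else Op b (refl (a \<bullet> b) (c \<bullet> b) 3 (-4)) (W i))"

text \<open>By \<open>mpoly_refl\<close> the divergence passes through the step with one and the
  same operator. What is left over is the derivative of the cut-off in the normal component, a term
  of order zero in the field.\<close>

lemma dv_step:
  assumes b: "b \<in> Basis" and W: "\<And>i. i \<in> Basis \<Longrightarrow> smooth_fun (W i)"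
  shows "dv (step b W) x = Op b (refl (a \<bullet> b) (c \<bullet> b) 3 (-4)) (dv W) x
    + Op b (dpoly (refl (a \<bullet> b) (c \<bullet> b) (-3) 2)) (W b) x"
proof -
  let ?L = "refl (a \<bullet> b) (c \<bullet> b) 3 (-4)" and ?M = "refl (a \<bullet> b) (c \<bullet> b) (-3) 2"
  have 1: "partial_dir i (step b W i) x = Op b ?L (partial_dir i (W i)) x" if "i \<in> Basis - {b}" for i
    using that partial_Op_other[OF W b] by (simp add: step_def)
  have 2: "partial_dir b (step b W b) x = Op b (dpoly ?M) (W b) x + Op b ?L (partial_dir b (W b)) x"
    using partial_Op_same[OF W[OF b] b] by (simp add: step_def mpoly_refl)
  have "dv (step b W) x = partial_dir b (step b W b) x + (\<Sum>i\<in>Basis - {b}. partial_dir i (step b W i) x)"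
    unfolding dv_def using b by (subst sum.remove[of _ b]) auto
  also have "... = Op b (dpoly ?M) (W b) x + (\<Sum>i\<in>Basis. Op b ?L (partial_dir i (W i)) x)"
    using b by (simp add: 1 2 sum.remove[of Basis b "\<lambda>i. Op b ?L (partial_dir i (W i)) x"])
  also have "(\<Sum>i\<in>Basis. Op b ?L (partial_dir i (W i)) x) = Op b ?L (dv W) x"
    unfolding dv_def[abs_def] by (simp add: Op_sum)
  finally show ?thesis by simp
qed

text \<open>The operator acting on the divergence fixes q, so the error
  \<open>dv W x - r x - q x\<close> is itself transported by it and keeps its L2 bound although q
  has no regularity. The constant precedes V and q: the induction step only multiplies operator
  bounds.\<close>

lemma corrected_field:
  assumes "finite I" "I \<subseteq> Basis"
  shows "\<exists>C\<ge>0. \<forall>V q. (\<forall>b\<in>Basis. smooth_fun (V b)) \<longrightarrow> Lsq (Bx {}) q \<longrightarrow> (\<forall>x. x \<notin> box a c \<longrightarrow> q x = 0) \<longrightarrow>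
    (\<exists>W r. (\<forall>b\<in>Basis. smooth_fun (W b) \<and> vanish I (W b)) \<and> smooth_fun r \<and> vanish I r
      \<and> (\<Sum>b\<in>Basis. hn (Bx I) (W b)) + hn (Bx I) r \<le> C * (\<Sum>b\<in>Basis. hn (Bx {}) (V b))
      \<and> Lsq (Bx I) (\<lambda>x. dv W x - r x - q x)
      \<and> norm (cls (Bx I) (\<lambda>x. dv W x - r x - q x)) \<le> C * norm (cls (Bx {}) (\<lambda>x. dv V x - q x)))"
  using assms
proof (induction I rule: finite_induct)
  case empty
  have "\<exists>W r. (\<forall>b\<in>Basis. smooth_fun (W b) \<and> vanish {} (W b)) \<and> smooth_fun r \<and> vanish {} r
      \<and> (\<Sum>b\<in>Basis. hn (Bx {}) (W b)) + hn (Bx {}) r \<le> 1 * (\<Sum>b\<in>Basis. hn (Bx {}) (V b))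
      \<and> Lsq (Bx {}) (\<lambda>x. dv W x - r x - q x)
      \<and> norm (cls (Bx {}) (\<lambda>x. dv W x - r x - q x)) \<le> 1 * norm (cls (Bx {}) (\<lambda>x. dv V x - q x))"
    if V: "\<forall>b\<in>Basis. smooth_fun (V b)" and q: "Lsq (Bx {}) q" for V q
    using V Lsq_diff[OF Bx_facts(2) Lsq_smooth[OF smooth_dv Bx_facts] q, of V]
    by (intro exI[of _ V] exI[of _ "\<lambda>x. 0"]) (auto simp: vanish_def smooth_const hn_zero)
  then show ?case by (intro exI[of _ 1]) auto
next
  case (insert b I)
  have b: "b \<in> Basis" "b \<notin> I" and I: "I \<subseteq> Basis" using insert by auto
  let ?D = "Bx I" and ?D' = "Bx (insert b I)"
  let ?L = "refl (a \<bullet> b) (c \<bullet> b) 3 (-4)" and ?M = "refl (a \<bullet> b) (c \<bullet> b) (-3) 2"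
  have acb: "a \<bullet> b < c \<bullet> b" by (rule ac[OF b(1)])
  note gL = good_refl[OF b, of 3 "-4"] and gM = good_refl[OF b, of "-3" 2]
  note gM' = good_dpoly[OF gM]
  obtain C where C: "C \<ge> 0" and IH: "\<And>V q. \<forall>b\<in>Basis. smooth_fun (V b) \<Longrightarrow> Lsq (Bx {}) q \<Longrightarrow> \<forall>x. x \<notin> box a c \<longrightarrow> q x = 0 \<Longrightarrow>
    (\<exists>W r. (\<forall>b\<in>Basis. smooth_fun (W b) \<and> vanish I (W b)) \<and> smooth_fun r \<and> vanish I r
      \<and> (\<Sum>b\<in>Basis. hn (Bx I) (W b)) + hn (Bx I) r \<le> C * (\<Sum>b\<in>Basis. hn (Bx {}) (V b))
      \<and> Lsq (Bx I) (\<lambda>x. dv W x - r x - q x)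
      \<and> norm (cls (Bx I) (\<lambda>x. dv W x - r x - q x)) \<le> C * norm (cls (Bx {}) (\<lambda>x. dv V x - q x)))"
    using insert.IH[OF I] by (elim exE conjE) (rule that, assumption, blast)
  obtain C0 where C0: "C0 \<ge> 0" "\<And>f. Lsq ?D f \<Longrightarrow> Lsq ?D' (Op b ?L f)"
    "\<And>f. Lsq ?D f \<Longrightarrow> norm (cls ?D' (Op b ?L f)) \<le> C0 * norm (cls ?D f)"
    using Op_bounded_L2[OF b(1) Bx_facts(1) Bx_facts(2) Bx_facts(2) gL] by blast
  obtain C1 where C1: "C1 \<ge> 0" "\<And>f. smooth_fun f \<Longrightarrow> hn ?D' (Op b ?L f) \<le> C1 * hn ?D f"
    using Op_bounded_hn[OF b(1) Bx_facts(1) Bx_facts(1) Bx_facts(2) Bx_facts(2) gL] by blast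
  obtain C2 where C2: "C2 \<ge> 0" "\<And>f. smooth_fun f \<Longrightarrow> hn ?D' (Op b ?M f) \<le> C2 * hn ?D f"
    using Op_bounded_hn[OF b(1) Bx_facts(1) Bx_facts(1) Bx_facts(2) Bx_facts(2) gM] by blast
  obtain C3 where C3: "C3 \<ge> 0" "\<And>f. smooth_fun f \<Longrightarrow> hn ?D' (Op b (dpoly ?M) f) \<le> C3 * hn ?D f"
    using Op_bounded_hn[OF b(1) Bx_facts(1) Bx_facts(1) Bx_facts(2) Bx_facts(2) gM'] by blast
  define K where "K = C0 * C + (C1 + C2 + C3) * C"
  have K0: "K \<ge> 0" unfolding K_def using C C0 C1 C2 C3 by (intro add_nonneg_nonneg mult_nonneg_nonneg) auto
  have main: "\<exists>W r. (\<forall>i\<in>Basis. smooth_fun (W i) \<and> vanish (insert b I) (W i)) \<and> smooth_fun r \<and> vanish (insert b I) r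
      \<and> (\<Sum>i\<in>Basis. hn ?D' (W i)) + hn ?D' r \<le> K * (\<Sum>i\<in>Basis. hn (Bx {}) (V i))
      \<and> Lsq ?D' (\<lambda>x. dv W x - r x - q x)
      \<and> norm (cls ?D' (\<lambda>x. dv W x - r x - q x)) \<le> K * norm (cls (Bx {}) (\<lambda>x. dv V x - q x))"
    if V: "\<forall>b\<in>Basis. smooth_fun (V b)" and q: "Lsq (Bx {}) q" and q0: "\<forall>x. x \<notin> box a c \<longrightarrow> q x = 0" for V q
  proof -
    from IH[OF V q q0] obtain W r where WR: "(\<forall>i\<in>Basis. smooth_fun (W i) \<and> vanish I (W i)) \<and> smooth_fun r \<and> vanish I r
      \<and> (\<Sum>i\<in>Basis. hn ?D (W i)) + hn ?D r \<le> C * (\<Sum>i\<in>Basis. hn (Bx {}) (V i))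
      \<and> Lsq ?D (\<lambda>x. dv W x - r x - q x)
      \<and> norm (cls ?D (\<lambda>x. dv W x - r x - q x)) \<le> C * norm (cls (Bx {}) (\<lambda>x. dv V x - q x))"
      by (elim exE) (rule that)
    have W: "\<And>i. i \<in> Basis \<Longrightarrow> smooth_fun (W i)" "\<And>i. i \<in> Basis \<Longrightarrow> vanish I (W i)"
      and r: "smooth_fun r" "vanish I r"
      and bd: "(\<Sum>i\<in>Basis. hn ?D (W i)) + hn ?D r \<le> C * (\<Sum>i\<in>Basis. hn (Bx {}) (V i))"
      and eL: "Lsq ?D (\<lambda>x. dv W x - r x - q x)"
      and en: "norm (cls ?D (\<lambda>x. dv W x - r x - q x)) \<le> C * norm (cls (Bx {}) (\<lambda>x. dv V x - q x))"
      using WR by simp_all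
    define W' where "W' = step b W"
    \<comment> \<open>The old remainder is carried along by the operator that acts on the
      divergence, and the cut-off term of this coordinate is added; with this choice the new error
      is exactly the transported old one.\<close>
    define r' where "r' x = Op b ?L r x + Op b (dpoly ?M) (W b) x" for x
    have sW': "smooth_fun (W' i)" if "i \<in> Basis" for i
      using that unfolding W'_def step_def by (auto intro!: smooth_Op b W)
    have sr': "smooth_fun r'" unfolding r'_def[abs_def] by (intro smooth_add smooth_Op b W r)
    have vW': "vanish (insert b I) (W' i)" if "i \<in> Basis" for i
      unfolding W'_def step_def using that
      by (auto intro!: vanish_Op[OF b I _ gL] vanish_Op[OF b I _ gM] W refl_vanishes[OF acb])
    have "vanish (insert b I) (Op b ?L r)" "vanish (insert b I) (Op b (dpoly ?M) (W b))"
      by (auto intro!: vanish_Op[OF b I _ gL] vanish_Op[OF b I _ gM'] W r b refl_vanishes[OF acb] dpoly_refl_vanishes[OF acb])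
    then have vr': "vanish (insert b I) r'" unfolding vanish_def r'_def by simp
    have hW': "hn ?D' (W' i) \<le> (C1 + C2) * hn ?D (W i)" if i: "i \<in> Basis" for i
    proof -
      have "hn ?D' (W' i) \<le> C1 * hn ?D (W i) \<or> hn ?D' (W' i) \<le> C2 * hn ?D (W i)"
        unfolding W'_def step_def using C1(2)[OF W(1)[OF i]] C2(2)[OF W(1)[OF i]] by (cases "i = b") auto
      then show ?thesis using mult_nonneg_nonneg[OF C1(1) hn_nonneg[of ?D "W i"]]
          mult_nonneg_nonneg[OF C2(1) hn_nonneg[of ?D "W i"]] by (auto simp: distrib_right)
    qed
    have hr': "hn ?D' r' \<le> C1 * hn ?D r + C3 * hn ?D (W b)"
      unfolding r'_def by (intro order_trans[OF hn_add] add_mono C1 C3 smooth_Op b W r Bx_facts)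
    have Wb: "hn ?D (W b) \<le> (\<Sum>i\<in>Basis. hn ?D (W i))"
      using b by (intro member_le_sum) (auto simp: hn_nonneg)
    have "(\<Sum>i\<in>Basis. hn ?D' (W' i)) + hn ?D' r' \<le> (C1 + C2) * (\<Sum>i\<in>Basis. hn ?D (W i)) + (C1 * hn ?D r + C3 * (\<Sum>i\<in>Basis. hn ?D (W i)))"
    proof (rule add_mono)
      show "(\<Sum>i\<in>Basis. hn ?D' (W' i)) \<le> (C1 + C2) * (\<Sum>i\<in>Basis. hn ?D (W i))"
        unfolding sum_distrib_left by (rule sum_mono[OF hW'])
      show "hn ?D' r' \<le> C1 * hn ?D r + C3 * (\<Sum>i\<in>Basis. hn ?D (W i))"
        using hr' mult_left_mono[OF Wb C3(1)] by linarith
    qed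
    also have "... \<le> (C1 + C2 + C3) * ((\<Sum>i\<in>Basis. hn ?D (W i)) + hn ?D r)"
      using mult_nonneg_nonneg[OF C2(1) hn_nonneg[of ?D r]] mult_nonneg_nonneg[OF C3(1) hn_nonneg[of ?D r]]
      by (simp add: algebra_simps)
    also have "... \<le> (C1 + C2 + C3) * (C * (\<Sum>i\<in>Basis. hn (Bx {}) (V i)))"
      using bd C1(1) C2(1) C3(1) by (intro mult_left_mono) auto
    also have "... \<le> K * (\<Sum>i\<in>Basis. hn (Bx {}) (V i))"
      unfolding K_def using mult_nonneg_nonneg[OF mult_nonneg_nonneg[OF C0(1) C] sum_nonneg[of Basis "\<lambda>i. hn (Bx {}) (V i)"]]
      by (simp add: hn_nonneg distrib_right mult.assoc)
    finally have bd': "(\<Sum>i\<in>Basis. hn ?D' (W' i)) + hn ?D' r' \<le> K * (\<Sum>i\<in>Basis. hn (Bx {}) (V i))" .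
    have "dv W' x - r' x - q x = Op b ?L (\<lambda>x. dv W x - r x - q x) x" if "x \<in> ?D'" for x
      using dv_step[OF b(1) W(1), where x=x] Op_refl_supported[OF b that, of q 3 "-4"] q0
      by (simp add: W'_def r'_def Op_diff)
    then have e: "cls ?D' (\<lambda>x. dv W' x - r' x - q x) = cls ?D' (Op b ?L (\<lambda>x. dv W x - r x - q x))"
      and e': "(\<lambda>x. if x \<in> ?D' then dv W' x - r' x - q x else 0) = (\<lambda>x. if x \<in> ?D' then Op b ?L (\<lambda>x. dv W x - r x - q x) x else 0)"
      by (auto intro!: cls_cong)
    have eL': "Lsq ?D' (\<lambda>x. dv W' x - r' x - q x)"
      using C0(2)[OF eL] unfolding Lsq_iff_sqint[OF Bx_facts(2)] e' .
    have "norm (cls ?D' (\<lambda>x. dv W' x - r' x - q x)) \<le> C0 * norm (cls ?D (\<lambda>x. dv W x - r x - q x))"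
      unfolding e by (rule C0(3)[OF eL])
    also have "... \<le> C0 * (C * norm (cls (Bx {}) (\<lambda>x. dv V x - q x)))" by (rule mult_left_mono[OF en C0(1)])
    also have "... \<le> K * norm (cls (Bx {}) (\<lambda>x. dv V x - q x))"
      unfolding K_def mult.assoc[symmetric] using C C1 C2 C3 by (intro mult_right_mono) auto
    finally show ?thesis using sW' vW' sr' vr' bd' eL' by (intro exI[of _ W'] exI[of _ r']) auto
  qed
  show ?case using K0 main by blast
qed

text \<open>The remainder \<open>r\<close> is of first order in the field, hence more regular than the divergence;
  it collects the terms in which derivatives fall on the cut-offs.\<close>

theorem divergence_with_remainder:
  "\<exists>C\<ge>0. \<forall>Q. restr (box a c) Q = Q \<longrightarrow>
    (\<exists>W r. (\<forall>b\<in>Basis. smooth_fun (W b)) \<and> smooth_fun r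
      \<and> (\<forall>x\<in>cbox a c. \<forall>i\<in>Basis. x \<bullet> i = a \<bullet> i \<or> x \<bullet> i = c \<bullet> i \<longrightarrow> r x = 0 \<and> (\<forall>b\<in>Basis. W b x = 0))
      \<and> (\<Sum>b\<in>Basis. hn (box a c) (W b)) + hn (box a c) r \<le> C * norm Q
      \<and> norm (cls (box a c) (\<lambda>x. dv W x - r x) - Q) \<le> norm Q / 2)"
proof -
  obtain C where C: "C \<ge> 0" and cf: "\<And>V q. \<forall>b\<in>Basis. smooth_fun (V b) \<Longrightarrow> Lsq (Bx {}) q \<Longrightarrow> \<forall>x. x \<notin> box a c \<longrightarrow> q x = 0 \<Longrightarrow>
    (\<exists>W r. (\<forall>b\<in>Basis. smooth_fun (W b) \<and> vanish Basis (W b)) \<and> smooth_fun r \<and> vanish Basis r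
      \<and> (\<Sum>b\<in>Basis. hn (Bx Basis) (W b)) + hn (Bx Basis) r \<le> C * (\<Sum>b\<in>Basis. hn (Bx {}) (V b))
      \<and> Lsq (Bx Basis) (\<lambda>x. dv W x - r x - q x)
      \<and> norm (cls (Bx Basis) (\<lambda>x. dv W x - r x - q x)) \<le> C * norm (cls (Bx {}) (\<lambda>x. dv V x - q x)))"
    using corrected_field[OF finite_Basis order_refl] by (elim exE conjE) (rule that, assumption, blast)
  have lohi: "lo {} \<bullet> b < hi {} \<bullet> b" if "b \<in> Basis" for b
    using ac[OF that] that by (simp add: lo_hi_inner)
  \<comment> \<open>The Poisson problem is posed on the enlarged box, so that reflected points stay
    where the field is controlled.\<close>
  let ?om = "om (lo {}) (hi {})"
  have om: "?om b > 0" if "b \<in> Basis" for b using om_pos[OF lohi that] .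
  define K where "K = (\<Sum>b\<in>(Basis::'a set). 1 / ?om b + real (DIM('a)))"
  have K0: "K \<ge> 0" unfolding K_def using om by (intro sum_nonneg add_nonneg_nonneg) (auto intro: less_imp_le)
  have Um: "box a c \<in> sets lebesgue" by auto
  have sub: "box a c \<subseteq> Bx {}" "box a c \<subseteq> cbox a c"
    using ac unfolding Bx_iff subset_iff mem_box by (auto simp: lo_hi_inner intro: less_imp_le)
  show ?thesis
  proof (intro exI[of _ "C * K * 2"] conjI allI impI)
    show "0 \<le> C * K * 2" using C K0 by simp
    fix Q assume Q: "restr (box a c) Q = Q"
    show "\<exists>W r. (\<forall>b\<in>Basis. smooth_fun (W b)) \<and> smooth_fun r
      \<and> (\<forall>x\<in>cbox a c. \<forall>i\<in>Basis. x \<bullet> i = a \<bullet> i \<or> x \<bullet> i = c \<bullet> i \<longrightarrow> r x = 0 \<and> (\<forall>b\<in>Basis. W b x = 0))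
      \<and> (\<Sum>b\<in>Basis. hn (box a c) (W b)) + hn (box a c) r \<le> C * K * 2 * norm Q
      \<and> norm (cls (box a c) (\<lambda>x. dv W x - r x) - Q) \<le> norm Q / 2"
    proof (cases "Q = 0")
      case True
      have "dv (\<lambda>_ _. 0) = (\<lambda>x::'a. 0)" by (auto simp: dv_def partial_const)
      then show ?thesis using True
        by (intro exI[of _ "\<lambda>_ _. 0"] exI[of _ "\<lambda>_. 0"]) (auto simp: smooth_const hn_zero cls_zero)
    next
      case False
      then have nQ: "norm Q > 0" by simp
      \<comment> \<open>The correction amplifies the error of the sine approximation by at most C,
        and half of the norm of Q is allowed in the end. The added 1 covers C = 0; the case Q = 0 is
        split off because e would vanish.\<close>
      define e where "e = norm Q / (2 * (C + 1))"
      have e: "e > 0" "e \<le> norm Q" "C * e \<le> norm Q / 2" using nQ C by (auto simp: e_def field_simps)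
      \<comment> \<open>The representative is set to zero off the open box, since the reflection
        argument needs q to vanish there at every point and not only almost everywhere.\<close>
      define q where "q x = (if x \<in> box a c then rp Q x else 0)" for x
      have "sqint q" unfolding q_def by (rule sqint_indicator[OF Um sqint_rp])
      moreover have "(\<lambda>x. if x \<in> Bx {} then q x else 0) = q" using sub by (intro ext) (auto simp: q_def)
      ultimately have qL: "Lsq (Bx {}) q" and qQ: "cls (Bx {}) q = abs_l2 q"
        using Lsq_iff_sqint[OF Bx_facts(2)] by (auto simp: cls_def)
      have qQ: "cls (Bx {}) q = Q" and qU: "cls (box a c) q = Q"
        using Q qQ unfolding q_def[abs_def] by (auto simp: restr_def cls_def cong: if_cong)
      have q0: "\<forall>x. x \<notin> box a c \<longrightarrow> q x = 0" by (simp add: q_def)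
      have "restr (cbox (lo {}) (hi {})) Q = Q"
        using restr_idem[OF Bx_facts(2) qL] unfolding qQ by (simp add: Bx_def)
      then obtain F d where F: "finite F" "F \<subseteq> modes"
        and Fd: "norm (cls (Bx {}) (\<lambda>x. \<Sum>k\<in>F. d k * snp (lo {}) (hi {}) (\<lambda>_. 0) k x) - Q) < e"
        using sines_dense[OF lohi _ e(1), of Q] unfolding Bx_def by blast
      define q1 where "q1 = (\<lambda>x. \<Sum>k\<in>F. d k * snp (lo {}) (hi {}) (\<lambda>_. 0) k x)"
      obtain V where V: "\<forall>b\<in>Basis. smooth_fun (V b)" "(\<lambda>x. \<Sum>b\<in>Basis. partial_dir b (V b) x) = q1"
        "\<forall>b\<in>Basis. norm (cls (Bx {}) (V b)) \<le> norm (cls (Bx {}) q1) / ?om b"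
        "\<forall>b\<in>Basis. \<forall>b'\<in>Basis. norm (cls (Bx {}) (partial_dir b' (V b))) \<le> norm (cls (Bx {}) q1)"
        using sine_gradient_field[OF lohi F, of d] unfolding Bx_def q1_def by blast
      have dvV: "dv V = q1" using V(2) by (simp add: dv_def[abs_def])
      have sq1: "smooth_fun q1" using smooth_dv[of V] V(1) dvV by simp
      have n1: "norm (cls (Bx {}) q1) \<le> 2 * norm Q"
        using Fd e(2) norm_triangle_ineq2[of "cls (Bx {}) q1" Q] unfolding q1_def by linarith
      have "hn (Bx {}) (V b) \<le> (1 / ?om b + real (DIM('a))) * norm (cls (Bx {}) q1)" if b: "b \<in> Basis" for b
      proof -
        have "(\<Sum>b'\<in>Basis. norm (cls (Bx {}) (partial_dir b' (V b)))) \<le> (\<Sum>b'\<in>(Basis::'a set). norm (cls (Bx {}) q1))"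
          using V(4) b by (intro sum_mono) auto
        then show ?thesis using bspec[OF V(3) b] unfolding hn_def by (simp add: distrib_right)
      qed
      then have "(\<Sum>b\<in>Basis. hn (Bx {}) (V b)) \<le> (\<Sum>b\<in>Basis. (1 / ?om b + real (DIM('a))) * norm (cls (Bx {}) q1))"
        by (rule sum_mono)
      also have "... = K * norm (cls (Bx {}) q1)" by (simp add: K_def sum_distrib_right)
      also have "... \<le> K * (2 * norm Q)" by (rule mult_left_mono[OF n1 K0])
      finally have hV: "(\<Sum>b\<in>Basis. hn (Bx {}) (V b)) \<le> K * (2 * norm Q)" .
      from cf[OF V(1) qL q0] obtain W r where WR: "(\<forall>b\<in>Basis. smooth_fun (W b) \<and> vanish Basis (W b)) \<and> smooth_fun r \<and> vanish Basis r
        \<and> (\<Sum>b\<in>Basis. hn (Bx Basis) (W b)) + hn (Bx Basis) r \<le> C * (\<Sum>b\<in>Basis. hn (Bx {}) (V b))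
        \<and> Lsq (Bx Basis) (\<lambda>x. dv W x - r x - q x)
        \<and> norm (cls (Bx Basis) (\<lambda>x. dv W x - r x - q x)) \<le> C * norm (cls (Bx {}) (\<lambda>x. dv V x - q x))"
        by (elim exE) (rule that)
      have W: "\<And>b. b \<in> Basis \<Longrightarrow> smooth_fun (W b)" "\<And>b. b \<in> Basis \<Longrightarrow> vanish Basis (W b)"
        and r: "smooth_fun r" "vanish Basis r"
        and bd: "(\<Sum>b\<in>Basis. hn (Bx Basis) (W b)) + hn (Bx Basis) r \<le> C * (\<Sum>b\<in>Basis. hn (Bx {}) (V b))"
        and eL: "Lsq (Bx Basis) (\<lambda>x. dv W x - r x - q x)"
        and en: "norm (cls (Bx Basis) (\<lambda>x. dv W x - r x - q x)) \<le> C * norm (cls (Bx {}) (\<lambda>x. dv V x - q x))"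
        using WR by simp_all
      note bd = bd[unfolded Bx_Basis] and eL = eL[unfolded Bx_Basis] and en = en[unfolded Bx_Basis]
      have hle: "hn (box a c) f \<le> hn (cbox a c) f" if "smooth_fun f" for f
        unfolding hn_def using that
        by (intro add_mono sum_mono norm_cls_subset Lsq_smooth smooth_partial sub) auto
      have "(\<Sum>b\<in>Basis. hn (box a c) (W b)) + hn (box a c) r \<le> (\<Sum>b\<in>Basis. hn (cbox a c) (W b)) + hn (cbox a c) r"
        by (intro add_mono sum_mono hle W r)
      also have "... \<le> C * (K * (2 * norm Q))" using bd mult_left_mono[OF hV C] by linarith
      finally have B: "(\<Sum>b\<in>Basis. hn (box a c) (W b)) + hn (box a c) r \<le> C * K * 2 * norm Q" by (simp add: mult_ac)
      have sdv: "smooth_fun (\<lambda>x. dv W x - r x)" by (intro smooth_diff smooth_dv W r)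
      have "cls (box a c) (\<lambda>x. dv W x - r x) - Q = cls (box a c) (\<lambda>x. dv W x - r x - q x)"
        unfolding qU[symmetric]
        by (rule cls_diff[symmetric]) (auto intro!: Lsq_smooth sdv Lsq_subset[OF Bx_facts(2) Um sub(1) qL])
      then have "norm (cls (box a c) (\<lambda>x. dv W x - r x) - Q) \<le> norm (cls (cbox a c) (\<lambda>x. dv W x - r x - q x))"
        using norm_cls_subset[OF _ Um sub(2) eL] by simp
      also have "... \<le> C * norm (cls (Bx {}) (\<lambda>x. dv V x - q x))" by (rule en)
      also have "cls (Bx {}) (\<lambda>x. dv V x - q x) = cls (Bx {}) q1 - Q"
        unfolding dvV qQ[symmetric] by (rule cls_diff) (auto intro!: Lsq_smooth sq1 Bx_facts qL)
      also have "C * norm (cls (Bx {}) q1 - Q) \<le> C * e"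
        using Fd C unfolding q1_def by (intro mult_left_mono) auto
      finally have E: "norm (cls (box a c) (\<lambda>x. dv W x - r x) - Q) \<le> norm Q / 2" using e(3) by linarith
      have "r x = 0 \<and> (\<forall>b\<in>Basis. W b x = 0)" if "x \<in> cbox a c" "i \<in> Basis" "x \<bullet> i = a \<bullet> i \<or> x \<bullet> i = c \<bullet> i" for x i
        using W(2) r(2) that unfolding vanish_def Bx_Basis by blast
      then show ?thesis using W r B E by (intro exI[of _ W] exI[of _ r]) blast
    qed
  qed
qed

end

section \<open>Korn's inequality\<close>

lemma inner_cls_integral:
  assumes "S \<in> sets lebesgue" "Lsq S f" "Lsq S g"
  shows "inner (cls S f) (cls S g) = integral\<^sup>L (lebesgue_on S) (\<lambda>x. f x * g x)"
  using inner_cls[OF assms] by (simp add: ip_def)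

lemma ibp_box:
  fixes p f :: "'a::euclidean_space \<Rightarrow> real"
  assumes p: "smooth_fun p" and f: "smooth_fun f" and b: "b \<in> Basis"
    and f0: "\<And>x. x \<in> cbox a c \<Longrightarrow> x \<bullet> b = a \<bullet> b \<or> x \<bullet> b = c \<bullet> b \<Longrightarrow> f x = 0"
  shows "inner (cls (box a c) p) (cls (box a c) (partial_dir b f))
    = - inner (cls (box a c) (partial_dir b p)) (cls (box a c) f)"
proof -
  have U: "box a c \<in> sets lebesgue" "bounded (box a c)" by auto
  have L: "Lsq (box a c) g" if "smooth_fun g" for g using that U by (intro Lsq_smooth)
  have "integral\<^sup>L (lebesgue_on (box a c)) (partial_dir b (\<lambda>x. p x * f x)) = 0"
    by (rule integral_partial_zero[OF smooth_mult[OF p f] b]) (use f0 in auto)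
  moreover have "integral\<^sup>L (lebesgue_on (box a c)) (partial_dir b (\<lambda>x. p x * f x))
      = integral\<^sup>L (lebesgue_on (box a c)) (\<lambda>x. partial_dir b p x * f x)
      + integral\<^sup>L (lebesgue_on (box a c)) (\<lambda>x. p x * partial_dir b f x)"
    unfolding partial_mult[OF p f b]
    by (intro Bochner_Integration.integral_add Lsq_mult_integrable U L smooth_partial p f b)
  ultimately show ?thesis
    by (simp add: inner_cls_integral U L smooth_partial p f b)
qed

definition sg :: "('a::euclidean_space \<Rightarrow> 'a \<Rightarrow> real) \<Rightarrow> 'a \<Rightarrow> 'a \<Rightarrow> 'a \<Rightarrow> real" where
  "sg v i j x = (partial_dir j (v i) x + partial_dir i (v j) x) / 2"

lemma smooth_sg:
  assumes "\<forall>i\<in>Basis. smooth_fun (v i)" "i \<in> Basis" "j \<in> Basis"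
  shows "smooth_fun (sg v i j)"
proof -
  note v = bspec[OF assms(1)]
  have "smooth_fun (\<lambda>x. (1/2) * (partial_dir j (v i) x + partial_dir i (v j) x))"
    by (intro smooth_cmult smooth_add smooth_partial v assms)
  then show ?thesis by (simp add: sg_def[abs_def])
qed

text \<open>The identity behind Korn's inequality: all derivatives of an entry of the gradient are
  combinations of derivatives of the strain \<open>sg\<close>. It rests on the symmetry of second
  derivatives.\<close>

lemma second_derivative_sg:
  assumes vB: "\<forall>i\<in>Basis. smooth_fun (v i)" and B: "i \<in> Basis" "j \<in> Basis" "k \<in> Basis"
  shows "partial_dir j (partial_dir k (v i)) x
    = partial_dir j (sg v i k) x + partial_dir k (sg v i j) x - partial_dir i (sg v j k) x"
proof -
  note v = bspec[OF vB]
  have *: "partial_dir l (sg v m n) = (\<lambda>x. (1/2) * (partial_dir l (partial_dir n (v m)) x + partial_dir l (partial_dir m (v n)) x))"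
    if "l \<in> Basis" "m \<in> Basis" "n \<in> Basis" for l m n
  proof -
    have "sg v m n = (\<lambda>x. (1/2) * (partial_dir n (v m) x + partial_dir m (v n) x))"
      by (simp add: sg_def[abs_def])
    then show ?thesis
      by (simp only: partial_cmult partial_add smooth_add smooth_partial v that)
  qed
  show ?thesis
    unfolding *[OF B(2,1,3)] *[OF B(3,1,2)] *[OF B(1,2,3)]
    using partial_commute[OF v[OF B(1)] B(2,3)] partial_commute[OF v[OF B(2)] B(1,3)]
      partial_commute[OF v[OF B(3)] B(1,2)]
    by (simp add: field_simps)
qed

text \<open>An entry Q of the gradient is written as the class of \<open>dv W x - r x\<close> up to
  half its norm and tested with itself. Integrating by parts twice in the term with
  \<open>dv W\<close> leaves only strain against first derivatives of W; the half is absorbed on the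
  left.\<close>

theorem korn_second:
  fixes a c :: "'a::euclidean_space"
  assumes ac: "\<forall>b\<in>Basis. a \<bullet> b < c \<bullet> b"
  shows "\<exists>C\<ge>0. \<forall>v. (\<forall>i\<in>Basis. smooth_fun (v i)) \<longrightarrow> (\<forall>i\<in>Basis. \<forall>k\<in>Basis.
    norm (cls (box a c) (partial_dir k (v i)))
      \<le> C * ((\<Sum>i\<in>Basis. norm (cls (box a c) (v i))) + (\<Sum>i\<in>Basis. \<Sum>j\<in>Basis. norm (cls (box a c) (sg v i j)))))"
proof -
  let ?U = "box a c"
  have U: "?U \<in> sets lebesgue" "bounded ?U" by auto
  have L: "Lsq ?U g" if "smooth_fun g" for g using that U by (intro Lsq_smooth)
  obtain C where C: "C \<ge> 0" and core: "\<And>Q. restr ?U Q = Q \<Longrightarrow>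
    (\<exists>W r. (\<forall>b\<in>Basis. smooth_fun (W b)) \<and> smooth_fun r
      \<and> (\<forall>x\<in>cbox a c. \<forall>i\<in>Basis. x \<bullet> i = a \<bullet> i \<or> x \<bullet> i = c \<bullet> i \<longrightarrow> r x = 0 \<and> (\<forall>b\<in>Basis. W b x = 0))
      \<and> (\<Sum>b\<in>Basis. hn ?U (W b)) + hn ?U r \<le> C * norm Q
      \<and> norm (cls ?U (\<lambda>x. dv W x - r x) - Q) \<le> norm Q / 2)"
    using divergence_with_remainder[OF ac] by (elim exE conjE) (rule that, assumption, blast)
  have "norm (cls ?U (partial_dir k (v i)))
      \<le> (6 * C) * ((\<Sum>i\<in>Basis. norm (cls ?U (v i))) + (\<Sum>i\<in>Basis. \<Sum>j\<in>Basis. norm (cls ?U (sg v i j))))"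
    if vB: "\<forall>i\<in>Basis. smooth_fun (v i)" and i: "i \<in> Basis" and k: "k \<in> Basis" for v i k
  proof -
    note v = bspec[OF vB]
    define p where "p = partial_dir k (v i)"
    have sp: "smooth_fun p" unfolding p_def by (intro smooth_partial v i k)
    define Q where "Q = cls ?U p"
    define S where "S = (\<Sum>i\<in>Basis. \<Sum>j\<in>Basis. norm (cls ?U (sg v i j)))"
    define N where "N = (\<Sum>i\<in>Basis. norm (cls ?U (v i)))"
    have S0: "S \<ge> 0" "N \<ge> 0" unfolding S_def N_def by (auto intro!: sum_nonneg)
    have nS: "norm (cls ?U (sg v m n)) \<le> S" if "m \<in> Basis" "n \<in> Basis" for m n
    proof -
      have "norm (cls ?U (sg v m n)) \<le> (\<Sum>j\<in>Basis. norm (cls ?U (sg v m j)))"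
        using that by (intro member_le_sum) auto
      also have "... \<le> S" unfolding S_def using that by (intro member_le_sum) (auto intro: sum_nonneg)
      finally show ?thesis .
    qed
    have nN: "norm (cls ?U (v i)) \<le> N" unfolding N_def using i by (intro member_le_sum) auto
    have "restr ?U Q = Q" unfolding Q_def by (rule restr_idem[OF U(1) L[OF sp]])
    from core[OF this] obtain W r where WR: "(\<forall>b\<in>Basis. smooth_fun (W b)) \<and> smooth_fun r
      \<and> (\<forall>x\<in>cbox a c. \<forall>i\<in>Basis. x \<bullet> i = a \<bullet> i \<or> x \<bullet> i = c \<bullet> i \<longrightarrow> r x = 0 \<and> (\<forall>b\<in>Basis. W b x = 0))
      \<and> (\<Sum>b\<in>Basis. hn ?U (W b)) + hn ?U r \<le> C * norm Q
      \<and> norm (cls ?U (\<lambda>x. dv W x - r x) - Q) \<le> norm Q / 2" by (elim exE) (rule that)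
    have W: "\<And>b. b \<in> Basis \<Longrightarrow> smooth_fun (W b)" and r: "smooth_fun r"
      and bd: "(\<Sum>b\<in>Basis. hn ?U (W b)) + hn ?U r \<le> C * norm Q"
      and app: "norm (cls ?U (\<lambda>x. dv W x - r x) - Q) \<le> norm Q / 2" using WR by simp_all
    have r0: "r x = 0" if "x \<in> cbox a c" "m \<in> Basis" "x \<bullet> m = a \<bullet> m \<or> x \<bullet> m = c \<bullet> m" for x m
      using WR that by blast
    have W0: "W b x = 0" if "b \<in> Basis" "x \<in> cbox a c" "m \<in> Basis" "x \<bullet> m = a \<bullet> m \<or> x \<bullet> m = c \<bullet> m" for b x m
      using WR that by blast
    have "0 \<le> (\<Sum>b\<in>Basis. hn ?U (W b))" by (intro sum_nonneg hn_nonneg)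
    then have bW: "(\<Sum>b\<in>Basis. hn ?U (W b)) \<le> C * norm Q" and br: "hn ?U r \<le> C * norm Q"
      using bd hn_nonneg[of ?U r] by linarith+
    \<comment> \<open>r vanishes on the boundary, so the derivative moves from v to r; this is where
      the L2 norm of v enters the inequality.\<close>
    have term_r: "\<bar>inner Q (cls ?U r)\<bar> \<le> N * (C * norm Q)"
    proof -
      have "inner (cls ?U r) Q = - inner (cls ?U (partial_dir k r)) (cls ?U (v i))"
      proof -
        have "inner (cls ?U (v i)) (cls ?U (partial_dir k r)) = - inner (cls ?U p) (cls ?U r)"
          unfolding p_def by (rule ibp_box[OF v[OF i] r k]) (use r0 k in blast)
        then show ?thesis by (simp add: Q_def inner_commute)
      qed
      then have "\<bar>inner Q (cls ?U r)\<bar> \<le> norm (cls ?U (partial_dir k r)) * norm (cls ?U (v i))"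
        using Cauchy_Schwarz_ineq2[of "cls ?U (partial_dir k r)" "cls ?U (v i)"] by (simp add: inner_commute)
      also have "... \<le> (C * norm Q) * N"
        using order_trans[OF norm_cls_partial_le_hn[OF k] br] nN C by (intro mult_mono) auto
      finally show ?thesis by (simp add: mult.commute)
    qed
    \<comment> \<open>One integration by parts puts the derivative on Q, where the identity for
      second derivatives replaces it by three strain derivatives; a second one returns these
      derivatives to W.\<close>
    have term_W: "\<bar>inner Q (cls ?U (partial_dir j (W j)))\<bar> \<le> 3 * S * hn ?U (W j)" if j: "j \<in> Basis" for j
    proof -
      note s = smooth_sg[OF vB]
      have D: "inner (cls ?U (sg v m n)) (cls ?U (partial_dir l (W j)))
          = - inner (cls ?U (partial_dir l (sg v m n))) (cls ?U (W j))" if "m \<in> Basis" "n \<in> Basis" "l \<in> Basis" for m n l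
        by (rule ibp_box[OF s[OF that(1,2)] W[OF j] that(3)]) (use W0[OF j] that(3) in blast)
      have "inner Q (cls ?U (partial_dir j (W j))) = - inner (cls ?U (partial_dir j p)) (cls ?U (W j))"
        unfolding Q_def by (rule ibp_box[OF sp W[OF j] j]) (use W0[OF j] j in blast)
      also have "cls ?U (partial_dir j p) = cls ?U (partial_dir j (sg v i k)) + cls ?U (partial_dir k (sg v i j)) - cls ?U (partial_dir i (sg v j k))"
      proof -
        have "partial_dir j p = (\<lambda>x. partial_dir j (sg v i k) x + partial_dir k (sg v i j) x - partial_dir i (sg v j k) x)"
          unfolding p_def using second_derivative_sg[OF vB i j k] by (rule ext)
        then show ?thesis
          by (simp add: cls_add cls_diff Lsq_add U L smooth_partial s i j k)
      qed
      finally have "inner Q (cls ?U (partial_dir j (W j))) = inner (cls ?U (sg v i k)) (cls ?U (partial_dir j (W j)))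
          + inner (cls ?U (sg v i j)) (cls ?U (partial_dir k (W j))) - inner (cls ?U (sg v j k)) (cls ?U (partial_dir i (W j)))"
        using D[OF i k j] D[OF i j k] D[OF j k i] by (simp add: inner_add_left inner_diff_left)
      moreover have cs: "\<bar>inner (cls ?U (sg v m n)) (cls ?U (partial_dir l (W j)))\<bar> \<le> S * hn ?U (W j)"
        if "m \<in> Basis" "n \<in> Basis" "l \<in> Basis" for m n l
        by (rule order_trans[OF Cauchy_Schwarz_ineq2])
          (intro mult_mono nS norm_cls_partial_le_hn that S0 norm_ge_zero)
      ultimately show ?thesis
        using cs[OF i k j] cs[OF i j k] cs[OF j k i] by linarith
    qed
    have dvW: "cls ?U (\<lambda>x. dv W x - r x) = (\<Sum>j\<in>Basis. cls ?U (partial_dir j (W j))) - cls ?U r"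
    proof -
      have "cls ?U (dv W) = (\<Sum>j\<in>Basis. cls ?U (partial_dir j (W j)))"
        unfolding dv_def[abs_def] by (rule conjunct2[OF cls_sum]) (auto intro!: L smooth_partial W)
      then show ?thesis by (simp add: cls_diff U L smooth_dv W r)
    qed
    have "\<bar>inner Q (\<Sum>j\<in>Basis. cls ?U (partial_dir j (W j)))\<bar> \<le> (\<Sum>j\<in>Basis. \<bar>inner Q (cls ?U (partial_dir j (W j)))\<bar>)"
      unfolding inner_sum_right by (rule sum_abs)
    also have "... \<le> (\<Sum>j\<in>Basis. 3 * S * hn ?U (W j))" by (rule sum_mono[OF term_W])
    also have "... = 3 * S * (\<Sum>j\<in>Basis. hn ?U (W j))" by (rule sum_distrib_left[symmetric])
    also have "... \<le> 3 * S * (C * norm Q)" by (rule mult_left_mono[OF bW]) (use S0 in simp)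
    finally have t1: "\<bar>inner Q (\<Sum>j\<in>Basis. cls ?U (partial_dir j (W j)))\<bar> \<le> 3 * S * (C * norm Q)" .
    have t2: "\<bar>inner Q (cls ?U (\<lambda>x. dv W x - r x) - Q)\<bar> \<le> norm Q * (norm Q / 2)"
      by (rule order_trans[OF Cauchy_Schwarz_ineq2 mult_left_mono[OF app norm_ge_zero]])
    have "(norm Q)\<^sup>2 = inner Q (\<Sum>j\<in>Basis. cls ?U (partial_dir j (W j))) - inner Q (cls ?U r)
        - inner Q (cls ?U (\<lambda>x. dv W x - r x) - Q)"
      unfolding dvW by (simp add: power2_norm_eq_inner inner_diff_right)
    then have "(norm Q)\<^sup>2 \<le> 3 * S * (C * norm Q) + N * (C * norm Q) + norm Q * (norm Q / 2)"
      using t1 t2 term_r by linarith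
    then have "norm Q * norm Q \<le> norm Q * (2 * C * (3 * S + N))"
      by (simp add: power2_eq_square algebra_simps)
    then have "norm Q \<le> 2 * C * (3 * S + N)"
      using C S0 by (cases "norm Q = 0") (auto intro!: mult_nonneg_nonneg add_nonneg_nonneg)
    also have "... \<le> (6 * C) * (N + S)" using mult_nonneg_nonneg[OF C S0(2)] by (simp add: algebra_simps)
    finally show ?thesis unfolding Q_def p_def N_def S_def .
  qed
  then show ?thesis using C by (intro exI[of _ "6 * C"]) simp
qed

section \<open>The divergence on fields with one free face\<close>

lemma antider_lower: "x \<bullet> b = a \<Longrightarrow> antider b a f x = 0"
  by (simp add: antider_def)

text \<open>A Poincare inequality with a free upper end: the weight k vanishes on the upper face,
  where u need not. Integrating by parts against \<open>k x * u x\<close> shows that the squared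
  norm of u is twice the inner product of u with \<open>k x * f x\<close>.\<close>

lemma antider_bound:
  fixes a c :: "'a::euclidean_space"
  assumes f: "smooth_fun f" and b: "b \<in> Basis" and ac: "a \<bullet> b < c \<bullet> b"
  shows "norm (cls (box a c) (antider b (a \<bullet> b) f)) \<le> 2 * (c \<bullet> b - a \<bullet> b) * norm (cls (box a c) f)"
proof -
  let ?U = "box a c" and ?l = "c \<bullet> b - a \<bullet> b"
  have U: "?U \<in> sets lebesgue" "bounded ?U" by auto
  have L: "Lsq ?U g" if "smooth_fun g" for g using that U by (intro Lsq_smooth)
  define u where "u = antider b (a \<bullet> b) f"
  have su: "smooth_fun u" unfolding u_def by (rule smooth_antider[OF f b])
  have pu: "partial_dir b u = f" unfolding u_def by (simp add: partial_antider[OF f b b])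
  define k where "k x = c \<bullet> b + - 1 * (x \<bullet> b)" for x
  have sk: "smooth_fun k" unfolding k_def[abs_def] by (intro smooth_add smooth_const smooth_cmult smooth_inner)
  have pk: "partial_dir b k = (\<lambda>x. - 1)"
  proof (intro ext partial_dir_eqI)
    fix x
    show "((\<lambda>t. k (x + t *\<^sub>R b)) has_real_derivative - 1) (at 0)"
      unfolding k_def using b by (auto intro!: derivative_eq_intros simp: inner_add_left)
  qed
  have ku: "smooth_fun (\<lambda>x. k x * u x)" by (intro smooth_mult sk su)
  have "inner (cls ?U u) (cls ?U (partial_dir b (\<lambda>x. k x * u x))) = - inner (cls ?U (partial_dir b u)) (cls ?U (\<lambda>x. k x * u x))"
    by (rule ibp_box[OF su ku b]) (auto simp: k_def u_def antider_lower)
  moreover have "cls ?U (partial_dir b (\<lambda>x. k x * u x)) = - cls ?U u + cls ?U (\<lambda>x. k x * f x)"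
  proof -
    have "partial_dir b (\<lambda>x. k x * u x) = (\<lambda>x. k x * f x - u x)"
      unfolding partial_mult[OF sk su b] pk pu by auto
    then show ?thesis by (simp add: cls_diff U L smooth_mult sk f su)
  qed
  moreover have "inner (cls ?U f) (cls ?U (\<lambda>x. k x * u x)) = inner (cls ?U u) (cls ?U (\<lambda>x. k x * f x))"
    unfolding inner_cls_integral[OF U(1) L[OF f] L[OF ku]]
      inner_cls_integral[OF U(1) L[OF su] L[OF smooth_mult[OF sk f]]]
    by (simp add: mult_ac)
  ultimately have "(norm (cls ?U u))\<^sup>2 = 2 * inner (cls ?U u) (cls ?U (\<lambda>x. k x * f x))"
    unfolding pu by (simp add: power2_norm_eq_inner inner_add_right inner_diff_right)
  also have "... \<le> 2 * (norm (cls ?U u) * norm (cls ?U (\<lambda>x. k x * f x)))"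
    using norm_cauchy_schwarz[of "cls ?U u" "cls ?U (\<lambda>x. k x * f x)"] by simp
  also have "... \<le> 2 * (norm (cls ?U u) * (?l * norm (cls ?U f)))"
  proof -
    have "\<bar>k x\<bar> \<le> ?l" if "x \<in> ?U" for x
    proof -
      have "a \<bullet> b < x \<bullet> b" "x \<bullet> b < c \<bullet> b" using that b by (auto simp: mem_box)
      then show ?thesis by (simp add: k_def)
    qed
    then have "norm (cls ?U (\<lambda>x. k x * f x)) \<le> ?l * norm (cls ?U f)"
      using Lsq_mult_bounded[OF U(1) L[OF f] smooth_continuous[OF sk], of ?l] ac by simp
    then show ?thesis by (intro mult_left_mono) auto
  qed
  finally have "norm (cls ?U u) * norm (cls ?U u) \<le> norm (cls ?U u) * (2 * ?l * norm (cls ?U f))"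
    by (simp add: power2_eq_square algebra_simps)
  then show ?thesis unfolding u_def[symmetric]
    using ac by (cases "norm (cls ?U u) = 0") auto
qed

theorem divergence_free_face:
  fixes a c :: "'a::euclidean_space"
  assumes ac: "\<forall>b\<in>Basis. a \<bullet> b < c \<bullet> b" and e: "e \<in> Basis"
  shows "\<exists>C\<ge>0. \<forall>Q. restr (box a c) Q = Q \<longrightarrow>
    (\<exists>V. (\<forall>b\<in>Basis. smooth_fun (V b))
      \<and> (\<forall>x\<in>cbox a c. \<forall>i\<in>Basis. x \<bullet> i = a \<bullet> i \<or> x \<bullet> i = c \<bullet> i \<and> i \<noteq> e \<longrightarrow> (\<forall>b\<in>Basis. V b x = 0))
      \<and> (\<Sum>b\<in>Basis. hn (box a c) (V b)) \<le> C * norm Q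
      \<and> norm (cls (box a c) (dv V) - Q) \<le> norm Q / 2)"
proof -
  let ?U = "box a c"
  have U: "?U \<in> sets lebesgue" "bounded ?U" by auto
  obtain C where C: "C \<ge> 0" and core: "\<And>Q. restr ?U Q = Q \<Longrightarrow>
    (\<exists>W r. (\<forall>b\<in>Basis. smooth_fun (W b)) \<and> smooth_fun r
      \<and> (\<forall>x\<in>cbox a c. \<forall>i\<in>Basis. x \<bullet> i = a \<bullet> i \<or> x \<bullet> i = c \<bullet> i \<longrightarrow> r x = 0 \<and> (\<forall>b\<in>Basis. W b x = 0))
      \<and> (\<Sum>b\<in>Basis. hn ?U (W b)) + hn ?U r \<le> C * norm Q
      \<and> norm (cls ?U (\<lambda>x. dv W x - r x) - Q) \<le> norm Q / 2)"
    using divergence_with_remainder[OF ac] by (elim exE conjE) (rule that, assumption, blast)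
  define l where "l = c \<bullet> e - a \<bullet> e"
  have l: "l > 0" using bspec[OF ac e] by (simp add: l_def)
  have "\<exists>V. (\<forall>b\<in>Basis. smooth_fun (V b))
      \<and> (\<forall>x\<in>cbox a c. \<forall>i\<in>Basis. x \<bullet> i = a \<bullet> i \<or> x \<bullet> i = c \<bullet> i \<and> i \<noteq> e \<longrightarrow> (\<forall>b\<in>Basis. V b x = 0))
      \<and> (\<Sum>b\<in>Basis. hn ?U (V b)) \<le> ((2 * l + 1) * C) * norm Q
      \<and> norm (cls ?U (dv V) - Q) \<le> norm Q / 2" if Q: "restr ?U Q = Q" for Q
  proof -
    from core[OF Q] obtain W r where WR: "(\<forall>b\<in>Basis. smooth_fun (W b)) \<and> smooth_fun r
      \<and> (\<forall>x\<in>cbox a c. \<forall>i\<in>Basis. x \<bullet> i = a \<bullet> i \<or> x \<bullet> i = c \<bullet> i \<longrightarrow> r x = 0 \<and> (\<forall>b\<in>Basis. W b x = 0))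
      \<and> (\<Sum>b\<in>Basis. hn ?U (W b)) + hn ?U r \<le> C * norm Q
      \<and> norm (cls ?U (\<lambda>x. dv W x - r x) - Q) \<le> norm Q / 2" by (elim exE) (rule that)
    have W: "\<And>b. b \<in> Basis \<Longrightarrow> smooth_fun (W b)" and r: "smooth_fun r"
      and bd: "(\<Sum>b\<in>Basis. hn ?U (W b)) + hn ?U r \<le> C * norm Q"
      and app: "norm (cls ?U (\<lambda>x. dv W x - r x) - Q) \<le> norm Q / 2" using WR by simp_all
    have r0: "r x = 0" if "x \<in> cbox a c" "m \<in> Basis" "x \<bullet> m = a \<bullet> m \<or> x \<bullet> m = c \<bullet> m" for x m
      using WR that by blast
    have W0: "W b x = 0" if "b \<in> Basis" "x \<in> cbox a c" "m \<in> Basis" "x \<bullet> m = a \<bullet> m \<or> x \<bullet> m = c \<bullet> m" for b x m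
      using WR that by blast
    define u where "u = antider e (a \<bullet> e) r"
    have su: "smooth_fun u" unfolding u_def by (rule smooth_antider[OF r e])
    define V where "V b = (if b = e then (\<lambda>x. W b x + - 1 * u x) else W b)" for b
    have sV: "smooth_fun (V b)" if "b \<in> Basis" for b
      using that unfolding V_def by (auto intro!: smooth_diff W su)
    \<comment> \<open>On a lateral face the segment of integration stays inside that face, where r
      vanishes; on the lower face in direction e it has length 0. The upper face in direction e is
      left free.\<close>
    have u0: "u x = 0" if x: "x \<in> cbox a c" and i: "i \<in> Basis" and face: "x \<bullet> i = a \<bullet> i \<or> x \<bullet> i = c \<bullet> i \<and> i \<noteq> e" for x i
    proof (cases "i = e")
      case True
      then show ?thesis using face unfolding u_def by (intro antider_lower) auto
    next
      case False
      have "r (rc e s (a \<bullet> e - s * (a \<bullet> e)) x) = 0" if s: "s \<in> {0..1}" for s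
      proof (rule r0[OF _ i])
        let ?y = "rc e s (a \<bullet> e - s * (a \<bullet> e)) x"
        have ae: "a \<bullet> e \<le> x \<bullet> e" "x \<bullet> e \<le> c \<bullet> e" using x e by (auto simp: mem_box)
        define z where "z = s * (x \<bullet> e - a \<bullet> e)"
        have ye: "?y \<bullet> e = a \<bullet> e + z" using rc_inner[OF e e] by (simp add: z_def algebra_simps)
        have "z \<le> 1 * (x \<bullet> e - a \<bullet> e)"
          unfolding z_def using s ae by (intro mult_right_mono) auto
        moreover have "0 \<le> z" unfolding z_def using s ae by simp
        ultimately have y: "a \<bullet> e \<le> ?y \<bullet> e" "?y \<bullet> e \<le> c \<bullet> e" using ae ye by simp_all
        show "?y \<in> cbox a c" unfolding mem_box
        proof
          fix j :: 'a assume j: "j \<in> Basis"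
          show "a \<bullet> j \<le> ?y \<bullet> j \<and> ?y \<bullet> j \<le> c \<bullet> j"
          proof (cases "j = e")
            case False
            then show ?thesis using rc_inner[OF e j] x j by (auto simp: mem_box)
          qed (use y in simp)
        qed
        show "?y \<bullet> i = a \<bullet> i \<or> ?y \<bullet> i = c \<bullet> i" using rc_inner[OF e i] False face by auto
      qed
      then have "integral {0..1} (\<lambda>s. r (rc e s (a \<bullet> e - s * (a \<bullet> e)) x)) = integral {0..1} (\<lambda>s::real. 0::real)"
        by (rule Henstock_Kurzweil_Integration.integral_cong)
      then show ?thesis by (simp add: u_def antider_def)
    qed
    have V0: "V b x = 0" if "b \<in> Basis" "x \<in> cbox a c" "i \<in> Basis" "x \<bullet> i = a \<bullet> i \<or> x \<bullet> i = c \<bullet> i \<and> i \<noteq> e" for b x i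
      using W0[OF that(1-3)] u0[OF that(2-4)] that(4) by (auto simp: V_def)
    \<comment> \<open>The derivative of u along e is r itself, and along another direction it is the
      antiderivative of a derivative of r; so a first-order bound on r gives one on u.\<close>
    have hu: "hn ?U u \<le> (2 * l + 1) * hn ?U r"
    proof -
      have p: "norm (cls ?U (partial_dir b u)) \<le> (if b = e then norm (cls ?U r) else 0) + 2 * l * norm (cls ?U (partial_dir b r))" if b: "b \<in> Basis" for b
      proof (cases "b = e")
        case True
        then show ?thesis using partial_antider[OF r e e] l by (simp add: u_def)
      next
        case False
        then show ?thesis
          using partial_antider[OF r e b] antider_bound[OF smooth_partial[OF r b] e bspec[OF ac e]] by (simp add: u_def l_def)
      qed
      have "(\<Sum>b\<in>Basis. norm (cls ?U (partial_dir b u)))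
          \<le> (\<Sum>b\<in>Basis. (if b = e then norm (cls ?U r) else 0) + 2 * l * norm (cls ?U (partial_dir b r)))"
        by (rule sum_mono[OF p])
      also have "... = norm (cls ?U r) + 2 * l * (\<Sum>b\<in>Basis. norm (cls ?U (partial_dir b r)))"
        using e by (simp add: sum.distrib sum_distrib_left)
      finally have "hn ?U u \<le> 2 * l * norm (cls ?U r) + (norm (cls ?U r) + 2 * l * (\<Sum>b\<in>Basis. norm (cls ?U (partial_dir b r))))"
        unfolding hn_def[of ?U u] using antider_bound[OF r e bspec[OF ac e]] by (simp add: u_def l_def)
      also have "... = 2 * l * hn ?U r + norm (cls ?U r)" unfolding hn_def by (simp add: algebra_simps)
      also have "... \<le> (2 * l + 1) * hn ?U r" using norm_cls_le_hn[of ?U r] by (simp add: distrib_right)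
      finally show ?thesis .
    qed
    have hneg: "hn ?U (\<lambda>x. - 1 * u x) = hn ?U u"
    proof -
      have "cls ?U (\<lambda>x. - 1 * g x) = - cls ?U g" if "smooth_fun g" for g
        using cls_scale[OF U(1) Lsq_smooth[OF that U(2,1)], of "-1"] by simp
      then show ?thesis unfolding hn_def
        using su by (simp add: partial_cmult[OF su, of _ "-1", simplified] smooth_partial)
    qed
    have hV: "hn ?U (V b) \<le> hn ?U (W b) + (if b = e then hn ?U u else 0)" if b: "b \<in> Basis" for b
      using hn_add[OF W[OF b] smooth_cmult[OF su, of "-1"] U(2,1)] hneg by (auto simp: V_def)
    have "(\<Sum>b\<in>Basis. hn ?U (V b)) \<le> (\<Sum>b\<in>Basis. hn ?U (W b) + (if b = e then hn ?U u else 0))"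
      by (rule sum_mono[OF hV])
    also have "... = (\<Sum>b\<in>Basis. hn ?U (W b)) + hn ?U u" using e by (simp add: sum.distrib)
    also have "... \<le> (2 * l + 1) * ((\<Sum>b\<in>Basis. hn ?U (W b)) + hn ?U r)"
    proof -
      have "0 \<le> (\<Sum>b\<in>Basis. hn ?U (W b))" by (intro sum_nonneg hn_nonneg)
      then have "0 \<le> l * (2 * (\<Sum>b\<in>Basis. hn ?U (W b)))" using l by simp
      then show ?thesis using hu by (simp add: algebra_simps)
    qed
    also have "... \<le> (2 * l + 1) * (C * norm Q)" using bd l by (intro mult_left_mono) auto
    finally have B: "(\<Sum>b\<in>Basis. hn ?U (V b)) \<le> ((2 * l + 1) * C) * norm Q" by (simp add: mult.assoc)
    have "dv V = (\<lambda>x. dv W x - r x)"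
    proof
      fix x
      have pe: "partial_dir e (V e) x = partial_dir e (W e) x - r x"
        using partial_add[OF W[OF e] smooth_cmult[OF su, of "-1"] e] partial_cmult[OF su e, of "-1"] partial_antider[OF r e e]
        by (simp add: V_def u_def)
      have "dv V x = partial_dir e (V e) x + (\<Sum>b\<in>Basis - {e}. partial_dir b (V b) x)"
        unfolding dv_def using e by (subst sum.remove[of _ e]) auto
      also have "... = partial_dir e (W e) x + (\<Sum>b\<in>Basis - {e}. partial_dir b (W b) x) - r x"
        unfolding pe by (simp add: V_def)
      also have "... = dv W x - r x" unfolding dv_def using e by (subst sum.remove[of Basis e]) auto
      finally show "dv V x = dv W x - r x" .
    qed
    then have "norm (cls ?U (dv V) - Q) \<le> norm Q / 2" using app by (simp only:)
    then show ?thesis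
      by (intro exI[of _ V] conjI ballI impI sV V0 B) assumption+
  qed
  moreover have "(2 * l + 1) * C \<ge> 0" using l C by simp
  ultimately show ?thesis by blast
qed

section \<open>The trace on the interface\<close>

lemma prod_Basis_vec: "(\<Prod>b\<in>(Basis :: (real^'n) set). f b) = (\<Prod>i\<in>UNIV. f (axis i 1))"
proof -
  have B: "(Basis :: (real^'n) set) = range (\<lambda>i. axis i 1)" by (auto simp: Basis_vec_def)
  have i: "inj (\<lambda>i. axis i 1 :: real^'n)" by (auto simp: inj_on_def axis_eq_axis)
  show ?thesis unfolding B prod.reindex[OF i] o_def ..
qed

lemma sum_Basis_vec: "(\<Sum>b\<in>(Basis :: (real^'n) set). f b) = (\<Sum>i\<in>UNIV. f (axis i 1))"
proof -
  have B: "(Basis :: (real^'n) set) = range (\<lambda>i. axis i 1)" by (auto simp: Basis_vec_def)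
  have i: "inj (\<lambda>i. axis i 1 :: real^'n)" by (auto simp: inj_on_def axis_eq_axis)
  show ?thesis unfolding B sum.reindex[OF i] o_def ..
qed

lemma fz_eq: "fz s y = (y $ 1) *\<^sub>R axis 1 1 + (y $ 2) *\<^sub>R axis 2 1 + s *\<^sub>R axis 3 1"
  by (simp add: fz_def vec_eq_iff forall_3 axis_def)

lemma fz_nth: "fz s y $ 1 = y $ 1" "fz s y $ 2 = y $ 2" "fz s y $ 3 = s"
  by (simp_all add: fz_def)

lemma fz_measurable: "(\<lambda>(y, s). fz s y) \<in> borel_measurable (lborel \<Otimes>\<^sub>M lborel)"
proof -
  have "continuous_on UNIV (\<lambda>p :: (real^2) \<times> real. fz (snd p) (fst p))"
    unfolding fz_eq by (intro continuous_intros)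
  then have "(\<lambda>p :: (real^2) \<times> real. fz (snd p) (fst p)) \<in> borel_measurable borel"
    by (rule borel_measurable_continuous_onI)
  then show ?thesis by (simp add: split_beta' lborel_prod)
qed

text \<open>Slicing space by horizontal planes preserves volume, in the parametrisation
  \<open>fz\<close> that the traces use; this prepares Fubini's theorem over the interface.\<close>

lemma lborel_fz: "distr (lborel \<Otimes>\<^sub>M lborel) borel (\<lambda>(y, s). fz s y) = lborel"
proof (rule lborel_eqI[symmetric])
  fix l u :: "real^3" assume lu: "\<And>b. b \<in> Basis \<Longrightarrow> l \<bullet> b \<le> u \<bullet> b"
  have le: "l $ i \<le> u $ i" for i
    using lu[of "axis i 1"] by (simp add: inner_axis)
  let ?l = "vector [l $ 1, l $ 2] :: real^2" and ?u = "vector [u $ 1, u $ 2] :: real^2"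
  have pre: "(\<lambda>(y, s). fz s y) -` box l u \<inter> space (lborel \<Otimes>\<^sub>M lborel) = box ?l ?u \<times> {l $ 3 <..< u $ 3}"
  proof (rule set_eqI)
    fix p :: "(real^2) \<times> real"
    show "p \<in> (\<lambda>(y, s). fz s y) -` box l u \<inter> space (lborel \<Otimes>\<^sub>M lborel) \<longleftrightarrow> p \<in> box ?l ?u \<times> {l $ 3 <..< u $ 3}"
      by (cases p) (simp add: mem_box_cart forall_3 forall_2 fz_nth space_pair_measure conj_ac)
  qed
  have "emeasure (distr (lborel \<Otimes>\<^sub>M lborel) borel (\<lambda>(y, s). fz s y)) (box l u)
      = emeasure (lborel \<Otimes>\<^sub>M lborel) (box ?l ?u \<times> {l $ 3 <..< u $ 3})"
    unfolding pre[symmetric] by (rule emeasure_distr[OF fz_measurable]) simp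
  also have "... = emeasure lborel (box ?l ?u) * emeasure lborel {l $ 3 <..< u $ 3}"
    by (rule lborel.emeasure_pair_measure_Times) simp_all
  also have "emeasure lborel (box ?l ?u) = ennreal ((u $ 1 - l $ 1) * (u $ 2 - l $ 2))"
  proof -
    have "?l $ i \<le> ?u $ i" for i using le exhaust_2[of i] by auto
    then have "?l \<bullet> b \<le> ?u \<bullet> b" if "b \<in> Basis" for b
      using that by (auto simp: Basis_vec_def inner_axis)
    then have "emeasure lborel (box ?l ?u) = (\<Prod>b\<in>Basis. (?u - ?l) \<bullet> b)" by (rule emeasure_lborel_box)
    then have "emeasure lborel (box ?l ?u) = ennreal (\<Prod>i\<in>UNIV. (?u - ?l) \<bullet> axis i 1)" unfolding prod_Basis_vec .
    also have "(\<Prod>i\<in>UNIV. (?u - ?l) \<bullet> axis i 1) = (u $ 1 - l $ 1) * (u $ 2 - l $ 2)"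
      unfolding UNIV_2 by (simp add: inner_axis)
    finally show ?thesis .
  qed
  also have "ennreal ((u $ 1 - l $ 1) * (u $ 2 - l $ 2)) * emeasure lborel {l $ 3 <..< u $ 3}
      = ennreal ((u $ 1 - l $ 1) * (u $ 2 - l $ 2) * (u $ 3 - l $ 3))"
    using le[of 1] le[of 2] le[of 3] by (subst emeasure_lborel_Ioo) (simp_all flip: ennreal_mult)
  also have "(u $ 1 - l $ 1) * (u $ 2 - l $ 2) * (u $ 3 - l $ 3) = (\<Prod>b\<in>Basis. (u - l) \<bullet> b)"
    unfolding prod_Basis_vec UNIV_3 by (simp add: inner_axis mult.assoc)
  finally show "emeasure (distr (lborel \<Otimes>\<^sub>M lborel) borel (\<lambda>(y, s). fz s y)) (box l u) = (\<Prod>b\<in>Basis. (u - l) \<bullet> b)" .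
qed simp

lemma OmP_fz: "fz s y \<in> OmP L1 L2 L3 \<longleftrightarrow> y \<in> Sig L1 L2 \<and> 0 < s \<and> s < L3"
  by (auto simp: OmP_def Sig_def mem_box_cart forall_3 forall_2 fz_nth)

lemma Om_facts:
  "OmP L1 L2 L3 \<in> sets lebesgue" "bounded (OmP L1 L2 L3)" "open (OmP L1 L2 L3)"
  "OmM L1 L2 L3 \<in> sets lebesgue" "bounded (OmM L1 L2 L3)" "open (OmM L1 L2 L3)"
  "OmPM L1 L2 L3 \<in> sets lebesgue" "bounded (OmPM L1 L2 L3)" "open (OmPM L1 L2 L3)"
  "Sig L1 L2 \<in> sets lebesgue" "bounded (Sig L1 L2)" "open (Sig L1 L2)"
  "OmP L1 L2 L3 \<subseteq> OmPM L1 L2 L3" "OmM L1 L2 L3 \<subseteq> OmPM L1 L2 L3"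
  by (auto simp: OmP_def OmM_def OmPM_def Sig_def intro: bounded_Un[THEN iffD2])

lemma smooth_restrict_fz: "continuous_on UNIV f \<Longrightarrow> continuous_on UNIV (\<lambda>y. f (fz s y))"
  unfolding fz_eq by (rule continuous_on_compose2[of UNIV f]) (auto intro!: continuous_intros)

text \<open>The fundamental theorem of calculus along vertical lines for
  \<open>\<psi> x * (\<phi> x * \<phi> x)\<close>, with \<psi> falling linearly from 1 on the
  interface to 0 on top. The slope of \<psi> gives \<open>1 / L3\<close>, the product rule gives the
  2.\<close>

lemma trace_inequality:
  assumes \<phi>: "smooth_fun \<phi>" and L3: "L3 > 0"
  shows "(norm (cls (Sig L1 L2) (\<lambda>y. \<phi> (fz 0 y))))\<^sup>2 \<le> (1 / L3 + 2) * (hn (OmP L1 L2 L3) \<phi>)\<^sup>2"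
proof -
  let ?U = "OmP L1 L2 L3" and ?S = "Sig L1 L2" and ?e = "axis 3 1 :: real^3"
  have e: "?e \<in> Basis" by (auto simp: Basis_vec_def)
  have L: "Lsq ?U g" if "smooth_fun g" for g using that Om_facts by (intro Lsq_smooth)
  define \<psi> where "\<psi> x = 1 + (- 1 / L3) * (x \<bullet> ?e)" for x
  have s\<psi>: "smooth_fun \<psi>" unfolding \<psi>_def[abs_def] by (intro smooth_add smooth_const smooth_cmult smooth_inner)
  have p\<psi>: "partial_dir ?e \<psi> = (\<lambda>x. - 1 / L3)"
  proof (intro ext partial_dir_eqI)
    fix x
    show "((\<lambda>t. \<psi> (x + t *\<^sub>R ?e)) has_real_derivative - 1 / L3) (at 0)"
      unfolding \<psi>_def using e L3 by (auto intro!: derivative_eq_intros simp: inner_add_left)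
  qed
  define h where "h x = \<psi> x * (\<phi> x * \<phi> x)" for x
  have s2: "smooth_fun (\<lambda>x. \<phi> x * \<phi> x)" by (intro smooth_mult \<phi>)
  have sh: "smooth_fun h" unfolding h_def[abs_def] by (intro smooth_mult s\<psi> s2)
  define G where "G = partial_dir ?e h"
  have sG: "smooth_fun G" unfolding G_def by (rule smooth_partial[OF sh e])
  have G: "G x = - (1 / L3) * (\<phi> x * \<phi> x) + 2 * (\<psi> x * \<phi> x * partial_dir ?e \<phi> x)" for x
    unfolding G_def h_def[abs_def] partial_mult[OF s\<psi> s2 e] partial_mult[OF \<phi> \<phi> e] p\<psi> by (simp add: algebra_simps)
  have ftc: "integral\<^sup>L lborel (\<lambda>s. indicator {0<..<L3} s * G (fz s y)) = - (\<phi> (fz 0 y))\<^sup>2" for y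
  proof -
    define z where "z = fz 0 y"
    have line: "fz s y = z + s *\<^sub>R ?e" for s by (simp add: z_def fz_eq)
    have "integral\<^sup>L lborel (\<lambda>s. G (fz s y) * indicator {0..L3} s) = h (fz L3 y) - h (fz 0 y)"
    proof (rule integral_FTC_Icc_real)
      show "((\<lambda>s. h (fz s y)) has_real_derivative G (fz s y)) (at s)" for s
        unfolding line G_def by (rule smooth_line_deriv[OF sh e])
      have "continuous_on UNIV (\<lambda>s. G (fz s y))"
        unfolding line by (rule continuous_on_compose2[OF smooth_continuous[OF sG, of UNIV]]) (auto intro!: continuous_intros)
      then show "isCont (\<lambda>s. G (fz s y)) s" for s by (simp add: continuous_on_eq_continuous_at)
    qed (use L3 in simp)
    also have "integral\<^sup>L lborel (\<lambda>s. G (fz s y) * indicator {0..L3} s) = integral\<^sup>L lborel (\<lambda>s. indicator {0<..<L3} s * G (fz s y))"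
    proof (rule integral_cong_AE)
      have m: "(\<lambda>s. G (fz s y)) \<in> borel_measurable borel"
        unfolding line by (intro borel_measurable_continuous_onI continuous_on_compose2[OF smooth_continuous[OF sG, of UNIV]])
          (auto intro!: continuous_intros)
      show "(\<lambda>s. G (fz s y) * indicator {0..L3} s) \<in> borel_measurable lborel"
        "(\<lambda>s. indicator {0<..<L3} s * G (fz s y)) \<in> borel_measurable lborel"
        using m by auto
      have "AE s in lborel. s \<noteq> 0" "AE s in lborel. s \<noteq> L3" by (auto intro: AE_lborel_singleton)
      then show "AE s in lborel. G (fz s y) * indicator {0..L3} s = indicator {0<..<L3} s * G (fz s y)"
        by eventually_elim (auto simp: indicator_def)
    qed
    finally show ?thesis using L3 by (simp add: h_def \<psi>_def power2_eq_square fz_nth inner_axis)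
  qed
  define g where "g x = indicator ?U x * G x" for x
  have Gc: "continuous_on UNIV G" by (rule smooth_continuous[OF sG])
  have gm: "g \<in> borel_measurable borel"
    unfolding g_def using Gc Om_facts(3) by (intro borel_measurable_times borel_measurable_indicator borel_measurable_continuous_onI) auto
  have gi: "integrable lborel g"
  proof -
    have "integrable (lebesgue_on ?U) (\<lambda>x. 1 * G x)"
      by (intro Lsq_mult_integrable Om_facts L smooth_const sG)
    then have "integrable lebesgue (\<lambda>x. indicator ?U x *\<^sub>R G x)"
      by (subst (asm) integrable_restrict_space) (auto simp: Om_facts)
    then show ?thesis using gm by (simp add: g_def[abs_def] integrable_completion)
  qed
  have gfz: "g (fz s y) = indicator ?S y * (indicator {0<..<L3} s * G (fz s y))" for s y
    by (auto simp: g_def indicator_def OmP_fz)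
  have "integral\<^sup>L lborel g = integral\<^sup>L (lborel \<Otimes>\<^sub>M lborel) (\<lambda>(y, s). g (fz s y))"
    unfolding lborel_fz[symmetric] using fz_measurable gm by (subst integral_distr) (auto simp: split_beta')
  also have "... = integral\<^sup>L lborel (\<lambda>y. integral\<^sup>L lborel (\<lambda>s. g (fz s y)))"
  proof -
    have "integrable (distr (lborel \<Otimes>\<^sub>M lborel) borel (\<lambda>(y, s). fz s y)) g" using gi by (simp add: lborel_fz)
    then have "integrable (lborel \<Otimes>\<^sub>M lborel) (\<lambda>(y, s). g (fz s y))"
      using fz_measurable gm by (subst (asm) integrable_distr_eq) (auto simp: split_beta')
    from lborel_pair.integral_fst'[OF this] show ?thesis by simp
  qed
  also have "... = integral\<^sup>L lborel (\<lambda>y. indicator ?S y * - (\<phi> (fz 0 y))\<^sup>2)"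
    unfolding gfz by (simp add: ftc)
  finally have I: "integral\<^sup>L lborel (\<lambda>y. indicator ?S y * (\<phi> (fz 0 y))\<^sup>2) = - integral\<^sup>L lborel g" by simp
  have c: "continuous_on UNIV (\<lambda>y. \<phi> (fz 0 y))" by (rule smooth_restrict_fz[OF smooth_continuous[OF \<phi>]])
  then have LS: "Lsq ?S (\<lambda>y. \<phi> (fz 0 y))" using Om_facts by (intro Lsq_continuous)
  have "(norm (cls ?S (\<lambda>y. \<phi> (fz 0 y))))\<^sup>2 = integral\<^sup>L lebesgue (\<lambda>y. indicator ?S y * (\<phi> (fz 0 y))\<^sup>2)"
    unfolding power2_norm_eq_inner inner_cls_integral[OF Om_facts(10) LS LS]
    by (subst integral_restrict_space) (auto simp: Om_facts power2_eq_square)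
  also have "... = integral\<^sup>L lborel (\<lambda>y. indicator ?S y * (\<phi> (fz 0 y))\<^sup>2)"
  proof (rule integral_completion)
    have "(\<lambda>y. \<phi> (fz 0 y)) \<in> borel_measurable borel" by (rule borel_measurable_continuous_onI[OF c])
    moreover have "indicator ?S \<in> borel_measurable borel" using Om_facts(12) by (intro borel_measurable_indicator) auto
    ultimately show "(\<lambda>y. indicator ?S y * (\<phi> (fz 0 y))\<^sup>2) \<in> borel_measurable lborel"
      unfolding measurable_lborel2 by (intro borel_measurable_times borel_measurable_power)
  qed
  also have "... = - integral\<^sup>L lebesgue g" using I gm by (simp add: integral_completion)
  also have "integral\<^sup>L lebesgue g = integral\<^sup>L (lebesgue_on ?U) G"
    unfolding g_def by (subst integral_restrict_space) (auto simp: Om_facts)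
  also have "integral\<^sup>L (lebesgue_on ?U) G = - (1 / L3) * inner (cls ?U \<phi>) (cls ?U \<phi>)
      + 2 * inner (cls ?U (\<lambda>x. \<psi> x * \<phi> x)) (cls ?U (partial_dir ?e \<phi>))"
  proof -
    have 1: "integrable (lebesgue_on ?U) (\<lambda>x. \<phi> x * \<phi> x)"
      "integrable (lebesgue_on ?U) (\<lambda>x. \<psi> x * \<phi> x * partial_dir ?e \<phi> x)"
      by (intro Lsq_mult_integrable Om_facts L smooth_mult s\<psi> \<phi> smooth_partial e)+
    then have "integral\<^sup>L (lebesgue_on ?U) G = - (1 / L3) * integral\<^sup>L (lebesgue_on ?U) (\<lambda>x. \<phi> x * \<phi> x)
      + 2 * integral\<^sup>L (lebesgue_on ?U) (\<lambda>x. \<psi> x * \<phi> x * partial_dir ?e \<phi> x)"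
      unfolding G by (subst Bochner_Integration.integral_add) auto
    then show ?thesis
      by (simp add: inner_cls_integral Om_facts L smooth_mult s\<psi> \<phi> smooth_partial e)
  qed
  finally have N: "(norm (cls ?S (\<lambda>y. \<phi> (fz 0 y))))\<^sup>2 = (1 / L3) * (norm (cls ?U \<phi>))\<^sup>2
      - 2 * inner (cls ?U (\<lambda>x. \<psi> x * \<phi> x)) (cls ?U (partial_dir ?e \<phi>))"
    by (simp add: power2_norm_eq_inner)
  have "\<bar>\<psi> x\<bar> \<le> 1" if "x \<in> ?U" for x
  proof -
    have x: "0 < x $ 3" "x $ 3 < L3" using that by (auto simp: OmP_def mem_box_cart forall_3)
    then have "0 \<le> x $ 3 / L3" "x $ 3 / L3 \<le> 1" using L3 by auto
    then show ?thesis by (simp add: \<psi>_def inner_axis)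
  qed
  then have "norm (cls ?U (\<lambda>x. \<psi> x * \<phi> x)) \<le> 1 * norm (cls ?U \<phi>)"
    using Lsq_mult_bounded[OF Om_facts(1) L[OF \<phi>] smooth_continuous[OF s\<psi>], of 1] by simp
  then have "norm (cls ?U (\<lambda>x. \<psi> x * \<phi> x)) * norm (cls ?U (partial_dir ?e \<phi>)) \<le> hn ?U \<phi> * hn ?U \<phi>"
    using norm_cls_le_hn[of ?U \<phi>] norm_cls_partial_le_hn[OF e, of ?U \<phi>]
    by (intro mult_mono) (auto simp: hn_nonneg)
  then have "- inner (cls ?U (\<lambda>x. \<psi> x * \<phi> x)) (cls ?U (partial_dir ?e \<phi>)) \<le> (hn ?U \<phi>)\<^sup>2"
    using Cauchy_Schwarz_ineq2[of "cls ?U (\<lambda>x. \<psi> x * \<phi> x)" "cls ?U (partial_dir ?e \<phi>)"] by (simp add: power2_eq_square)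
  moreover have "(1 / L3) * (norm (cls ?U \<phi>))\<^sup>2 \<le> (1 / L3) * (hn ?U \<phi>)\<^sup>2"
    using L3 by (intro mult_left_mono power_mono norm_cls_le_hn) auto
  ultimately show ?thesis unfolding N distrib_right by linarith
qed

section \<open>Sobolev spaces as closed spaces of jets\<close>

lemma closure_subspace_image:
  fixes f :: "'x \<Rightarrow> 'y::real_normed_vector"
  assumes "\<exists>x. P x \<and> f x = 0" and "\<And>x y. P x \<Longrightarrow> P y \<Longrightarrow> \<exists>z. P z \<and> f z = f x + f y"
    and "\<And>c x. P x \<Longrightarrow> \<exists>z. P z \<and> f z = c *\<^sub>R f x"
  shows "subspace (closure (f ` {x. P x}))"
proof (rule subspace_closure)
  show "subspace (f ` {x. P x})"
    unfolding subspace_def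
  proof (intro conjI ballI allI)
    show "0 \<in> f ` {x. P x}" using assms(1) by force
    show "u + v \<in> f ` {x. P x}" if uv: "u \<in> f ` {x. P x}" "v \<in> f ` {x. P x}" for u v
    proof -
      obtain x y where "P x" "u = f x" "P y" "v = f y" using uv by auto
      then obtain z where "P z" "f z = u + v" using assms(2)[of x y] by auto
      then show ?thesis by (metis imageI mem_Collect_eq)
    qed
    show "c *\<^sub>R u \<in> f ` {x. P x}" if u: "u \<in> f ` {x. P x}" for c u
    proof -
      obtain x where "P x" "u = f x" using u by auto
      then obtain z where "P z" "f z = c *\<^sub>R u" using assms(3)[of x c] by auto
      then show ?thesis by (metis imageI mem_Collect_eq)
    qed
  qed
qed

lemma axis_Basis: "axis i 1 \<in> (Basis :: (real^'n) set)"
  by (auto simp: Basis_vec_def)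

type_synonym 'n jet = "(real^'n) l2 \<times> ((real^'n) l2 ^ 'n)"
type_synonym 'n jet2 = "'n jet \<times> ((real^'n) l2 ^ 'n ^ 'n)"

text \<open>A jet lists the class of a function and of its first derivatives, classical ones in \<open>jet\<close> and
  weak ones in \<open>wjet\<close>; its norm is the Sobolev norm.\<close>

definition jet :: "(real^'n) set \<Rightarrow> (real^'n \<Rightarrow> real) \<Rightarrow> 'n jet" where
  "jet U f = (cls U f, \<chi> i. cls U (partial_dir (axis i 1) f))"

definition wjet :: "(real^'n) set \<Rightarrow> (real^'n \<Rightarrow> real) \<Rightarrow> 'n jet" where
  "wjet U f = (cls U f, \<chi> i. cls U (wd U (axis i 1) f))"

definition jet2 :: "(real^'n) set \<Rightarrow> (real^'n \<Rightarrow> real) \<Rightarrow> 'n jet2" where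
  "jet2 U f = (jet U f, \<chi> i. \<chi> j. cls U (partial_dir (axis j 1) (partial_dir (axis i 1) f)))"

definition wjet2 :: "(real^'n) set \<Rightarrow> (real^'n \<Rightarrow> real) \<Rightarrow> 'n jet2" where
  "wjet2 U f = (wjet U f, \<chi> i. \<chi> j. cls U (wd U (axis j 1) (wd U (axis i 1) f)))"

text \<open>The weak derivative as a relation between classes: a family of linear equations
  continuous in both arguments, which makes the spaces of jets closed subspaces.\<close>

definition wdrel :: "(real^'n) set \<Rightarrow> 'n \<Rightarrow> (real^'n) l2 \<Rightarrow> (real^'n) l2 \<Rightarrow> bool" where
  "wdrel U i F G \<longleftrightarrow> (\<forall>\<phi>. test_fun U \<phi> \<longrightarrow>
     inner F (cls U (partial_dir (axis i 1) \<phi>)) = - inner G (cls U \<phi>))"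

definition H1j :: "(real^'n) set \<Rightarrow> 'n jet set" where
  "H1j U = {J. restr U (fst J) = fst J \<and> (\<forall>i. restr U (snd J $ i) = snd J $ i \<and> wdrel U i (fst J) (snd J $ i))}"

text \<open>Each first derivative together with its row of second derivatives is again a first-order
  jet, so the facts on \<open>H1j\<close> are reused.\<close>

definition H2j :: "(real^'n) set \<Rightarrow> 'n jet2 set" where
  "H2j U = {J. fst J \<in> H1j U \<and> (\<forall>i. (snd (fst J) $ i, snd J $ i) \<in> H1j U)}"

lemma test_fun_smooth: "test_fun U \<phi> \<Longrightarrow> smooth_fun \<phi>"
  by (simp add: test_fun_def)

lemma test_fun_zero_outside:
  assumes "test_fun U \<phi>" "x \<notin> U" "b \<in> Basis"
  shows "\<phi> x = 0" "partial_dir b \<phi> x = 0"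
proof -
  have x: "x \<notin> tsupp \<phi>" using assms by (auto simp: test_fun_def)
  then show "\<phi> x = 0" using closure_subset[of "{x. \<phi> x \<noteq> 0}"] by (auto simp: tsupp_def)
  have "open (- tsupp \<phi>)" by (simp add: tsupp_def open_Compl)
  then obtain e where e: "e > 0" "ball x e \<subseteq> - tsupp \<phi>" using x openE[of "- tsupp \<phi>" x] by blast
  have z: "\<phi> y = 0" if "y \<in> ball x e" for y
    using e(2) that closure_subset[of "{x. \<phi> x \<noteq> 0}"] by (auto simp: tsupp_def)
  show "partial_dir b \<phi> x = 0"
  proof (rule partial_dir_eqI)
    have "((\<lambda>t::real. 0::real) has_real_derivative 0) (at 0)" by simp
    then show "((\<lambda>t. \<phi> (x + t *\<^sub>R b)) has_real_derivative 0) (at 0)"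
    proof (rule has_field_derivative_transform_within[where d=e])
      fix t :: real assume "dist t 0 < e"
      then show "0 = \<phi> (x + t *\<^sub>R b)" using assms(3) by (intro z[symmetric]) (simp add: dist_norm)
    qed (use e in auto)
  qed
qed

lemma test_fun_add:
  assumes "test_fun U f" "test_fun U g"
  shows "test_fun U (\<lambda>x. f x + g x)"
proof -
  have "{x. f x + g x \<noteq> 0} \<subseteq> {x. f x \<noteq> 0} \<union> {x. g x \<noteq> 0}" by auto
  then have s: "tsupp (\<lambda>x. f x + g x) \<subseteq> tsupp f \<union> tsupp g"
    unfolding tsupp_def by (metis closure_Un closure_mono)
  moreover have "compact (tsupp f \<union> tsupp g)" using assms by (auto simp: test_fun_def)
  ultimately have "compact (tsupp (\<lambda>x. f x + g x))"
    by (metis closed_closure compact_Int_closed inf.absorb_iff2 tsupp_def)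
  then show ?thesis using assms s by (auto simp: test_fun_def intro: smooth_add)
qed

lemma test_fun_scale:
  assumes "test_fun U f"
  shows "test_fun U (\<lambda>x. c * f x)"
proof -
  have "{x. c * f x \<noteq> 0} \<subseteq> {x. f x \<noteq> 0}" by auto
  then have s: "tsupp (\<lambda>x. c * f x) \<subseteq> tsupp f" unfolding tsupp_def by (rule closure_mono)
  moreover have "compact (tsupp f)" using assms by (auto simp: test_fun_def)
  ultimately have "compact (tsupp (\<lambda>x. c * f x))"
    by (metis closed_closure compact_Int_closed inf.absorb_iff2 tsupp_def)
  then show ?thesis using assms s by (auto simp: test_fun_def intro: smooth_cmult)
qed

lemma test_fun_zero: "test_fun U (\<lambda>x. 0)"
  by (simp add: test_fun_def tsupp_def smooth_const)

lemma test_fun_mono: "test_fun W f \<Longrightarrow> W \<subseteq> U \<Longrightarrow> test_fun U f"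
  by (auto simp: test_fun_def)

lemma cls_test_mono:
  assumes "test_fun W \<phi>" "W \<subseteq> U" "b \<in> Basis"
  shows "cls U \<phi> = cls W \<phi>" "cls U (partial_dir b \<phi>) = cls W (partial_dir b \<phi>)"
  using test_fun_zero_outside[OF assms(1) _ assms(3)] assms(2)
  unfolding cls_def by (intro arg_cong[where f=abs_l2] ext; force)+

lemma subspace_H1j:
  fixes U :: "(real^'n) set"
  assumes "U \<in> sets lebesgue"
  shows "subspace (H1j U)"
proof -
  interpret r: bounded_linear "restr U" by (rule bounded_linear_restr[OF assms])
  show ?thesis
    unfolding H1j_def subspace_def wdrel_def
    by (auto simp: r.add r.scaleR r.zero inner_add_left)
qed

lemma closed_H1j:
  fixes U :: "(real^'n) set"
  assumes "U \<in> sets lebesgue"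
  shows "closed (H1j U)"
proof -
  interpret r: bounded_linear "restr U" by (rule bounded_linear_restr[OF assms])
  show ?thesis
    unfolding H1j_def wdrel_def
    by (intro closed_Collect_conj closed_Collect_all closed_Collect_eq closed_Collect_imp open_Collect_const
        r.continuous_on continuous_intros)
qed

lemma inner_restr_cls:
  assumes "U \<in> sets lebesgue" "Lsq U f"
  shows "inner (restr U F) (cls U f) = inner F (cls U f)"
  using inner_restr(2)[OF assms(1), of F "cls U f"] by (simp add: restr_idem assms)

locale bounded_open =
  fixes U :: "(real^'n) set"
  assumes op: "open U" and bd: "bounded U"
begin

lemma Um: "U \<in> sets lebesgue"
  using op by auto

lemma LS: "smooth_fun f \<Longrightarrow> Lsq U f"
  by (rule Lsq_smooth[OF _ bd Um])

lemma LSp: "smooth_fun f \<Longrightarrow> Lsq U (partial_dir (axis i 1) f)"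
  by (intro LS smooth_partial axis_Basis)

lemma weak_pd_iff:
  assumes "Lsq U f" "Lsq U g"
  shows "weak_pd U (axis i 1) f g \<longleftrightarrow> wdrel U i (cls U f) (cls U g)"
proof -
  have "integral\<^sup>L (lebesgue_on U) (\<lambda>x. f x * partial_dir (axis i 1) \<phi> x) = inner (cls U f) (cls U (partial_dir (axis i 1) \<phi>))"
    "integral\<^sup>L (lebesgue_on U) (\<lambda>x. g x * \<phi> x) = inner (cls U g) (cls U \<phi>)" if "test_fun U \<phi>" for \<phi>
    using that test_fun_smooth[OF that] by (simp_all add: inner_cls_integral Um assms LS LSp)
  then show ?thesis unfolding weak_pd_def wdrel_def by auto
qed

lemma wdrel_unique:
  assumes "wdrel U i F G" "wdrel U i F G'" "restr U G = G" "restr U G' = G'"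
  shows "G = G'"
proof -
  interpret r: bounded_linear "restr U" by (rule bounded_linear_restr[OF Um])
  have "G - G' = 0"
  proof (rule fundamental_lemma[OF op])
    show "restr U (G - G') = G - G'" using assms by (simp add: r.diff)
    fix \<phi> assume "test_fun U \<phi>"
    then show "inner (G - G') (cls U \<phi>) = 0" using assms(1,2) by (simp add: wdrel_def inner_diff_left)
  qed
  then show ?thesis by simp
qed

lemma H1_wd:
  assumes "H1 U f"
  shows "Lsq U f" "Lsq U (wd U (axis i 1) f)" "weak_pd U (axis i 1) f (wd U (axis i 1) f)"
proof -
  show "Lsq U f" using assms by (simp add: H1_def)
  have "\<exists>g. Lsq U g \<and> weak_pd U (axis i 1) f g" using assms axis_Basis[of i] unfolding H1_def by blast
  from someI_ex[OF this] show "Lsq U (wd U (axis i 1) f)" "weak_pd U (axis i 1) f (wd U (axis i 1) f)"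
    unfolding wd_def by auto
qed

lemma wjet_H1j: "H1 U f \<Longrightarrow> wjet U f \<in> H1j U"
  using H1_wd[of f] weak_pd_iff[of f] by (auto simp: H1j_def wjet_def restr_idem Um)

text \<open>\<open>wd\<close> picks some weak derivative, but the fundamental lemma fixes its class;
  so a jet that satisfies the relations and starts with the class of f is the jet of f. This is the
  way back from classes to functions.\<close>

lemma H1_of_jet:
  assumes f: "Lsq U f" "cls U f = fst J" and J: "J \<in> H1j U"
  shows "H1 U f" "wjet U f = J"
proof -
  have g: "Lsq U (rp (snd J $ i))" "cls U (rp (snd J $ i)) = snd J $ i" for i
    using J Lsq_rp[OF Um] by (auto simp: H1j_def restr_def)
  have w: "weak_pd U (axis i 1) f (rp (snd J $ i))" for i
    using J unfolding weak_pd_iff[OF f(1) g(1)] g f by (auto simp: H1j_def)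
  show h: "H1 U f" unfolding H1_def
  proof (intro conjI ballI f)
    fix b :: "real^'n" assume "b \<in> Basis"
    then obtain i where "b = axis i 1" by (auto simp: Basis_vec_def)
    then show "\<exists>g. Lsq U g \<and> weak_pd U b f g" using g w by blast
  qed
  have "cls U (wd U (axis i 1) f) = snd J $ i" for i
  proof (rule wdrel_unique)
    show "wdrel U i (cls U f) (cls U (wd U (axis i 1) f))"
      using H1_wd[OF h] weak_pd_iff by blast
    show "wdrel U i (cls U f) (snd J $ i)" "restr U (snd J $ i) = snd J $ i" using J f by (auto simp: H1j_def)
    show "restr U (cls U (wd U (axis i 1) f)) = cls U (wd U (axis i 1) f)"
      by (rule restr_idem[OF Um H1_wd(2)[OF h]])
  qed
  then show "wjet U f = J" using f by (simp add: wjet_def prod_eq_iff vec_eq_iff)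
qed

lemma H1_rep:
  assumes "J \<in> H1j U"
  shows "Lsq U (rp (fst J))" "H1 U (rp (fst J))" "wjet U (rp (fst J)) = J"
proof -
  show L: "Lsq U (rp (fst J))" by (rule Lsq_rp[OF Um])
  have "cls U (rp (fst J)) = fst J" using assms by (simp add: H1j_def restr_def)
  from H1_of_jet[OF L this assms] show "H1 U (rp (fst J))" "wjet U (rp (fst J)) = J" by auto
qed

lemma H1_diff:
  assumes "H1 U f" "H1 U g"
  shows "H1 U (\<lambda>x. f x - g x)" "wjet U (\<lambda>x. f x - g x) = wjet U f - wjet U g"
proof -
  have "Lsq U (\<lambda>x. f x - g x)" "cls U (\<lambda>x. f x - g x) = fst (wjet U f - wjet U g)"
    using H1_wd(1)[OF assms(1)] H1_wd(1)[OF assms(2)] by (auto simp: wjet_def cls_diff Lsq_diff Um)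
  from H1_of_jet[OF this subspace_diff[OF subspace_H1j[OF Um] wjet_H1j[OF assms(1)] wjet_H1j[OF assms(2)]]]
  show "H1 U (\<lambda>x. f x - g x)" "wjet U (\<lambda>x. f x - g x) = wjet U f - wjet U g" by auto
qed

text \<open>U is enclosed in a box, on whose boundary a test function of U vanishes, and the
  classical integration by parts is carried out there.\<close>

lemma smooth_wdrel:
  assumes f: "smooth_fun f"
  shows "wdrel U i (cls U f) (cls U (partial_dir (axis i 1) f))"
  unfolding wdrel_def
proof (intro allI impI)
  fix \<phi> assume \<phi>: "test_fun U \<phi>"
  let ?b = "axis i 1 :: real^'n"
  obtain a where a: "U \<subseteq> box (-a) a" using bounded_subset_box_symmetric[OF bd] by blast
  let ?B = "box (-a) a"
  have Bm: "?B \<in> sets lebesgue" "bounded ?B" by auto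
  have LB: "Lsq ?B g" if "smooth_fun g" for g using Lsq_smooth[OF that Bm(2,1)] .
  have "inner (cls ?B f) (cls ?B (partial_dir ?b \<phi>)) = - inner (cls ?B (partial_dir ?b f)) (cls ?B \<phi>)"
  proof (rule ibp_box[OF f test_fun_smooth[OF \<phi>] axis_Basis])
    fix x assume "x \<in> cbox (-a) a" "x \<bullet> ?b = (-a) \<bullet> ?b \<or> x \<bullet> ?b = a \<bullet> ?b"
    then have "x \<notin> ?B" using axis_Basis[of i] unfolding mem_box by (metis less_irrefl)
    then have "x \<notin> U" using a by blast
    then show "\<phi> x = 0" by (rule test_fun_zero_outside(1)[OF \<phi> _ axis_Basis])
  qed
  moreover have "inner (cls ?B g) (cls U h) = inner (cls U g) (cls U h)" if "smooth_fun g" "Lsq U h" for g h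
  proof -
    have "inner (cls ?B g) (cls U h) = inner (restr U (cls ?B g)) (cls U h)"
      by (rule inner_restr_cls[OF Um that(2), symmetric])
    then show ?thesis by (simp add: restr_subset Bm Um a LB that(1))
  qed
  ultimately show "inner (cls U f) (cls U (partial_dir ?b \<phi>)) = - inner (cls U (partial_dir ?b f)) (cls U \<phi>)"
    using f test_fun_smooth[OF \<phi>]
    by (simp add: cls_test_mono[OF \<phi> a axis_Basis] LS LSp smooth_partial axis_Basis)
qed

lemma jet_H1j: "smooth_fun f \<Longrightarrow> jet U f \<in> H1j U"
  by (simp add: H1j_def jet_def smooth_wdrel restr_idem Um LS LSp)

lemma smooth_H1:
  assumes "smooth_fun f"
  shows "H1 U f" "wjet U f = jet U f"
  using H1_of_jet[OF LS[OF assms] _ jet_H1j[OF assms]] by (auto simp: jet_def)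

lemma H1norm_eq: 
  assumes "H1 U f"
  shows "H1norm U f = norm (wjet U f)"
proof -
  have "H1norm U f = sqrt ((norm (cls U f))\<^sup>2 + (\<Sum>i\<in>UNIV. (norm (cls U (wd U (axis i 1) f)))\<^sup>2))"
    unfolding H1norm_def sum_Basis_vec power2_norm_eq_inner
    by (simp add: inner_cls Um H1_wd[OF assms])
  also have "... = norm (wjet U f)"
    by (simp add: wjet_def norm_Pair norm_vec_def L2_set_def sum_nonneg)
  finally show ?thesis .
qed

text \<open>The Sobolev norm of a difference is the distance of the jets, so approximability by test
  functions is membership in a closure.\<close>

lemma H10_iff: "H10 U f \<longleftrightarrow> H1 U f \<and> wjet U f \<in> closure (jet U ` {\<phi>. test_fun U \<phi>})"
proof -
  have eq: "H1norm U (\<lambda>x. f x - \<phi> x) = dist (jet U \<phi>) (wjet U f)" if "H1 U f" "test_fun U \<phi>" for \<phi>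
  proof -
    note s = smooth_H1[OF test_fun_smooth[OF that(2)]]
    show ?thesis using H1_diff[OF that(1) s(1)] s(2) H1norm_eq by (simp add: dist_norm norm_minus_commute)
  qed
  have "(\<exists>\<phi>. test_fun U \<phi> \<and> H1norm U (\<lambda>x. f x - \<phi> x) < e) \<longleftrightarrow>
      (\<exists>y\<in>jet U ` {\<phi>. test_fun U \<phi>}. dist y (wjet U f) < e)" if "H1 U f" for e
  proof -
    have "(\<exists>\<phi>. test_fun U \<phi> \<and> H1norm U (\<lambda>x. f x - \<phi> x) < e) \<longleftrightarrow>
      (\<exists>\<phi>. test_fun U \<phi> \<and> dist (jet U \<phi>) (wjet U f) < e)"
      by (intro ex_cong1 conj_cong refl) (simp only: eq[OF that])
    then show ?thesis by blast
  qed
  then show ?thesis unfolding H10_def closure_approachable by blast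
qed

lemma jet_add: "smooth_fun f \<Longrightarrow> smooth_fun g \<Longrightarrow> jet U (\<lambda>x. f x + g x) = jet U f + jet U g"
  by (simp add: jet_def partial_add axis_Basis cls_add Um LS LSp prod_eq_iff vec_eq_iff)

lemma jet_scale: "smooth_fun f \<Longrightarrow> jet U (\<lambda>x. c * f x) = c *\<^sub>R jet U f"
  by (simp add: jet_def partial_cmult axis_Basis cls_scale Um LS LSp prod_eq_iff vec_eq_iff)

lemma jet_zero: "jet U (\<lambda>x. 0) = 0"
proof -
  have "partial_dir b (\<lambda>x. 0) = (\<lambda>x. 0)" for b :: "real^'n" by (rule ext) (rule partial_const)
  then show ?thesis by (simp add: jet_def cls_zero prod_eq_iff vec_eq_iff)
qed

definition H10j :: "'n jet set" where "H10j = closure (jet U ` {\<phi>. test_fun U \<phi>})"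

lemma H10j_facts: "subspace H10j" "closed H10j" "H10j \<subseteq> H1j U"
proof -
  show "subspace H10j" unfolding H10j_def
  proof (rule closure_subspace_image)
    show "\<exists>x. test_fun U x \<and> jet U x = 0" using test_fun_zero jet_zero by blast
    show "\<exists>z. test_fun U z \<and> jet U z = jet U x + jet U y" if "test_fun U x" "test_fun U y" for x y
      using test_fun_add[OF that] jet_add[OF test_fun_smooth[OF that(1)] test_fun_smooth[OF that(2)]] by blast
    show "\<exists>z. test_fun U z \<and> jet U z = c *\<^sub>R jet U x" if "test_fun U x" for c x
      using test_fun_scale[OF that] jet_scale[OF test_fun_smooth[OF that]] by blast
  qed
  show "closed H10j" unfolding H10j_def by (rule closed_closure)
  show "H10j \<subseteq> H1j U" unfolding H10j_def
    by (rule closure_minimal[OF _ closed_H1j[OF Um]]) (rule image_subsetI, rule jet_H1j, rule test_fun_smooth, simp)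
qed

lemma H10_wjet: "H10 U f \<Longrightarrow> H1 U f \<and> wjet U f \<in> H10j"
  by (simp add: H10_iff H10j_def)

lemma H10_rep: "J \<in> H10j \<Longrightarrow> H10 U (rp (fst J)) \<and> wjet U (rp (fst J)) = J"
  using H1_rep[of J] H10j_facts(3) by (auto simp: H10_iff H10j_def)

subsection \<open>Second order\<close>

text \<open>The derivative with H1 regularity in the definition of \<open>H2\<close> need not be the
  one chosen by \<open>wd\<close>, but both have the same class, and regularity depends on the class
  only.\<close>

lemma H2_wd:
  assumes f: "H2 U f"
  shows "H1 U f" "H1 U (wd U (axis i 1) f)"
proof -
  have "\<exists>g. Lsq U g \<and> weak_pd U b f g" if "b \<in> Basis" for b
    using f that unfolding H2_def H1_def by blast
  then show h: "H1 U f" using f unfolding H2_def H1_def by blast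
  obtain g where g: "H1 U g" "weak_pd U (axis i 1) f g"
    using f axis_Basis[of i] unfolding H2_def by blast
  have "cls U (wd U (axis i 1) f) = cls U g"
  proof (rule wdrel_unique)
    show "wdrel U i (cls U f) (cls U (wd U (axis i 1) f))" using H1_wd[OF h] weak_pd_iff by blast
    show "wdrel U i (cls U f) (cls U g)" using H1_wd(1)[OF h] H1_wd(1)[OF g(1)] g(2) weak_pd_iff by blast
  qed (auto intro!: restr_idem Um H1_wd(2)[OF h] H1_wd(1)[OF g(1)])
  then show "H1 U (wd U (axis i 1) f)"
    using H1_of_jet(1)[OF H1_wd(2)[OF h] _ wjet_H1j[OF g(1)]] by (simp add: wjet_def)
qed

lemma wjet2_H2j:
  assumes "H2 U f"
  shows "wjet2 U f \<in> H2j U"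
proof -
  have "(snd (wjet U f) $ i, \<chi> j. cls U (wd U (axis j 1) (wd U (axis i 1) f))) = wjet U (wd U (axis i 1) f)" for i
    by (simp add: wjet_def)
  then show ?thesis using wjet_H1j H2_wd[OF assms] by (simp add: H2j_def wjet2_def)
qed

lemma H2_of_jet:
  assumes f: "Lsq U f" "cls U f = fst (fst J)" and J: "J \<in> H2j U"
  shows "H2 U f" "wjet2 U f = J"
proof -
  have J1: "fst J \<in> H1j U" and J2: "\<And>i. (snd (fst J) $ i, snd J $ i) \<in> H1j U" using J by (auto simp: H2j_def)
  note h = H1_of_jet[OF f J1]
  have c: "cls U (wd U (axis i 1) f) = fst (snd (fst J) $ i, snd J $ i)" for i
    by (simp add: h(2)[symmetric] wjet_def)
  have d: "H1 U (wd U (axis i 1) f)" "wjet U (wd U (axis i 1) f) = (snd (fst J) $ i, snd J $ i)" for i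
    using H1_of_jet[OF H1_wd(2)[OF h(1)] c J2] by auto
  show "H2 U f" unfolding H2_def
  proof (intro conjI ballI f)
    fix b :: "real^'n" assume "b \<in> Basis"
    then obtain i where "b = axis i 1" by (auto simp: Basis_vec_def)
    then show "\<exists>g. H1 U g \<and> weak_pd U b f g" using d(1) H1_wd(3)[OF h(1)] by blast
  qed
  have "cls U (wd U (axis j 1) (wd U (axis i 1) f)) = snd J $ i $ j" for i j
    using arg_cong[OF d(2)[of i], of "\<lambda>J. snd J $ j"] by (simp add: wjet_def)
  then show "wjet2 U f = J" using h(2) by (simp add: wjet2_def prod_eq_iff vec_eq_iff)
qed

lemma H2j_facts: "subspace (H2j U)" "closed (H2j U)"
proof -
  note s = subspace_H1j[OF Um] closed_H1j[OF Um]
  show "subspace (H2j U)" using s(1) unfolding H2j_def subspace_def by (auto simp flip: zero_prod_def add_Pair scaleR_Pair)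
  have "continuous_on UNIV (\<lambda>J :: 'n jet2. (snd (fst J) $ i, snd J $ i))" for i by (intro continuous_intros)
  then have "closed {J :: 'n jet2. (snd (fst J) $ i, snd J $ i) \<in> H1j U}" for i
    using continuous_closed_preimage[of UNIV _ "H1j U"] s(2) by (auto simp: vimage_def)
  moreover have "continuous_on UNIV (fst :: 'n jet2 \<Rightarrow> _)" by (intro continuous_intros)
  then have "closed {J :: 'n jet2. fst J \<in> H1j U}"
    using continuous_closed_preimage[of UNIV fst "H1j U"] s(2) by (auto simp: vimage_def)
  ultimately show "closed (H2j U)" unfolding H2j_def by (intro closed_Collect_conj closed_Collect_all)
qed

lemma H2_diff:
  assumes "H2 U f" "H2 U g"
  shows "H2 U (\<lambda>x. f x - g x)" "wjet2 U (\<lambda>x. f x - g x) = wjet2 U f - wjet2 U g"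
proof -
  have "Lsq U (\<lambda>x. f x - g x)" "cls U (\<lambda>x. f x - g x) = fst (fst (wjet2 U f - wjet2 U g))"
    using H1_wd(1)[OF H2_wd(1)[OF assms(1)]] H1_wd(1)[OF H2_wd(1)[OF assms(2)]]
    by (auto simp: wjet_def wjet2_def cls_diff Lsq_diff Um)
  from H2_of_jet[OF this subspace_diff[OF H2j_facts(1) wjet2_H2j[OF assms(1)] wjet2_H2j[OF assms(2)]]]
  show "H2 U (\<lambda>x. f x - g x)" "wjet2 U (\<lambda>x. f x - g x) = wjet2 U f - wjet2 U g" by auto
qed

lemma jet2_H2j:
  assumes "smooth_fun f"
  shows "jet2 U f \<in> H2j U"
proof -
  have "(snd (jet U f) $ i, \<chi> j. cls U (partial_dir (axis j 1) (partial_dir (axis i 1) f))) = jet U (partial_dir (axis i 1) f)" for i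
    by (simp add: jet_def)
  then show ?thesis using assms by (simp add: H2j_def jet2_def jet_H1j smooth_partial axis_Basis)
qed

lemma smooth_H2:
  assumes "smooth_fun f"
  shows "H2 U f" "wjet2 U f = jet2 U f"
  using H2_of_jet[OF LS[OF assms] _ jet2_H2j[OF assms]] by (auto simp: jet_def jet2_def)

lemma H2norm_eq: 
  assumes "H2 U f"
  shows "H2norm U f = norm (wjet2 U f)"
proof -
  note h = H2_wd[OF assms]
  have "H2norm U f = sqrt ((norm (cls U f))\<^sup>2 + (\<Sum>i\<in>UNIV. (norm (cls U (wd U (axis i 1) f)))\<^sup>2)
      + (\<Sum>i\<in>UNIV. \<Sum>j\<in>UNIV. (norm (cls U (wd U (axis j 1) (wd U (axis i 1) f))))\<^sup>2))"
    unfolding H2norm_def sum_Basis_vec power2_norm_eq_inner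
    by (simp add: inner_cls Um H1_wd[OF h(1)] H1_wd[OF h(2)])
  also have "... = norm (wjet2 U f)"
    by (simp add: wjet_def wjet2_def norm_Pair norm_vec_def L2_set_def sum_nonneg)
  finally show ?thesis .
qed

lemma H20_iff: "H20 U f \<longleftrightarrow> H2 U f \<and> wjet2 U f \<in> closure (jet2 U ` {\<phi>. test_fun U \<phi>})"
proof -
  have eq: "H2norm U (\<lambda>x. f x - \<phi> x) = dist (jet2 U \<phi>) (wjet2 U f)" if "H2 U f" "test_fun U \<phi>" for \<phi>
  proof -
    note s = smooth_H2[OF test_fun_smooth[OF that(2)]]
    show ?thesis using H2_diff[OF that(1) s(1)] s(2) H2norm_eq by (simp add: dist_norm norm_minus_commute)
  qed
  have "(\<exists>\<phi>. test_fun U \<phi> \<and> H2norm U (\<lambda>x. f x - \<phi> x) < e) \<longleftrightarrow>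
      (\<exists>y\<in>jet2 U ` {\<phi>. test_fun U \<phi>}. dist y (wjet2 U f) < e)" if "H2 U f" for e
  proof -
    have "(\<exists>\<phi>. test_fun U \<phi> \<and> H2norm U (\<lambda>x. f x - \<phi> x) < e) \<longleftrightarrow>
      (\<exists>\<phi>. test_fun U \<phi> \<and> dist (jet2 U \<phi>) (wjet2 U f) < e)"
      by (intro ex_cong1 conj_cong refl) (simp only: eq[OF that])
    then show ?thesis by blast
  qed
  then show ?thesis unfolding H20_def closure_approachable by blast
qed

lemma jet2_add: "smooth_fun f \<Longrightarrow> smooth_fun g \<Longrightarrow> jet2 U (\<lambda>x. f x + g x) = jet2 U f + jet2 U g"
  by (simp add: jet2_def jet_add partial_add axis_Basis cls_add Um LS LSp smooth_partial prod_eq_iff vec_eq_iff)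

lemma jet2_scale: "smooth_fun f \<Longrightarrow> jet2 U (\<lambda>x. c * f x) = c *\<^sub>R jet2 U f"
  by (simp add: jet2_def jet_scale partial_cmult axis_Basis cls_scale Um LS LSp smooth_partial prod_eq_iff vec_eq_iff)

lemma jet2_zero: "jet2 U (\<lambda>x. 0) = 0"
proof -
  have "partial_dir b (\<lambda>x. 0) = (\<lambda>x. 0)" for b :: "real^'n" by (rule ext) (rule partial_const)
  then show ?thesis by (simp add: jet2_def jet_zero cls_zero prod_eq_iff vec_eq_iff)
qed

definition H20j :: "'n jet2 set" where "H20j = closure (jet2 U ` {\<phi>. test_fun U \<phi>})"

lemma H20j_facts: "subspace H20j" "closed H20j" "H20j \<subseteq> H2j U"
proof -
  show "subspace H20j" unfolding H20j_def
  proof (rule closure_subspace_image)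
    show "\<exists>x. test_fun U x \<and> jet2 U x = 0" using test_fun_zero jet2_zero by blast
    show "\<exists>z. test_fun U z \<and> jet2 U z = jet2 U x + jet2 U y" if "test_fun U x" "test_fun U y" for x y
      using test_fun_add[OF that] jet2_add[OF test_fun_smooth[OF that(1)] test_fun_smooth[OF that(2)]] by blast
    show "\<exists>z. test_fun U z \<and> jet2 U z = c *\<^sub>R jet2 U x" if "test_fun U x" for c x
      using test_fun_scale[OF that] jet2_scale[OF test_fun_smooth[OF that]] by blast
  qed
  show "closed H20j" unfolding H20j_def by (rule closed_closure)
  show "H20j \<subseteq> H2j U" unfolding H20j_def
    by (rule closure_minimal[OF _ H2j_facts(2)]) (rule image_subsetI, rule jet2_H2j, rule test_fun_smooth, simp)
qed

lemma H20_wjet2: "H20 U f \<Longrightarrow> H2 U f \<and> wjet2 U f \<in> H20j"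
  by (simp add: H20_iff H20j_def)

lemma H20_rep:
  assumes "J \<in> H20j"
  shows "H20 U (rp (fst (fst J))) \<and> wjet2 U (rp (fst (fst J))) = J"
proof -
  have J: "J \<in> H2j U" using assms H20j_facts(3) by blast
  have "cls U (rp (fst (fst J))) = fst (fst J)" using J by (simp add: H2j_def H1j_def restr_def)
  from H2_of_jet[OF Lsq_rp[OF Um] this J] show ?thesis using assms by (simp add: H20_iff H20j_def)
qed

end

subsection \<open>Traces\<close>

text \<open>The closed graph of the trace on the face parametrised by P. Membership of a pair says
  in particular that its jet is a limit of jets of functions smooth up to the boundary.\<close>

definition Gam :: "(real^3) set \<Rightarrow> (real^2 \<Rightarrow> real^3) \<Rightarrow> (real^2) set \<Rightarrow> (3 jet \<times> (real^2) l2) set" where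
  "Gam U P R = closure ((\<lambda>\<phi>. (jet U \<phi>, cls R (\<lambda>y. \<phi> (P y)))) ` {\<phi>. smooth_fun \<phi>})"

lemma Lsq_smooth_comp:
  assumes "smooth_fun \<phi>" "continuous_on UNIV P" "bounded R" "R \<in> sets lebesgue"
  shows "Lsq R (\<lambda>y. \<phi> (P y))"
  by (rule Lsq_continuous[OF continuous_on_compose2[OF smooth_continuous[OF assms(1)] assms(2)] assms(3,4)]) auto

lemma Gam_facts:
  assumes U: "bounded_open U" and P: "continuous_on UNIV P" and R: "bounded R" "R \<in> sets lebesgue"
  shows "subspace (Gam U P R)" "closed (Gam U P R)"
proof -
  interpret bounded_open U by fact
  show "subspace (Gam U P R)" unfolding Gam_def
  proof (rule closure_subspace_image)
    have "(jet U (\<lambda>x. 0), cls R (\<lambda>y. 0)) = 0" by (simp add: jet_zero cls_zero zero_prod_def)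
    then show "\<exists>x. smooth_fun x \<and> (jet U x, cls R (\<lambda>y. x (P y))) = 0"
      using smooth_const[of 0] by (intro exI[of _ "\<lambda>x. 0"]) simp
    show "\<exists>z. smooth_fun z \<and> (jet U z, cls R (\<lambda>y. z (P y))) = (jet U f, cls R (\<lambda>y. f (P y))) + (jet U g, cls R (\<lambda>y. g (P y)))"
      if "smooth_fun f" "smooth_fun g" for f g
      using that P R
      by (intro exI[of _ "\<lambda>x. f x + g x"]) (simp add: smooth_add jet_add cls_add Lsq_smooth_comp)
    show "\<exists>z. smooth_fun z \<and> (jet U z, cls R (\<lambda>y. z (P y))) = c *\<^sub>R (jet U f, cls R (\<lambda>y. f (P y)))"
      if "smooth_fun f" for c f
      using that P R
      by (intro exI[of _ "\<lambda>x. c * f x"]) (simp add: smooth_cmult jet_scale cls_scale Lsq_smooth_comp)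
  qed
  show "closed (Gam U P R)" by (simp add: Gam_def)
qed

text \<open>The two null sequences in the definition of a trace amount to convergence of a sequence
  of pairs, hence to membership in a sequential closure.\<close>

lemma is_trace_iff:
  assumes U: "bounded_open U" and P: "continuous_on UNIV P" and R: "bounded R" "R \<in> sets lebesgue"
    and f: "H1 U f" and t: "Lsq R t"
  shows "is_trace U P R f t \<longleftrightarrow> (wjet U f, cls R t) \<in> Gam U P R"
proof -
  interpret bounded_open U by fact
  let ?g = "\<lambda>\<phi>. (jet U \<phi>, cls R (\<lambda>y. \<phi> (P y)))"
  have n1: "H1norm U (\<lambda>x. f x - \<phi> x) = norm (jet U \<phi> - wjet U f)" if "smooth_fun \<phi>" for \<phi>
    using H1_diff[OF f smooth_H1(1)[OF that]] smooth_H1(2)[OF that] H1norm_eq by (simp add: norm_minus_commute)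
  have n2: "integral\<^sup>L (lebesgue_on R) (\<lambda>y. (\<phi> (P y) - t y)\<^sup>2) = (norm (cls R (\<lambda>y. \<phi> (P y)) - cls R t))\<^sup>2"
    if "smooth_fun \<phi>" for \<phi>
  proof -
    note L = Lsq_smooth_comp[OF that P R]
    have "(norm (cls R (\<lambda>y. \<phi> (P y)) - cls R t))\<^sup>2 = inner (cls R (\<lambda>y. \<phi> (P y) - t y)) (cls R (\<lambda>y. \<phi> (P y) - t y))"
      by (simp add: power2_norm_eq_inner cls_diff R L t)
    then show ?thesis by (simp add: inner_cls_integral R L t Lsq_diff power2_eq_square)
  qed
  have sq: "(\<lambda>k. (norm (a k))\<^sup>2) \<longlonglongrightarrow> 0 \<longleftrightarrow> a \<longlonglongrightarrow> 0" for a :: "nat \<Rightarrow> (real^2) l2"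
  proof
    assume "(\<lambda>k. (norm (a k))\<^sup>2) \<longlonglongrightarrow> 0"
    from tendsto_real_sqrt[OF this] have "(\<lambda>k. norm (a k)) \<longlonglongrightarrow> 0" by simp
    then show "a \<longlonglongrightarrow> 0" by (rule tendsto_norm_zero_cancel)
  next
    assume "a \<longlonglongrightarrow> 0"
    from tendsto_power[OF tendsto_norm_zero[OF this], of 2] show "(\<lambda>k. (norm (a k))\<^sup>2) \<longlonglongrightarrow> 0" by simp
  qed
  have conv: "(\<lambda>k. H1norm U (\<lambda>x. f x - \<phi> k x)) \<longlonglongrightarrow> 0 \<and>
      (\<lambda>k. integral\<^sup>L (lebesgue_on R) (\<lambda>y. (\<phi> k (P y) - t y)\<^sup>2)) \<longlonglongrightarrow> 0
      \<longleftrightarrow> (\<lambda>k. ?g (\<phi> k)) \<longlonglongrightarrow> (wjet U f, cls R t)" if "\<And>k. smooth_fun (\<phi> k)" for \<phi>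
  proof -
    have "(\<lambda>k. ?g (\<phi> k)) \<longlonglongrightarrow> (wjet U f, cls R t) \<longleftrightarrow>
        (\<lambda>k. jet U (\<phi> k)) \<longlonglongrightarrow> wjet U f \<and> (\<lambda>k. cls R (\<lambda>y. \<phi> k (P y))) \<longlonglongrightarrow> cls R t"
    proof
      assume l: "(\<lambda>k. ?g (\<phi> k)) \<longlonglongrightarrow> (wjet U f, cls R t)"
      from tendsto_fst[OF l] tendsto_snd[OF l]
      show "(\<lambda>k. jet U (\<phi> k)) \<longlonglongrightarrow> wjet U f \<and> (\<lambda>k. cls R (\<lambda>y. \<phi> k (P y))) \<longlonglongrightarrow> cls R t" by simp
    qed (rule tendsto_Pair; simp)
    then show ?thesis
      unfolding n1[OF that] n2[OF that] sq tendsto_norm_zero_iff LIM_zero_iff by (simp only:)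
  qed
  show ?thesis
  proof
    assume "is_trace U P R f t"
    then obtain \<phi> where s: "\<And>k. smooth_fun (\<phi> k)" and "(\<lambda>k. H1norm U (\<lambda>x. f x - \<phi> k x)) \<longlonglongrightarrow> 0 \<and>
      (\<lambda>k. integral\<^sup>L (lebesgue_on R) (\<lambda>y. (\<phi> k (P y) - t y)\<^sup>2)) \<longlonglongrightarrow> 0"
      unfolding is_trace_def by (elim exE conjE) (rule that, simp_all)
    then have "(\<lambda>k. ?g (\<phi> k)) \<longlonglongrightarrow> (wjet U f, cls R t)" using conv[OF s] by (simp only:)
    moreover have "?g (\<phi> k) \<in> ?g ` {\<phi>. smooth_fun \<phi>}" for k by (rule imageI) (simp add: s)
    ultimately show "(wjet U f, cls R t) \<in> Gam U P R"
      unfolding Gam_def closure_sequential by (intro exI[where x="\<lambda>k. ?g (\<phi> k)"] conjI allI)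
  next
    assume "(wjet U f, cls R t) \<in> Gam U P R"
    then have "\<exists>X. (\<forall>k. X k \<in> ?g ` {\<phi>. smooth_fun \<phi>}) \<and> X \<longlonglongrightarrow> (wjet U f, cls R t)"
      unfolding Gam_def closure_sequential .
    then obtain X where X: "\<And>k. X k \<in> ?g ` {\<phi>. smooth_fun \<phi>}" "X \<longlonglongrightarrow> (wjet U f, cls R t)"
      by (elim exE conjE) (rule that, simp_all only:)
    have "\<exists>\<phi>. smooth_fun \<phi> \<and> X k = ?g \<phi>" for k using X(1)[of k] by (simp only: image_iff mem_Collect_eq Bex_def)
    then have "\<exists>\<phi>. \<forall>k. smooth_fun (\<phi> k) \<and> X k = ?g (\<phi> k)" by (intro choice allI)
    then obtain \<phi> where \<phi>: "\<forall>k. smooth_fun (\<phi> k) \<and> X k = ?g (\<phi> k)" ..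
    then have s: "\<And>k. smooth_fun (\<phi> k)" by simp
    have "X = (\<lambda>k. ?g (\<phi> k))" using \<phi> by (intro ext) simp
    then have "(\<lambda>k. ?g (\<phi> k)) \<longlonglongrightarrow> (wjet U f, cls R t)" using X(2) by (simp only:)
    then have "(\<lambda>k. H1norm U (\<lambda>x. f x - \<phi> k x)) \<longlonglongrightarrow> 0 \<and>
      (\<lambda>k. integral\<^sup>L (lebesgue_on R) (\<lambda>y. (\<phi> k (P y) - t y)\<^sup>2)) \<longlonglongrightarrow> 0"
      using conv[OF s] by (simp only:)
    then show "is_trace U P R f t" unfolding is_trace_def using t s by (intro conjI exI[where x=\<phi>] allI) simp_all
  qed
qed

definition rj :: "(real^'n) set \<Rightarrow> 'n jet \<Rightarrow> 'n jet" where
  "rj W J = (restr W (fst J), \<chi> i. restr W (snd J $ i))"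

lemma bounded_linear_rj:
  fixes W :: "(real^'n) set"
  assumes "W \<in> sets lebesgue"
  shows "bounded_linear (rj W)"
proof -
  interpret r: bounded_linear "restr W" by (rule bounded_linear_restr[OF assms])
  have "linear (rj W)" by (rule linearI) (auto simp: rj_def prod_eq_iff vec_eq_iff r.add r.scaleR)
  moreover have "norm (rj W J) \<le> norm J" for J
  proof -
    have "norm (\<chi> i. restr W (snd J $ i)) \<le> norm (snd J)"
      unfolding norm_vec_def by (intro L2_set_mono) (auto simp: norm_restr_le assms)
    then show ?thesis using norm_restr_le[OF assms, of "fst J"]
      unfolding rj_def norm_Pair norm_prod_def by (intro real_sqrt_le_mono add_mono power_mono) auto
  qed
  ultimately show ?thesis
    unfolding bounded_linear_def bounded_linear_axioms_def by (intro conjI exI[of _ 1]) auto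
qed

text \<open>A test function of W is one of U with the same classes, so weak derivatives
  restrict.\<close>

lemma wjet_subset:
  fixes U W :: "(real^'n) set"
  assumes U: "bounded_open U" and W: "bounded_open W" and WU: "W \<subseteq> U" and f: "H1 U f"
  shows "H1 W f" "wjet W f = rj W (wjet U f)"
proof -
  interpret U: bounded_open U by fact
  interpret W: bounded_open W by fact
  note J = U.wjet_H1j[OF f]
  have idem: "restr W (restr W F) = restr W F" for F
    unfolding restr_def[of W F] by (rule restr_idem[OF W.Um Lsq_rp[OF W.Um]])
  have "wdrel W i (restr W F) (restr W G)" if "wdrel U i F G" for i F G
    unfolding wdrel_def
  proof (intro allI impI)
    fix \<phi> assume \<phi>: "test_fun W \<phi>"
    have "inner F (cls U (partial_dir (axis i 1) \<phi>)) = - inner G (cls U \<phi>)"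
      using that test_fun_mono[OF \<phi> WU] by (simp add: wdrel_def)
    then show "inner (restr W F) (cls W (partial_dir (axis i 1) \<phi>)) = - inner (restr W G) (cls W \<phi>)"
      unfolding cls_test_mono[OF \<phi> WU axis_Basis[of i]]
        inner_restr_cls[OF W.Um W.LSp[OF test_fun_smooth[OF \<phi>]]] inner_restr_cls[OF W.Um W.LS[OF test_fun_smooth[OF \<phi>]]] .
  qed
  note rel = this
  have "rj W (wjet U f) \<in> H1j W"
    unfolding H1j_def rj_def mem_Collect_eq fst_conv snd_conv vec_lambda_beta
  proof (intro conjI allI idem)
    fix i
    have "wdrel U i (fst (wjet U f)) (snd (wjet U f) $ i)" using J unfolding H1j_def mem_Collect_eq by blast
    then show "wdrel W i (restr W (fst (wjet U f))) (restr W (snd (wjet U f) $ i))" by (rule rel)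
  qed
  moreover have "Lsq W f" by (rule Lsq_subset[OF U.Um W.Um WU U.H1_wd(1)[OF f]])
  moreover have "cls W f = fst (rj W (wjet U f))"
    by (simp add: rj_def wjet_def restr_subset U.Um W.Um WU U.H1_wd(1)[OF f])
  ultimately show "H1 W f" "wjet W f = rj W (wjet U f)" using W.H1_of_jet by auto
qed

section \<open>The velocity space\<close>

lemma closed_subspace_vimage:
  assumes f: "bounded_linear f" and G: "subspace G" "closed G"
  shows "subspace {x. f x \<in> G}" "closed {x. f x \<in> G}"
proof -
  interpret f: bounded_linear f by fact
  show "subspace {x. f x \<in> G}" using G(1) by (auto simp: subspace_def f.add f.scaleR f.zero)
  have "closed (f -` G)" by (rule continuous_closed_vimage[OF G(2)]) (rule f.isCont[OF continuous_ident])
  then show "closed {x. f x \<in> G}" by (simp add: vimage_def)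
qed

lemma bounded_linear_vec_nth_comp: "bounded_linear f \<Longrightarrow> bounded_linear (\<lambda>x. f x $ i)"
  by (rule bounded_linear_compose[OF bounded_linear_vec_nth])

lemma bounded_linear_fst_comp: "bounded_linear f \<Longrightarrow> bounded_linear (\<lambda>x. fst (f x))"
  by (rule bounded_linear_compose[OF bounded_linear_fst])

lemma bounded_linear_snd_comp: "bounded_linear f \<Longrightarrow> bounded_linear (\<lambda>x. snd (f x))"
  by (rule bounded_linear_compose[OF bounded_linear_snd])

lemmas bl_intros = bounded_linear_ident bounded_linear_vec_nth_comp bounded_linear_fst_comp bounded_linear_snd_comp
  bounded_linear_Pair bounded_linear_zero bounded_linear_add bounded_linear_sum bounded_linear_const_scaleR
  bounded_linear_sub

lemma norm_Pair_le_sum: "norm (x, y) \<le> norm x + norm y"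
  unfolding norm_Pair by (rule sqrt_sum_squares_le_sum) auto

lemma norm_vec_le_sum: "norm (x :: 'a::real_normed_vector ^ 'n) \<le> (\<Sum>i\<in>UNIV. norm (x $ i))"
  unfolding norm_vec_def by (rule L2_set_le_sum) auto

lemma norm_nth_le': "norm (x $ i) \<le> norm (x :: 'a::real_normed_vector ^ 'n)"
  by (rule Finite_Cartesian_Product.norm_nth_le)

lemma norm_fst_le': "norm (fst x) \<le> norm x" and norm_snd_le': "norm (snd x) \<le> norm x"
  by (cases x; simp add: norm_fst_le norm_snd_le)+

lemma norm_jet_le_hn: "norm (jet U f) \<le> hn U f"
proof -
  have "norm (jet U f) \<le> norm (cls U f) + norm (\<chi> i. cls U (partial_dir (axis i 1) f))"
    unfolding jet_def by (rule norm_Pair_le_sum)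
  also have "norm (\<chi> i. cls U (partial_dir (axis i 1) f)) \<le> (\<Sum>i\<in>UNIV. norm (cls U (partial_dir (axis i 1) f)))"
    using norm_vec_le_sum[of "\<chi> i. cls U (partial_dir (axis i 1) f)"] by simp
  finally show ?thesis unfolding hn_def sum_Basis_vec by simp
qed

lemma hn_le_norm_jet:
  fixes f :: "real^'n \<Rightarrow> real"
  shows "hn U f \<le> (1 + real CARD('n)) * norm (jet U f)"
proof -
  have "norm (cls U f) \<le> norm (jet U f)" using norm_fst_le'[of "jet U f"] by (simp add: jet_def)
  moreover have "norm (cls U (partial_dir (axis i 1) f)) \<le> norm (jet U f)" for i
    using order_trans[OF norm_nth_le'[of "snd (jet U f)" i] norm_snd_le'[of "jet U f"]] by (simp add: jet_def)
  then have "(\<Sum>i\<in>UNIV. norm (cls U (partial_dir (axis i 1) f))) \<le> (\<Sum>i\<in>(UNIV::'n set). norm (jet U f))"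
    by (intro sum_mono)
  ultimately show ?thesis unfolding hn_def sum_Basis_vec by (simp add: distrib_right)
qed

lemma fx_eq: "fx c y = c *\<^sub>R axis 1 1 + (y $ 1) *\<^sub>R axis 2 1 + (y $ 2) *\<^sub>R axis 3 1"
  by (simp add: fx_def vec_eq_iff forall_3 axis_def)

lemma fy_eq: "fy c y = (y $ 1) *\<^sub>R axis 1 1 + c *\<^sub>R axis 2 1 + (y $ 2) *\<^sub>R axis 3 1"
  by (simp add: fy_def vec_eq_iff forall_3 axis_def)

lemma continuous_faces: "continuous_on UNIV (fx c)" "continuous_on UNIV (fy c)" "continuous_on UNIV (fz c)"
  unfolding fx_eq fy_eq fz_eq by (intro continuous_intros)+

lemma closure_vec:
  fixes A :: "'a::metric_space set"
  assumes "\<And>i. J $ i \<in> closure A"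
  shows "J \<in> closure {J :: 'a ^ 'n. \<forall>i. J $ i \<in> A}"
proof -
  have "\<forall>i. \<exists>X. (\<forall>k::nat. X k \<in> A) \<and> X \<longlonglongrightarrow> J $ i" using assms unfolding closure_sequential by blast
  then obtain X where X: "\<And>i k. X i k \<in> A" "\<And>i. X i \<longlonglongrightarrow> J $ i" by metis
  have "(\<lambda>k. \<chi> i. X i k) \<longlonglongrightarrow> J" by (rule vec_tendstoI) (simp add: X)
  then show ?thesis unfolding closure_sequential
    by (intro exI[where x="\<lambda>k. \<chi> i. X i k"]) (simp add: X)
qed

text \<open>For a fixed pair of indices the inequality is a closed condition on jets, so it extends
  from smooth fields to componentwise limits of them.\<close>

lemma korn_jets:
  fixes a c :: "real^3"
  assumes ac: "\<forall>b\<in>Basis. a \<bullet> b < c \<bullet> b"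
  shows "\<exists>C\<ge>0. \<forall>J :: (3 jet)^3. (\<forall>i. J $ i \<in> closure (jet (box a c) ` {\<phi>. smooth_fun \<phi>})) \<longrightarrow>
    (\<forall>i k. norm (snd (J $ i) $ k) \<le> C * ((\<Sum>i\<in>UNIV. norm (fst (J $ i)))
      + (\<Sum>i\<in>UNIV. \<Sum>j\<in>UNIV. norm ((1/2) *\<^sub>R (snd (J $ i) $ j + snd (J $ j) $ i)))))"
proof -
  let ?U = "box a c"
  interpret bounded_open ?U by standard auto
  obtain C where C: "C \<ge> 0" and K: "\<And>v i k. \<forall>i\<in>Basis. smooth_fun (v i) \<Longrightarrow> i \<in> Basis \<Longrightarrow> k \<in> Basis \<Longrightarrow>
    norm (cls ?U (partial_dir k (v i)))
      \<le> C * ((\<Sum>i\<in>Basis. norm (cls ?U (v i))) + (\<Sum>i\<in>Basis. \<Sum>j\<in>Basis. norm (cls ?U (sg v i j))))"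
    using korn_second[OF ac] by (elim exE conjE) (rule that, assumption, blast)
  let ?A = "jet ?U ` {\<phi>. smooth_fun \<phi>}"
  define E where "E J i k \<longleftrightarrow> norm (snd (J $ i) $ k) \<le> C * ((\<Sum>i\<in>UNIV. norm (fst (J $ i)))
      + (\<Sum>i\<in>UNIV. \<Sum>j\<in>UNIV. norm ((1/2) *\<^sub>R (snd (J $ i) $ j + snd (J $ j) $ i))))" for J :: "(3 jet)^3" and i k
  have "E J i k" if J: "\<And>i. J $ i \<in> closure ?A" for J i k
  proof -
    have "closed {J. E J i k}" unfolding E_def by (intro closed_Collect_le continuous_intros)
    moreover have "{J. \<forall>i. J $ i \<in> ?A} \<subseteq> {J. E J i k}"
    proof
      fix J :: "(3 jet)^3" assume "J \<in> {J. \<forall>i. J $ i \<in> ?A}"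
      then have "\<forall>i. \<exists>\<phi>. smooth_fun \<phi> \<and> J $ i = jet ?U \<phi>" by blast
      then obtain v where v: "\<And>i. smooth_fun (v i)" "\<And>i. J $ i = jet ?U (v i)" by metis
      \<comment> \<open>Korn's inequality is indexed by basis vectors, jets by coordinate numbers; w
        translates between the two.\<close>
      define w where "w b = v (SOME i. b = axis i 1)" for b :: "real^3"
      have wi: "w (axis i 1) = v i" for i
      proof -
        have "(SOME j. (axis i 1 :: real^3) = axis j 1) = i" by (rule some_equality) (auto simp: axis_eq_axis)
        then show ?thesis by (simp add: w_def)
      qed
      have sw: "\<forall>b\<in>Basis. smooth_fun (w b)" by (simp add: w_def v)
      have sgw: "cls ?U (sg w (axis i 1) (axis j 1)) = (1/2) *\<^sub>R (snd (J $ i) $ j + snd (J $ j) $ i)" for i j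
      proof -
        have "sg w (axis i 1) (axis j 1) = (\<lambda>x. (1/2) * (partial_dir (axis j 1) (v i) x + partial_dir (axis i 1) (v j) x))"
          by (simp add: sg_def[abs_def] wi)
        then show ?thesis
          by (simp only: cls_scale cls_add Lsq_add LSp v Um) (simp add: v(2) jet_def)
      qed
      show "J \<in> {J. E J i k}"
        using K[OF sw axis_Basis axis_Basis, of k i] unfolding E_def sum_Basis_vec wi sgw
        by (simp add: v(2) jet_def)
    qed
    ultimately have "closure {J. \<forall>i. J $ i \<in> ?A} \<subseteq> {J. E J i k}" by (rule closure_minimal[rotated])
    then show ?thesis using closure_vec[OF J] by blast
  qed
  then show ?thesis unfolding E_def using C by blast
qed

section \<open>The channel, its faces and the classes of velocities\<close>

locale channel =
  fixes L1 L2 L3 :: real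
  assumes L: "L1 > 0" "L2 > 0" "L3 > 0"
begin

abbreviation "UA \<equiv> OmPM L1 L2 L3"
abbreviation "UP \<equiv> OmP L1 L2 L3"
abbreviation "UM \<equiv> OmM L1 L2 L3"
abbreviation "SS \<equiv> Sig L1 L2"

sublocale A: bounded_open UA by standard (rule Om_facts)+
sublocale P: bounded_open UP by standard (rule Om_facts)+
sublocale M: bounded_open UM by standard (rule Om_facts)+
sublocale S: bounded_open SS by standard (rule Om_facts)+

text \<open>The top face is left out, being the outflow boundary, and the lateral faces are split at
  the interface, with one piece for each half.\<close>

definition faces :: "((real^3) set \<times> (real^2 \<Rightarrow> real^3) \<times> (real^2) set) set" where
  "faces = {(UM, fz (- L3), SS),
    (UM, fx 0, box (vector [0, - L3]) (vector [L2, 0])), (UM, fx L1, box (vector [0, - L3]) (vector [L2, 0])),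
    (UM, fy 0, box (vector [0, - L3]) (vector [L1, 0])), (UM, fy L2, box (vector [0, - L3]) (vector [L1, 0])),
    (UP, fx 0, box (vector [0, 0]) (vector [L2, L3])), (UP, fx L1, box (vector [0, 0]) (vector [L2, L3])),
    (UP, fy 0, box (vector [0, 0]) (vector [L1, L3])), (UP, fy L2, box (vector [0, 0]) (vector [L1, L3]))}"

lemma zero_bc_faces: "zero_bc L1 L2 L3 f \<longleftrightarrow> (\<forall>(U, p, R)\<in>faces. is_trace U p R f (\<lambda>_. 0))"
  unfolding zero_bc_def faces_def by simp

lemma faces_facts:
  assumes "(U, p, R) \<in> faces"
  shows "bounded_open U" "U \<subseteq> UA" "continuous_on UNIV p" "bounded R" "R \<in> sets lebesgue"
proof -
  have "U = UP \<or> U = UM" using assms unfolding faces_def by auto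
  then show "bounded_open U" "U \<subseteq> UA"
    using P.bounded_open_axioms M.bounded_open_axioms Om_facts(13,14) by metis+
  have "p \<in> range fx \<union> range fy \<union> range fz" using assms unfolding faces_def by auto
  then show "continuous_on UNIV p" using continuous_faces by auto
  have "R = SS \<or> (\<exists>a c. R = box a c)" using assms unfolding faces_def by auto
  then show "bounded R" "R \<in> sets lebesgue" using S.bd S.Um by auto
qed

text \<open>One velocity component is the jet of a function on both parts of the channel together with its trace
  on the interface, which has to be a trace from either side.\<close>

definition S3 :: "(3 jet \<times> (real^2) l2) set" where
  "S3 = {x. fst x \<in> H1j UA \<and> restr SS (snd x) = snd x
    \<and> (rj UP (fst x), snd x) \<in> Gam UP (fz 0) SS \<and> (rj UM (fst x), snd x) \<in> Gam UM (fz 0) SS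
    \<and> (\<forall>(U, p, R)\<in>faces. (rj U (fst x), 0) \<in> Gam U p R)}"

lemma S3_facts: "subspace S3" "closed S3"
proof -
  have bl: "bounded_linear (\<lambda>x :: 3 jet \<times> (real^2) l2. rj U (fst x))" if "U \<in> sets lebesgue" for U
    by (rule bounded_linear_compose[OF bounded_linear_rj[OF that] bounded_linear_fst])
  define X1 where "X1 = {x :: 3 jet \<times> (real^2) l2. fst x \<in> H1j UA}"
  define X2 where "X2 = {x :: 3 jet \<times> (real^2) l2. snd x \<in> {T. restr SS T = T}}"
  define X3 where "X3 = {x :: 3 jet \<times> (real^2) l2. (rj UP (fst x), snd x) \<in> Gam UP (fz 0) SS}"
  define X4 where "X4 = {x :: 3 jet \<times> (real^2) l2. (rj UM (fst x), snd x) \<in> Gam UM (fz 0) SS}"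
  define X5 where "X5 F = {x :: 3 jet \<times> (real^2) l2. (rj (fst F) (fst x), 0) \<in> Gam (fst F) (fst (snd F)) (snd (snd F))}"
    for F :: "(real^3) set \<times> (real^2 \<Rightarrow> real^3) \<times> (real^2) set"
  have x1: "subspace X1" "closed X1"
    unfolding X1_def by (rule closed_subspace_vimage[OF bounded_linear_fst subspace_H1j[OF A.Um] closed_H1j[OF A.Um]])+
  have x2: "subspace X2" "closed X2"
    unfolding X2_def by (rule closed_subspace_vimage[OF bounded_linear_snd restr_fixed_subspace[OF S.Um]])+
  have x3: "subspace X3" "closed X3"
    unfolding X3_def by (rule closed_subspace_vimage[OF bounded_linear_Pair[OF bl[OF P.Um] bounded_linear_snd]
        Gam_facts[OF P.bounded_open_axioms continuous_faces(3) S.bd S.Um]])+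
  have x4: "subspace X4" "closed X4"
    unfolding X4_def by (rule closed_subspace_vimage[OF bounded_linear_Pair[OF bl[OF M.Um] bounded_linear_snd]
        Gam_facts[OF M.bounded_open_axioms continuous_faces(3) S.bd S.Um]])+
  have x5: "subspace (X5 F)" "closed (X5 F)" if "F \<in> faces" for F
  proof -
    obtain U p R where F: "F = (U, p, R)" by (cases F)
    note f = faces_facts[OF that[unfolded F]]
    note c = closed_subspace_vimage[OF bounded_linear_Pair[OF bl[OF bounded_open.Um[OF f(1)]] bounded_linear_zero]
        Gam_facts[OF f(1,3,4,5)]]
    show "subspace (X5 F)" "closed (X5 F)" unfolding X5_def F fst_conv snd_conv by (rule c)+
  qed
  have eq: "S3 = X1 \<inter> X2 \<inter> X3 \<inter> X4 \<inter> (\<Inter>F\<in>faces. X5 F)"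
    unfolding S3_def X1_def X2_def X3_def X4_def X5_def by (auto simp: split_beta)
  show "subspace S3" unfolding eq using x1 x2 x3 x4 x5 by (intro subspace_inter) (auto intro!: subspace_Int)
  show "closed S3" unfolding eq using x1 x2 x3 x4 x5 by (intro closed_Int closed_INT) auto
qed

text \<open>The root is the constant of \<open>trace_inequality\<close>; the 4 is one plus the
  dimension, the price of comparing \<open>hn\<close> with the norm of a jet.\<close>

definition trc :: real where "trc = sqrt (1 / L3 + 2) * 4"

lemma trace_bound:
  assumes "(J, T) \<in> Gam UP (fz 0) SS"
  shows "norm T \<le> trc * norm J"
proof -
  have "closed {x :: 3 jet \<times> (real^2) l2. norm (snd x) \<le> trc * norm (fst x)}"
    by (intro closed_Collect_le continuous_intros)
  moreover have "(\<lambda>\<phi>. (jet UP \<phi>, cls SS (\<lambda>y. \<phi> (fz 0 y)))) ` {\<phi>. smooth_fun \<phi>}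
      \<subseteq> {x. norm (snd x) \<le> trc * norm (fst x)}"
  proof (rule image_subsetI)
    fix \<phi> :: "real^3 \<Rightarrow> real" assume "\<phi> \<in> {\<phi>. smooth_fun \<phi>}"
    then have "(norm (cls SS (\<lambda>y. \<phi> (fz 0 y))))\<^sup>2 \<le> (1 / L3 + 2) * (hn UP \<phi>)\<^sup>2"
      using trace_inequality L(3) by simp
    also have "... = (sqrt (1 / L3 + 2) * hn UP \<phi>)\<^sup>2" using L(3) by (simp add: power_mult_distrib)
    finally have "norm (cls SS (\<lambda>y. \<phi> (fz 0 y))) \<le> sqrt (1 / L3 + 2) * hn UP \<phi>"
      by (rule power2_le_imp_le) (use L(3) hn_nonneg[of UP \<phi>] in auto)
    also have "... \<le> sqrt (1 / L3 + 2) * (4 * norm (jet UP \<phi>))"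
      using hn_le_norm_jet[of UP \<phi>] L(3) by (intro mult_left_mono) auto
    finally show "(jet UP \<phi>, cls SS (\<lambda>y. \<phi> (fz 0 y))) \<in> {x. norm (snd x) \<le> trc * norm (fst x)}"
      by (simp add: trc_def)
  qed
  ultimately have "Gam UP (fz 0) SS \<subseteq> {x. norm (snd x) \<le> trc * norm (fst x)}"
    unfolding Gam_def by (rule closure_minimal[rotated])
  then show ?thesis using assms by auto
qed

text \<open>By linearity and the bound. It makes the trace picked in \<open>trSig\<close>
  independent of the choice up to null sets.\<close>

lemma trace_unique:
  assumes "(J, T) \<in> Gam UP (fz 0) SS" "(J, T') \<in> Gam UP (fz 0) SS"
  shows "T = T'"
proof -
  have "(J, T) - (J, T') \<in> Gam UP (fz 0) SS"
    by (rule subspace_diff[OF Gam_facts(1)[OF P.bounded_open_axioms continuous_faces(3) S.bd S.Um] assms])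
  then have "norm (T - T') \<le> trc * norm (0 :: 3 jet)" using trace_bound[of "J - J" "T - T'"] by simp
  then show ?thesis by simp
qed

definition VV :: "((3 jet \<times> (real^2) l2)^3) set" where "VV = {V. \<forall>i. V $ i \<in> S3}"

lemma VV_facts: "subspace VV" "closed VV"
proof -
  have eq: "VV = (\<Inter>i. {V. V $ i \<in> S3})" by (auto simp: VV_def)
  show "subspace VV" unfolding VV_def
    by (rule subspaceI) (simp_all add: subspace_0 subspace_add subspace_scale S3_facts(1))
  show "closed VV" unfolding eq
    by (rule closed_INT) (auto intro!: closed_subspace_vimage(2)[OF bounded_linear_vec_nth S3_facts])
qed

definition vj :: "(real^3 \<Rightarrow> real^3) \<Rightarrow> (3 jet \<times> (real^2) l2)^3" where
  "vj v = (\<chi> i. (wjet UA (\<lambda>x. v x $ i), cls SS (\<lambda>y. trSig L1 L2 L3 v y $ i)))"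

lemma Gam_iff:
  assumes f: "H1 UA f" and t: "Lsq SS t"
  shows "is_trace UP (fz 0) SS f t \<longleftrightarrow> (rj UP (wjet UA f), cls SS t) \<in> Gam UP (fz 0) SS"
    and "is_trace UM (fz 0) SS f t \<longleftrightarrow> (rj UM (wjet UA f), cls SS t) \<in> Gam UM (fz 0) SS"
proof -
  note p = wjet_subset[OF A.bounded_open_axioms P.bounded_open_axioms Om_facts(13) f]
  note m = wjet_subset[OF A.bounded_open_axioms M.bounded_open_axioms Om_facts(14) f]
  show "is_trace UP (fz 0) SS f t \<longleftrightarrow> (rj UP (wjet UA f), cls SS t) \<in> Gam UP (fz 0) SS"
    using is_trace_iff[OF P.bounded_open_axioms continuous_faces(3) S.bd S.Um p(1) t] p(2) by simp
  show "is_trace UM (fz 0) SS f t \<longleftrightarrow> (rj UM (wjet UA f), cls SS t) \<in> Gam UM (fz 0) SS"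
    using is_trace_iff[OF M.bounded_open_axioms continuous_faces(3) S.bd S.Um m(1) t] m(2) by simp
qed

lemma zero_bc_iff:
  assumes f: "H1 UA f"
  shows "zero_bc L1 L2 L3 f \<longleftrightarrow> (\<forall>(U, p, R)\<in>faces. (rj U (wjet UA f), 0) \<in> Gam U p R)"
proof -
  have "is_trace U p R f (\<lambda>_. 0) \<longleftrightarrow> (rj U (wjet UA f), 0) \<in> Gam U p R" if F: "(U, p, R) \<in> faces" for U p R
  proof -
    note ff = faces_facts[OF F]
    note w = wjet_subset[OF A.bounded_open_axioms ff(1,2) f]
    show ?thesis
      using is_trace_iff[OF ff(1,3,4,5) w(1) Lsq_zero[OF ff(5)]] w(2) by (simp add: cls_zero)
  qed
  then show ?thesis unfolding zero_bc_faces by auto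
qed

lemma Vspace_vj:
  assumes v: "Vspace L1 L2 L3 v"
  shows "vj v \<in> VV" "H1 UA (\<lambda>x. v x $ i)" "Lsq SS (\<lambda>y. trSig L1 L2 L3 v y $ i)"
proof -
  have h: "H1 UA (\<lambda>x. v x $ i)" for i using v by (simp add: Vspace_def)
  then show "H1 UA (\<lambda>x. v x $ i)" .
  have t: "is_trace UP (fz 0) SS (\<lambda>x. v x $ i) (\<lambda>y. trSig L1 L2 L3 v y $ i)" for i
  proof -
    have "\<exists>t. is_trace UP (fz 0) SS (\<lambda>x. v x $ i) t" using v unfolding Vspace_def by blast
    from someI_ex[OF this] show ?thesis by (simp add: trSig_def)
  qed
  have l: "Lsq SS (\<lambda>y. trSig L1 L2 L3 v y $ i)" for i using t[of i] by (simp add: is_trace_def)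
  then show "Lsq SS (\<lambda>y. trSig L1 L2 L3 v y $ i)" .
  have "vj v $ i \<in> S3" for i
  proof -
    let ?J = "wjet UA (\<lambda>x. v x $ i)" and ?T = "cls SS (\<lambda>y. trSig L1 L2 L3 v y $ i)"
    \<comment> \<open>The common trace promised by \<open>Vspace\<close> need not be the one chosen
      by \<open>trSig\<close>. Uniqueness on the upper side identifies their classes, which makes
      the chosen one a trace from below as well.\<close>
    obtain t0 where t0: "is_trace UP (fz 0) SS (\<lambda>x. v x $ i) t0" "is_trace UM (fz 0) SS (\<lambda>x. v x $ i) t0"
      using v unfolding Vspace_def by blast
    have l0: "Lsq SS t0" using t0(1) by (simp add: is_trace_def)
    have 1: "(rj UP ?J, ?T) \<in> Gam UP (fz 0) SS" using Gam_iff(1)[OF h l] t by simp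
    have "(rj UP ?J, cls SS t0) \<in> Gam UP (fz 0) SS" using Gam_iff(1)[OF h l0] t0(1) by simp
    then have "?T = cls SS t0" by (rule trace_unique[OF 1])
    then have 2: "(rj UM ?J, ?T) \<in> Gam UM (fz 0) SS" using Gam_iff(2)[OF h l0] t0(2) by simp
    have 3: "\<forall>(U, p, R)\<in>faces. (rj U ?J, 0) \<in> Gam U p R"
      using v zero_bc_iff[OF h] by (simp add: Vspace_def)
    show ?thesis unfolding S3_def vj_def
      using 1 2 3 A.wjet_H1j[OF h] restr_idem[OF S.Um l] by simp
  qed
  then show "vj v \<in> VV" by (simp add: VV_def)
qed

text \<open>Representatives of the leading entries form the function; the trace chosen for it by
  \<open>trSig\<close> agrees with the prescribed one by uniqueness.\<close>

lemma VV_rep: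
  assumes V: "V \<in> VV"
  shows "\<exists>v. Vspace L1 L2 L3 v \<and> vj v = V"
proof -
  define v where "v x = (\<chi> i. rp (fst (fst (V $ i))) x)" for x
  have V3: "V $ i \<in> S3" for i using V by (simp add: VV_def)
  have Vj: "fst (V $ i) \<in> H1j UA" for i using V3[of i] by (simp add: S3_def)
  have c: "(\<lambda>x. v x $ i) = rp (fst (fst (V $ i)))" for i by (auto simp: v_def)
  have h: "H1 UA (\<lambda>x. v x $ i)" and w: "wjet UA (\<lambda>x. v x $ i) = fst (V $ i)" for i
    unfolding c using A.H1_rep[OF Vj[of i]] by auto
  define t where "t i = rp (snd (V $ i))" for i
  have l: "Lsq SS (t i)" for i unfolding t_def by (rule Lsq_rp[OF S.Um])
  have ct: "cls SS (t i) = snd (V $ i)" for i using V3[of i] by (simp add: S3_def t_def restr_def)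
  have tr: "is_trace UP (fz 0) SS (\<lambda>x. v x $ i) (t i)" "is_trace UM (fz 0) SS (\<lambda>x. v x $ i) (t i)" for i
    using Gam_iff[OF h[of i] l[of i]] V3[of i] unfolding w ct by (auto simp: S3_def)
  have z: "zero_bc L1 L2 L3 (\<lambda>x. v x $ i)" for i
    using zero_bc_iff[OF h[of i]] V3[of i] unfolding w by (simp add: S3_def)
  have vs: "Vspace L1 L2 L3 v" unfolding Vspace_def using h tr z by blast
  have "vj v $ i = V $ i" for i
  proof -
    have "vj v $ i \<in> S3" using Vspace_vj(1)[OF vs] by (simp add: VV_def)
    then have "(rj UP (wjet UA (\<lambda>x. v x $ i)), snd (vj v $ i)) \<in> Gam UP (fz 0) SS" by (simp add: S3_def vj_def)
    moreover have "(rj UP (wjet UA (\<lambda>x. v x $ i)), snd (V $ i)) \<in> Gam UP (fz 0) SS"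
      using V3[of i] unfolding w by (simp add: S3_def)
    ultimately have "snd (vj v $ i) = snd (V $ i)" by (rule trace_unique)
    then show ?thesis using w[of i] by (simp add: vj_def prod_eq_iff)
  qed
  then show ?thesis using vs by (auto simp: vec_eq_iff)
qed

subsection \<open>Strain and divergence\<close>

definition Fj :: "(3 jet \<times> (real^2) l2)^3 \<Rightarrow> 3 \<Rightarrow> (real^3) l2" where "Fj V i = fst (fst (V $ i))"
definition Gj :: "(3 jet \<times> (real^2) l2)^3 \<Rightarrow> 3 \<Rightarrow> 3 \<Rightarrow> (real^3) l2" where "Gj V i j = snd (fst (V $ i)) $ j"
definition Tj :: "(3 jet \<times> (real^2) l2)^3 \<Rightarrow> 3 \<Rightarrow> (real^2) l2" where "Tj V i = snd (V $ i)"
definition Dj :: "(3 jet \<times> (real^2) l2)^3 \<Rightarrow> 3 \<Rightarrow> 3 \<Rightarrow> (real^3) l2" where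
  "Dj V i j = (1/2) *\<^sub>R (Gj V i j + Gj V j i)"
definition dvj :: "(3 jet \<times> (real^2) l2)^3 \<Rightarrow> (real^3) l2" where "dvj V = (\<Sum>i\<in>UNIV. Gj V i i)"

lemma bl_components:
  assumes "bounded_linear f"
  shows "bounded_linear (\<lambda>x. Fj (f x) i)" "bounded_linear (\<lambda>x. Gj (f x) i j)" "bounded_linear (\<lambda>x. Tj (f x) i)"
    "bounded_linear (\<lambda>x. Dj (f x) i j)" "bounded_linear (\<lambda>x. dvj (f x))"
  unfolding Fj_def Gj_def Tj_def Dj_def dvj_def by (intro bl_intros assms)+

lemma restr_split:
  assumes "restr UA F = F"
  shows "F = restr UP F + restr UM F"
proof -
  have disj: "x \<notin> UM" if "x \<in> UP" for x using that by (auto simp: OmP_def OmM_def mem_box_cart forall_3)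
  let ?f = "rp F"
  have s: "sqint (\<lambda>x. if x \<in> UP then ?f x else 0)" "sqint (\<lambda>x. if x \<in> UM then ?f x else 0)"
    by (intro sqint_indicator sqint_rp P.Um M.Um)+
  have "restr UP F + restr UM F = abs_l2 (\<lambda>x. (if x \<in> UP then ?f x else 0) + (if x \<in> UM then ?f x else 0))"
    unfolding restr_def cls_def by (rule add_abs_l2[OF s])
  also have "(\<lambda>x. (if x \<in> UP then ?f x else 0) + (if x \<in> UM then ?f x else 0)) = (\<lambda>x. if x \<in> UA then ?f x else 0)"
    using disj by (intro ext) (auto simp: OmPM_def)
  also have "abs_l2 (\<lambda>x. if x \<in> UA then ?f x else 0) = restr UA F" by (simp add: restr_def cls_def)
  finally show ?thesis using assms by simp
qed

lemma vector_box_pos: "\<forall>b\<in>Basis. (vector [a1, a2, a3] :: real^3) \<bullet> b < vector [c1, c2, c3] \<bullet> b"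
  if "a1 < c1" "a2 < c2" "a3 < c3"
proof
  fix b :: "real^3" assume "b \<in> Basis"
  then obtain i where b: "b = axis i 1" by (auto simp: Basis_vec_def)
  have "(vector [a1, a2, a3] :: real^3) $ i < vector [c1, c2, c3] $ i"
    using that exhaust_3[of i] by auto
  then show "(vector [a1, a2, a3] :: real^3) \<bullet> b < vector [c1, c2, c3] \<bullet> b" by (simp add: b inner_axis)
qed

text \<open>Korn's inequality bounds the gradient on each half, and the interface trace, which is an
  entry of V, is bounded by the jet on the upper half.\<close>

theorem velocity_coercive:
  "\<exists>K\<ge>0. \<forall>V\<in>VV. norm V \<le> K * sqrt ((\<Sum>i\<in>UNIV. (norm (Fj V i))\<^sup>2) + (\<Sum>i\<in>UNIV. \<Sum>j\<in>UNIV. (norm (Dj V i j))\<^sup>2))"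
proof -
  have bp: "\<forall>b\<in>Basis. (vector [0, 0, 0] :: real^3) \<bullet> b < vector [L1, L2, L3] \<bullet> b"
    and bm: "\<forall>b\<in>Basis. (vector [0, 0, - L3] :: real^3) \<bullet> b < vector [L1, L2, 0] \<bullet> b"
    by (rule vector_box_pos; use L in simp)+
  obtain CP where CP: "CP \<ge> 0" "\<And>J i k. (\<forall>i. J $ i \<in> closure (jet UP ` {\<phi>. smooth_fun \<phi>})) \<Longrightarrow>
    norm (snd (J $ i) $ k) \<le> CP * ((\<Sum>i\<in>UNIV. norm (fst (J $ i)))
      + (\<Sum>i\<in>UNIV. \<Sum>j\<in>UNIV. norm ((1/2) *\<^sub>R (snd (J $ i) $ j + snd (J $ j) $ i))))"
  proof -
    from korn_jets[OF bp, folded OmP_def] obtain C where "C \<ge> 0"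
      and k: "\<forall>J :: (3 jet)^3. (\<forall>i. J $ i \<in> closure (jet UP ` {\<phi>. smooth_fun \<phi>})) \<longrightarrow>
        (\<forall>i k. norm (snd (J $ i) $ k) \<le> C * ((\<Sum>i\<in>UNIV. norm (fst (J $ i)))
      + (\<Sum>i\<in>UNIV. \<Sum>j\<in>UNIV. norm ((1/2) *\<^sub>R (snd (J $ i) $ j + snd (J $ j) $ i)))))"
      by (elim exE conjE) (rule that)
    show ?thesis by (rule that[OF \<open>C \<ge> 0\<close>]) (rule k[THEN spec, THEN mp, THEN spec, THEN spec])
  qed
  obtain CM where CM: "CM \<ge> 0" "\<And>J i k. (\<forall>i. J $ i \<in> closure (jet UM ` {\<phi>. smooth_fun \<phi>})) \<Longrightarrow>
    norm (snd (J $ i) $ k) \<le> CM * ((\<Sum>i\<in>UNIV. norm (fst (J $ i)))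
      + (\<Sum>i\<in>UNIV. \<Sum>j\<in>UNIV. norm ((1/2) *\<^sub>R (snd (J $ i) $ j + snd (J $ j) $ i))))"
  proof -
    from korn_jets[OF bm, folded OmM_def] obtain C where "C \<ge> 0"
      and k: "\<forall>J :: (3 jet)^3. (\<forall>i. J $ i \<in> closure (jet UM ` {\<phi>. smooth_fun \<phi>})) \<longrightarrow>
        (\<forall>i k. norm (snd (J $ i) $ k) \<le> C * ((\<Sum>i\<in>UNIV. norm (fst (J $ i)))
      + (\<Sum>i\<in>UNIV. \<Sum>j\<in>UNIV. norm ((1/2) *\<^sub>R (snd (J $ i) $ j + snd (J $ j) $ i)))))"
      by (elim exE conjE) (rule that)
    show ?thesis by (rule that[OF \<open>C \<ge> 0\<close>]) (rule k[THEN spec, THEN mp, THEN spec, THEN spec])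
  qed
  \<comment> \<open>The trace conditions on the interface supply the approximation by smooth
    functions on each half that Korn's inequality asks for.\<close>
  have Gam_fst: "fst x \<in> closure (jet U ` {\<phi>. smooth_fun \<phi>})" if "x \<in> Gam U p R" for x U p R
  proof -
    have "fst ` closure ((\<lambda>\<phi>. (jet U \<phi>, cls R (\<lambda>y. \<phi> (p y)))) ` {\<phi>. smooth_fun \<phi>})
        \<subseteq> closure (jet U ` {\<phi>. smooth_fun \<phi>})"
    proof (rule image_closure_subset)
      show "continuous_on (closure ((\<lambda>\<phi>. (jet U \<phi>, cls R (\<lambda>y. \<phi> (p y)))) ` {\<phi>. smooth_fun \<phi>})) fst"
        by (intro continuous_intros)
      show "fst ` (\<lambda>\<phi>. (jet U \<phi>, cls R (\<lambda>y. \<phi> (p y)))) ` {\<phi>. smooth_fun \<phi>} \<subseteq> closure (jet U ` {\<phi>. smooth_fun \<phi>})"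
        using closure_subset by (force simp: image_image)
    qed simp
    then show ?thesis using that unfolding Gam_def by blast
  qed
  \<comment> \<open>Twelve is the number of norms on the right of Korn's inequality, 3 components
    and 9 strain entries, each at most N below.\<close>
  define C where "C = 12 * (CP + CM)"
  define K where "K = 3 * ((1 + 3 * C) * (1 + trc))"
  have C0: "C \<ge> 0" using CP CM by (simp add: C_def)
  have trc0: "trc \<ge> 0" using L by (simp add: trc_def)
  have "norm V \<le> K * sqrt ((\<Sum>i\<in>UNIV. (norm (Fj V i))\<^sup>2) + (\<Sum>i\<in>UNIV. \<Sum>j\<in>UNIV. (norm (Dj V i j))\<^sup>2))"
    if V: "V \<in> VV" for V
  proof -
    define N where "N = sqrt ((\<Sum>i\<in>UNIV. (norm (Fj V i))\<^sup>2) + (\<Sum>i\<in>UNIV. \<Sum>j\<in>UNIV. (norm (Dj V i j))\<^sup>2))"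
    have N0: "N \<ge> 0" unfolding N_def by (intro real_sqrt_ge_zero add_nonneg_nonneg sum_nonneg) auto
    have V3: "V $ i \<in> S3" for i using V by (simp add: VV_def)
    have rG: "restr UA (Gj V i k) = Gj V i k" for i k using V3[of i] by (simp add: S3_def H1j_def Gj_def)
    have F: "norm (Fj V i) \<le> N" for i unfolding N_def
    proof (rule real_le_rsqrt)
      have "(norm (Fj V i))\<^sup>2 \<le> (\<Sum>i\<in>UNIV. (norm (Fj V i))\<^sup>2)" by (rule member_le_sum) auto
      then show "(norm (Fj V i))\<^sup>2 \<le> (\<Sum>i\<in>UNIV. (norm (Fj V i))\<^sup>2) + (\<Sum>i\<in>UNIV. \<Sum>j\<in>UNIV. (norm (Dj V i j))\<^sup>2)"
        by (simp add: add_increasing2 sum_nonneg)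
    qed
    have D: "norm (Dj V i j) \<le> N" for i j unfolding N_def
    proof (rule real_le_rsqrt)
      have "(norm (Dj V i j))\<^sup>2 \<le> (\<Sum>j\<in>UNIV. (norm (Dj V i j))\<^sup>2)" by (rule member_le_sum) auto
      also have "... \<le> (\<Sum>i\<in>UNIV. \<Sum>j\<in>UNIV. (norm (Dj V i j))\<^sup>2)" by (rule member_le_sum) (auto intro: sum_nonneg)
      finally show "(norm (Dj V i j))\<^sup>2 \<le> (\<Sum>i\<in>UNIV. (norm (Fj V i))\<^sup>2) + (\<Sum>i\<in>UNIV. \<Sum>j\<in>UNIV. (norm (Dj V i j))\<^sup>2)"
        by (simp add: add_increasing sum_nonneg)
    qed
    \<comment> \<open>One argument for both halves, with the Korn constant of the half W as c; it
      works because restriction commutes with forming the strain.\<close>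
    have part: "norm (restr W (Gj V i k)) \<le> c * (12 * N)"
      if W: "W \<in> sets lebesgue" and c: "c \<ge> 0"
        and K: "\<And>J i k. (\<forall>i. J $ i \<in> closure (jet W ` {\<phi>. smooth_fun \<phi>})) \<Longrightarrow>
          norm (snd (J $ i) $ k) \<le> c * ((\<Sum>i\<in>UNIV. norm (fst (J $ i)))
          + (\<Sum>i\<in>UNIV. \<Sum>j\<in>UNIV. norm ((1/2) *\<^sub>R (snd (J $ i) $ j + snd (J $ j) $ i))))"
        and cl: "\<And>i. rj W (fst (V $ i)) \<in> closure (jet W ` {\<phi>. smooth_fun \<phi>})" for W c i k
    proof -
      interpret r: bounded_linear "restr W" by (rule bounded_linear_restr[OF W])
      define J :: "(3 jet)^3" where "J = (\<chi> i. rj W (fst (V $ i)))"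
      have Ji: "fst (J $ i) = restr W (Fj V i)" "snd (J $ i) $ j = restr W (Gj V i j)" for i j
        by (simp_all add: J_def rj_def Fj_def Gj_def)
      have Dr: "(1/2) *\<^sub>R (restr W (Gj V i j) + restr W (Gj V j i)) = restr W (Dj V i j)" for i j
        by (simp add: Dj_def r.scaleR r.add)
      have "norm (snd (J $ i) $ k) \<le> c * ((\<Sum>i\<in>UNIV. norm (fst (J $ i)))
          + (\<Sum>i\<in>UNIV. \<Sum>j\<in>UNIV. norm ((1/2) *\<^sub>R (snd (J $ i) $ j + snd (J $ j) $ i))))"
        by (rule K) (simp add: J_def cl)
      also have "... \<le> c * ((\<Sum>i\<in>(UNIV::3 set). N) + (\<Sum>i\<in>(UNIV::3 set). \<Sum>j\<in>(UNIV::3 set). N))"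
        unfolding Ji Dr using norm_restr_le[OF W] F D
        by (intro mult_left_mono add_mono sum_mono c) (meson order_trans)+
      also have "... = c * (12 * N)" by simp
      finally show ?thesis unfolding Ji .
    qed
    have "rj UP (fst (V $ i)) \<in> closure (jet UP ` {\<phi>. smooth_fun \<phi>})"
      "rj UM (fst (V $ i)) \<in> closure (jet UM ` {\<phi>. smooth_fun \<phi>})" for i
      using V3[of i] Gam_fst[of "(rj UP (fst (V $ i)), snd (V $ i))"] Gam_fst[of "(rj UM (fst (V $ i)), snd (V $ i))"]
      by (auto simp: S3_def)
    note cl = this
    have G: "norm (Gj V i k) \<le> C * N" for i k
    proof -
      have "norm (Gj V i k) = norm (restr UP (Gj V i k) + restr UM (Gj V i k))"
        using restr_split[OF rG[of i k]] by simp
      also have "... \<le> norm (restr UP (Gj V i k)) + norm (restr UM (Gj V i k))" by (rule norm_triangle_ineq)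
      also have "... \<le> CP * (12 * N) + CM * (12 * N)"
        by (rule add_mono[OF part[OF P.Um CP cl(1)] part[OF M.Um CM cl(2)]])
      finally show ?thesis by (simp add: C_def algebra_simps)
    qed
    have J: "norm (fst (V $ i)) \<le> (1 + 3 * C) * N" for i
    proof -
      have "norm (fst (V $ i)) \<le> norm (Fj V i) + norm (snd (fst (V $ i)))"
        using norm_Pair_le_sum[of "fst (fst (V $ i))" "snd (fst (V $ i))"] by (simp add: Fj_def)
      also have "norm (snd (fst (V $ i))) \<le> (\<Sum>k\<in>UNIV. norm (Gj V i k))"
        unfolding Gj_def by (rule norm_vec_le_sum)
      also have "(\<Sum>k\<in>UNIV. norm (Gj V i k)) \<le> (\<Sum>k\<in>(UNIV::3 set). C * N)" by (rule sum_mono[OF G])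
      finally show ?thesis using F[of i] by (simp add: algebra_simps)
    qed
    have Vi: "norm (V $ i) \<le> ((1 + 3 * C) * (1 + trc)) * N" for i
    proof -
      have "norm (V $ i) \<le> norm (fst (V $ i)) + norm (snd (V $ i))"
        using norm_Pair_le_sum[of "fst (V $ i)" "snd (V $ i)"] by simp
      also have "norm (snd (V $ i)) \<le> trc * norm (rj UP (fst (V $ i)))"
        using V3[of i] by (intro trace_bound) (simp add: S3_def)
      also have "trc * norm (rj UP (fst (V $ i))) \<le> trc * norm (fst (V $ i))"
      proof (rule mult_left_mono[OF _ trc0])
        have "norm (\<chi> k. restr UP (snd (fst (V $ i)) $ k)) \<le> norm (snd (fst (V $ i)))"
          unfolding norm_vec_def by (intro L2_set_mono) (auto simp: norm_restr_le P.Um)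
        then show "norm (rj UP (fst (V $ i))) \<le> norm (fst (V $ i))"
          unfolding rj_def norm_Pair norm_prod_def using norm_restr_le[OF P.Um]
          by (intro real_sqrt_le_mono add_mono power_mono) auto
      qed
      also have "norm (fst (V $ i)) + trc * norm (fst (V $ i)) = (1 + trc) * norm (fst (V $ i))" by (simp add: algebra_simps)
      also have "... \<le> (1 + trc) * ((1 + 3 * C) * N)" using J trc0 by (intro mult_left_mono) auto
      finally show ?thesis by (simp add: mult_ac)
    qed
    have "norm V \<le> (\<Sum>i\<in>UNIV. norm (V $ i))" by (rule norm_vec_le_sum)
    also have "... \<le> (\<Sum>i\<in>(UNIV::3 set). ((1 + 3 * C) * (1 + trc)) * N)" by (rule sum_mono[OF Vi])
    also have "... = K * N" by (simp add: K_def)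
    finally show ?thesis by (simp add: N_def)
  qed
  moreover have "K \<ge> 0" unfolding K_def using C0 trc0 by simp
  ultimately show ?thesis by blast
qed

lemma dvj_restr:
  assumes "V \<in> VV"
  shows "restr UA (dvj V) = dvj V"
proof -
  interpret r: bounded_linear "restr UA" by (rule bounded_linear_restr[OF A.Um])
  have "restr UA (Gj V i k) = Gj V i k" for i k using assms by (simp add: VV_def S3_def H1j_def Gj_def)
  then show ?thesis by (simp add: dvj_def r.sum)
qed

text \<open>A function smooth across the interface is its own approximating sequence on either side,
  so its restriction is the trace from both.\<close>

lemma smooth_S3:
  assumes \<phi>: "smooth_fun \<phi>" and z: "\<And>U p R y. (U, p, R) \<in> faces \<Longrightarrow> y \<in> R \<Longrightarrow> \<phi> (p y) = 0"
  shows "(jet UA \<phi>, cls SS (\<lambda>y. \<phi> (fz 0 y))) \<in> S3"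
proof -
  have g: "(rj U (jet UA \<phi>), cls R (\<lambda>y. \<phi> (p y))) \<in> Gam U p R" if "bounded_open U" "U \<subseteq> UA" for U p R
  proof -
    interpret bounded_open U by fact
    have "rj U (jet UA \<phi>) = jet U \<phi>"
      using wjet_subset(2)[OF A.bounded_open_axioms that A.smooth_H1(1)[OF \<phi>]] A.smooth_H1(2)[OF \<phi>] smooth_H1(2)[OF \<phi>] by simp
    then show ?thesis unfolding Gam_def using \<phi> by (intro subsetD[OF closure_subset]) auto
  qed
  have "(rj U (jet UA \<phi>), 0) \<in> Gam U p R" if F: "(U, p, R) \<in> faces" for U p R
  proof -
    have "cls R (\<lambda>y. \<phi> (p y)) = cls R (\<lambda>y. 0)" by (rule cls_cong) (rule z[OF F])
    then show ?thesis using g[of U R p] faces_facts(1,2)[OF F] by (simp add: cls_zero)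
  qed
  moreover have "restr SS (cls SS (\<lambda>y. \<phi> (fz 0 y))) = cls SS (\<lambda>y. \<phi> (fz 0 y))"
    by (rule restr_idem[OF S.Um Lsq_smooth_comp[OF \<phi> continuous_faces(3) S.bd S.Um]])
  ultimately show ?thesis unfolding S3_def
    using g[OF P.bounded_open_axioms Om_facts(13)] g[OF M.bounded_open_axioms Om_facts(14)] A.jet_H1j[OF \<phi>] by auto
qed

text \<open>The problem is solved on the whole box with the top face free and then restricted; the
  interface lies inside, so the traces from both sides agree. The class q vanishes off
  \<open>UA\<close> and is thus admissible data on the box.\<close>

theorem divergence_velocity:
  "\<exists>C\<ge>0. \<forall>q. restr UA q = q \<longrightarrow> (\<exists>V\<in>VV. norm V \<le> C * norm q \<and> norm (dvj V - q) \<le> norm q / 2)"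
proof -
  let ?a = "vector [0, 0, - L3] :: real^3" and ?c = "vector [L1, L2, L3] :: real^3"
  let ?B = "box ?a ?c"
  have ac: "\<forall>b\<in>Basis. ?a \<bullet> b < ?c \<bullet> b" using L by (intro vector_box_pos) auto
  have Bm: "?B \<in> sets lebesgue" "bounded ?B" by auto
  have AB: "UA \<subseteq> ?B" using L by (auto simp: OmPM_def OmP_def OmM_def mem_box_cart forall_3)
  have PA: "UP \<subseteq> UA" by (rule Om_facts)
  obtain C where C: "C \<ge> 0" and core: "\<And>Q. restr ?B Q = Q \<Longrightarrow>
    (\<exists>V. (\<forall>b\<in>Basis. smooth_fun (V b))
      \<and> (\<forall>x\<in>cbox ?a ?c. \<forall>i\<in>Basis. x \<bullet> i = ?a \<bullet> i \<or> x \<bullet> i = ?c \<bullet> i \<and> i \<noteq> axis 3 1 \<longrightarrow> (\<forall>b\<in>Basis. V b x = 0))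
      \<and> (\<Sum>b\<in>Basis. hn ?B (V b)) \<le> C * norm Q
      \<and> norm (cls ?B (dv V) - Q) \<le> norm Q / 2)"
    using divergence_free_face[OF ac axis_Basis[of 3]] by (elim exE conjE) (rule that, assumption, blast)
  have trc0: "trc \<ge> 0" using L by (simp add: trc_def)
  have "\<exists>V\<in>VV. norm V \<le> ((1 + trc) * C) * norm q \<and> norm (dvj V - q) \<le> norm q / 2" if q: "restr UA q = q" for q
  proof -
    have "restr ?B q = q"
    proof -
      have "q = cls UA (rp q)" using q by (simp add: restr_def)
      then have "restr ?B q = cls (UA \<inter> ?B) (rp q)" using restr_cls[OF A.Um Bm(1) Lsq_rp[OF A.Um]] by metis
      then show ?thesis using AB q by (simp add: Int_absorb2 restr_def)
    qed
    from core[OF this] obtain V where VV0: "(\<forall>b\<in>Basis. smooth_fun (V b))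
      \<and> (\<forall>x\<in>cbox ?a ?c. \<forall>i\<in>Basis. x \<bullet> i = ?a \<bullet> i \<or> x \<bullet> i = ?c \<bullet> i \<and> i \<noteq> axis 3 1 \<longrightarrow> (\<forall>b\<in>Basis. V b x = 0))
      \<and> (\<Sum>b\<in>Basis. hn ?B (V b)) \<le> C * norm q
      \<and> norm (cls ?B (dv V) - q) \<le> norm q / 2" by (elim exE) (rule that)
    define v where "v i = V (axis i 1)" for i
    have sv: "smooth_fun (v i)" for i using VV0 axis_Basis by (simp add: v_def)
    have v0: "v i x = 0" if "x \<in> cbox ?a ?c" "x $ k = ?a $ k \<or> x $ k = ?c $ k \<and> k \<noteq> 3" for i x k
    proof -
      have "x \<bullet> axis k 1 = ?a \<bullet> axis k 1 \<or> x \<bullet> axis k 1 = ?c \<bullet> axis k 1 \<and> axis k 1 \<noteq> (axis 3 1 :: real^3)"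
        using that(2) by (auto simp: inner_axis axis_eq_axis)
      then show ?thesis using VV0 that(1) axis_Basis unfolding v_def by blast
    qed
    have bnd: "(\<Sum>i\<in>UNIV. hn ?B (v i)) \<le> C * norm q" using VV0 by (simp add: sum_Basis_vec v_def)
    have dvV: "dv V = (\<lambda>x. \<Sum>i\<in>UNIV. partial_dir (axis i 1) (v i) x)"
      by (simp add: dv_def[abs_def] sum_Basis_vec v_def)
    define X :: "(3 jet \<times> (real^2) l2)^3" where "X = (\<chi> i. (jet UA (v i), cls SS (\<lambda>y. v i (fz 0 y))))"
    have XS: "X $ i \<in> S3" for i
      unfolding X_def vec_lambda_beta
    proof (rule smooth_S3[OF sv])
      fix U p R y assume F: "(U, p, R) \<in> faces" and y: "y \<in> R"
      have "\<exists>k. p y $ k = ?a $ k \<or> p y $ k = ?c $ k \<and> k \<noteq> 3"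
        using F unfolding faces_def
        by (auto simp: fx_def fy_def fz_def intro: exI[of _ 1] exI[of _ 2] exI[of _ 3])
      then obtain k where k: "p y $ k = ?a $ k \<or> p y $ k = ?c $ k \<and> k \<noteq> 3" by blast
      have "p y \<in> cbox ?a ?c"
        using F y L unfolding faces_def
        by (auto simp: fx_def fy_def fz_def mem_box_cart forall_3 forall_2 Sig_def less_imp_le)
      then show "v i (p y) = 0" by (rule v0[OF _ k])
    qed
    then have XV: "X \<in> VV" by (simp add: VV_def)
    have hB: "hn UA (v i) \<le> hn ?B (v i)" for i
      unfolding hn_def by (intro add_mono sum_mono norm_cls_subset Bm A.Um AB Lsq_smooth sv smooth_partial)
    have Xi: "norm (X $ i) \<le> (1 + trc) * hn ?B (v i)" for i
    proof -
      have T: "norm (snd (X $ i)) \<le> trc * norm (rj UP (fst (X $ i)))"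
        using XS[of i] by (intro trace_bound) (simp add: S3_def)
      have "rj UP (jet UA (v i)) = jet UP (v i)"
        using wjet_subset(2)[OF A.bounded_open_axioms P.bounded_open_axioms PA A.smooth_H1(1)[OF sv]]
          A.smooth_H1(2)[OF sv] P.smooth_H1(2)[OF sv] by simp
      moreover have "hn UP (v i) \<le> hn ?B (v i)"
        unfolding hn_def using PA AB
        by (intro add_mono sum_mono norm_cls_subset Bm P.Um Lsq_smooth sv smooth_partial) auto
      ultimately have "trc * norm (rj UP (fst (X $ i))) \<le> trc * hn ?B (v i)"
        using order_trans[OF norm_jet_le_hn[of UP "v i"]] trc0 by (intro mult_left_mono) (auto simp: X_def)
      moreover have "norm (fst (X $ i)) \<le> hn ?B (v i)"
        using order_trans[OF norm_jet_le_hn[of UA "v i"] hB] by (simp add: X_def)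
      moreover have "norm (X $ i) \<le> norm (fst (X $ i)) + norm (snd (X $ i))"
        using norm_Pair_le_sum[of "fst (X $ i)" "snd (X $ i)"] by simp
      ultimately show ?thesis using T by (simp add: distrib_right)
    qed
    have "norm X \<le> (\<Sum>i\<in>UNIV. norm (X $ i))" by (rule norm_vec_le_sum)
    also have "... \<le> (\<Sum>i\<in>UNIV. (1 + trc) * hn ?B (v i))" by (rule sum_mono[OF Xi])
    also have "... = (1 + trc) * (\<Sum>i\<in>UNIV. hn ?B (v i))" by (rule sum_distrib_left[symmetric])
    also have "... \<le> (1 + trc) * (C * norm q)" using bnd trc0 by (intro mult_left_mono) auto
    finally have nX: "norm X \<le> ((1 + trc) * C) * norm q" by (simp add: mult.assoc)
    have sdv: "smooth_fun (dv V)" unfolding dvV by (intro smooth_sum smooth_partial sv axis_Basis)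
    have "dvj X = cls UA (dv V)"
      unfolding dvV dvj_def Gj_def X_def jet_def
      by (simp add: conjunct2[OF cls_sum] A.Um A.LSp sv)
    also have "... = restr UA (cls ?B (dv V))"
      by (simp add: restr_subset Bm A.Um AB Lsq_smooth sdv)
    finally have "dvj X - q = restr UA (cls ?B (dv V) - q)"
      using linear_diff[OF bounded_linear.linear[OF bounded_linear_restr[OF A.Um]], of "cls ?B (dv V)" q] q by simp
    then have "norm (dvj X - q) \<le> norm (cls ?B (dv V) - q)" by (simp add: norm_restr_le A.Um)
    then have "norm (dvj X - q) \<le> norm q / 2" using VV0 by linarith
    then show ?thesis using XV nX by blast
  qed
  moreover have "(1 + trc) * C \<ge> 0" using C trc0 by simp
  ultimately show ?thesis by blast
qed

end

section \<open>The time step as a saddle point problem\<close>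

lemma bounded_bilinear_plus:
  assumes "bounded_bilinear f" "bounded_bilinear g"
  shows "bounded_bilinear (\<lambda>x y. f x y + g x y)"
proof -
  interpret f: bounded_bilinear f by fact
  interpret g: bounded_bilinear g by fact
  obtain a b where a: "\<And>x y. norm (f x y) \<le> norm x * norm y * a" and b: "\<And>x y. norm (g x y) \<le> norm x * norm y * b"
    using f.bounded g.bounded by blast
  have "norm (f x y + g x y) \<le> norm x * norm y * (a + b)" for x y
    using norm_triangle_ineq[of "f x y" "g x y"] a[of x y] b[of x y] by (simp add: distrib_left)
  then show ?thesis
    by (intro bounded_bilinear.intro exI[of _ "a + b"] allI)
      (auto simp: f.add_left f.add_right g.add_left g.add_right f.scaleR_left f.scaleR_right
        g.scaleR_left g.scaleR_right scaleR_add_right)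
qed

lemma bounded_bilinear_mult_const:
  fixes f :: "'a::real_normed_vector \<Rightarrow> 'b::real_normed_vector \<Rightarrow> real"
  assumes "bounded_bilinear f"
  shows "bounded_bilinear (\<lambda>x y. c * f x y)"
proof -
  have "(\<lambda>x y. c * f x y) = (\<lambda>x y. f (c *\<^sub>R x) y)"
    using bounded_bilinear.scaleR_left[OF assms] by (intro ext) simp
  then show ?thesis
    using bounded_bilinear.comp1[OF assms bounded_linear_scaleR_right[of c]] by simp
qed

lemma bounded_bilinear_zero: "bounded_bilinear (\<lambda>x y. 0)"
  by (rule bounded_bilinear.intro) (auto intro: exI[of _ 0])

lemma bounded_bilinear_sum:
  assumes "\<And>i. i \<in> I \<Longrightarrow> bounded_bilinear (f i)"
  shows "bounded_bilinear (\<lambda>x y. \<Sum>i\<in>I. f i x y)"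
  using assms by (induction I rule: infinite_finite_induct) (auto intro: bounded_bilinear_zero bounded_bilinear_plus)

lemmas bilinear_intros = bounded_bilinear_plus bounded_bilinear_mult_const bounded_bilinear_sum
  bounded_bilinear.comp[OF bounded_bilinear_inner]

lemmas functional_intros = bounded_linear_add bounded_linear_sub bounded_linear_sum bounded_linear_const_mult
  bounded_linear_compose[OF bounded_linear_inner_right]

section \<open>Integrals of the scheme as inner products of classes\<close>

lemma has_bochner_integral_inner_cls:
  assumes "S \<in> sets lebesgue" "Lsq S f" "Lsq S g"
  shows "has_bochner_integral (lebesgue_on S) (\<lambda>x. f x * g x) (inner (cls S f) (cls S g))"
  using Lsq_mult_integrable[OF assms] inner_cls_integral[OF assms] by (simp add: has_bochner_integral_iff)

lemma integral_inner_cls: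
  fixes f g :: "'a::euclidean_space \<Rightarrow> real^'n"
  assumes "S \<in> sets lebesgue" "\<And>i. Lsq S (\<lambda>x. f x $ i)" "\<And>i. Lsq S (\<lambda>x. g x $ i)"
  shows "integral\<^sup>L (lebesgue_on S) (\<lambda>x. f x \<bullet> g x)
    = (\<Sum>i\<in>UNIV. inner (cls S (\<lambda>x. f x $ i)) (cls S (\<lambda>x. g x $ i)))"
  unfolding inner_vec_def inner_real_def
  by (intro has_bochner_integral_integral_eq has_bochner_integral_sum has_bochner_integral_inner_cls assms)

definition kf :: "real^3^3 \<Rightarrow> (3 \<Rightarrow> 'a::euclidean_space l2) \<Rightarrow> (3 \<Rightarrow> 'a l2) \<Rightarrow> real" where
  "kf M X Y = (\<Sum>i\<in>UNIV. \<Sum>j\<in>UNIV. M $ i $ j * inner (X j) (Y i))"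

lemma kf_left: "kf M (\<lambda>i. X i - c *\<^sub>R Y i) Z = kf M X Z - c * kf M Y Z"
  by (simp add: kf_def inner_diff_left sum_distrib_left sum_subtractf right_diff_distrib mult_ac)

lemma kf_right: "kf M Z (\<lambda>i. X i - c *\<^sub>R Y i) = kf M Z X - c * kf M Z Y"
  by (simp add: kf_def inner_diff_right sum_distrib_left sum_subtractf right_diff_distrib mult_ac)

lemma integral_kf:
  fixes f g :: "'a::euclidean_space \<Rightarrow> real^3"
  assumes "S \<in> sets lebesgue" "\<And>i. Lsq S (\<lambda>x. f x $ i)" "\<And>i. Lsq S (\<lambda>x. g x $ i)"
  shows "integral\<^sup>L (lebesgue_on S) (\<lambda>x. (M *v f x) \<bullet> g x)
    = kf M (\<lambda>i. cls S (\<lambda>x. f x $ i)) (\<lambda>i. cls S (\<lambda>x. g x $ i))"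
proof -
  have "(\<lambda>x. (M *v f x) \<bullet> g x) = (\<lambda>x. \<Sum>i\<in>UNIV. \<Sum>j\<in>UNIV. M $ i $ j * (f x $ j * g x $ i))"
    by (simp add: inner_vec_def matrix_vector_mult_def sum_distrib_right mult.assoc)
  then show ?thesis unfolding kf_def
    by (simp only:) (intro has_bochner_integral_integral_eq has_bochner_integral_sum has_bochner_integral_mult_right
        has_bochner_integral_inner_cls assms)
qed

text \<open>For representatives of the classes the form is the integral of a pointwise nonnegative
  function.\<close>

lemma kf_nonneg:
  assumes M: "\<And>z. 0 \<le> (M *v z) \<bullet> z"
  shows "0 \<le> kf M X X"
proof -
  define f where "f x = (\<chi> i. rp (X i) x)" for x
  have U: "UNIV \<in> sets lebesgue" by simp
  have f: "(\<lambda>x. f x $ i) = rp (X i)" for i by (simp add: f_def)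
  have c: "cls UNIV (\<lambda>x. f x $ i) = X i" for i unfolding f by (simp add: cls_def abs_l2_rp)
  have L: "Lsq UNIV (\<lambda>x. f x $ i)" for i unfolding f by (rule Lsq_rp[OF U])
  have "kf M X X = integral\<^sup>L (lebesgue_on UNIV) (\<lambda>x. (M *v f x) \<bullet> f x)"
    by (simp only: integral_kf[OF U L L] c)
  then show ?thesis using M by (simp add: integral_nonneg)
qed

text \<open>Writing z as the image of its preimage under M turns the form of the inverse into the
  form of M at that preimage.\<close>

lemma matrix_inv_nonneg:
  fixes M :: "real^'n^'n"
  assumes pd: "\<forall>x. x \<noteq> 0 \<longrightarrow> x \<bullet> (M *v x) > 0"
  shows "0 \<le> (matrix_inv M *v z) \<bullet> z"
proof -
  have "\<forall>x. M *v x = 0 \<longrightarrow> x = 0" using pd by (metis inner_zero_right less_irrefl)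
  then have "invertible M" using invertible_left_inverse matrix_left_invertible_ker by blast
  then have "M ** matrix_inv M = mat 1" unfolding invertible_def matrix_inv_def by (metis (mono_tags, lifting) someI_ex)
  then have "z = M *v (matrix_inv M *v z)" by (simp add: matrix_vector_mul_assoc)
  moreover have "0 \<le> (matrix_inv M *v z) \<bullet> (M *v (matrix_inv M *v z))"
    using pd by (cases "matrix_inv M *v z = 0") (auto simp: less_imp_le)
  ultimately show ?thesis by simp
qed

subsection \<open>The plate form\<close>

type_synonym plate_jet = "((2 jet)^2) \<times> 2 jet2"

definition ej :: "plate_jet \<Rightarrow> 2 \<Rightarrow> 2 \<Rightarrow> (real^2) l2" where
  "ej U i j = (1/2) *\<^sub>R (snd (fst U $ i) $ j + snd (fst U $ j) $ i)"
definition hj :: "plate_jet \<Rightarrow> 2 \<Rightarrow> 2 \<Rightarrow> (real^2) l2" where "hj U i j = snd (snd U) $ i $ j"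
definition u0 :: "plate_jet \<Rightarrow> (real^2) l2" where "u0 U = fst (fst (snd U))"

definition tp :: "(2 \<Rightarrow> 2 \<Rightarrow> 2 \<Rightarrow> 2 \<Rightarrow> real) \<Rightarrow> (2 \<Rightarrow> 2 \<Rightarrow> (real^2) l2) \<Rightarrow> (2 \<Rightarrow> 2 \<Rightarrow> (real^2) l2) \<Rightarrow> real" where
  "tp a M N = (\<Sum>i\<in>UNIV. \<Sum>j\<in>UNIV. \<Sum>k\<in>UNIV. \<Sum>l\<in>UNIV. a i j k l * inner (M k l) (N i j))"

definition aj :: "(2 \<Rightarrow> 2 \<Rightarrow> 2 \<Rightarrow> 2 \<Rightarrow> real) \<Rightarrow> (2 \<Rightarrow> 2 \<Rightarrow> 2 \<Rightarrow> 2 \<Rightarrow> real) \<Rightarrow> (2 \<Rightarrow> 2 \<Rightarrow> 2 \<Rightarrow> 2 \<Rightarrow> real)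
    \<Rightarrow> plate_jet \<Rightarrow> plate_jet \<Rightarrow> real" where
  "aj a b c U U' = tp a (ej U) (ej U') + tp b (ej U) (hj U') + tp b (hj U) (ej U') + tp c (hj U) (hj U')"

lemma tpair_tp:
  assumes "S \<in> sets lebesgue" "\<And>i j. Lsq S (M i j)" "\<And>i j. Lsq S (N i j)"
    and "\<And>i j. cls S (M i j) = M' i j" "\<And>i j. cls S (N i j) = N' i j"
  shows "tpair S a M N = tp a M' N'"
proof -
  have "tpair S a M N = integral\<^sup>L (lebesgue_on S)
      (\<lambda>x. \<Sum>i\<in>UNIV. \<Sum>j\<in>UNIV. \<Sum>k\<in>UNIV. \<Sum>l\<in>UNIV. a i j k l * (M k l x * N i j x))"
    by (simp add: tpair_def sum_distrib_right mult.assoc)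
  also have "... = tp a M' N'" unfolding tp_def assms(4,5)[symmetric]
    by (intro has_bochner_integral_integral_eq has_bochner_integral_sum has_bochner_integral_mult_right
        has_bochner_integral_inner_cls assms)
  finally show ?thesis .
qed

lemma bl_plate:
  assumes "bounded_linear f"
  shows "bounded_linear (\<lambda>x. ej (f x) i j)" "bounded_linear (\<lambda>x. hj (f x) i j)" "bounded_linear (\<lambda>x. u0 (f x))"
  unfolding ej_def hj_def u0_def by (intro bl_intros assms)+

lemma bounded_bilinear_aj:
  assumes "bounded_linear f" "bounded_linear g"
  shows "bounded_bilinear (\<lambda>x y. aj a b c (f x) (g y))"
  unfolding aj_def tp_def by (intro bilinear_intros bl_plate assms)

context channel
begin

definition UU :: "plate_jet set" where
  "UU = {U. (\<forall>i. fst U $ i \<in> S.H10j) \<and> snd U \<in> S.H20j}"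

lemma UU_facts: "subspace UU" "closed UU"
proof -
  have eq: "UU = (\<Inter>i. {U. fst U $ i \<in> S.H10j}) \<inter> {U. snd U \<in> S.H20j}" by (auto simp: UU_def)
  show "subspace UU" unfolding UU_def
    by (rule subspaceI) (simp_all add: subspace_0 subspace_add subspace_scale S.H10j_facts(1) S.H20j_facts(1))
  show "closed UU" unfolding eq
    by (intro closed_Int closed_INT ballI closed_subspace_vimage(2)[OF _ S.H10j_facts(1,2)]
        closed_subspace_vimage(2)[OF _ S.H20j_facts(1,2)] bl_intros)
qed

definition uj :: "(real^2 \<Rightarrow> real^2) \<Rightarrow> (real^2 \<Rightarrow> real) \<Rightarrow> plate_jet" where
  "uj ub u3 = ((\<chi> i. wjet SS (\<lambda>y. ub y $ i)), wjet2 SS u3)"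

lemma uj_UU:
  assumes "\<forall>i. H10 SS (\<lambda>y. ub y $ i)" "H20 SS u3"
  shows "uj ub u3 \<in> UU"
  using assms S.H10_wjet S.H20_wjet2 by (simp add: UU_def uj_def)

lemma UU_rep:
  assumes "U \<in> UU"
  shows "\<exists>ub u3. (\<forall>i. H10 SS (\<lambda>y. ub y $ i)) \<and> H20 SS u3 \<and> uj ub u3 = U"
proof -
  define ub where "ub y = (\<chi> i. rp (fst (fst U $ i)) y)" for y
  have c: "(\<lambda>y. ub y $ i) = rp (fst (fst U $ i))" for i by (simp add: ub_def)
  have 1: "H10 SS (\<lambda>y. ub y $ i) \<and> wjet SS (\<lambda>y. ub y $ i) = fst U $ i" for i
    unfolding c by (rule S.H10_rep) (use assms in \<open>simp add: UU_def\<close>)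
  have 2: "H20 SS (rp (fst (fst (snd U)))) \<and> wjet2 SS (rp (fst (fst (snd U)))) = snd U"
    by (rule S.H20_rep) (use assms in \<open>simp add: UU_def\<close>)
  have "uj ub (rp (fst (fst (snd U)))) = U" using 1 2 by (simp add: uj_def prod_eq_iff vec_eq_iff)
  then show ?thesis using 1 2 by blast
qed

lemma plate_classes:
  assumes ub: "\<forall>i. H10 SS (\<lambda>y. ub y $ i)" and u3: "H20 SS u3"
  shows "Lsq SS (symgrad2 SS ub i j)" "cls SS (symgrad2 SS ub i j) = ej (uj ub u3) i j"
    "Lsq SS (hess2 SS u3 i j)" "cls SS (hess2 SS u3 i j) = hj (uj ub u3) i j"
    "Lsq SS u3" "cls SS u3 = u0 (uj ub u3)" "Lsq SS (\<lambda>y. ub y $ i)"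
proof -
  have h: "H1 SS (\<lambda>y. ub y $ i)" for i using ub S.H10_wjet by blast
  have h2: "H2 SS u3" using u3 S.H20_wjet2 by blast
  have s: "symgrad2 SS ub i j = (\<lambda>x. (1/2) * (wd SS (axis j 1) (\<lambda>y. ub y $ i) x + wd SS (axis i 1) (\<lambda>y. ub y $ j) x))"
    by (intro ext) (simp add: symgrad2_def)
  have t: "hess2 SS u3 i j = wd SS (axis j 1) (wd SS (axis i 1) u3)" by (intro ext) (simp add: hess2_def)
  note w = S.H1_wd(2)[OF h]
  show "Lsq SS (symgrad2 SS ub i j)" unfolding s by (intro Lsq_scale Lsq_add w S.Um)
  show "cls SS (symgrad2 SS ub i j) = ej (uj ub u3) i j"
    unfolding s by (simp only: cls_scale cls_add Lsq_add w S.Um) (simp add: ej_def uj_def wjet_def)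
  show "Lsq SS (hess2 SS u3 i j)" unfolding t by (rule S.H1_wd(2)[OF S.H2_wd(2)[OF h2]])
  show "cls SS (hess2 SS u3 i j) = hj (uj ub u3) i j" unfolding t by (simp add: hj_def uj_def wjet2_def)
  show "Lsq SS u3" by (rule S.H1_wd(1)[OF S.H2_wd(1)[OF h2]])
  show "cls SS u3 = u0 (uj ub u3)" by (simp add: u0_def uj_def wjet2_def wjet_def)
  show "Lsq SS (\<lambda>y. ub y $ i)" by (rule S.H1_wd(1)[OF h])
qed

lemma ahom_aj:
  assumes "\<forall>i. H10 SS (\<lambda>y. ub y $ i)" "H20 SS u3" "\<forall>i. H10 SS (\<lambda>y. ub' y $ i)" "H20 SS u3'"
  shows "ahom SS a b c ub u3 ub' u3' = aj a b c (uj ub u3) (uj ub' u3')"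
proof -
  note p = plate_classes[OF assms(1,2)] plate_classes[OF assms(3,4)]
  show ?thesis unfolding ahom_def aj_def by (intro arg_cong2[where f="(+)"] tpair_tp S.Um p)
qed

lemma stdnorm2_uj:
  assumes "\<forall>i. H10 SS (\<lambda>y. ub y $ i)" "H20 SS u3"
  shows "stdnorm2 SS ub u3 = (norm (uj ub u3))\<^sup>2"
proof -
  have "H1 SS (\<lambda>y. ub y $ i)" "H2 SS u3" for i using assms S.H10_wjet S.H20_wjet2 by blast+
  then show ?thesis
    by (simp add: stdnorm2_def S.H1norm_eq S.H2norm_eq uj_def norm_Pair norm_vec_def L2_set_def sum_nonneg)
qed

lemma velocity_classes:
  assumes v: "Vspace L1 L2 L3 v"
  shows "Lsq UA (\<lambda>x. v x $ i)" "cls UA (\<lambda>x. v x $ i) = Fj (vj v) i"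
    "Lsq UA (symgrad3 UA v i j)" "cls UA (symgrad3 UA v i j) = Dj (vj v) i j"
    "Lsq UA (div3 UA v)" "cls UA (div3 UA v) = dvj (vj v)"
    "Lsq SS (\<lambda>y. trSig L1 L2 L3 v y $ i)" "cls SS (\<lambda>y. trSig L1 L2 L3 v y $ i) = Tj (vj v) i"
proof -
  note h = Vspace_vj(2)[OF v]
  note w = A.H1_wd(2)[OF h]
  have s: "symgrad3 UA v i j = (\<lambda>x. (1/2) * (wd UA (axis j 1) (\<lambda>y. v y $ i) x + wd UA (axis i 1) (\<lambda>y. v y $ j) x))"
    by (intro ext) (simp add: symgrad3_def)
  have d: "div3 UA v = (\<lambda>x. \<Sum>i\<in>UNIV. wd UA (axis i 1) (\<lambda>y. v y $ i) x)" by (intro ext) (simp add: div3_def)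
  show "Lsq UA (\<lambda>x. v x $ i)" by (rule A.H1_wd(1)[OF h])
  show "cls UA (\<lambda>x. v x $ i) = Fj (vj v) i" by (simp add: Fj_def vj_def wjet_def)
  show "Lsq UA (symgrad3 UA v i j)" unfolding s by (intro Lsq_scale Lsq_add w A.Um)
  show "cls UA (symgrad3 UA v i j) = Dj (vj v) i j"
    unfolding s by (simp only: cls_scale cls_add Lsq_add w A.Um) (simp add: Dj_def Gj_def vj_def wjet_def)
  show "Lsq UA (div3 UA v)" "cls UA (div3 UA v) = dvj (vj v)"
    unfolding d using cls_sum[of UNIV UA "\<lambda>i. wd UA (axis i 1) (\<lambda>y. v y $ i)"]
    by (simp_all add: w A.Um dvj_def Gj_def vj_def wjet_def)
  show "Lsq SS (\<lambda>y. trSig L1 L2 L3 v y $ i)" by (rule Vspace_vj(3)[OF v])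
  show "cls SS (\<lambda>y. trSig L1 L2 L3 v y $ i) = Tj (vj v) i" by (simp add: Tj_def vj_def)
qed

end

subsection \<open>Elimination of the plate velocity\<close>

text \<open>The components of the vertical vector field \<open>u y *\<^sub>R e3\<close> at the level
  of classes.\<close>

definition ef :: "'a::zero \<Rightarrow> 3 \<Rightarrow> 'a" where "ef u i = (if i = 3 then u else 0)"

lemma ef_e3:
  fixes u :: "'a::euclidean_space \<Rightarrow> real"
  assumes "S \<in> sets lebesgue" "Lsq S u"
  shows "Lsq S (\<lambda>y. (u y *\<^sub>R e3) $ i)" "cls S (\<lambda>y. (u y *\<^sub>R e3) $ i) = ef (cls S u) i"
  using assms by (simp_all add: e3_def axis_def ef_def Lsq_zero cls_zero)

lemma bounded_linear_ef: "bounded_linear f \<Longrightarrow> bounded_linear (\<lambda>x. ef (f x) i)"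
  by (cases "i = 3") (simp_all add: ef_def)

locale time_step = channel L1 L2 L3 for L1 L2 L3 +
  fixes \<rho>f \<mu> \<rho>s dt :: real and K :: "real^3^3" and a b c :: "2 \<Rightarrow> 2 \<Rightarrow> 2 \<Rightarrow> 2 \<Rightarrow> real"
    and f vn :: "real^3 \<Rightarrow> real^3" and g3 u3n w3n :: "real^2 \<Rightarrow> real"
  assumes pos: "\<rho>f > 0" "\<mu> > 0" "\<rho>s > 0" "dt > 0"
    and K_pd: "\<forall>x::real^3. x \<noteq> 0 \<longrightarrow> x \<bullet> (K *v x) > 0"
    and coercive: "\<exists>c1>0. \<forall>ub u3.
      (\<forall>i. H10 (Sig L1 L2) (\<lambda>y. ub y $ i)) \<and> H20 (Sig L1 L2) u3 \<longrightarrow>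
      c1 * stdnorm2 (Sig L1 L2) ub u3 \<le> ahom (Sig L1 L2) a b c ub u3 ub u3"
    and f: "\<And>i. Lsq (OmPM L1 L2 L3) (\<lambda>x. f x $ i)" and vn: "\<And>i. Lsq (OmPM L1 L2 L3) (\<lambda>x. vn x $ i)"
    and g3: "Lsq (Sig L1 L2) g3" and u3n: "Lsq (Sig L1 L2) u3n" and w3n: "Lsq (Sig L1 L2) w3n"
begin

abbreviation "Ki \<equiv> matrix_inv K"
abbreviation "fc i \<equiv> cls UA (\<lambda>x. f x $ i)"
abbreviation "vc i \<equiv> cls UA (\<lambda>x. vn x $ i)"
abbreviation "gc \<equiv> cls SS g3"
abbreviation "un \<equiv> cls SS u3n"
abbreviation "wn \<equiv> cls SS w3n"

text \<open>The residual of the momentum equation, left side minus right side, read on classes;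
  \<open>R3\<close> below is that of the plate equation.\<close>

definition R1 where "R1 V p U V' =
  \<rho>f / dt * (\<Sum>i\<in>UNIV. inner (Fj V i) (Fj V' i))
  + 2 * \<mu> * (\<Sum>i\<in>UNIV. \<Sum>j\<in>UNIV. inner (Dj V i j) (Dj V' i j))
  - inner p (dvj V') + kf Ki (Tj V) (Tj V') - 1 / dt * kf Ki (ef (u0 U)) (Tj V')
  - ((\<Sum>i\<in>UNIV. inner (fc i) (Fj V' i)) + \<rho>f / dt * (\<Sum>i\<in>UNIV. inner (vc i) (Fj V' i))
     - 1 / dt * kf Ki (ef un) (Tj V'))"

definition R3 where "R3 V U w U' =
  \<rho>s / dt * inner w (u0 U') + aj a b c U U' - kf Ki (Tj V) (ef (u0 U')) + 1 / dt * kf Ki (ef (u0 U)) (ef (u0 U'))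
  - (inner gc (u0 U') + \<rho>s / dt * inner wn (u0 U') + 1 / dt * kf Ki (ef un) (ef (u0 U')))"

definition zf :: "((3 jet \<times> (real^2) l2)^3) \<times> plate_jet \<Rightarrow> 3 \<Rightarrow> (real^2) l2" where
  "zf X i = Tj (fst X) i - (1 / dt) *\<^sub>R ef (u0 (snd X)) i"

text \<open>The last equation of the scheme says \<open>w = (u - un) / dt\<close>.  With this, \<open>dt\<close> times the momentum equation plus
  the plate equation is a saddle point problem for \<open>(V, U)\<close> with pressure \<open>dt * p\<close>, and the four permeability
  terms form the square of \<open>v - u e\<^sub>3 / dt\<close>.\<close>

definition ac where "ac X X' =
  \<rho>f * (\<Sum>i\<in>UNIV. inner (Fj (fst X) i) (Fj (fst X') i))
  + (2 * \<mu> * dt) * (\<Sum>i\<in>UNIV. \<Sum>j\<in>UNIV. inner (Dj (fst X) i j) (Dj (fst X') i j))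
  + dt * kf Ki (zf X) (zf X') + \<rho>s / dt\<^sup>2 * inner (u0 (snd X)) (u0 (snd X')) + aj a b c (snd X) (snd X')"

definition lc where "lc X' =
  dt * (\<Sum>i\<in>UNIV. inner (fc i) (Fj (fst X') i)) + \<rho>f * (\<Sum>i\<in>UNIV. inner (vc i) (Fj (fst X') i))
  - kf Ki (ef un) (zf X') + inner gc (u0 (snd X')) + \<rho>s / dt * inner wn (u0 (snd X'))
  + \<rho>s / dt\<^sup>2 * inner un (u0 (snd X'))"

definition PP where "PP = {p. restr UA p = p}"
definition WW where "WW = {w. restr SS w = w}"

definition jet_scheme where "jet_scheme V p U w \<longleftrightarrow>
  (\<forall>V'\<in>VV. R1 V p U V' = 0) \<and> (\<forall>p'\<in>PP. inner (dvj V) p' = 0) \<and> (\<forall>U'\<in>UU. R3 V U w U' = 0)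
  \<and> (\<forall>w'\<in>WW. \<rho>s * inner w w' - \<rho>s / dt * inner (u0 U) w' = - (\<rho>s / dt * inner un w'))"

text \<open>The factor dt on the momentum residual matches its coupling term with that of the plate:
  \<open>dt * kf Ki (zf X) (zf X')\<close> expands into two permeability terms of each residual. The
  data term with \<open>un\<close> likewise collects to one value of \<open>kf Ki\<close> at
  \<open>zf X'\<close>.\<close>

lemma combined:
  "ac (V, U) X' - inner (dt *\<^sub>R p) (dvj (fst X')) - lc X'
    = dt * R1 V p U (fst X') + R3 V U ((1 / dt) *\<^sub>R (u0 U - un)) (snd X')"
proof -
  have z: "zf X = (\<lambda>i. Tj (fst X) i - (1 / dt) *\<^sub>R ef (u0 (snd X)) i)" for X by (intro ext) (simp add: zf_def)
  have d: "dt * (\<rho>f / dt) = \<rho>f" "dt * (1 / dt) = 1" "\<rho>s / dt\<^sup>2 = \<rho>s / dt * (1 / dt)"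
    using pos by (simp_all add: power2_eq_square)
  show ?thesis
    unfolding ac_def lc_def R1_def R3_def z kf_left kf_right fst_conv snd_conv inner_scaleR_left inner_diff_left
    using pos by (simp add: field_simps power2_eq_square)
qed

text \<open>With this, test pairs having one vanishing entry isolate a single residual in
  \<open>combined\<close>.\<close>

lemma zero_residual: "R1 V p U 0 = 0" "R3 V U w 0 = 0"
proof -
  have "Fj 0 i = 0" "Dj 0 i j = 0" "Tj 0 i = 0" "dvj 0 = 0" "u0 0 = 0" "ej 0 i' j' = 0" "hj 0 i' j' = 0" for i j i' j'
    by (simp_all add: Fj_def Dj_def Gj_def Tj_def dvj_def)
      (simp_all add: u0_def ej_def hj_def)
  note z = this
  have "ef (0 :: (real^2) l2) i = 0" for i by (simp add: ef_def)
  then show "R1 V p U 0 = 0" "R3 V U w 0 = 0"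
    by (simp_all add: R1_def R3_def z kf_def aj_def tp_def)
qed

lemma PP_facts: "subspace PP" "closed PP"
  unfolding PP_def by (rule restr_fixed_subspace[OF A.Um])+

lemma WW_u: "U \<in> UU \<Longrightarrow> u0 U \<in> WW"
  using S.H20j_facts(3) by (auto simp: UU_def WW_def u0_def H2j_def H1j_def)

lemma un_WW: "un \<in> WW"
  by (simp add: WW_def restr_idem S.Um u3n)

lemma WW_subspace: "subspace WW"
  unfolding WW_def by (rule restr_fixed_subspace[OF S.Um])

lemma dvj_PP: "V \<in> VV \<Longrightarrow> dvj V \<in> PP"
  by (simp add: PP_def dvj_restr)

text \<open>The test functions of the two combined equations are independent, so their sum is
  equivalent to both. The other two equations say that an element is orthogonal to a subspace
  containing it, hence zero.\<close>

lemma jet_scheme_iff: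
  assumes V: "V \<in> VV" and U: "U \<in> UU" and w: "w \<in> WW"
  shows "jet_scheme V p U w \<longleftrightarrow> w = (1 / dt) *\<^sub>R (u0 U - un) \<and> dvj V = 0
    \<and> (\<forall>X'\<in>VV \<times> UU. ac (V, U) X' - inner (dt *\<^sub>R p) (dvj (fst X')) = lc X')"
    (is "_ \<longleftrightarrow> w = ?w \<and> _")
proof -
  have 0: "0 \<in> VV" "0 \<in> UU" using VV_facts(1) UU_facts(1) by (auto intro: subspace_0)
  have wW: "?w \<in> WW" by (intro subspace_scale subspace_diff WW_subspace WW_u U un_WW)
  have e: "(\<rho>s * inner w w' - \<rho>s / dt * inner (u0 U) w' = - (\<rho>s / dt * inner un w')) \<longleftrightarrow> inner (w - ?w) w' = 0" for w'
  proof -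
    have "\<rho>s * inner w w' - \<rho>s / dt * inner (u0 U) w' - - (\<rho>s / dt * inner un w') = \<rho>s * inner (w - ?w) w'"
      unfolding inner_diff_left inner_scaleR_left by (simp add: algebra_simps diff_divide_distrib)
    then show ?thesis using pos(3) by (metis eq_iff_diff_eq_0 less_irrefl mult_eq_0_iff)
  qed
  have 4: "(\<forall>w'\<in>WW. inner (w - ?w) w' = 0) \<longleftrightarrow> w = ?w"
  proof
    assume "\<forall>w'\<in>WW. inner (w - ?w) w' = 0"
    then have "inner (w - ?w) (w - ?w) = 0" using subspace_diff[OF WW_subspace w wW] by blast
    then show "w = ?w" by simp
  qed (simp only: diff_self inner_zero_left, simp)
  have 2: "(\<forall>p'\<in>PP. inner (dvj V) p' = 0) \<longleftrightarrow> dvj V = 0"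
    using dvj_PP[OF V] by (metis inner_eq_zero_iff inner_zero_left)
  have 3: "((\<forall>V'\<in>VV. R1 V p U V' = 0) \<and> (\<forall>U'\<in>UU. R3 V U ?w U' = 0)) \<longleftrightarrow>
     (\<forall>X'\<in>VV \<times> UU. ac (V, U) X' - inner (dt *\<^sub>R p) (dvj (fst X')) = lc X')" (is "?l \<longleftrightarrow> ?r")
  proof
    assume ?l
    show ?r
    proof
      fix X' assume "X' \<in> VV \<times> UU"
      then have "fst X' \<in> VV" "snd X' \<in> UU" by auto
      then show "ac (V, U) X' - inner (dt *\<^sub>R p) (dvj (fst X')) = lc X'"
        using combined[of V U X' p] \<open>?l\<close> by simp
    qed
  next
    assume r: ?r
    have "R1 V p U V' = 0" if "V' \<in> VV" for V'
    proof -
      have "(V', 0) \<in> VV \<times> UU" using that 0 by simp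
      from r[rule_format, OF this] show ?thesis using combined[of V U "(V', 0)" p] pos(4) by (simp add: zero_residual)
    qed
    moreover have "R3 V U ?w U' = 0" if "U' \<in> UU" for U'
    proof -
      have "(0, U') \<in> VV \<times> UU" using that 0 by simp
      from r[rule_format, OF this] show ?thesis using combined[of V U "(0, U')" p] by (simp add: zero_residual)
    qed
    ultimately show ?l by blast
  qed
  show ?thesis unfolding jet_scheme_def e 4 2 using 3 by blast
qed

lemma bounded_linear_zf: "bounded_linear g \<Longrightarrow> bounded_linear (\<lambda>x. zf (g x) i)"
  unfolding zf_def by (intro bounded_linear_sub bounded_linear_const_scaleR bounded_linear_ef bl_plate bl_components
    bounded_linear_fst_comp bounded_linear_snd_comp)

lemma bounded_bilinear_ac: "bounded_bilinear ac"
proof -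
  have "bounded_bilinear (\<lambda>X X'. ac X X')"
    unfolding ac_def kf_def
    by (intro bilinear_intros bounded_bilinear_aj bounded_linear_zf bl_plate bl_components
      bounded_linear_ident bounded_linear_fst_comp bounded_linear_snd_comp)
  then show ?thesis .
qed

lemma bounded_linear_lc: "bounded_linear lc"
proof -
  have "bounded_linear (\<lambda>X'. lc X')"
    unfolding lc_def kf_def
    by (intro functional_intros bounded_linear_zf bl_plate bl_components
      bounded_linear_ident bounded_linear_fst_comp bounded_linear_snd_comp)
  then show ?thesis .
qed

lemma plate_coercive: "\<exists>c1>0. \<forall>U\<in>UU. c1 * (norm U)\<^sup>2 \<le> aj a b c U U"
proof -
  from coercive obtain c1 where c1: "c1 > 0" and *: "\<forall>ub u3. (\<forall>i. H10 SS (\<lambda>y. ub y $ i)) \<and> H20 SS u3 \<longrightarrow>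
      c1 * stdnorm2 SS ub u3 \<le> ahom SS a b c ub u3 ub u3" by (elim exE conjE) (rule that)
  have "c1 * (norm U)\<^sup>2 \<le> aj a b c U U" if "U \<in> UU" for U
  proof -
    from UU_rep[OF that] obtain ub u3 where u: "\<forall>i. H10 SS (\<lambda>y. ub y $ i)" "H20 SS u3" and U: "uj ub u3 = U"
      by (elim exE conjE) (rule that)
    from *[THEN spec, THEN spec, THEN mp, OF conjI[OF u]] show ?thesis
      by (simp only: stdnorm2_uj[OF u] ahom_aj[OF u u] U)
  qed
  then show ?thesis using c1 by blast
qed

lemma coercive_ac: "\<exists>k>0. \<forall>X\<in>VV \<times> UU. k * (norm X)\<^sup>2 \<le> ac X X"
proof -
  from velocity_coercive obtain KV where KV: "KV \<ge> 0" and V: "\<forall>V\<in>VV. norm V \<le> KV *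
     sqrt ((\<Sum>i\<in>UNIV. (norm (Fj V i))\<^sup>2) + (\<Sum>i\<in>UNIV. \<Sum>j\<in>UNIV. (norm (Dj V i j))\<^sup>2))"
    by (elim exE conjE) (rule that)
  from plate_coercive obtain c1 where c1: "c1 > 0" and U: "\<forall>U\<in>UU. c1 * (norm U)\<^sup>2 \<le> aj a b c U U"
    by (elim exE conjE) (rule that)
  define m where "m = min \<rho>f (2 * \<mu> * dt)"
  have m: "m > 0" "m \<le> \<rho>f" "m \<le> 2 * \<mu> * dt" using pos by (auto simp: m_def)
  \<comment> \<open>The added 1 keeps the denominator positive, as KV is only known to be
    nonnegative.\<close>
  define k where "k = min (m / (KV\<^sup>2 + 1)) c1"
  have KV1: "KV\<^sup>2 + 1 > 0" by (simp add: add_nonneg_pos)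
  have k: "k > 0" "k \<le> m / (KV\<^sup>2 + 1)" "k \<le> c1" using m c1 KV1 by (auto simp: k_def)
  have "k * (norm X)\<^sup>2 \<le> ac X X" if X: "X \<in> VV \<times> UU" for X
  proof -
    define F where "F = (\<Sum>i\<in>UNIV. (norm (Fj (fst X) i))\<^sup>2)"
    define D where "D = (\<Sum>i\<in>UNIV. \<Sum>j\<in>UNIV. (norm (Dj (fst X) i j))\<^sup>2)"
    have FD: "F \<ge> 0" "D \<ge> 0" unfolding F_def D_def by (auto intro!: sum_nonneg)
    have "norm (fst X) \<le> KV * sqrt (F + D)" using V X unfolding F_def D_def by auto
    then have "(norm (fst X))\<^sup>2 \<le> (KV * sqrt (F + D))\<^sup>2" by (rule power_mono) simp
    also have "... = KV\<^sup>2 * (F + D)" using FD by (simp add: power_mult_distrib)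
    also have "... \<le> (KV\<^sup>2 + 1) * (F + D)" using FD by (intro mult_right_mono) auto
    finally have 1: "(norm (fst X))\<^sup>2 \<le> (KV\<^sup>2 + 1) * (F + D)" .
    have "k * (norm (fst X))\<^sup>2 \<le> m / (KV\<^sup>2 + 1) * ((KV\<^sup>2 + 1) * (F + D))"
      using k m KV1 by (intro mult_mono 1) auto
    also have "... = m * F + m * D" using KV1 by (simp add: distrib_left)
    also have "... \<le> \<rho>f * F + (2 * \<mu> * dt) * D" by (intro add_mono mult_right_mono m FD)
    finally have f: "k * (norm (fst X))\<^sup>2 \<le> \<rho>f * F + (2 * \<mu> * dt) * D" .
    have "k * (norm (snd X))\<^sup>2 \<le> c1 * (norm (snd X))\<^sup>2" by (intro mult_right_mono k) auto
    also have "... \<le> aj a b c (snd X) (snd X)" using U X by auto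
    finally have s: "k * (norm (snd X))\<^sup>2 \<le> aj a b c (snd X) (snd X)" .
    have t: "0 \<le> dt * kf Ki (zf X) (zf X)"
      by (intro mult_nonneg_nonneg kf_nonneg matrix_inv_nonneg K_pd less_imp_le pos)
    have u: "0 \<le> \<rho>s / dt\<^sup>2 * inner (u0 (snd X)) (u0 (snd X))" using pos by simp
    have n: "(norm X)\<^sup>2 = (norm (fst X))\<^sup>2 + (norm (snd X))\<^sup>2" by (simp add: norm_prod_def)
    have "ac X X = \<rho>f * F + (2 * \<mu> * dt) * D + dt * kf Ki (zf X) (zf X)
        + \<rho>s / dt\<^sup>2 * inner (u0 (snd X)) (u0 (snd X)) + aj a b c (snd X) (snd X)"
      by (simp add: ac_def F_def D_def power2_norm_eq_inner)
    then show ?thesis using f s t u unfolding n distrib_left by linarith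
  qed
  then show ?thesis using k(1) by blast
qed

section \<open>Existence and uniqueness at the level of classes\<close>

lemma bounded_linear_dvj: "bounded_linear (\<lambda>X :: ((3 jet \<times> (real^2) l2)^3) \<times> plate_jet. dvj (fst X))"
  by (rule bl_components bounded_linear_fst)+

lemma subspace_X: "subspace (VV \<times> UU)" "closed (VV \<times> UU)"
  using VV_facts UU_facts by (auto intro: subspace_Times closed_Times)

text \<open>The divergence does not involve the plate, so the plate entry can be 0 and the velocity
  result applies.\<close>

lemma approx_X: "\<exists>C. \<forall>q\<in>PP. \<exists>X\<in>VV \<times> UU. norm X \<le> C * norm q \<and> norm (dvj (fst X) - q) \<le> norm q / 2"
proof -
  from divergence_velocity obtain C where C: "\<forall>q. restr UA q = q \<longrightarrow>
      (\<exists>V\<in>VV. norm V \<le> C * norm q \<and> norm (dvj V - q) \<le> norm q / 2)" by (elim exE conjE) (rule that)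
  have "\<exists>X\<in>VV \<times> UU. norm X \<le> C * norm q \<and> norm (dvj (fst X) - q) \<le> norm q / 2" if "q \<in> PP" for q
  proof -
    have "restr UA q = q" using that by (simp add: PP_def)
    from C[THEN spec, THEN mp, OF this] obtain V where V: "V \<in> VV" "norm V \<le> C * norm q" "norm (dvj V - q) \<le> norm q / 2"
      by (elim bexE conjE) (rule that)
    have "(V, 0) \<in> VV \<times> UU" using V(1) subspace_0[OF UU_facts(1)] by simp
    moreover have "norm (V, 0 :: plate_jet) = norm V" by (simp add: norm_Pair)
    ultimately show ?thesis using V by (intro bexI[of _ "(V, 0)"]) auto
  qed
  then show ?thesis by blast
qed

lemma jet_scheme_exists: "\<exists>V\<in>VV. \<exists>p\<in>PP. \<exists>U\<in>UU. \<exists>w\<in>WW. jet_scheme V p U w"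
proof -
  from coercive_ac obtain k where k: "k > 0" "\<forall>X\<in>VV \<times> UU. k * (norm X)\<^sup>2 \<le> ac X X" by (elim exE conjE) (rule that)
  from approx_X obtain C where C: "\<forall>q\<in>PP. \<exists>X\<in>VV \<times> UU. norm X \<le> C * norm q \<and> norm (dvj (fst X) - q) \<le> norm q / 2"
    by (elim exE) (rule that)
  have Q: "(\<lambda>X :: _ \<times> plate_jet. dvj (fst X)) ` (VV \<times> UU) \<subseteq> PP" using dvj_PP by auto
  have "\<exists>X\<in>VV \<times> UU. \<exists>p\<in>PP. dvj (fst X) = 0 \<and> (\<forall>y\<in>VV \<times> UU. ac X y - inner p (dvj (fst y)) = lc y)"
    by (rule saddle_point_exists[OF subspace_X bounded_bilinear_ac bounded_linear_lc k(1) k(2)[rule_format]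
      bounded_linear_dvj PP_facts Q C[rule_format]])
  then obtain X p where X: "X \<in> VV \<times> UU" and p: "p \<in> PP" and eq: "dvj (fst X) = 0"
      "\<forall>y\<in>VV \<times> UU. ac X y - inner p (dvj (fst y)) = lc y" by (elim bexE conjE) (rule that)
  obtain V U where VU: "X = (V, U)" by (cases X)
  have V: "V \<in> VV" and U: "U \<in> UU" using X VU by auto
  \<comment> \<open>The multiplier of the combined problem is dt times the pressure of the scheme,
    which explains the division; \<open>?w\<close> is read off the last equation.\<close>
  let ?w = "(1 / dt) *\<^sub>R (u0 U - un)" and ?p = "(1 / dt) *\<^sub>R p"
  have w: "?w \<in> WW" by (intro subspace_scale subspace_diff WW_subspace WW_u U un_WW)
  have p': "?p \<in> PP" by (intro subspace_scale PP_facts p)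
  have "jet_scheme V ?p U ?w"
    unfolding jet_scheme_iff[OF V U w] using eq pos(4) unfolding VU by simp
  then show ?thesis using V U w p' by blast
qed

lemma jet_scheme_unique:
  assumes "V \<in> VV" "p \<in> PP" "U \<in> UU" "w \<in> WW" "jet_scheme V p U w"
    and "V' \<in> VV" "p' \<in> PP" "U' \<in> UU" "w' \<in> WW" "jet_scheme V' p' U' w'"
  shows "V = V' \<and> p = p' \<and> U = U' \<and> w = w'"
proof -
  from coercive_ac obtain k where k: "k > 0" "\<forall>X\<in>VV \<times> UU. k * (norm X)\<^sup>2 \<le> ac X X" by (elim exE conjE) (rule that)
  from approx_X obtain C where C: "\<forall>q\<in>PP. \<exists>X\<in>VV \<times> UU. norm X \<le> C * norm q \<and> norm (dvj (fst X) - q) \<le> norm q / 2"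
    by (elim exE) (rule that)
  have Q: "(\<lambda>X :: _ \<times> plate_jet. dvj (fst X)) ` (VV \<times> UU) \<subseteq> PP" using dvj_PP by auto
  have 1: "w = (1 / dt) *\<^sub>R (u0 U - un)" "dvj (fst (V, U)) = 0"
      "\<And>y. y \<in> VV \<times> UU \<Longrightarrow> ac (V, U) y - inner (dt *\<^sub>R p) (dvj (fst y)) = lc y"
    using assms(5)[unfolded jet_scheme_iff[OF assms(1,3,4)]] unfolding fst_conv by blast+
  have 2: "w' = (1 / dt) *\<^sub>R (u0 U' - un)" "dvj (fst (V', U')) = 0"
      "\<And>y. y \<in> VV \<times> UU \<Longrightarrow> ac (V', U') y - inner (dt *\<^sub>R p') (dvj (fst y)) = lc y"
    using assms(10)[unfolded jet_scheme_iff[OF assms(6,8,9)]] unfolding fst_conv by blast+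
  have m: "(V, U) \<in> VV \<times> UU" "dt *\<^sub>R p \<in> PP" "(V', U') \<in> VV \<times> UU" "dt *\<^sub>R p' \<in> PP"
    using assms PP_facts(1) by (auto intro: subspace_scale)
  have "(V, U) = (V', U') \<and> dt *\<^sub>R p = dt *\<^sub>R p'"
    by (rule saddle_point_unique[OF subspace_X bounded_bilinear_ac k(1) k(2)[rule_format]
      bounded_linear_dvj PP_facts(1) Q C[rule_format] m(1,2) 1(2,3) m(3,4) 2(2,3)])
  then show ?thesis using 1(1) 2(1) pos(4) by simp
qed

subsection \<open>Translation to functions\<close>

lemma Yspace_jets:
  assumes "Yspace L1 L2 L3 v p ub u3 w3"
  shows "vj v \<in> VV" "cls UA p \<in> PP" "uj ub u3 \<in> UU" "cls SS w3 \<in> WW"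
  using assms unfolding Yspace_def PP_def WW_def
  by (simp_all add: Vspace_vj(1) uj_UU restr_idem A.Um S.Um)

lemma Yspace_rep:
  assumes "V \<in> VV" "p \<in> PP" "U \<in> UU" "w \<in> WW"
  shows "\<exists>v p' ub u3 w3. Yspace L1 L2 L3 v p' ub u3 w3 \<and> vj v = V \<and> cls UA p' = p \<and> uj ub u3 = U \<and> cls SS w3 = w"
proof -
  have p: "Lsq UA (rp p)" "cls UA (rp p) = p" and w: "Lsq SS (rp w)" "cls SS (rp w) = w"
    using assms by (simp_all add: PP_def WW_def restr_def Lsq_rp A.Um S.Um)
  from VV_rep[OF assms(1)] obtain v where v: "Vspace L1 L2 L3 v" "vj v = V" by (elim exE conjE) (rule that)
  from UU_rep[OF assms(3)] obtain ub u3 where u: "\<forall>i. H10 SS (\<lambda>y. ub y $ i)" "H20 SS u3" "uj ub u3 = U"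
    by (elim exE conjE) (rule that)
  show ?thesis unfolding Yspace_def using p w v u by (intro exI[of _ v] exI[of _ "rp p"] exI[of _ ub] exI[of _ u3] exI[of _ "rp w"]) simp
qed

lemma equations_jets:
  assumes Y: "Yspace L1 L2 L3 v p ub u3 w3" and Y': "Yspace L1 L2 L3 V P Ub U3 W3"
  shows "\<rho>f / dt * integral\<^sup>L (lebesgue_on UA) (\<lambda>x. v x \<bullet> V x)
       + 2 * \<mu> * integral\<^sup>L (lebesgue_on UA)
            (\<lambda>x. \<Sum>i\<in>UNIV. \<Sum>j\<in>UNIV. symgrad3 UA v i j x * symgrad3 UA V i j x)
       - ip UA p (div3 UA V)
       + integral\<^sup>L (lebesgue_on SS) (\<lambda>y. (Ki *v trSig L1 L2 L3 v y) \<bullet> trSig L1 L2 L3 V y)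
       - 1 / dt * integral\<^sup>L (lebesgue_on SS) (\<lambda>y. (Ki *v (u3 y *\<^sub>R e3)) \<bullet> trSig L1 L2 L3 V y)
     = integral\<^sup>L (lebesgue_on UA) (\<lambda>x. f x \<bullet> V x)
       + \<rho>f / dt * integral\<^sup>L (lebesgue_on UA) (\<lambda>x. vn x \<bullet> V x)
       - 1 / dt * integral\<^sup>L (lebesgue_on SS) (\<lambda>y. (Ki *v (u3n y *\<^sub>R e3)) \<bullet> trSig L1 L2 L3 V y)
     \<longleftrightarrow> R1 (vj v) (cls UA p) (uj ub u3) (vj V) = 0"
    and "- ip UA (div3 UA v) P = 0 \<longleftrightarrow> inner (dvj (vj v)) (cls UA P) = 0"
    and "\<rho>s / dt * ip SS w3 U3 + ahom SS a b c ub u3 Ub U3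
       - integral\<^sup>L (lebesgue_on SS) (\<lambda>y. (Ki *v trSig L1 L2 L3 v y) \<bullet> (U3 y *\<^sub>R e3))
       + 1 / dt * integral\<^sup>L (lebesgue_on SS) (\<lambda>y. (Ki *v (u3 y *\<^sub>R e3)) \<bullet> (U3 y *\<^sub>R e3))
     = ip SS g3 U3 + \<rho>s / dt * ip SS w3n U3
       + 1 / dt * integral\<^sup>L (lebesgue_on SS) (\<lambda>y. (Ki *v (u3n y *\<^sub>R e3)) \<bullet> (U3 y *\<^sub>R e3))
     \<longleftrightarrow> R3 (vj v) (uj ub u3) (cls SS w3) (uj Ub U3) = 0"
    and "\<rho>s * ip SS w3 W3 - \<rho>s / dt * ip SS u3 W3 = - (\<rho>s / dt * ip SS u3n W3)
     \<longleftrightarrow> \<rho>s * inner (cls SS w3) (cls SS W3) - \<rho>s / dt * inner (u0 (uj ub u3)) (cls SS W3)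
        = - (\<rho>s / dt * inner un (cls SS W3))"
proof -
  have y: "Vspace L1 L2 L3 v" "Lsq UA p" "\<forall>i. H10 SS (\<lambda>y. ub y $ i)" "H20 SS u3" "Lsq SS w3"
    using Y by (simp_all add: Yspace_def)
  have y': "Vspace L1 L2 L3 V" "Lsq UA P" "\<forall>i. H10 SS (\<lambda>y. Ub y $ i)" "H20 SS U3" "Lsq SS W3"
    using Y' by (simp_all add: Yspace_def)
  note c = velocity_classes[OF y(1)] plate_classes[OF y(3,4)]
  note c' = velocity_classes[OF y'(1)] plate_classes[OF y'(3,4)]
  have i1: "integral\<^sup>L (lebesgue_on UA) (\<lambda>x. h x \<bullet> V x) = (\<Sum>i\<in>UNIV. inner (cls UA (\<lambda>x. h x $ i)) (Fj (vj V) i))"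
    if "\<And>i. Lsq UA (\<lambda>x. h x $ i)" for h
    by (simp only: integral_inner_cls[OF A.Um that c'(1)] c'(2))
  have i2: "integral\<^sup>L (lebesgue_on UA) (\<lambda>x. \<Sum>i\<in>UNIV. \<Sum>j\<in>UNIV. symgrad3 UA v i j x * symgrad3 UA V i j x)
      = (\<Sum>i\<in>UNIV. \<Sum>j\<in>UNIV. inner (Dj (vj v) i j) (Dj (vj V) i j))"
    unfolding c(4)[symmetric] c'(4)[symmetric]
    by (intro has_bochner_integral_integral_eq has_bochner_integral_sum has_bochner_integral_inner_cls A.Um c(3) c'(3))
  have i3: "ip UA p (div3 UA V) = inner (cls UA p) (dvj (vj V))" "ip UA (div3 UA v) P = inner (dvj (vj v)) (cls UA P)"
    by (simp_all only: inner_cls[symmetric] A.Um y(2) y'(2) c(5,6) c'(5,6))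
  note e = ef_e3[OF S.Um]
  have k1: "integral\<^sup>L (lebesgue_on SS) (\<lambda>y. (Ki *v trSig L1 L2 L3 v y) \<bullet> trSig L1 L2 L3 V y) = kf Ki (Tj (vj v)) (Tj (vj V))"
    by (simp only: integral_kf[OF S.Um c(7) c'(7)] c(8) c'(8))
  have k2: "integral\<^sup>L (lebesgue_on SS) (\<lambda>y. (Ki *v (h y *\<^sub>R e3)) \<bullet> trSig L1 L2 L3 V y) = kf Ki (ef (cls SS h)) (Tj (vj V))"
    if "Lsq SS h" for h
    by (simp only: integral_kf[OF S.Um e(1)[OF that] c'(7)] e(2)[OF that] c'(8))
  have k3: "integral\<^sup>L (lebesgue_on SS) (\<lambda>y. (Ki *v trSig L1 L2 L3 v y) \<bullet> (U3 y *\<^sub>R e3)) = kf Ki (Tj (vj v)) (ef (u0 (uj Ub U3)))"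
    by (simp only: integral_kf[OF S.Um c(7) e(1)[OF c'(13)]] c(8) e(2)[OF c'(13)] c'(14))
  have k4: "integral\<^sup>L (lebesgue_on SS) (\<lambda>y. (Ki *v (h y *\<^sub>R e3)) \<bullet> (U3 y *\<^sub>R e3)) = kf Ki (ef (cls SS h)) (ef (u0 (uj Ub U3)))"
    if "Lsq SS h" for h
    by (simp only: integral_kf[OF S.Um e(1)[OF that] e(1)[OF c'(13)]] e(2)[OF that] e(2)[OF c'(13)] c'(14))
  have s: "ip SS h U3 = inner (cls SS h) (u0 (uj Ub U3))" if "Lsq SS h" for h
    by (simp only: inner_cls[OF S.Um that c'(13), symmetric] c'(14))
  have s': "ip SS h W3 = inner (cls SS h) (cls SS W3)" if "Lsq SS h" for h
    by (rule inner_cls[OF S.Um that y'(5), symmetric])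
  show "\<rho>f / dt * integral\<^sup>L (lebesgue_on UA) (\<lambda>x. v x \<bullet> V x)
       + 2 * \<mu> * integral\<^sup>L (lebesgue_on UA)
            (\<lambda>x. \<Sum>i\<in>UNIV. \<Sum>j\<in>UNIV. symgrad3 UA v i j x * symgrad3 UA V i j x)
       - ip UA p (div3 UA V)
       + integral\<^sup>L (lebesgue_on SS) (\<lambda>y. (Ki *v trSig L1 L2 L3 v y) \<bullet> trSig L1 L2 L3 V y)
       - 1 / dt * integral\<^sup>L (lebesgue_on SS) (\<lambda>y. (Ki *v (u3 y *\<^sub>R e3)) \<bullet> trSig L1 L2 L3 V y)
     = integral\<^sup>L (lebesgue_on UA) (\<lambda>x. f x \<bullet> V x)
       + \<rho>f / dt * integral\<^sup>L (lebesgue_on UA) (\<lambda>x. vn x \<bullet> V x)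
       - 1 / dt * integral\<^sup>L (lebesgue_on SS) (\<lambda>y. (Ki *v (u3n y *\<^sub>R e3)) \<bullet> trSig L1 L2 L3 V y)
     \<longleftrightarrow> R1 (vj v) (cls UA p) (uj ub u3) (vj V) = 0"
    unfolding R1_def i1[OF c(1)] i1[OF f] i1[OF vn] c(2) i2 i3 k1 k2[OF c(13)] k2[OF u3n] c(14) by linarith
  show "- ip UA (div3 UA v) P = 0 \<longleftrightarrow> inner (dvj (vj v)) (cls UA P) = 0" unfolding i3 by simp
  show "\<rho>s / dt * ip SS w3 U3 + ahom SS a b c ub u3 Ub U3
       - integral\<^sup>L (lebesgue_on SS) (\<lambda>y. (Ki *v trSig L1 L2 L3 v y) \<bullet> (U3 y *\<^sub>R e3))
       + 1 / dt * integral\<^sup>L (lebesgue_on SS) (\<lambda>y. (Ki *v (u3 y *\<^sub>R e3)) \<bullet> (U3 y *\<^sub>R e3))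
     = ip SS g3 U3 + \<rho>s / dt * ip SS w3n U3
       + 1 / dt * integral\<^sup>L (lebesgue_on SS) (\<lambda>y. (Ki *v (u3n y *\<^sub>R e3)) \<bullet> (U3 y *\<^sub>R e3))
     \<longleftrightarrow> R3 (vj v) (uj ub u3) (cls SS w3) (uj Ub U3) = 0"
    unfolding R3_def ahom_aj[OF y(3,4) y'(3,4)] k3 k4[OF c(13)] k4[OF u3n] s[OF y(5)] s[OF g3] s[OF w3n] c(14)
    by linarith
  show "\<rho>s * ip SS w3 W3 - \<rho>s / dt * ip SS u3 W3 = - (\<rho>s / dt * ip SS u3n W3)
     \<longleftrightarrow> \<rho>s * inner (cls SS w3) (cls SS W3) - \<rho>s / dt * inner (u0 (uj ub u3)) (cls SS W3)
        = - (\<rho>s / dt * inner un (cls SS W3))"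
    by (simp only: s'[OF y(5)] s'[OF c(13)] s'[OF u3n] c(14))
qed

text \<open>Every tuple of classes is realised by functions in \<open>Yspace\<close>, so testing
  with functions and testing with classes amount to the same.\<close>

lemma scheme_eqs_jets:
  assumes Y: "Yspace L1 L2 L3 v p ub u3 w3"
  shows "scheme_eqs L1 L2 L3 \<rho>f \<mu> \<rho>s K a b c dt f g3 vn u3n w3n v p ub u3 w3
    \<longleftrightarrow> jet_scheme (vj v) (cls UA p) (uj ub u3) (cls SS w3)"
proof -
  let ?E = "\<lambda>V P U W. R1 (vj v) (cls UA p) (uj ub u3) V = 0 \<and> inner (dvj (vj v)) P = 0
      \<and> R3 (vj v) (uj ub u3) (cls SS w3) U = 0
      \<and> \<rho>s * inner (cls SS w3) W - \<rho>s / dt * inner (u0 (uj ub u3)) W = - (\<rho>s / dt * inner un W)"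
  have "scheme_eqs L1 L2 L3 \<rho>f \<mu> \<rho>s K a b c dt f g3 vn u3n w3n v p ub u3 w3
    \<longleftrightarrow> (\<forall>V P Ub U3 W3. Yspace L1 L2 L3 V P Ub U3 W3 \<longrightarrow> ?E (vj V) (cls UA P) (uj Ub U3) (cls SS W3))"
    unfolding scheme_eqs_def Let_def
    by (intro arg_cong[where f=All] ext imp_cong conj_cong HOL.refl) (rule equations_jets[OF Y], assumption)+
  also have "... \<longleftrightarrow> (\<forall>V\<in>VV. \<forall>P\<in>PP. \<forall>U\<in>UU. \<forall>W\<in>WW. ?E V P U W)" (is "?l \<longleftrightarrow> ?r")
  proof
    assume l: ?l
    show ?r
    proof (intro ballI)
      fix V P U W assume "V \<in> VV" "P \<in> PP" "U \<in> UU" "W \<in> WW"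
      from Yspace_rep[OF this] obtain V' P' Ub U3 W3 where Y': "Yspace L1 L2 L3 V' P' Ub U3 W3"
        and e: "vj V' = V" "cls UA P' = P" "uj Ub U3 = U" "cls SS W3 = W" by (elim exE conjE) (rule that)
      from l[THEN spec, THEN spec, THEN spec, THEN spec, THEN spec, THEN mp, OF Y'] show "?E V P U W" unfolding e .
    qed
  next
    assume r: ?r
    show ?l by (intro allI impI r[THEN bspec, THEN bspec, THEN bspec, THEN bspec] Yspace_jets)
  qed
  also have "... \<longleftrightarrow> jet_scheme (vj v) (cls UA p) (uj ub u3) (cls SS w3)"
  proof -
    \<comment> \<open>The scheme tests all equations with one tuple, \<open>jet_scheme\<close> tests
      each equation with its own entry. Pulling the quantifiers apart takes a member of every space
      to fill the other entries.\<close>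
    have "0 \<in> VV" "0 \<in> PP" "0 \<in> UU" "0 \<in> WW"
      using VV_facts(1) PP_facts(1) UU_facts(1) WW_subspace by (auto intro: subspace_0)
    then show ?thesis unfolding jet_scheme_def by meson
  qed
  finally show ?thesis .
qed

lemma Y_eq_jets:
  assumes Y: "Yspace L1 L2 L3 v p ub u3 w3" and Y': "Yspace L1 L2 L3 v' p' ub' u3' w3'"
    and e: "vj v = vj v'" "cls UA p = cls UA p'" "uj ub u3 = uj ub' u3'" "cls SS w3 = cls SS w3'"
  shows "Y_eq L1 L2 L3 (v, p, ub, u3, w3) (v', p', ub', u3', w3')"
proof -
  have y: "Vspace L1 L2 L3 v" "Lsq UA p" "\<forall>i. H10 SS (\<lambda>y. ub y $ i)" "H20 SS u3" "Lsq SS w3"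
    using Y by (simp_all add: Yspace_def)
  have y': "Vspace L1 L2 L3 v'" "Lsq UA p'" "\<forall>i. H10 SS (\<lambda>y. ub' y $ i)" "H20 SS u3'" "Lsq SS w3'"
    using Y' by (simp_all add: Yspace_def)
  note c = velocity_classes[OF y(1)] plate_classes[OF y(3,4)]
  note c' = velocity_classes[OF y'(1)] plate_classes[OF y'(3,4)]
  have "AE x in lebesgue_on UA. v x $ i = v' x $ i" for i
    using cls_eq_iff[OF A.Um c(1)[of i] c'(1)[of i]] by (simp only: c(2) c'(2) e(1) simp_thms)
  then have v: "AE x in lebesgue_on UA. \<forall>i. v x $ i = v' x $ i" by (rule eventually_all_finite)
  have p: "AE x in lebesgue_on UA. p x = p' x" using cls_eq_iff[OF A.Um y(2) y'(2)] e(2) by simp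
  have "AE x in lebesgue_on SS. ub x $ i = ub' x $ i" for i
  proof -
    have "fst (uj ub u3) $ i = fst (uj ub' u3') $ i" using e(3) by simp
    then have "cls SS (\<lambda>y. ub y $ i) = cls SS (\<lambda>y. ub' y $ i)" by (simp add: uj_def wjet_def)
    then show ?thesis using cls_eq_iff[OF S.Um c(15) c'(15)] by simp
  qed
  then have ub: "AE x in lebesgue_on SS. \<forall>i. ub x $ i = ub' x $ i" by (rule eventually_all_finite)
  have u: "AE x in lebesgue_on SS. u3 x = u3' x" using cls_eq_iff[OF S.Um c(13) c'(13)] c(14) c'(14) e(3) by simp
  have w: "AE x in lebesgue_on SS. w3 x = w3' x" using cls_eq_iff[OF S.Um y(5) y'(5)] e(4) by simp
  show ?thesis unfolding Y_eq_def prod.case vec_eq_iff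
    by (intro conjI eventually_conj v p ub u w)
qed

theorem scheme_solvable:
  "\<exists>v p ub u3 w3. Yspace L1 L2 L3 v p ub u3 w3
    \<and> scheme_eqs L1 L2 L3 \<rho>f \<mu> \<rho>s K a b c dt f g3 vn u3n w3n v p ub u3 w3
    \<and> (\<forall>v' p' ub' u3' w3'. Yspace L1 L2 L3 v' p' ub' u3' w3'
         \<and> scheme_eqs L1 L2 L3 \<rho>f \<mu> \<rho>s K a b c dt f g3 vn u3n w3n v' p' ub' u3' w3'
         \<longrightarrow> Y_eq L1 L2 L3 (v, p, ub, u3, w3) (v', p', ub', u3', w3'))"
proof -
  from jet_scheme_exists obtain V P U W where J: "V \<in> VV" "P \<in> PP" "U \<in> UU" "W \<in> WW" "jet_scheme V P U W"
    by (elim bexE) (rule that)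
  from Yspace_rep[OF J(1-4)] obtain v p ub u3 w3 where Y: "Yspace L1 L2 L3 v p ub u3 w3"
    and e: "vj v = V" "cls UA p = P" "uj ub u3 = U" "cls SS w3 = W" by (elim exE conjE) (rule that)
  have s: "scheme_eqs L1 L2 L3 \<rho>f \<mu> \<rho>s K a b c dt f g3 vn u3n w3n v p ub u3 w3"
    unfolding scheme_eqs_jets[OF Y] e by (rule J(5))
  have "Y_eq L1 L2 L3 (v, p, ub, u3, w3) (v', p', ub', u3', w3')"
    if Y': "Yspace L1 L2 L3 v' p' ub' u3' w3'"
      and s': "scheme_eqs L1 L2 L3 \<rho>f \<mu> \<rho>s K a b c dt f g3 vn u3n w3n v' p' ub' u3' w3'" for v' p' ub' u3' w3'
  proof -
    have "V = vj v' \<and> P = cls UA p' \<and> U = uj ub' u3' \<and> W = cls SS w3'"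
      by (rule jet_scheme_unique[OF J Yspace_jets[OF Y'] s'[unfolded scheme_eqs_jets[OF Y']]])
    then show ?thesis using e by (intro Y_eq_jets[OF Y Y']) simp_all
  qed
  then show ?thesis using Y s by blast
qed

end

text \<open>One step covers the whole scheme: the fluid velocity, the deflection and the plate
  velocity of a solution are again square-integrable, hence admissible data for the next
  step.\<close>

theorem mainTheorem1:
  fixes L1 L2 L3 \<rho>f \<mu> \<rho>s dt :: real
    and K :: "real^3^3"
    and A B C :: "2 \<Rightarrow> 2 \<Rightarrow> 2 \<Rightarrow> 2 \<Rightarrow> real"
    and f vn :: "real^3 \<Rightarrow> real^3"
    and g3 u3n w3n :: "real^2 \<Rightarrow> real"
  assumes L_pos: "L1 > 0" "L2 > 0" "L3 > 0"
    and const_pos: "\<rho>f > 0" "\<mu> > 0" "\<rho>s > 0"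
    and K_sym: "transpose K = K"
    and K_pd: "\<forall>x::real^3. x \<noteq> 0 \<longrightarrow> x \<bullet> (K *v x) > 0"
    and ahom_bounded: "\<exists>M. \<forall>ub u3 Ub U3.
          (\<forall>i. H10 (Sig L1 L2) (\<lambda>y. ub y $ i)) \<and> H20 (Sig L1 L2) u3 \<and>
          (\<forall>i. H10 (Sig L1 L2) (\<lambda>y. Ub y $ i)) \<and> H20 (Sig L1 L2) U3 \<longrightarrow>
          \<bar>ahom (Sig L1 L2) A B C ub u3 Ub U3\<bar>
            \<le> M * sqrt (stdnorm2 (Sig L1 L2) ub u3) * sqrt (stdnorm2 (Sig L1 L2) Ub U3)"
    and ahom_equiv: "\<exists>c1 c2. c1 > 0 \<and> c2 > 0 \<and> (\<forall>ub u3.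
          (\<forall>i. H10 (Sig L1 L2) (\<lambda>y. ub y $ i)) \<and> H20 (Sig L1 L2) u3 \<longrightarrow>
          c1 * stdnorm2 (Sig L1 L2) ub u3 \<le> ahom (Sig L1 L2) A B C ub u3 ub u3 \<and>
          ahom (Sig L1 L2) A B C ub u3 ub u3 \<le> c2 * stdnorm2 (Sig L1 L2) ub u3)"
    and dt_pos: "dt > 0"
    and f_L2: "\<forall>i. Lsq (OmPM L1 L2 L3) (\<lambda>x. f x $ i)"
    and g3_L2: "Lsq (Sig L1 L2) g3"
    and vn_L2: "\<forall>i. Lsq (OmPM L1 L2 L3) (\<lambda>x. vn x $ i)"
    and u3n_L2: "Lsq (Sig L1 L2) u3n"
    and w3n_L2: "Lsq (Sig L1 L2) w3n"
  shows "\<exists>v p ub u3 w3. Yspace L1 L2 L3 v p ub u3 w3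
           \<and> scheme_eqs L1 L2 L3 \<rho>f \<mu> \<rho>s K A B C dt f g3 vn u3n w3n v p ub u3 w3
           \<and> (\<forall>v' p' ub' u3' w3'. Yspace L1 L2 L3 v' p' ub' u3' w3'
                \<and> scheme_eqs L1 L2 L3 \<rho>f \<mu> \<rho>s K A B C dt f g3 vn u3n w3n v' p' ub' u3' w3'
                \<longrightarrow> Y_eq L1 L2 L3 (v, p, ub, u3, w3) (v', p', ub', u3', w3'))"
proof -
  from ahom_equiv obtain c1 c2 where "c1 > 0" and *: "\<forall>ub u3.
      (\<forall>i. H10 (Sig L1 L2) (\<lambda>y. ub y $ i)) \<and> H20 (Sig L1 L2) u3 \<longrightarrow>
      c1 * stdnorm2 (Sig L1 L2) ub u3 \<le> ahom (Sig L1 L2) A B C ub u3 ub u3 \<and>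
      ahom (Sig L1 L2) A B C ub u3 ub u3 \<le> c2 * stdnorm2 (Sig L1 L2) ub u3"
    by (elim exE conjE) (rule that)
  have "\<exists>c1>0. \<forall>ub u3. (\<forall>i. H10 (Sig L1 L2) (\<lambda>y. ub y $ i)) \<and> H20 (Sig L1 L2) u3 \<longrightarrow>
      c1 * stdnorm2 (Sig L1 L2) ub u3 \<le> ahom (Sig L1 L2) A B C ub u3 ub u3"
    using \<open>c1 > 0\<close> * by (intro exI[of _ c1] conjI allI impI) simp_all
  then interpret time_step L1 L2 L3 \<rho>f \<mu> \<rho>s dt K A B C f vn g3 u3n w3n
    using assms by unfold_locales simp_all
  show ?thesis by (rule scheme_solvable)
qed

end
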